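(* Let $K$ be an algebraic number field, $\Delta$ its discriminant over $\mathbf{Q}$, and $s$ the number of complex places of $K$. Let $d=(2/\pi)^s|\Delta|^{1/2}$, and let $S=S_\infty\cup\{\mathfrak p : \mathfrak p \text{ is a finite place of } K \text{ with } \mathfrak N\mathfrak p\le d\}$, where $S_\infty$ is the set of archimedean places of $K$. Then the group $K_S$ of $S$-units is generated by the set of those $x\in K_S$ for which $H(x)\le d^2$, and the ideal class group of the ring of integers of $K$ is generated by the ideal classes of the finite primes in $S$.
   Context: A place $\mathfrak p$ of $K$ is an equivalence class of nontrivial absolute values of $K$; $S_\infty$ is the set of archimedean places. For a non-archimedean (finite) place $\mathfrak p$, corresponding to a nonzero prime ideal of the ring of integers, the norm $\mathfrak N\mathfrak p$ is the cardinality of the residue class field at $\mathfrak p$. For each place $\mathfrak p$, $|\cdot|_{\mathfrak p}\colon K\to\mathbf R_{\ge 0}$ denotes the unique absolute value belonging to $\mathfrak p$ normalized by: $|2|_{\mathfrak p}=2$ if $\mathfrak p$ is real; $|2|_{\mathfrak p}=4$ if $\mathfrak p$ is complex (so it is the square of the usual absolute value); $|K^*|_{\mathfrak p}=(\mathfrak N\mathfrak p)^{\mathbf Z}$ if $\mathfrak p$ is non-archimedean. The height of $x\in K$ is $H(x)=\prod_{\mathfrak p}\max\{1,|x|_{\mathfrak p}\}$, the product over all places $\mathfrak p$ of $K$. For a set $S$ of places with $S_\infty\subset S$, $K_S=\{x\in K^* : |x|_{\mathfrak p}=1 \text{ for all places } \mathfrak p\notin S\}$. *)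

theory Defs
  imports
    "HOL-Algebra.Generated_Groups"
    "HOL-Algebra.Coset"
    "HOL-Computational_Algebra.Polynomial"
    "Jordan_Normal_Form.Determinant"
    Complex_Main
begin

section \<open>Number fields, trace, integral bases, discriminant\<close>

text \<open>Any field of characteristic zero is a vector space over the rationals, and in
  particular a module over the integers.\<close>

global_interpretation QV: vector_space "\<lambda>(q::rat) (x::'a::field_char_0). of_rat q * x"
  defines Qspan = QV.span and Qrepresentation = QV.representation
    and Qextend_basis = QV.extend_basis
  by unfold_locales (simp_all add: algebra_simps of_rat_add of_rat_mult)

global_interpretation ZM: Modules.module "\<lambda>(n::int) (x::'a::field_char_0). of_int n * x"
  defines Zspan = ZM.span and Zdependent = ZM.dependent
  by unfold_locales (simp_all add: algebra_simps)

class number_field = field_char_0 +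
  assumes finite_degree: "\<exists>B. finite B \<and> (\<forall>x. \<exists>c. x = (\<Sum>b\<in>B. of_rat (c b) * b))"

instance rat :: number_field
proof
  show "\<exists>B. finite B \<and> (\<forall>x::rat. \<exists>c. x = (\<Sum>b\<in>B. of_rat (c b) * b))"
    by (intro exI[of _ "{1}"] conjI allI) auto
qed

text \<open>The trace of the endomorphism \<open>y \<mapsto> x * y\<close> of the rational vector space \<open>'k\<close>, computed on
  an arbitrary basis.\<close>

definition field_trace :: "'k::number_field \<Rightarrow> rat" where
  "field_trace x = (let B = Qextend_basis {} in \<Sum>b\<in>B. Qrepresentation B (x * b) b)"

definition ring_of_integers :: "'k::number_field set" where
  "ring_of_integers = {x. algebraic_int x}"

definition integral_basis :: "'k::number_field list \<Rightarrow> bool" where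
  "integral_basis bs \<longleftrightarrow>
     distinct bs \<and> \<not> Zdependent (set bs) \<and> Zspan (set bs) = ring_of_integers"

text \<open>The value does not depend on the integral basis that is chosen.\<close>

definition discriminant :: "'k::number_field itself \<Rightarrow> rat" where
  "discriminant _ =
     (let bs = (SOME bs :: 'k list. integral_basis bs); n = length bs
      in Determinant.det (mat n n (\<lambda>(i, j). field_trace (bs ! i * bs ! j))))"


section \<open>Places\<close>

text \<open>Absolute values are understood in Artin's sense: the triangle inequality is relaxed to
  \<open>v (x + y) \<le> C * max (v x) (v y)\<close>, so that every positive power of an absolute value is again
  an absolute value.  This is needed for the normalized absolute value at a complex place, the
  square of the usual one, to be a member of its place.  Every such function has a positive power
  that satisfies the triangle inequality, so the places are the same as with the narrower notion.\<close>

definition absolute_value :: "('k::field \<Rightarrow> real) \<Rightarrow> bool" where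
  "absolute_value v \<longleftrightarrow>
     (\<forall>x. v x \<ge> 0) \<and> (\<forall>x. v x = 0 \<longleftrightarrow> x = 0) \<and> (\<forall>x y. v (x * y) = v x * v y) \<and>
     (\<exists>C. \<forall>x y. v (x + y) \<le> C * max (v x) (v y))"

definition nontrivial_absolute_values :: "('k::field \<Rightarrow> real) set" where
  "nontrivial_absolute_values = {v. absolute_value v \<and> (\<exists>x. x \<noteq> 0 \<and> v x \<noteq> 1)}"

definition equivalent_absolute_values :: "(('k::field \<Rightarrow> real) \<times> ('k \<Rightarrow> real)) set" where
  "equivalent_absolute_values =
     {(v, w). v \<in> nontrivial_absolute_values \<and> w \<in> nontrivial_absolute_values \<and>
        (\<exists>c>0. \<forall>x. w x = v x powr c)}"

type_synonym 'k place = "('k \<Rightarrow> real) set"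

definition places :: "'k::field place set" where
  "places = nontrivial_absolute_values // equivalent_absolute_values"

definition finite_places :: "'k::field place set" where
  "finite_places = {p \<in> places. \<forall>v\<in>p. \<forall>x y. v (x + y) \<le> max (v x) (v y)}"

definition archimedean_places :: "'k::field place set" where
  "archimedean_places = places - finite_places"

definition real_places :: "'k::field place set" where
  "real_places = {p \<in> archimedean_places. \<exists>\<sigma> :: 'k \<Rightarrow> real. field_hom \<sigma> \<and> (\<lambda>x. \<bar>\<sigma> x\<bar>) \<in> p}"

definition complex_places :: "'k::field place set" where
  "complex_places = {p \<in> archimedean_places.
     \<exists>\<sigma> :: 'k \<Rightarrow> complex. field_hom \<sigma> \<and> \<not> range \<sigma> \<subseteq> \<real> \<and> (\<lambda>x. cmod (\<sigma> x)) \<in> p}"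

text \<open>The quantifiers over \<open>v\<close> below are harmless: for equivalent \<open>v\<close> and \<open>w\<close> one has
  \<open>v x \<le> 1 \<longleftrightarrow> w x \<le> 1\<close> and \<open>v x < 1 \<longleftrightarrow> w x < 1\<close>.\<close>

definition valuation_ring :: "'k::field place \<Rightarrow> 'k set" where
  "valuation_ring p = {x. \<forall>v\<in>p. v x \<le> 1}"

definition valuation_ideal :: "'k::field place \<Rightarrow> 'k set" where
  "valuation_ideal p = {x. \<forall>v\<in>p. v x < 1}"

definition residue_classes :: "'k::field place \<Rightarrow> 'k set set" where
  "residue_classes p = valuation_ring p //
     {(x, y). x \<in> valuation_ring p \<and> y \<in> valuation_ring p \<and> x - y \<in> valuation_ideal p}"

definition place_norm :: "'k::field place \<Rightarrow> nat" where
  "place_norm p = card (residue_classes p)"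

definition prime_of_place :: "'k::number_field place \<Rightarrow> 'k set" where
  "prime_of_place p = ring_of_integers \<inter> valuation_ideal p"

definition normalized_abs :: "'k::field place \<Rightarrow> 'k \<Rightarrow> real" where
  "normalized_abs p = (THE v. v \<in> p \<and>
     (p \<in> real_places \<longrightarrow> v 2 = 2) \<and>
     (p \<in> complex_places \<longrightarrow> v 2 = 4) \<and>
     (p \<in> finite_places \<longrightarrow> v ` (- {0}) = range (\<lambda>k::int. real (place_norm p) powi k)))"


section \<open>Height and S-units\<close>

text \<open>The product over all places, written as a product over the places that contribute a
  factor different from 1; the restriction is needed since \<open>prod\<close> is \<open>1\<close> on infinite sets.\<close>

definition height :: "'k::number_field \<Rightarrow> real" where
  "height x = (\<Prod>p | p \<in> places \<and> max 1 (normalized_abs p x) \<noteq> 1. max 1 (normalized_abs p x))"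

definition S_units :: "'k::number_field place set \<Rightarrow> 'k set" where
  "S_units S = {x. x \<noteq> 0 \<and> (\<forall>p \<in> places - S. normalized_abs p x = 1)}"

definition S_unit_group :: "'k::number_field place set \<Rightarrow> 'k monoid" where
  "S_unit_group S = \<lparr>carrier = S_units S, monoid.mult = (*), one = 1\<rparr>"


section \<open>Ideal class group\<close>

definition fractional_ideal :: "'k::number_field set \<Rightarrow> bool" where
  "fractional_ideal I \<longleftrightarrow>
     0 \<in> I \<and> I \<noteq> {0} \<and> (\<forall>x\<in>I. \<forall>y\<in>I. x + y \<in> I) \<and>
     (\<forall>a\<in>ring_of_integers. \<forall>x\<in>I. a * x \<in> I) \<and>
     (\<exists>a\<in>ring_of_integers. a \<noteq> 0 \<and> (\<forall>x\<in>I. a * x \<in> ring_of_integers))"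

definition fractional_ideal_group :: "'k::number_field set monoid" where
  "fractional_ideal_group =
     \<lparr>carrier = {I. fractional_ideal I},
      monoid.mult = (\<lambda>I J. Zspan {x * y | x y. x \<in> I \<and> y \<in> J}),
      one = ring_of_integers\<rparr>"

definition principal_fractional_ideals :: "'k::number_field set set" where
  "principal_fractional_ideals = {(*) x ` ring_of_integers | x. x \<noteq> 0}"

definition ideal_class_group :: "'k::number_field set set monoid" where
  "ideal_class_group = fractional_ideal_group Mod principal_fractional_ideals"

definition ideal_class :: "'k::number_field set \<Rightarrow> 'k set set" where
  "ideal_class I = principal_fractional_ideals #>\<^bsub>fractional_ideal_group\<^esub> I"

end

theory Submission
  imports Defs "Jordan_Normal_Form.Char_Poly" "HOL-Algebra.Algebraic_Closure_Type"
    "HOL-Analysis.Analysis" "HOL-Real_Asymp.Real_Asymp"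
begin

text \<open>Minkowski's theorem says: if positive radii \<open>y\<^sub>p\<close>, almost all equal to \<open>1\<close>, have product \<open>d\<close>, then
  some \<open>x \<noteq> 0\<close> satisfies \<open>\<bar>x\<bar>\<^sub>p \<le> y\<^sub>p\<close> at all places. If the radii outside \<open>S\<close> are \<open>1\<close>, then \<open>x\<close> is an
  \<open>S\<close>-unit by the product formula, since no \<open>\<bar>x\<bar>\<^sub>p\<close> can be smaller than \<open>y\<^sub>p\<close> by more than the factor \<open>d\<close>.
  Applied to the finite radii given by a fractional ideal, this yields an ideal in the same class
  composed of primes in \<open>S\<close>.

  If \<open>x\<close> and \<open>x'\<close> are bounded by \<open>y\<close> and \<open>y'\<close>, then \<open>H(x'/x) \<le> \<Prod> max(y\<^sub>p, y'\<^sub>p)\<close> by the product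
  formula. Two systems of radii can be joined by steps in which this product is at most \<open>d\<^sup>2\<close>: change
  one finite radius by the factor \<open>Np \<le> d\<close> and compensate at the archimedean places, or, if \<open>d > 1\<close>,
  move the archimedean radii along a geometric interpolation in small steps. Going from radii that
  bound \<open>1\<close> to radii that bound an \<open>S\<close>-unit \<open>x\<close> expresses \<open>x\<close> through \<open>S\<close>-units of height at most
  \<open>d\<^sup>2\<close>. If \<open>d = 1\<close>, then \<open>S\<close> contains no finite primes and Minkowski's theorem holds with equality, so
  \<open>\<bar>x\<bar>\<^sub>p \<noteq> 1\<close> would make all values \<open>\<bar>x\<bar>\<^sub>p\<^sup>t\<close> with \<open>t \<in> \<real>\<close> occur on the countable field \<open>K\<close>.\<close>

text \<open>The constant d is an exact volume. In the coordinates \<open>coord\<close> the ring of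
  integers has covolume 2^(-s) times the square root of |\<Delta>|, the product of intervals and
  discs with radii \<rho> has volume 2^r pi^s times the product of \<rho> over all embeddings, and
  Minkowski's factor is 2^n with n = r + 2s; this leaves (2/pi)^s |\<Delta>|^(1/2). Radii whose
  product is exactly d therefore suffice once Minkowski's theorem holds with equality, which takes a
  compactness argument. Fractional ideals are represented by exponent functions on the primes,
  \<open>val_lattice e\<close> being the product of the P^(e P). The product formula is itself a
  consequence of Minkowski's theorem for integral ideals: applied to high powers of an integer it
  gives one inequality, and a count of residues modulo a natural number turns it into an equality.
  The case d = 1 has to stand apart: an interpolation step multiplies a product of radii equal to d
  by a factor above 1 that must not exceed d.\<close>

hide_const (open) Polynomials.degree Polynomials.lead_coeff up_ring.coeff up_ring.monom

interpretation of_rat_poly_hom: map_poly_inj_idom_hom "of_rat :: rat \<Rightarrow> 'a::field_char_0" ..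

section \<open>Integral elements\<close>

text \<open>The subgroup spanned by the family \<open>w\<close> is mapped into itself by
  \<open>t\<close>. The integer matrix is part of the formula because its characteristic polynomial
  is the monic equation sought for \<open>t\<close>.\<close>

definition stable_under :: "'i set \<Rightarrow> ('i \<Rightarrow> 'a::field_char_0) \<Rightarrow> 'a \<Rightarrow> bool" where
  "stable_under I w t \<longleftrightarrow>
     (\<exists>a::'i \<Rightarrow> 'i \<Rightarrow> int. \<forall>i\<in>I. t * w i = (\<Sum>j\<in>I. of_int (a i j) * w j))"

lemma stable_under_add:
  assumes "stable_under I w s" "stable_under I w t"
  shows "stable_under I w (s + t)"
proof -
  from assms obtain a b where
    "\<forall>i\<in>I. s * w i = (\<Sum>j\<in>I. of_int (a i j) * w j)" "\<forall>i\<in>I. t * w i = (\<Sum>j\<in>I. of_int (b i j) * w j)"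
    unfolding stable_under_def by blast
  then have "\<forall>i\<in>I. (s + t) * w i = (\<Sum>j\<in>I. of_int (a i j + b i j) * w j)"
    by (simp add: ring_distribs sum.distrib)
  then show ?thesis unfolding stable_under_def by (intro exI[of _ "\<lambda>i j. a i j + b i j"])
qed

lemma stable_under_mult:
  assumes "stable_under I w s" "stable_under I w t"
  shows "stable_under I w (s * t)"
proof -
  from assms obtain a b where a: "\<forall>i\<in>I. s * w i = (\<Sum>j\<in>I. of_int (a i j) * w j)"
    and b: "\<forall>i\<in>I. t * w i = (\<Sum>j\<in>I. of_int (b i j) * w j)"
    unfolding stable_under_def by blast
  have "(s * t) * w i = (\<Sum>k\<in>I. of_int (\<Sum>j\<in>I. b i j * a j k) * w k)" if "i \<in> I" for i
  proof -
    have "(s * t) * w i = s * (t * w i)" by (simp add: mult_ac)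
    also have "\<dots> = (\<Sum>j\<in>I. of_int (b i j) * (s * w j))"
      using b that by (simp add: sum_distrib_left mult_ac)
    also have "\<dots> = (\<Sum>j\<in>I. \<Sum>k\<in>I. of_int (b i j) * (of_int (a j k) * w k))"
      using a by (simp add: sum_distrib_left)
    also have "\<dots> = (\<Sum>k\<in>I. \<Sum>j\<in>I. of_int (b i j) * (of_int (a j k) * w k))"
      by (rule sum.swap)
    also have "\<dots> = (\<Sum>k\<in>I. of_int (\<Sum>j\<in>I. b i j * a j k) * w k)"
      by (simp add: sum_distrib_left sum_distrib_right mult_ac)
    finally show ?thesis .
  qed
  then show ?thesis unfolding stable_under_def
    by (intro exI[of _ "\<lambda>i k. \<Sum>j\<in>I. b i j * a j k"]) blast
qed

text \<open>The determinant trick: \<open>t\<close> is an eigenvalue of an integer matrix.\<close>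

lemma algebraic_int_if_stable_under:
  fixes w :: "'i \<Rightarrow> 'a::field_char_0"
  assumes fin: "finite I" and nz: "i0 \<in> I" "w i0 \<noteq> 0" and st: "stable_under I w t"
  shows "algebraic_int t"
proof -
  define n where "n = card I"
  obtain e where e: "bij_betw e {0..<n} I"
    using fin ex_bij_betw_nat_finite n_def by blast
  from st obtain a where a: "\<forall>i\<in>I. t * w i = (\<Sum>j\<in>I. of_int (a i j) * w j)"
    unfolding stable_under_def by blast
  define A :: "int mat" where "A = Matrix.mat n n (\<lambda>(i,j). a (e i) (e j))"
  define B :: "'a mat" where "B = map_mat of_int A"
  define v where "v = Matrix.vec n (\<lambda>i. w (e i))"
  have A: "A \<in> carrier_mat n n" by (simp add: A_def)
  have B: "B \<in> carrier_mat n n" by (simp add: B_def A_def)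
  have "eigenvector B v t"
    unfolding eigenvector_def
  proof (intro conjI)
    show "v \<in> carrier_vec (dim_row B)" using B by (simp add: v_def)
    obtain k where k: "k < n" "e k = i0" using e nz(1) unfolding bij_betw_def by force
    show "v \<noteq> 0\<^sub>v (dim_row B)"
    proof
      assume "v = 0\<^sub>v (dim_row B)"
      then have "vec_index v k = vec_index (0\<^sub>v n) k" using B by simp
      with k nz(2) show False by (simp add: v_def)
    qed
    show "B *\<^sub>v v = t \<cdot>\<^sub>v v"
    proof (rule eq_vecI)
      fix i assume "i < dim_vec (t \<cdot>\<^sub>v v)"
      then have i: "i < n" by (simp add: v_def)
      then have ei: "e i \<in> I" using e bij_betwE by fastforce
      have "vec_index (B *\<^sub>v v) i = (\<Sum>j\<in>{0..<n}. of_int (a (e i) (e j)) * w (e j))"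
        using i by (simp add: B_def A_def v_def scalar_prod_def)
      also have "\<dots> = (\<Sum>j\<in>I. of_int (a (e i) j) * w j)"
        by (rule sum.reindex_bij_betw[OF e])
      also have "\<dots> = t * w (e i)" using a ei by simp
      finally show "vec_index (B *\<^sub>v v) i = vec_index (t \<cdot>\<^sub>v v) i" using i by (simp add: v_def)
    qed (use B in \<open>simp add: v_def\<close>)
  qed
  then have "poly (char_poly B) t = 0"
    using eigenvalue_root_char_poly[OF B] eigenvalue_def by blast
  moreover have "char_poly B = map_poly of_int (char_poly A)"
    unfolding B_def by (rule of_int_hom.char_poly_hom[OF A])
  moreover have "lead_coeff (char_poly A) = 1"
    using degree_monic_char_poly[OF A] by simp
  ultimately show ?thesis unfolding algebraic_int_altdef_ipoly by auto
qed

text \<open>The powers of \<open>x\<close> below the degree of its monic equation span a subgroup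
  stable under \<open>x\<close>; \<open>a\<close> is the companion matrix, a shift except in its
  last row, where the equation rewrites x^m.\<close>

lemma power_reduction:
  fixes x :: "'a::field_char_0"
  assumes "algebraic_int x"
  obtains m :: nat and a :: "nat \<Rightarrow> nat \<Rightarrow> int" where
    "m > 0" "\<And>i. i < m \<Longrightarrow> x * x ^ i = (\<Sum>j<m. of_int (a i j) * x ^ j)"
proof -
  from assms obtain p where p: "poly (map_poly of_int p) x = 0" "lead_coeff p = 1"
    unfolding algebraic_int_altdef_ipoly by blast
  define m where "m = degree p"
  have "m > 0"
  proof (rule ccontr)
    assume "\<not> m > 0"
    then have "p = [:1:]" using p(2) m_def by (metis degree_eq_zeroE lead_coeff_pCons(2) gr0I pCons_0_0 coeff_pCons_0 degree_pCons_0)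
    with p(1) show False by simp
  qed
  have "0 = (\<Sum>j\<le>m. of_int (coeff p j) * x ^ j)"
    using p(1) by (simp add: poly_altdef m_def)
  also have "{..m} = insert m {..<m}" by auto
  also have "(\<Sum>j\<in>insert m {..<m}. of_int (coeff p j) * x ^ j) = x ^ m + (\<Sum>j<m. of_int (coeff p j) * x ^ j)"
    using p(2) by (simp add: m_def)
  finally have xm: "x ^ m = (\<Sum>j<m. of_int (- coeff p j) * x ^ j)"
    by (simp add: sum_negf eq_neg_iff_add_eq_0)
  define a :: "nat \<Rightarrow> nat \<Rightarrow> int" where
    "a = (\<lambda>i j. if Suc i < m then (if j = Suc i then 1 else 0) else - coeff p j)"
  have "x * x ^ i = (\<Sum>j<m. of_int (a i j) * x ^ j)" if "i < m" for i
  proof (cases "Suc i < m")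
    case True
    have "(\<Sum>j<m. of_int (a i j) * x ^ j) = (\<Sum>j<m. if j = Suc i then x ^ j else 0)"
      using True by (intro sum.cong) (auto simp: a_def)
    then show ?thesis using True by simp
  next
    case False
    then have "Suc i = m" using that by simp
    then have "x * x ^ i = x ^ m" by auto
    then show ?thesis using False xm by (simp add: a_def)
  qed
  with \<open>m > 0\<close> that show thesis by blast
qed

text \<open>The products x^i y^j with bounded exponents span a subgroup stable under both elements,
  hence under their sum and product; \<open>x\<close> acts on the first exponent and
  \<open>y\<close> on the second.\<close>

lemma common_stable_module:
  fixes x y :: "'a::field_char_0"
  assumes "algebraic_int x" "algebraic_int y"
  obtains I :: "(nat \<times> nat) set" and w i0 where
    "finite I" "i0 \<in> I" "w i0 \<noteq> 0" "stable_under I w x" "stable_under I w y"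
proof -
  obtain m a where m: "m > 0" "\<And>i. i < m \<Longrightarrow> x * x ^ i = (\<Sum>j<m. of_int (a i j) * x ^ j)"
    using power_reduction[OF assms(1)] by blast
  obtain k b where k: "k > 0" "\<And>i. i < k \<Longrightarrow> y * y ^ i = (\<Sum>j<k. of_int (b i j) * y ^ j)"
    using power_reduction[OF assms(2)] by blast
  define I where "I = {..<m} \<times> {..<k}"
  define w where "w = (\<lambda>(i, j). x ^ i * y ^ j)"
  have "x * w p = (\<Sum>q\<in>I. of_int (if snd q = snd p then a (fst p) (fst q) else 0) * w q)" if "p \<in> I" for p
  proof -
    obtain i j where p: "p = (i,j)" "i < m" "j < k" using \<open>p \<in> I\<close> unfolding I_def by (cases p) auto
    have "(\<Sum>q\<in>I. of_int (if snd q = snd p then a (fst p) (fst q) else 0) * w q) =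
          (\<Sum>i'<m. \<Sum>j'<k. of_int (if j' = j then a i i' else 0) * (x ^ i' * y ^ j'))"
      unfolding I_def sum.cartesian_product by (intro sum.cong) (auto simp: p w_def)
    also have "\<dots> = (\<Sum>i'<m. \<Sum>j'<k. if j' = j then of_int (a i i') * (x ^ i' * y ^ j) else 0)"
      by (intro sum.cong) auto
    also have "\<dots> = (\<Sum>i'<m. of_int (a i i') * x ^ i') * y ^ j"
      using p by (simp add: sum_distrib_left sum_distrib_right mult_ac)
    also have "\<dots> = x * w p" using m(2)[of i] p by (simp add: w_def mult_ac)
    finally show ?thesis ..
  qed
  then have 1: "stable_under I w x" unfolding stable_under_def
    by (intro exI[of _ "\<lambda>p q. if snd q = snd p then a (fst p) (fst q) else 0"]) blast
  have "y * w p = (\<Sum>q\<in>I. of_int (if fst q = fst p then b (snd p) (snd q) else 0) * w q)" if "p \<in> I" for p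
  proof -
    obtain i j where p: "p = (i,j)" "i < m" "j < k" using \<open>p \<in> I\<close> unfolding I_def by (cases p) auto
    have "(\<Sum>q\<in>I. of_int (if fst q = fst p then b (snd p) (snd q) else 0) * w q) =
          (\<Sum>i'<m. \<Sum>j'<k. of_int (if i' = i then b j j' else 0) * (x ^ i' * y ^ j'))"
      unfolding I_def sum.cartesian_product by (intro sum.cong) (auto simp: p w_def)
    also have "\<dots> = (\<Sum>i'<m. if i' = i then (\<Sum>j'<k. of_int (b j j') * y ^ j') * x ^ i else 0)"
      by (intro sum.cong) (auto simp: sum_distrib_left sum_distrib_right mult_ac)
    also have "\<dots> = y * w p" using k(2)[of j] p by (simp add: w_def mult_ac)
    finally show ?thesis ..
  qed
  then have 2: "stable_under I w y" unfolding stable_under_def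
    by (intro exI[of _ "\<lambda>p q. if fst q = fst p then b (snd p) (snd q) else 0"]) blast
  show thesis
    by (rule that[OF _ _ _ 1 2, of "(0,0)"]) (use m k in \<open>auto simp: I_def w_def\<close>)
qed

lemma algebraic_int_add: "algebraic_int x \<Longrightarrow> algebraic_int y \<Longrightarrow> algebraic_int (x + y :: 'a::field_char_0)"
  by (rule common_stable_module[of x y]) (auto intro: algebraic_int_if_stable_under stable_under_add)

lemma algebraic_int_mult: "algebraic_int x \<Longrightarrow> algebraic_int y \<Longrightarrow> algebraic_int (x * y :: 'a::field_char_0)"
  by (rule common_stable_module[of x y]) (auto intro: algebraic_int_if_stable_under stable_under_mult)

section \<open>Primitive elements\<close>

abbreviation rpoly :: "rat poly \<Rightarrow> 'a::field_char_0 \<Rightarrow> 'a" where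
  "rpoly p x \<equiv> poly (map_poly of_rat p) x"

text \<open>In a number field this ring is already the field \<rat>(x), by
  \<open>adjoin_inverse\<close>.\<close>

definition adjoin :: "'a::field_char_0 \<Rightarrow> 'a set" where
  "adjoin x = range (\<lambda>p. rpoly p x)"

lemma adjoin_add: "a \<in> adjoin x \<Longrightarrow> b \<in> adjoin x \<Longrightarrow> a + b \<in> adjoin x"
  unfolding adjoin_def by (auto simp flip: poly_add of_rat_hom.map_poly_hom_add)

lemma adjoin_mult: "a \<in> adjoin x \<Longrightarrow> b \<in> adjoin x \<Longrightarrow> a * b \<in> adjoin x"
  unfolding adjoin_def by (auto simp flip: poly_mult of_rat_poly_hom.hom_mult)

lemma adjoin_of_rat: "of_rat q \<in> adjoin x"
proof -
  have "of_rat q = rpoly [:q:] x" by (cases "q = 0") (simp_all add: map_poly_pCons)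
  then show ?thesis unfolding adjoin_def by (rule range_eqI)
qed

lemma adjoin_gen: "x \<in> adjoin x"
proof -
  have "x = rpoly [:0, 1:] x" by (simp add: map_poly_pCons)
  then show ?thesis unfolding adjoin_def by (rule range_eqI)
qed

lemma adjoin_uminus: "a \<in> adjoin x \<Longrightarrow> - a \<in> adjoin x"
  using adjoin_mult[OF adjoin_of_rat[of "-1"]] by (simp add: of_rat_minus)

lemma adjoin_diff: "a \<in> adjoin x \<Longrightarrow> b \<in> adjoin x \<Longrightarrow> a - b \<in> adjoin x"
  using adjoin_add[OF _ adjoin_uminus] by fastforce

lemma adjoin_sum: "(\<And>i. i \<in> I \<Longrightarrow> f i \<in> adjoin x) \<Longrightarrow> sum f I \<in> adjoin x"
  using adjoin_of_rat[of 0 x] by (induction I rule: infinite_finite_induct) (auto intro: adjoin_add)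

lemma adjoin_subset:
  assumes "a \<in> adjoin x" shows "adjoin a \<subseteq> adjoin x"
proof -
  obtain p where "a = rpoly p x" using assms by (auto simp: adjoin_def)
  then have "rpoly q a = rpoly (pcompose q p) x" for q
    by (simp add: of_rat_hom.map_poly_pcompose poly_pcompose)
  then show ?thesis by (auto simp: adjoin_def)
qed

text \<open>Among more powers than a spanning set has elements there is a linear relation. Powers
  may coincide, and then they form too small a set; the difference of two monomials is taken
  instead.\<close>

lemma algebraic_rat:
  fixes x :: "'k::number_field"
  obtains p where "p \<noteq> 0" "rpoly p x = 0"
proof -
  obtain B :: "'k set" where B: "finite B" "\<forall>x. \<exists>c. x = (\<Sum>b\<in>B. of_rat (c b) * b)"
    using finite_degree by blast
  have span: "y \<in> QV.span B" for y
  proof -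
    obtain c where c: "y = (\<Sum>b\<in>B. of_rat (c b) * b)" using B(2) by blast
    show ?thesis unfolding c by (intro QV.span_sum QV.span_scale QV.span_base)
  qed
  define P where "P = (\<lambda>i. x ^ i) ` {..card B}"
  show thesis
  proof (cases "inj_on (\<lambda>i. x ^ i) {..card B}")
    case True
    then have "card P > card B" by (simp add: P_def card_image)
    then have "QV.dependent P" using QV.independent_span_bound[OF B(1), of P] span by fastforce
    then obtain u where u: "(\<Sum>v\<in>P. of_rat (u v) * v) = 0" "\<exists>v\<in>P. u v \<noteq> 0"
      using QV.dependent_finite[of P] by (auto simp: P_def)
    define p where "p = (\<Sum>i\<le>card B. monom (u (x ^ i)) i)"
    have "rpoly p x = (\<Sum>i\<le>card B. of_rat (u (x ^ i)) * x ^ i)"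
      by (simp add: p_def of_rat_poly_hom.hom_sum poly_sum poly_monom)
    also have "\<dots> = 0" using u(1) True by (simp add: P_def sum.reindex)
    finally have "rpoly p x = 0" .
    moreover have "p \<noteq> 0"
    proof -
      obtain i where i: "i \<le> card B" "u (x ^ i) \<noteq> 0" using u(2) by (auto simp: P_def)
      then have "coeff p i = u (x ^ i)" by (simp add: p_def coeff_sum coeff_monom if_distrib cong: if_cong)
      with i show ?thesis by auto
    qed
    ultimately show thesis using that by blast
  next
    case False
    then obtain i j where ij: "i \<noteq> j" "x ^ i = x ^ j" unfolding inj_on_def by blast
    define p :: "rat poly" where "p = monom 1 i - monom 1 j"
    have "coeff p i = 1" using ij by (simp add: p_def)
    then have "p \<noteq> 0" by auto
    moreover have "rpoly p x = 0" using ij by (simp add: p_def hom_distribs poly_monom)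
    ultimately show thesis using that by blast
  qed
qed

text \<open>A polynomial of least degree vanishing at a \<noteq> 0 has a nonzero constant term c,
  since otherwise X could be cancelled; a q(a) = - c then exhibits the inverse.\<close>

lemma adjoin_inverse:
  fixes x :: "'k::number_field"
  assumes "a \<in> adjoin x" shows "inverse a \<in> adjoin x"
proof (cases "a = 0")
  case False
  define d where "d = (LEAST d. \<exists>p. p \<noteq> 0 \<and> rpoly p a = 0 \<and> degree p = d)"
  have "\<exists>p. p \<noteq> 0 \<and> rpoly p a = 0 \<and> degree p = d"
    unfolding d_def by (rule LeastI_ex) (metis algebraic_rat)
  then obtain p where p: "p \<noteq> 0" "rpoly p a = 0" "degree p = d" by blast
  obtain c q where cq: "p = pCons c q" by (cases p)
  have "c \<noteq> 0"
  proof
    assume c: "c = 0"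
    with cq p False have "q \<noteq> 0" "rpoly q a = 0" by (auto simp: of_rat_hom.map_poly_pCons_hom)
    moreover have "degree q < d" using cq p c by auto
    ultimately show False unfolding d_def using not_less_Least by blast
  qed
  have "of_rat c + a * rpoly q a = 0" using p(2) cq by (simp add: of_rat_hom.map_poly_pCons_hom)
  then have "a * rpoly q a = - of_rat c" by (simp add: eq_neg_iff_add_eq_0 add.commute)
  then have "a * (of_rat (- 1 / c) * rpoly q a) = of_rat (-1/c) * (- of_rat c)" by (metis mult.left_commute)
  also have "\<dots> = 1" using \<open>c \<noteq> 0\<close> by (simp flip: of_rat_mult of_rat_minus)
  finally have "inverse a = of_rat (- 1 / c) * rpoly q a" using False by (simp add: inverse_unique)
  moreover have "rpoly q a \<in> adjoin x" using adjoin_subset[OF assms] by (auto simp: adjoin_def)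
  ultimately show ?thesis using adjoin_mult adjoin_of_rat by metis
qed (use adjoin_of_rat[of 0] in simp)

text \<open>Least degree gives divisibility. For a common divisor \<open>h\<close> of
  \<open>f\<close> and \<open>pderiv f\<close>, either \<open>h\<close> vanishes at \<open>x\<close>
  and \<open>f\<close> divides its own nonzero derivative, which is excluded by degree, or the
  cofactor vanishes, which leaves degree 0 for \<open>h\<close>.\<close>

lemma minimal_rat_poly:
  fixes x :: "'k::number_field"
  obtains f where "f \<noteq> 0" "rpoly f x = 0" "\<And>g. rpoly g x = 0 \<Longrightarrow> f dvd g" "coprime f (pderiv f)"
    "degree f > 0"
proof -
  define d where "d = (LEAST d. \<exists>p. p \<noteq> 0 \<and> rpoly p x = 0 \<and> degree p = d)"
  have "\<exists>p. p \<noteq> 0 \<and> rpoly p x = 0 \<and> degree p = d"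
    unfolding d_def by (rule LeastI_ex) (metis algebraic_rat)
  then obtain f where f: "f \<noteq> 0" "rpoly f x = 0" "degree f = d" by blast
  have min: "g = 0" if "rpoly g x = 0" "degree g < d" for g
    using that not_less_Least unfolding d_def by blast
  have dvd: "f dvd g" if "rpoly g x = 0" for g
  proof -
    have "map_poly of_rat g = map_poly of_rat (g div f) * map_poly of_rat f + map_poly of_rat (g mod f :: rat poly)"
      by (simp flip: of_rat_poly_hom.hom_mult of_rat_hom.map_poly_hom_add)
    from arg_cong[OF this, of "\<lambda>p. poly p x"] have "rpoly (g mod f) x = 0" using that f by simp
    moreover have "g mod f = 0 \<or> degree (g mod f) < d" using degree_mod_less[OF f(1)] f(3) by simp
    ultimately have "g mod f = 0" using min by blast
    then show ?thesis by auto
  qed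
  have d: "d > 0"
  proof (rule ccontr)
    assume "\<not> d > 0"
    then obtain c where "f = [:c:]" using f(3) degree_eq_zeroE by blast
    with f(1,2) show False by simp
  qed
  have "coprime f (pderiv f)"
  proof (rule coprimeI)
    fix h assume h: "h dvd f" "h dvd pderiv f"
    obtain q where q: "f = h * q" using h(1) by blast
    have "rpoly h x * rpoly q x = 0" using f(2) q by (simp add: of_rat_poly_hom.hom_mult)
    then consider "rpoly h x = 0" | "rpoly q x = 0" by auto
    then show "is_unit h"
    proof cases
      case 1
      then have "f dvd h" by (rule dvd)
      then have "f dvd pderiv f" using h(2) dvd_trans by blast
      moreover have "pderiv f \<noteq> 0" using d f by (simp add: pderiv_eq_0_iff)
      ultimately have "degree f \<le> degree (pderiv f)" by (simp add: dvd_imp_degree_le)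
      then show ?thesis using d f(3) by (simp add: degree_pderiv)
    next
      case 2
      then have "f dvd q" by (rule dvd)
      moreover have "q \<noteq> 0" "h \<noteq> 0" using q f(1) by auto
      ultimately have "degree f \<le> degree q" "degree f = degree h + degree q"
        using q by (auto simp: dvd_imp_degree_le degree_mult_eq)
      then have "degree h = 0" by simp
      then show ?thesis using \<open>h \<noteq> 0\<close> by (metis degree_eq_zeroE is_unit_const_poly_iff pCons_eq_0_iff dvd_field_iff)
    qed
  qed
  then show thesis using that f dvd d by blast
qed

text \<open>Subfields such as \<rat>(\<gamma>) are sets here, not types, so division with remainder
  is carried out while recording that coefficients stay in the set.\<close>

lemma poly_division_in_subfield:
  fixes g :: "'a::field poly" and F :: "'a set"
  assumes F: "0 \<in> F" "\<And>a b. a \<in> F \<Longrightarrow> b \<in> F \<Longrightarrow> a - b \<in> F" "\<And>a b. a \<in> F \<Longrightarrow> b \<in> F \<Longrightarrow> a * b \<in> F"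
      "\<And>a. a \<in> F \<Longrightarrow> inverse a \<in> F"
    and g: "g \<noteq> 0" "\<And>i. coeff g i \<in> F" and f: "\<And>i. coeff f i \<in> F"
  shows "\<exists>q r. f = q * g + r \<and> (\<forall>i. coeff r i \<in> F) \<and> (r = 0 \<or> degree r < degree g)"
  using f
proof (induction "degree f" arbitrary: f rule: less_induct)
  case less
  show ?case
  proof (cases "f = 0 \<or> degree f < degree g")
    case True
    then show ?thesis using less.prems by (intro exI[of _ 0] exI[of _ f]) auto
  next
    case False
    then have f0: "f \<noteq> 0" and le: "degree g \<le> degree f" by auto
    define c where "c = lead_coeff f * inverse (lead_coeff g)"
    define h where "h = monom c (degree f - degree g)"
    have cF: "c \<in> F" unfolding c_def by (intro F(3) F(4) g(2) less.prems)
    have c0: "c \<noteq> 0" using f0 g(1) by (simp add: c_def)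
    have dh: "degree (h * g) = degree f" using c0 g(1) le
      by (simp add: h_def degree_mult_eq degree_monom_eq monom_eq_0_iff)
    have "lead_coeff (h * g) = c * lead_coeff g" using le by (simp add: lead_coeff_mult h_def degree_monom_eq c0)
    then have lc: "coeff (h * g) (degree f) = lead_coeff f" using dh g(1) by (simp add: c_def)
    define f' where "f' = f - h * g"
    have f'F: "coeff f' i \<in> F" for i
    proof -
      have "coeff (h * g) i \<in> F"
        using F(1) F(3)[OF cF] g(2) by (simp add: h_def coeff_monom_mult)
      then show ?thesis using F(2)[OF less.prems] by (simp add: f'_def)
    qed
    show ?thesis
    proof (cases "f' = 0")
      case True
      then show ?thesis using F(1) by (intro exI[of _ h] exI[of _ 0]) (auto simp: f'_def)
    next
      case False
      have "degree f' \<le> degree f" unfolding f'_def using dh by (intro degree_diff_le) auto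
      moreover have "coeff f' (degree f) = 0" using lc by (simp add: f'_def)
      ultimately have "degree f' < degree f"
        using False by (metis leading_coeff_0_iff le_neq_implies_less)
      from less.hyps[OF this] f'F obtain q r where
        "f' = q * g + r" "\<forall>i. coeff r i \<in> F" "r = 0 \<or> degree r < degree g" by blast
      then show ?thesis by (intro exI[of _ "q + h"] exI[of _ r]) (auto simp: f'_def algebra_simps)
    qed
  qed
qed

interpretation to_ac_hom: field_hom "to_ac :: 'a::field \<Rightarrow> 'a alg_closure"
  by unfold_locales simp_all

interpretation to_ac_poly_hom: map_poly_inj_idom_hom "to_ac :: 'a::field \<Rightarrow> 'a alg_closure" ..

text \<open>A rational \<open>c\<close> is chosen such that \<open>g\<close> and \<open>f (\<gamma> - c X)\<close>, where \<open>\<gamma> = \<theta> + c * \<beta>\<close>, have only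
  the root \<open>\<beta>\<close> in common; then the minimal polynomial of \<open>\<beta>\<close> over \<open>\<rat>(\<gamma>)\<close> is linear.\<close>

lemma primitive_element_two:
  fixes \<theta> \<beta> :: "'k::number_field"
  obtains \<gamma> where "\<theta> \<in> adjoin \<gamma>" "\<beta> \<in> adjoin \<gamma>"
proof -
  let ?E = "to_ac :: 'k \<Rightarrow> 'k alg_closure"
  obtain f where f: "f \<noteq> 0" "rpoly f \<theta> = 0" using algebraic_rat by blast
  obtain g where g: "g \<noteq> 0" "rpoly g \<beta> = 0" "coprime g (pderiv g)" by (rule minimal_rat_poly[of \<beta>]) blast
  define f1 g1 :: "'k poly" where "f1 = map_poly of_rat f" and "g1 = map_poly of_rat g"
  have f1: "f1 \<noteq> 0" "poly f1 \<theta> = 0" and g1: "g1 \<noteq> 0" "poly g1 \<beta> = 0" using f g by (auto simp: f1_def g1_def)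
  have g1': "poly (pderiv g1) \<beta> \<noteq> 0"
  proof
    assume 0: "poly (pderiv g1) \<beta> = 0"
    obtain u v where "u * g + v * pderiv g = 1"
      using g(3) by (metis bezout_coefficients_fst_snd coprime_iff_gcd_eq_1)
    then have "map_poly of_rat (u * g + v * pderiv g) = (1::'k poly)" by simp
    then have "poly (map_poly of_rat (u * g + v * pderiv g)) \<beta> = 1" by simp
    then show False using g1(2) 0
      by (simp add: of_rat_poly_hom.hom_mult of_rat_poly_hom.hom_add g1_def of_rat_hom.map_poly_pderiv)
  qed
  define Rf where "Rf = {z. poly (map_poly ?E f1) z = 0}"
  define Rg where "Rg = {z. poly (map_poly ?E g1) z = 0}"
  have fin: "finite Rf" "finite Rg" unfolding Rf_def Rg_def using f1 g1 by (auto intro!: poly_roots_finite)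
  \<comment> \<open>These are the values of c for which \<theta> + c \<beta> - c w is a root z of f
    for some root w \<noteq> \<beta> of g. Pairs with w = \<beta> divide by 0 and merely exclude the
    value 0.\<close>
  define bad where "bad = (\<lambda>(z, w). (z - ?E \<theta>) / (?E \<beta> - w)) ` (Rf \<times> Rg)"
  have "finite bad" using fin by (simp add: bad_def)
  moreover have "infinite (range (\<lambda>c::rat. ?E (of_rat c)))"
    using finite_imageD[of "\<lambda>c::rat. ?E (of_rat c)" UNIV] infinite_UNIV_char_0 by (auto simp: inj_def)
  ultimately obtain c where c: "?E (of_rat c) \<notin> bad"
    by (meson finite_subset image_subsetI)
  define \<gamma> where "\<gamma> = \<theta> + of_rat c * \<beta>"
  define f2 where "f2 = pcompose f1 [:\<gamma>, - of_rat c:]"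
  let ?F = "adjoin \<gamma>"
  have F: "0 \<in> ?F" "\<And>a b. a \<in> ?F \<Longrightarrow> b \<in> ?F \<Longrightarrow> a - b \<in> ?F" "\<And>a b. a \<in> ?F \<Longrightarrow> b \<in> ?F \<Longrightarrow> a * b \<in> ?F"
      "\<And>a. a \<in> ?F \<Longrightarrow> inverse a \<in> ?F"
    using adjoin_of_rat[of 0] adjoin_diff adjoin_mult adjoin_inverse by auto
  have g1F: "coeff g1 i \<in> ?F" for i using adjoin_of_rat by (simp add: g1_def)
  have f2F: "coeff f2 i \<in> ?F" for i
  proof -
    have lin: "coeff [:\<gamma>, - of_rat c:] j \<in> ?F" for j
      using adjoin_gen[of \<gamma>] F(1) adjoin_uminus[OF adjoin_of_rat, of c \<gamma>]
      by (simp add: coeff_pCons split: nat.split)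
    have "\<forall>i. coeff (pcompose (map_poly of_rat p) [:\<gamma>, - of_rat c:]) i \<in> ?F" for p :: "rat poly"
    proof (induction p)
      case 0 show ?case using F(1) by simp
    next
      case (pCons a p)
      have "coeff ([:\<gamma>, - of_rat c:] * pcompose (map_poly of_rat p) [:\<gamma>, - of_rat c:]) j \<in> ?F" for j
        unfolding coeff_mult using lin pCons.IH by (intro adjoin_sum F(3)) auto
      moreover have "coeff [:of_rat a:] j \<in> ?F" for j
        using F(1) adjoin_of_rat[of a \<gamma>] by (simp add: coeff_pCons split: nat.split)
      ultimately show ?case
        by (simp add: of_rat_hom.map_poly_pCons_hom pcompose_pCons adjoin_add del: mult_pCons_left)
    qed
    then show ?thesis by (simp add: f2_def f1_def)
  qed
  have f2: "poly f2 \<beta> = 0" using f1(2) by (simp add: f2_def poly_pcompose \<gamma>_def)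
  \<comment> \<open>The polynomial \<open>k\<close> obtained below plays the minimal polynomial of
    \<beta> over \<rat>(\<gamma>): it divides every polynomial over that field that vanishes at
    \<beta>.\<close>
  define d where "d = (LEAST d. \<exists>p. p \<noteq> 0 \<and> (\<forall>i. coeff p i \<in> ?F) \<and> poly p \<beta> = 0 \<and> degree p = d)"
  have "\<exists>p. p \<noteq> 0 \<and> (\<forall>i. coeff p i \<in> ?F) \<and> poly p \<beta> = 0 \<and> degree p = d"
    unfolding d_def by (rule LeastI_ex) (use g1 g1F in blast)
  then obtain k where k: "k \<noteq> 0" "\<And>i. coeff k i \<in> ?F" "poly k \<beta> = 0" "degree k = d" by blast
  have min: "p = 0" if "\<forall>i. coeff p i \<in> ?F" "poly p \<beta> = 0" "degree p < d" for p
    using that not_less_Least unfolding d_def by blast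
  have dvd: "k dvd p" if p: "\<And>i. coeff p i \<in> ?F" "poly p \<beta> = 0" for p
  proof -
    obtain q r where qr: "p = q * k + r" "\<forall>i. coeff r i \<in> ?F" "r = 0 \<or> degree r < degree k"
      using poly_division_in_subfield[OF F k(1,2) p(1)] by blast
    then have "r = 0" using min[of r] p(2) k(3,4) by auto
    with qr show ?thesis by simp
  qed
  have kg: "k dvd g1" and kf: "k dvd f2" using dvd g1F g1 f2F f2 by blast+
  obtain k1 where k1: "k = [:- \<beta>, 1:] * k1" using k(3) by (auto simp: poly_eq_0_iff_dvd)
  \<comment> \<open>A root z of \<open>k1\<close> would make \<beta> a double root of
    \<open>g1\<close> if z = \<beta>, and would put \<open>c\<close> into \<open>bad\<close>
    otherwise.\<close>
  have "degree k1 = 0"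
  proof (rule ccontr)
    assume "degree k1 \<noteq> 0"
    then have "degree (map_poly ?E k1) > 0" by simp
    then obtain z where z: "poly (map_poly ?E k1) z = 0" using alg_closed_imp_poly_has_root by blast
    have kz: "poly (map_poly ?E k) z = 0" unfolding k1 using z by (simp only: to_ac_poly_hom.hom_mult poly_mult) simp
    show False
    proof (cases "z = ?E \<beta>")
      case True
      then have "poly k1 \<beta> = 0" using z by simp
      then obtain k2 where "k1 = [:- \<beta>, 1:] * k2" by (auto simp: poly_eq_0_iff_dvd)
      then obtain q where "g1 = [:- \<beta>, 1:] * ([:- \<beta>, 1:] * q)" using kg k1 by (metis dvd_def mult.assoc)
      then have "poly (pderiv g1) \<beta> = 0" by (simp only: pderiv_mult poly_add poly_mult) simp
      with g1' show False by blast
    next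
      case False
      have "map_poly ?E k dvd map_poly ?E g1" "map_poly ?E k dvd map_poly ?E f2"
        using kg kf by (auto elim!: dvdE simp: to_ac_poly_hom.hom_mult)
      then have zg: "z \<in> Rg" and zf: "poly (map_poly ?E f2) z = 0"
        using kz unfolding Rg_def by (auto elim!: dvdE)
      have "poly (map_poly ?E f1) (?E \<gamma> - ?E (of_rat c) * z) = 0"
        using zf by (simp add: f2_def to_ac_hom.map_poly_pcompose poly_pcompose hom_distribs mult.commute)
      then have "?E \<gamma> - ?E (of_rat c) * z \<in> Rf" by (simp add: Rf_def)
      moreover have "?E (of_rat c) = ((?E \<gamma> - ?E (of_rat c) * z) - ?E \<theta>) / (?E \<beta> - z)"
        using False by (simp add: \<gamma>_def field_simps)
      ultimately have "?E (of_rat c) \<in> bad" using zg unfolding bad_def by (intro image_eqI[of _ _ "(_, z)"]) auto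
      with c show False by blast
    qed
  qed
  then obtain b where b: "k1 = [:b:]" using degree_eq_zeroE by blast
  have "b \<noteq> 0" using k(1) k1 b by auto
  have "coeff k 0 = - \<beta> * b" "coeff k 1 = b" using k1 b by auto
  then have "\<beta> = - coeff k 0 * inverse (coeff k 1)" using \<open>b \<noteq> 0\<close> by simp
  moreover have "- coeff k 0 * inverse (coeff k 1) \<in> ?F" by (intro F(3) F(4) adjoin_uminus k(2))
  ultimately have "\<beta> \<in> ?F" by (simp only:)
  moreover have "\<theta> = \<gamma> - of_rat c * \<beta>" by (simp add: \<gamma>_def)
  moreover have "\<gamma> - of_rat c * \<beta> \<in> ?F"
    by (intro adjoin_diff adjoin_mult adjoin_gen adjoin_of_rat \<open>\<beta> \<in> ?F\<close>)
  ultimately have "\<beta> \<in> ?F" "\<theta> \<in> ?F" by (simp_all only:)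
  then show thesis using that by blast
qed

lemma primitive_element:
  obtains \<theta> :: "'k::number_field" where "adjoin \<theta> = UNIV"
proof -
  obtain B :: "'k set" where B: "finite B" "\<forall>x. \<exists>c. x = (\<Sum>b\<in>B. of_rat (c b) * b)"
    using finite_degree by blast
  from B(1) have "\<exists>\<theta>. B \<subseteq> adjoin \<theta>"
  proof (induction B)
    case (insert b B)
    then obtain \<theta> where "B \<subseteq> adjoin \<theta>" by blast
    moreover obtain \<gamma> where "\<theta> \<in> adjoin \<gamma>" "b \<in> adjoin \<gamma>" by (rule primitive_element_two)
    ultimately show ?case using adjoin_subset by blast
  qed simp
  then obtain \<theta> where "B \<subseteq> adjoin \<theta>" by blast
  then have "x \<in> adjoin \<theta>" for x
  proof -
    obtain c where c: "x = (\<Sum>b\<in>B. of_rat (c b) * b)" using B(2) by blast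
    show ?thesis unfolding c using \<open>B \<subseteq> adjoin \<theta>\<close> by (intro adjoin_sum adjoin_mult adjoin_of_rat) auto
  qed
  then show thesis using that by blast
qed

section \<open>Embeddings into the complex numbers\<close>

definition embeddings :: "('k::number_field \<Rightarrow> complex) set" where
  "embeddings = {\<sigma>. field_hom \<sigma>}"

lemma field_hom_of_rat:
  fixes \<sigma> :: "'a::field_char_0 \<Rightarrow> 'b::field_char_0"
  assumes "field_hom \<sigma>" shows "\<sigma> (of_rat q) = of_rat q"
proof -
  interpret field_hom \<sigma> by fact
  obtain a b where q: "q = Rat.Fract a b" "b > 0" by (cases q)
  have "\<sigma> (of_rat q) * of_int b = \<sigma> (of_rat q * of_int b)" by (simp add: hom_mult hom_of_int)
  also have "of_rat q * of_int b = of_int a" using q by (simp add: of_rat_rat)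
  also have "\<sigma> (of_int a) = of_int a" by (rule hom_of_int)
  finally show ?thesis using q by (simp add: of_rat_rat field_simps)
qed

lemma field_hom_rpoly:
  fixes \<sigma> :: "'a::field_char_0 \<Rightarrow> 'b::field_char_0"
  assumes "field_hom \<sigma>" shows "\<sigma> (rpoly p x) = rpoly p (\<sigma> x)"
proof -
  interpret field_hom \<sigma> by fact
  show ?thesis
    by (induction p) (simp_all add: hom_distribs field_hom_of_rat[OF assms] map_poly_pCons)
qed

text \<open>Embeddings correspond to the complex roots of the minimal polynomial of a primitive
  element \<theta>. It has no multiple roots, so their number equals its degree, and that many
  powers of \<theta> span the field.\<close>

lemma embeddings_structure:
  obtains \<theta> :: "'k::number_field" where
    "finite (embeddings :: ('k \<Rightarrow> complex) set)" "(embeddings :: ('k \<Rightarrow> complex) set) \<noteq> {}"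
    "inj_on (\<lambda>\<sigma>. \<sigma> \<theta>) (embeddings :: ('k \<Rightarrow> complex) set)"
    "\<And>x. \<exists>q. x = (\<Sum>i<card (embeddings :: ('k \<Rightarrow> complex) set). of_rat (q i) * \<theta> ^ i)"
proof -
  let ?Emb = "embeddings :: ('k \<Rightarrow> complex) set"
  obtain \<theta> :: 'k where \<theta>: "adjoin \<theta> = UNIV" by (rule primitive_element)
  obtain f where f: "f \<noteq> 0" "rpoly f \<theta> = 0" "\<And>g. rpoly g \<theta> = 0 \<Longrightarrow> f dvd g" "coprime f (pderiv f)"
    "degree f > 0" by (rule minimal_rat_poly[of \<theta>]) blast
  define fc :: "complex poly" where "fc = map_poly of_rat f"
  have rsq: "rsquarefree fc"
    unfolding rsquarefree_roots
  proof (intro allI notI)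
    fix a assume a: "poly fc a = 0 \<and> poly (pderiv fc) a = 0"
    obtain u v where "u * f + v * pderiv f = 1"
      using f(4) by (metis bezout_coefficients_fst_snd coprime_iff_gcd_eq_1)
    then have "map_poly of_rat (u * f + v * pderiv f) = (1::complex poly)" by simp
    then have "poly (map_poly of_rat (u * f + v * pderiv f)) a = 1" by simp
    then show False using a
      by (simp add: of_rat_poly_hom.hom_mult of_rat_poly_hom.hom_add fc_def of_rat_hom.map_poly_pderiv)
  qed
  define A where "A = {a. poly fc a = 0}"
  have "fc \<noteq> 0" using f(1) by (simp add: fc_def)
  have "card A = degree fc"
  proof -
    have "fc = smult (lead_coeff fc) (\<Prod>z|poly fc z = 0. [:-z, 1:])"
      by (rule complex_poly_decompose_rsquarefree[OF rsq, symmetric])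
    then have "degree fc = degree (\<Prod>z\<in>A. [:-z, 1:])" using \<open>fc \<noteq> 0\<close> unfolding A_def
      by (metis degree_smult_eq leading_coeff_0_iff)
    also have "\<dots> = card A" by (subst degree_prod_eq_sum_degree) auto
    finally show ?thesis ..
  qed
  then have cardA: "card A = degree f" by (simp add: fc_def)
  have finA: "finite A" unfolding A_def by (rule poly_roots_finite[OF \<open>fc \<noteq> 0\<close>])
  have surj: "\<exists>\<sigma>\<in>?Emb. \<sigma> \<theta> = a" if a: "a \<in> A" for a
  proof -
    define P where "P = (\<lambda>x. SOME p. x = rpoly p \<theta>)"
    have P: "x = rpoly (P x) \<theta>" for x
    proof -
      have "x \<in> adjoin \<theta>" using \<theta> by simp
      then have "\<exists>p. x = rpoly p \<theta>" unfolding adjoin_def by blast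
      then show ?thesis unfolding P_def by (rule someI_ex)
    qed
    define \<sigma> where "\<sigma> = (\<lambda>x. rpoly (P x) a)"
    \<comment> \<open>Independence of the chosen polynomial: two polynomials with equal value at
      \<theta> differ by a multiple of \<open>f\<close>, which vanishes at \<open>a\<close>.\<close>
    have \<sigma>: "\<sigma> (rpoly p \<theta>) = rpoly p a" for p
    proof -
      have "rpoly (P (rpoly p \<theta>) - p) \<theta> = 0" using P[of "rpoly p \<theta>"] by (simp add: hom_distribs)
      then obtain q where "P (rpoly p \<theta>) - p = f * q" using f(3) by blast
      then have "P (rpoly p \<theta>) = p + f * q" by (simp add: algebra_simps)
      then show ?thesis using a by (simp add: \<sigma>_def A_def fc_def of_rat_poly_hom.hom_mult of_rat_poly_hom.hom_add)
    qed
    have "field_hom \<sigma>"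
    proof
      show "\<sigma> 0 = 0" using \<sigma>[of 0] by simp
      show "\<sigma> 1 = 1" using \<sigma>[of 1] by simp
      show "\<sigma> (x + y) = \<sigma> x + \<sigma> y" for x y
        using \<sigma>[of "P x + P y"] \<sigma>[of "P x"] \<sigma>[of "P y"] by (simp add: of_rat_poly_hom.hom_add flip: P)
      show "\<sigma> (x * y) = \<sigma> x * \<sigma> y" for x y
        using \<sigma>[of "P x * P y"] \<sigma>[of "P x"] \<sigma>[of "P y"] by (simp add: of_rat_poly_hom.hom_mult flip: P)
    qed
    moreover have "\<sigma> \<theta> = a" using \<sigma>[of "[:0, 1:]"] by (simp add: map_poly_pCons)
    ultimately show ?thesis unfolding embeddings_def by blast
  qed
  have inA: "\<sigma> \<theta> \<in> A" if "\<sigma> \<in> ?Emb" for \<sigma>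
  proof -
    have h: "field_hom \<sigma>" using that by (simp add: embeddings_def)
    interpret field_hom \<sigma> by fact
    show ?thesis using field_hom_rpoly[OF h, of f \<theta>] f(2) by (simp add: A_def fc_def)
  qed
  have inj: "inj_on (\<lambda>\<sigma>. \<sigma> \<theta>) ?Emb"
  proof (rule inj_onI, rule ext)
    fix \<sigma> \<tau> :: "'k \<Rightarrow> complex" and x
    assume "\<sigma> \<in> ?Emb" "\<tau> \<in> ?Emb" and eq: "\<sigma> \<theta> = \<tau> \<theta>"
    then have h: "field_hom \<sigma>" "field_hom \<tau>" by (simp_all add: embeddings_def)
    obtain p where "x = rpoly p \<theta>" using \<theta> unfolding adjoin_def by blast
    then show "\<sigma> x = \<tau> x" using eq by (simp add: field_hom_rpoly[OF h(1)] field_hom_rpoly[OF h(2)])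
  qed
  have img: "(\<lambda>\<sigma>. \<sigma> \<theta>) ` ?Emb = A" using inA surj by force
  have fin: "finite ?Emb" using finA inj img by (metis finite_imageD)
  have card: "card ?Emb = degree f" using card_image[OF inj] img cardA by simp
  have ne: "?Emb \<noteq> {}" using card f(5) by force
  have "\<exists>q. x = (\<Sum>i<degree f. of_rat (q i) * \<theta> ^ i)" for x
  proof -
    obtain p where p: "x = rpoly p \<theta>" using \<theta> unfolding adjoin_def by blast
    have "p = (p div f) * f + p mod f" by simp
    then have "rpoly p \<theta> = rpoly ((p div f) * f + p mod f) \<theta>" by simp
    also have "\<dots> = rpoly (p mod f) \<theta>"
      using f(2) by (simp only: of_rat_poly_hom.hom_mult of_rat_poly_hom.hom_add poly_add poly_mult) simp
    also have "\<dots> = (\<Sum>i<degree f. of_rat (coeff (p mod f) i) * \<theta> ^ i)"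
    proof -
      have d: "p mod f = 0 \<or> degree (p mod f) < degree f" by (rule degree_mod_less[OF f(1)])
      have "rpoly (p mod f) \<theta> = (\<Sum>i\<le>degree (p mod f). of_rat (coeff (p mod f) i) * \<theta> ^ i)"
        by (simp add: poly_altdef)
      also have "\<dots> = (\<Sum>i<degree f. of_rat (coeff (p mod f) i) * \<theta> ^ i)"
        by (rule sum.mono_neutral_left) (use d f(5) in \<open>auto simp: not_le coeff_eq_0\<close>)
      finally show ?thesis .
    qed
    finally show ?thesis unfolding p by (rule exI[of _ "coeff (p mod f)"])
  qed
  then show thesis using that[of \<theta>] fin ne inj unfolding card by blast
qed

lemma finite_embeddings: "finite (embeddings :: ('k::number_field \<Rightarrow> complex) set)"
  by (rule embeddings_structure) blast

lemma embeddings_nonempty: "(embeddings :: ('k::number_field \<Rightarrow> complex) set) \<noteq> {}"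
  by (rule embeddings_structure) blast

text \<open>A relation between embeddings carries over from the powers of \<theta> to all complex
  polynomials evaluated at the conjugates; the one vanishing at every conjugate except \<sigma>
  \<theta> isolates the coefficient.\<close>

lemma embeddings_independent:
  fixes c :: "('k::number_field \<Rightarrow> complex) \<Rightarrow> complex"
  assumes 0: "\<And>x. (\<Sum>\<sigma>\<in>embeddings. c \<sigma> * \<sigma> x) = 0" and \<sigma>: "\<sigma> \<in> embeddings"
  shows "c \<sigma> = 0"
proof -
  let ?Emb = "embeddings :: ('k \<Rightarrow> complex) set"
  obtain \<theta> :: 'k where inj: "inj_on (\<lambda>\<sigma>. \<sigma> \<theta>) ?Emb" by (rule embeddings_structure)
  have pow: "\<tau> (\<theta> ^ i) = \<tau> \<theta> ^ i" if "\<tau> \<in> ?Emb" for \<tau> i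
  proof -
    interpret field_hom \<tau> using that by (simp add: embeddings_def)
    show ?thesis by (rule hom_power)
  qed
  have "(\<Sum>\<tau>\<in>?Emb. c \<tau> * poly p (\<tau> \<theta>)) = 0" for p
  proof -
    have "(\<Sum>\<tau>\<in>?Emb. c \<tau> * poly p (\<tau> \<theta>)) = (\<Sum>\<tau>\<in>?Emb. \<Sum>i\<le>degree p. coeff p i * (c \<tau> * \<tau> (\<theta> ^ i)))"
      by (intro sum.cong refl) (simp add: poly_altdef pow sum_distrib_left mult_ac)
    also have "\<dots> = (\<Sum>i\<le>degree p. coeff p i * (\<Sum>\<tau>\<in>?Emb. c \<tau> * \<tau> (\<theta> ^ i)))"
      by (subst sum.swap) (simp add: sum_distrib_left)
    also have "\<dots> = 0" by (simp add: 0)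
    finally show ?thesis .
  qed
  from this[of "\<Prod>\<tau>\<in>?Emb-{\<sigma>}. [:- \<tau> \<theta>, 1:]"]
  have "(\<Sum>\<tau>\<in>?Emb. c \<tau> * (\<Prod>\<rho>\<in>?Emb-{\<sigma>}. \<tau> \<theta> - \<rho> \<theta>)) = 0" by (simp add: poly_prod)
  also have "(\<Sum>\<tau>\<in>?Emb. c \<tau> * (\<Prod>\<rho>\<in>?Emb-{\<sigma>}. \<tau> \<theta> - \<rho> \<theta>)) = (\<Sum>\<tau>\<in>{\<sigma>}. c \<tau> * (\<Prod>\<rho>\<in>?Emb-{\<sigma>}. \<tau> \<theta> - \<rho> \<theta>))"
    using \<sigma> finite_embeddings by (intro sum.mono_neutral_right) auto
  finally have "c \<sigma> * (\<Prod>\<rho>\<in>?Emb-{\<sigma>}. \<sigma> \<theta> - \<rho> \<theta>) = 0" by simp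
  moreover have "(\<Prod>\<rho>\<in>?Emb-{\<sigma>}. \<sigma> \<theta> - \<rho> \<theta>) \<noteq> 0"
    using inj_onD[OF inj _ \<sigma>] by (subst prod_zero_iff) (auto intro: finite_embeddings)
  ultimately show ?thesis by simp
qed

text \<open>As a type, the embeddings can index vectors and matrices, so that determinants and
  Lebesgue measure on \<open>real^'k emb\<close> apply to them.\<close>

typedef (overloaded) 'k emb = "embeddings :: ('k::number_field \<Rightarrow> complex) set"
  using embeddings_nonempty by blast

lemma UNIV_emb: "(UNIV :: 'k::number_field emb set) = Abs_emb ` embeddings"
  using Rep_emb Rep_emb_inverse by (metis UNIV_eq_I image_eqI)

instance emb :: (number_field) finite
  by standard (simp add: UNIV_emb finite_embeddings)

text \<open>The order is only needed because the change of variables formula for Lebesgue measure is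
  stated for well-ordered index types; it also serves to select one of two conjugate embeddings.\<close>

instantiation emb :: (number_field) wellorder
begin

definition emb_index :: "'a emb \<Rightarrow> nat" where "emb_index = (SOME f. inj f)"

definition less_eq_emb :: "'a emb \<Rightarrow> 'a emb \<Rightarrow> bool" where "x \<le> y \<longleftrightarrow> emb_index x \<le> emb_index y"

definition less_emb :: "'a emb \<Rightarrow> 'a emb \<Rightarrow> bool" where "x < y \<longleftrightarrow> emb_index x < emb_index y"

lemma inj_emb_index: "inj (emb_index :: 'a emb \<Rightarrow> nat)"
proof -
  have "\<exists>f :: 'a emb \<Rightarrow> nat. inj f"
    using finite_imp_inj_to_nat_seg[OF finite[of "UNIV :: 'a emb set"]] by blast
  then show ?thesis unfolding emb_index_def by (rule someI_ex)
qed

instance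
proof
  fix x y :: "'a emb"
  show "x \<le> y \<Longrightarrow> y \<le> x \<Longrightarrow> x = y"
    using inj_emb_index by (auto simp: less_eq_emb_def inj_def)
  fix P :: "'a emb \<Rightarrow> bool" and a :: "'a emb"
  assume "\<And>x. (\<And>y. y < x \<Longrightarrow> P y) \<Longrightarrow> P x"
  then show "P a" unfolding less_emb_def by (rule measure_induct_rule[of emb_index])
qed (auto simp: less_eq_emb_def less_emb_def)

end

lemma field_hom_Rep_emb: "field_hom (Rep_emb \<sigma>)"
  using Rep_emb[of \<sigma>] by (simp add: embeddings_def)

interpretation emb: field_hom "Rep_emb \<sigma>" for \<sigma> :: "'k::number_field emb"
  by (rule field_hom_Rep_emb)

lemma Rep_emb_of_rat [simp]: "Rep_emb \<sigma> (of_rat q) = of_rat q"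
  by (rule field_hom_of_rat[OF field_hom_Rep_emb])

lemma Rep_emb_of_int [simp]: "Rep_emb \<sigma> (of_int q) = of_int q"
  by (rule emb.hom_of_int)

definition cnj_emb :: "'k::number_field emb \<Rightarrow> 'k emb" where
  "cnj_emb \<sigma> = Abs_emb (\<lambda>x. cnj (Rep_emb \<sigma> x))"

lemma Rep_cnj_emb [simp]: "Rep_emb (cnj_emb \<sigma>) x = cnj (Rep_emb \<sigma> x)"
proof -
  have "field_hom (\<lambda>x. cnj (Rep_emb \<sigma> x))"
    by unfold_locales (simp_all add: emb.hom_add emb.hom_mult)
  then show ?thesis unfolding cnj_emb_def by (subst Abs_emb_inverse) (auto simp: embeddings_def)
qed

lemma emb_eqI: "(\<And>x. Rep_emb \<sigma> x = Rep_emb \<tau> x) \<Longrightarrow> \<sigma> = \<tau>"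
  using Rep_emb_inject by blast

lemma cnj_cnj_emb [simp]: "cnj_emb (cnj_emb \<sigma>) = \<sigma>"
  by (rule emb_eqI) simp

definition real_embs :: "'k::number_field emb set" where "real_embs = {\<sigma>. cnj_emb \<sigma> = \<sigma>}"

definition cplx_embs :: "'k::number_field emb set" where "cplx_embs = {\<sigma>. \<sigma> < cnj_emb \<sigma>}"

lemma Im_real_emb: "\<sigma> \<in> real_embs \<Longrightarrow> Im (Rep_emb \<sigma> x) = 0"
  using Rep_cnj_emb[of \<sigma> x] unfolding real_embs_def by (auto simp: complex_eq_iff)

lemma UNIV_emb_split:
  "(UNIV :: 'k::number_field emb set) = real_embs \<union> cplx_embs \<union> cnj_emb ` cplx_embs"
  "(real_embs :: 'k emb set) \<inter> cplx_embs = {}" "(real_embs \<union> cplx_embs) \<inter> cnj_emb ` (cplx_embs :: 'k emb set) = {}"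
proof -
  have "\<sigma> \<in> real_embs \<union> cplx_embs \<union> cnj_emb ` cplx_embs" for \<sigma> :: "'k emb"
  proof -
    consider "cnj_emb \<sigma> = \<sigma>" | "\<sigma> < cnj_emb \<sigma>" | "cnj_emb \<sigma> < \<sigma>" by fastforce
    then show ?thesis
    proof cases
      case 3
      then have "cnj_emb \<sigma> \<in> cplx_embs" by (simp add: cplx_embs_def)
      then have "cnj_emb (cnj_emb \<sigma>) \<in> cnj_emb ` cplx_embs" by (rule imageI)
      then show ?thesis by simp
    qed (auto simp: real_embs_def cplx_embs_def)
  qed
  then show "UNIV = real_embs \<union> cplx_embs \<union> cnj_emb ` (cplx_embs :: 'k emb set)" by blast
qed (auto simp: real_embs_def cplx_embs_def)

lemma inj_cnj_emb: "inj_on cnj_emb A"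
  by (metis cnj_cnj_emb inj_onI)

lemma sum_emb_split:
  "(\<Sum>\<sigma>\<in>UNIV. f \<sigma>) = (\<Sum>\<sigma>\<in>real_embs. f \<sigma>) + (\<Sum>\<sigma>\<in>cplx_embs. f \<sigma> + f (cnj_emb \<sigma>) :: 'a::comm_monoid_add)"
  by (simp add: UNIV_emb_split sum.union_disjoint sum.reindex[OF inj_cnj_emb] sum.distrib add.assoc)

lemma prod_emb_split:
  "(\<Prod>\<sigma>\<in>UNIV. f \<sigma>) = (\<Prod>\<sigma>\<in>real_embs. f \<sigma>) * (\<Prod>\<sigma>\<in>cplx_embs. f \<sigma> * f (cnj_emb \<sigma>) :: 'a::comm_monoid_mult)"
  by (simp add: UNIV_emb_split prod.union_disjoint prod.reindex[OF inj_cnj_emb] prod.distrib mult.assoc)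

lemma CARD_emb: "CARD('k::number_field emb) = card (real_embs :: 'k emb set) + 2 * card (cplx_embs :: 'k emb set)"
  using sum_emb_split[of "\<lambda>_::'k emb. 1::nat"] by simp

lemma emb_independent:
  fixes c :: "'k::number_field emb \<Rightarrow> complex"
  assumes "\<And>x. (\<Sum>\<sigma>\<in>UNIV. c \<sigma> * Rep_emb \<sigma> x) = 0"
  shows "c \<sigma> = 0"
proof -
  have inj: "inj_on Abs_emb (embeddings :: ('k \<Rightarrow> complex) set)" by (meson Abs_emb_inject inj_onI)
  have "c (Abs_emb (Rep_emb \<sigma>)) = 0"
  proof (rule embeddings_independent[where c = "\<lambda>\<sigma>. c (Abs_emb \<sigma>)"])
    fix x
    show "(\<Sum>\<sigma>\<in>embeddings. c (Abs_emb \<sigma>) * \<sigma> x) = 0"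
      using assms[of x] by (simp add: UNIV_emb sum.reindex[OF inj] Abs_emb_inverse)
  qed (rule Rep_emb)
  then show ?thesis by (simp add: Rep_emb_inverse)
qed

text \<open>Real coordinates of K \<otimes> \<real>. Of a conjugate pair the smaller embedding
  records the real part and the larger one the imaginary part, so there are as many coordinates as
  embeddings and all matrices are real.\<close>

definition coord :: "'k::number_field emb \<Rightarrow> 'k \<Rightarrow> real" where
  "coord \<sigma> x = (if \<sigma> \<le> cnj_emb \<sigma> then Re (Rep_emb \<sigma> x) else Im (Rep_emb \<sigma> x))"

lemma coord_diff: "coord \<sigma> (x - y) = coord \<sigma> x - coord \<sigma> y"
  by (simp add: coord_def emb.hom_minus)

lemma coord_sum: "coord \<sigma> (\<Sum>i\<in>I. f i) = (\<Sum>i\<in>I. coord \<sigma> (f i))"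
  by (simp add: coord_def emb.hom_sum)

lemma coord_of_rat_mult: "coord \<sigma> (of_rat q * x) = of_rat q * coord \<sigma> x"
proof -
  have "(of_rat q :: complex) = complex_of_real (of_rat q)" by (cases q) (simp add: of_rat_rat)
  then show ?thesis by (simp add: coord_def emb.hom_mult)
qed

lemma coord_real: "\<sigma> \<in> real_embs \<Longrightarrow> coord \<sigma> x = Re (Rep_emb \<sigma> x)"
  by (simp add: coord_def real_embs_def)

lemma coord_cplx: "\<sigma> \<in> cplx_embs \<Longrightarrow> coord \<sigma> x = Re (Rep_emb \<sigma> x)"
  by (simp add: coord_def cplx_embs_def less_imp_le)

lemma coord_cnj_cplx: "\<sigma> \<in> cplx_embs \<Longrightarrow> coord (cnj_emb \<sigma>) x = - Im (Rep_emb \<sigma> x)"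
  by (simp add: coord_def cplx_embs_def flip: not_less)

lemma coord_independent:
  fixes a :: "'k::number_field emb \<Rightarrow> real"
  assumes 0: "\<And>x. (\<Sum>\<sigma>\<in>UNIV. a \<sigma> * coord \<sigma> x) = 0"
  shows "a \<sigma> = 0"
proof -
  \<comment> \<open>On a conjugate pair, a Re z - b Im z = c z + c' z' with c = (a + i b) / 2, where
    the prime denotes complex conjugation. This reduces the claim to the independence of the
    embeddings.\<close>
  define c where "c = (\<lambda>\<sigma>. if \<sigma> \<in> real_embs then complex_of_real (a \<sigma>)
     else if \<sigma> \<in> cplx_embs then Complex (a \<sigma> / 2) (a (cnj_emb \<sigma>) / 2)
     else Complex (a (cnj_emb \<sigma>) / 2) (- a \<sigma> / 2))"
  have notin: "cnj_emb \<sigma> \<notin> real_embs" "cnj_emb \<sigma> \<notin> cplx_embs" "\<sigma> \<notin> real_embs"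
    if "\<sigma> \<in> cplx_embs" for \<sigma> :: "'k emb"
    using that by (auto simp: real_embs_def cplx_embs_def)
  have eq: "(\<Sum>\<sigma>\<in>UNIV. c \<sigma> * Rep_emb \<sigma> x) = complex_of_real (\<Sum>\<sigma>\<in>UNIV. a \<sigma> * coord \<sigma> x)" for x
  proof -
    have 1: "c \<sigma> * Rep_emb \<sigma> x = complex_of_real (a \<sigma> * coord \<sigma> x)" if "\<sigma> \<in> real_embs" for \<sigma>
      using that Im_real_emb[OF that, of x] by (simp add: c_def coord_real complex_eq_iff)
    have 2: "c \<sigma> * Rep_emb \<sigma> x + c (cnj_emb \<sigma>) * Rep_emb (cnj_emb \<sigma>) x =
        complex_of_real (a \<sigma> * coord \<sigma> x + a (cnj_emb \<sigma>) * coord (cnj_emb \<sigma>) x)"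
      if "\<sigma> \<in> cplx_embs" for \<sigma>
      using that notin[OF that] by (simp add: c_def coord_cplx coord_cnj_cplx complex_eq_iff)
    show ?thesis
      unfolding of_real_sum sum_emb_split[of "\<lambda>\<sigma>. c \<sigma> * Rep_emb \<sigma> x"]
        sum_emb_split[of "\<lambda>\<sigma>. complex_of_real (a \<sigma> * coord \<sigma> x)"]
      by (rule arg_cong2[where f = "(+)"]; rule sum.cong) (simp_all only: 1 2 of_real_add)
  qed
  have c0: "c \<sigma> = 0" for \<sigma> by (rule emb_independent) (simp only: eq 0 of_real_0)
  show ?thesis
    using c0[of \<sigma>] by (auto simp: c_def complex_eq_iff split: if_splits)
qed

hide_const (open) Matrix.row Matrix.mat Matrix.vec Determinant.det
no_notation Matrix.vec_index (infixl "$" 100)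
no_notation Matrix.scalar_prod (infix "\<bullet>" 70)
no_notation fps_nth (infixl "$" 75)

section \<open>Bases and the discriminant\<close>

text \<open>The relation, read as a polynomial of degree below n, would have the n distinct
  conjugates of \<theta> as roots.\<close>

lemma powers_independent:
  fixes \<theta> :: "'k::number_field"
  assumes inj: "inj_on (\<lambda>\<sigma>. \<sigma> \<theta>) (embeddings :: ('k \<Rightarrow> complex) set)"
    and 0: "(\<Sum>i<card (embeddings :: ('k \<Rightarrow> complex) set). of_rat (q i) * \<theta> ^ i) = 0"
    and i: "i < card (embeddings :: ('k \<Rightarrow> complex) set)"
  shows "q i = 0"
proof -
  let ?n = "card (embeddings :: ('k \<Rightarrow> complex) set)"
  define p :: "complex poly" where "p = (\<Sum>i<?n. monom (of_rat (q i)) i)"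
  have root: "poly p (\<sigma> \<theta>) = 0" if "\<sigma> \<in> embeddings" for \<sigma>
  proof -
    have h: "field_hom \<sigma>" using that by (simp add: embeddings_def)
    interpret field_hom \<sigma> by (rule h)
    have "poly p (\<sigma> \<theta>) = \<sigma> (\<Sum>i<?n. of_rat (q i) * \<theta> ^ i)"
      by (simp add: p_def poly_sum poly_monom hom_sum hom_mult hom_power field_hom_of_rat[OF h])
    then show ?thesis using 0 by simp
  qed
  have coeff: "coeff p j = (if j < ?n then of_rat (q j) else 0)" for j
    by (simp add: p_def coeff_sum coeff_monom if_distrib cong: if_cong)
  have "p = 0"
  proof (rule ccontr)
    assume "p \<noteq> 0"
    have "?n = card ((\<lambda>\<sigma>. \<sigma> \<theta>) ` (embeddings :: ('k \<Rightarrow> complex) set))" using card_image[OF inj] by simp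
    also have "\<dots> \<le> card {z. poly p z = 0}"
      using root by (intro card_mono poly_roots_finite \<open>p \<noteq> 0\<close>) auto
    also have "\<dots> \<le> degree p" by (rule card_poly_roots_bound[OF \<open>p \<noteq> 0\<close>])
    finally have "?n \<le> degree p" .
    moreover have "coeff p (degree p) \<noteq> 0" using \<open>p \<noteq> 0\<close> by simp
    ultimately show False by (simp add: coeff)
  qed
  then have "coeff p i = 0" by simp
  then show ?thesis using i by (simp add: coeff)
qed

lemma CARD_emb_embeddings: "CARD('k::number_field emb) = card (embeddings :: ('k \<Rightarrow> complex) set)"
  unfolding UNIV_emb by (rule card_image) (meson Abs_emb_inject inj_onI)

text \<open>The powers of a primitive element form one basis with as many elements as there are
  embeddings; the exchange lemma compares any other basis with it.\<close>

lemma rational_basis_card: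
  fixes B :: "'k::number_field set"
  assumes ind: "QV.independent B" and span: "QV.span B = UNIV"
  shows "finite B" "card B = CARD('k emb)"
proof -
  let ?n = "card (embeddings :: ('k \<Rightarrow> complex) set)"
  obtain \<theta> :: 'k where inj: "inj_on (\<lambda>\<sigma>. \<sigma> \<theta>) (embeddings :: ('k \<Rightarrow> complex) set)"
    and sp: "\<And>x. \<exists>q. x = (\<Sum>i<?n. of_rat (q i) * \<theta> ^ i)" by (rule embeddings_structure) blast
  define P where "P = (\<lambda>i. \<theta> ^ i) ` {..<?n}"
  have inj_pow: "inj_on (\<lambda>i. \<theta> ^ i) {..<?n}"
  proof (rule inj_onI)
    fix i j assume ij: "i \<in> {..<?n}" "j \<in> {..<?n}" "\<theta> ^ i = \<theta> ^ j"
    show "i = j"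
    proof (rule ccontr)
      assume "i \<noteq> j"
      define q :: "nat \<Rightarrow> rat" where "q = (\<lambda>k. (if k = i then 1 else 0) - (if k = j then 1 else 0))"
      have "(\<Sum>k<?n. of_rat (q k) * \<theta> ^ k) = (\<Sum>k<?n. (if k = i then \<theta> ^ k else 0) - (if k = j then \<theta> ^ k else 0))"
        by (intro sum.cong) (auto simp: q_def of_rat_diff)
      also have "\<dots> = 0" using ij by (simp add: sum_subtractf)
      finally have "q i = 0" using powers_independent[OF inj] ij(1) by blast
      then show False using \<open>i \<noteq> j\<close> by (simp add: q_def)
    qed
  qed
  have finP: "finite P" and cardP: "card P = ?n" using inj_pow by (simp_all add: P_def card_image)
  have indP: "QV.independent P"
  proof
    assume "QV.dependent P"
    then obtain u where u: "\<exists>v\<in>P. u v \<noteq> 0" "(\<Sum>v\<in>P. of_rat (u v) * v) = 0"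
      using QV.dependent_finite[OF finP] by blast
    have "(\<Sum>i<?n. of_rat (u (\<theta> ^ i)) * \<theta> ^ i) = 0" using u(2) by (simp add: P_def sum.reindex[OF inj_pow])
    then have "u (\<theta> ^ i) = 0" if "i < ?n" for i
      using powers_independent[OF inj, of "\<lambda>i. u (\<theta> ^ i)"] that by blast
    with u(1) show False by (auto simp: P_def)
  qed
  have spanP: "x \<in> QV.span P" for x
  proof -
    obtain q where q: "x = (\<Sum>i<?n. of_rat (q i) * \<theta> ^ i)" using sp by blast
    show ?thesis unfolding q by (intro QV.span_sum QV.span_scale QV.span_base) (simp add: P_def)
  qed
  have B: "finite B \<and> card B \<le> card P" by (rule QV.independent_span_bound[OF finP ind]) (use spanP in blast)
  then show "finite B" by simp
  have "card P \<le> card B" using QV.independent_span_bound[of B P] B indP span by blast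
  with B cardP show "card B = CARD('k emb)" by (simp add: CARD_emb_embeddings)
qed

lemma independent_spans:
  fixes B :: "'k::number_field set"
  assumes ind: "QV.independent B" and card: "card B = CARD('k emb)"
  shows "QV.span B = UNIV"
proof -
  have finB: "finite B" using card by (metis card.infinite card_gt_0_iff finite finite_UNIV_card_ge_0 less_numeral_extra(3))
  let ?C = "QV.extend_basis B"
  have C: "QV.independent ?C" "QV.span ?C = UNIV" "B \<subseteq> ?C"
    using QV.independent_extend_basis[OF ind] QV.span_extend_basis[OF ind] QV.extend_basis_superset[OF ind] by auto
  have "finite ?C" "card ?C = card B" using rational_basis_card[OF C(1,2)] card by auto
  then have "B = ?C" using C(3) card_subset_eq by metis
  with C(2) show ?thesis by simp
qed

section \<open>Rational bases and invertible coordinate matrices\<close>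

definition coord_matrix :: "('k::number_field emb \<Rightarrow> 'k) \<Rightarrow> real^'k emb^'k emb" where
  "coord_matrix \<beta> = (\<chi> \<sigma> j. coord \<sigma> (\<beta> j))"

definition rational_basis :: "('k::number_field emb \<Rightarrow> 'k) \<Rightarrow> bool" where
  "rational_basis \<beta> \<longleftrightarrow> (\<forall>x. \<exists>q. x = (\<Sum>j\<in>UNIV. of_rat (q j) * \<beta> j))"

text \<open>A linear relation between the rows would extend from the family \<beta> to all of K and
  contradict \<open>coord_independent\<close>.\<close>

lemma det_coord_matrix_nonzero:
  assumes "rational_basis (\<beta> :: 'k::number_field emb \<Rightarrow> 'k)"
  shows "det (coord_matrix \<beta>) \<noteq> 0"
proof -
  have "\<forall>i. c i = 0" if c: "(\<Sum>i\<in>UNIV. c i *s row i (coord_matrix \<beta>)) = 0" for c :: "'k emb \<Rightarrow> real"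
  proof -
    have c': "(\<Sum>i\<in>UNIV. c i * coord i (\<beta> j)) = 0" for j
      using arg_cong[OF c, of "\<lambda>v. v $ j"] by (simp add: row_def coord_matrix_def)
    have "(\<Sum>i\<in>UNIV. c i * coord i x) = 0" for x
    proof -
      obtain q where q: "x = (\<Sum>j\<in>UNIV. of_rat (q j) * \<beta> j)" using assms unfolding rational_basis_def by blast
      have "(\<Sum>i\<in>UNIV. c i * coord i x) = (\<Sum>i\<in>UNIV. \<Sum>j\<in>UNIV. of_rat (q j) * (c i * coord i (\<beta> j)))"
        by (simp add: q coord_sum coord_of_rat_mult sum_distrib_left) (simp add: mult_ac)
      also have "\<dots> = (\<Sum>j\<in>UNIV. of_rat (q j) * (\<Sum>i\<in>UNIV. c i * coord i (\<beta> j)))"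
        by (subst sum.swap) (simp add: sum_distrib_left)
      finally show ?thesis by (simp add: c')
    qed
    then show ?thesis using coord_independent[of c] by blast
  qed
  then have "\<exists>B. coord_matrix \<beta> ** B = mat 1"
    unfolding matrix_right_invertible_independent_rows by blast
  then show ?thesis by (metis invertible_det_nz invertible_def matrix_left_right_inverse)
qed

lemma coord_matrix_mult: "(coord_matrix \<beta> *v (\<chi> j. of_rat (q j))) $ \<sigma> = coord \<sigma> (\<Sum>j\<in>UNIV. of_rat (q j) * \<beta> j)"
  by (simp add: coord_matrix_def matrix_vector_mult_def coord_sum coord_of_rat_mult) (simp add: mult.commute)

lemma rational_basis_unique:
  fixes \<beta> :: "'k::number_field emb \<Rightarrow> 'k"
  assumes det: "det (coord_matrix \<beta>) \<noteq> 0" and 0: "(\<Sum>j\<in>UNIV. of_rat (q j) * \<beta> j) = 0"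
  shows "q j = 0"
proof -
  have "coord_matrix \<beta> *v (\<chi> j. of_rat (q j)) = 0"
    by (simp add: vec_eq_iff coord_matrix_mult 0 coord_def)
  then have "(\<chi> j. of_rat (q j)) = (0 :: real^'k emb)"
    using det by (metis invertible_det_nz invertible_def matrix_left_invertible_ker)
  then show ?thesis by (auto simp: vec_eq_iff)
qed

lemma rational_basis_if_det:
  fixes \<beta> :: "'k::number_field emb \<Rightarrow> 'k"
  assumes det: "det (coord_matrix \<beta>) \<noteq> 0"
  shows "rational_basis \<beta>" "inj \<beta>" "QV.independent (range \<beta>)"
proof -
  show inj: "inj \<beta>"
  proof (rule injI, rule ccontr)
    fix i j assume ij: "\<beta> i = \<beta> j" "i \<noteq> j"
    define q :: "'k emb \<Rightarrow> rat" where "q = (\<lambda>k. (if k = i then 1 else 0) - (if k = j then 1 else 0))"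
    have "(\<Sum>k\<in>UNIV. of_rat (q k) * \<beta> k) = (\<Sum>k\<in>UNIV. (if k = i then \<beta> k else 0) - (if k = j then \<beta> k else 0))"
      by (intro sum.cong) (auto simp: q_def of_rat_diff)
    also have "\<dots> = 0" using ij by (simp add: sum_subtractf)
    finally have "q i = 0" by (rule rational_basis_unique[OF det])
    then show False using ij by (simp add: q_def)
  qed
  show ind: "QV.independent (range \<beta>)"
  proof
    assume "QV.dependent (range \<beta>)"
    then obtain u where u: "\<exists>v\<in>range \<beta>. u v \<noteq> 0" "(\<Sum>v\<in>range \<beta>. of_rat (u v) * v) = 0"
      using QV.dependent_finite[of "range \<beta>"] by auto
    have "(\<Sum>j\<in>UNIV. of_rat (u (\<beta> j)) * \<beta> j) = 0" using u(2) by (simp add: sum.reindex[OF inj])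
    from rational_basis_unique[OF det this] u(1) show False by auto
  qed
  have sp: "QV.span (range \<beta>) = UNIV" by (rule independent_spans[OF ind]) (simp add: card_image[OF inj])
  show "rational_basis \<beta>" unfolding rational_basis_def
  proof
    fix x
    have "x \<in> QV.span (range \<beta>)" using sp by simp
    then obtain u where "x = (\<Sum>v\<in>range \<beta>. of_rat (u v) * v)" by (auto simp: QV.span_finite)
    then show "\<exists>q. x = (\<Sum>j\<in>UNIV. of_rat (q j) * \<beta> j)"
      by (intro exI[of _ "\<lambda>j. u (\<beta> j)"]) (simp add: sum.reindex[OF inj])
  qed
qed

lemma rational_basis_exists: obtains \<beta> :: "'k::number_field emb \<Rightarrow> 'k" where "rational_basis \<beta>"
proof -
  let ?n = "card (embeddings :: ('k \<Rightarrow> complex) set)"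
  obtain \<theta> :: 'k where sp: "\<And>x. \<exists>q. x = (\<Sum>i<?n. of_rat (q i) * \<theta> ^ i)" by (rule embeddings_structure) blast
  obtain h :: "'k emb \<Rightarrow> nat" where h: "bij_betw h UNIV {..<?n}"
    by (metis CARD_emb_embeddings bij_betw_iff_card card_lessThan finite finite_lessThan)
  have "\<exists>q. x = (\<Sum>j\<in>UNIV. of_rat (q j) * \<theta> ^ h j)" for x
  proof -
    obtain q where "x = (\<Sum>i<?n. of_rat (q i) * \<theta> ^ i)" using sp by blast
    also have "\<dots> = (\<Sum>j\<in>UNIV. of_rat (q (h j)) * \<theta> ^ h j)" by (rule sum.reindex_bij_betw[OF h, symmetric])
    finally show ?thesis by (rule exI[of _ "\<lambda>j. q (h j)"])
  qed
  then show thesis using that[of "\<lambda>j. \<theta> ^ h j"] unfolding rational_basis_def by blast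
qed

subsection \<open>The trace\<close>

text \<open>With \<open>M\<close> the embeddings of a basis and \<open>A\<close> the matrix of
  multiplication by \<open>x\<close>, one has M A = D M for the diagonal matrix D of the \<sigma> x.
  Since \<open>M\<close> is invertible, A and D have the same trace.\<close>

lemma field_trace_eq_sum_emb: "of_rat (field_trace x) = (\<Sum>\<sigma>\<in>UNIV. Rep_emb \<sigma> (x :: 'k::number_field))"
proof -
  define B :: "'k set" where "B = QV.extend_basis {}"
  have ind: "QV.independent B" and span: "QV.span B = UNIV"
    unfolding B_def using QV.independent_extend_basis[OF QV.independent_empty] QV.span_extend_basis[OF QV.independent_empty] by auto
  have B: "finite B" "card B = CARD('k emb)" by (rule rational_basis_card[OF ind span])+
  then obtain \<beta> :: "'k emb \<Rightarrow> 'k" where \<beta>: "bij_betw \<beta> UNIV B"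
    by (metis bij_betw_iff_card finite)
  have inj: "inj \<beta>" and ran: "range \<beta> = B" using \<beta> by (auto simp: bij_betw_def)
  have exp: "y = (\<Sum>j\<in>UNIV. of_rat (QV.representation B y (\<beta> j)) * \<beta> j)" for y
  proof -
    have "(\<Sum>b\<in>B. of_rat (QV.representation B y b) * b) = y"
      by (rule QV.sum_representation_eq[OF ind _ B(1)]) (auto simp: span)
    then show ?thesis using sum.reindex_bij_betw[OF \<beta>, of "\<lambda>b. of_rat (QV.representation B y b) * b"] by simp
  qed
  define M :: "complex^'k emb^'k emb" where "M = (\<chi> \<sigma> j. Rep_emb \<sigma> (\<beta> j))"
  have "\<forall>i. c i = 0" if c: "(\<Sum>i\<in>UNIV. c i *s row i M) = 0" for c :: "'k emb \<Rightarrow> complex"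
  proof -
    have c': "(\<Sum>i\<in>UNIV. c i * Rep_emb i (\<beta> j)) = 0" for j
      using arg_cong[OF c, of "\<lambda>v. v $ j"] by (simp add: row_def M_def)
    have "(\<Sum>i\<in>UNIV. c i * Rep_emb i y) = 0" for y
    proof -
      have "(\<Sum>i\<in>UNIV. c i * Rep_emb i y) =
          (\<Sum>i\<in>UNIV. \<Sum>j\<in>UNIV. of_rat (QV.representation B y (\<beta> j)) * (c i * Rep_emb i (\<beta> j)))"
        by (subst exp[of y]) (simp add: emb.hom_sum emb.hom_mult sum_distrib_left mult_ac)
      also have "\<dots> = (\<Sum>j\<in>UNIV. of_rat (QV.representation B y (\<beta> j)) * (\<Sum>i\<in>UNIV. c i * Rep_emb i (\<beta> j)))"
        by (subst sum.swap) (simp add: sum_distrib_left)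
      finally show ?thesis by (simp add: c')
    qed
    then show ?thesis using emb_independent[of c] by blast
  qed
  then obtain W where MW: "M ** W = mat 1"
    unfolding matrix_right_invertible_independent_rows[symmetric] by (metis matrix_right_invertible_independent_rows)
  then have WM: "W ** M = mat 1" by (simp add: matrix_left_right_inverse)
  define A :: "complex^'k emb^'k emb" where "A = (\<chi> k j. of_rat (QV.representation B (x * \<beta> j) (\<beta> k)))"
  have MA: "(M ** A) $ \<sigma> $ j = Rep_emb \<sigma> x * M $ \<sigma> $ j" for \<sigma> j
  proof -
    have "Rep_emb \<sigma> x * M $ \<sigma> $ j = Rep_emb \<sigma> (x * \<beta> j)" by (simp add: M_def emb.hom_mult)
    also have "\<dots> = (\<Sum>k\<in>UNIV. of_rat (QV.representation B (x * \<beta> j) (\<beta> k)) * Rep_emb \<sigma> (\<beta> k))"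
      by (subst exp[of "x * \<beta> j"]) (simp add: emb.hom_sum emb.hom_mult)
    finally show ?thesis by (simp add: matrix_matrix_mult_def M_def A_def mult.commute)
  qed
  have "A = W ** (M ** A)" using WM by (simp add: matrix_mul_assoc)
  then have Ajj: "A $ j $ j = (\<Sum>\<sigma>\<in>UNIV. W $ j $ \<sigma> * (Rep_emb \<sigma> x * M $ \<sigma> $ j))" for j
    using MA by (metis (mono_tags, lifting) matrix_matrix_mult_def sum.cong vec_lambda_beta)
  have MWd: "(\<Sum>j\<in>UNIV. M $ \<sigma> $ j * W $ j $ \<sigma>) = 1" for \<sigma>
    using arg_cong[OF MW, of "\<lambda>Z. Z $ \<sigma> $ \<sigma>"] by (simp add: matrix_matrix_mult_def mat_def)
  have "of_rat (field_trace x) = (\<Sum>j\<in>UNIV. A $ j $ j)"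
    unfolding field_trace_def B_def[symmetric] Let_def
    using sum.reindex_bij_betw[OF \<beta>, of "\<lambda>b. of_rat (QV.representation B (x * b) b) :: complex"]
    by (simp add: A_def of_rat_sum)
  also have "\<dots> = (\<Sum>\<sigma>\<in>UNIV. \<Sum>j\<in>UNIV. Rep_emb \<sigma> x * (M $ \<sigma> $ j * W $ j $ \<sigma>))"
    unfolding Ajj by (subst sum.swap) (simp add: mult_ac)
  also have "\<dots> = (\<Sum>\<sigma>\<in>UNIV. Rep_emb \<sigma> x)"
    by (simp add: MWd flip: sum_distrib_left)
  finally show ?thesis .
qed

text \<open>The diagonal entries of the trace form in the coordinates \<open>coord\<close>: a
  conjugate pair contributes 2 Re(x y), that is 2 Re x Re y - 2 Im x Im y.\<close>

definition trace_sign :: "'k::number_field emb \<Rightarrow> real" where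
  "trace_sign \<sigma> = (if \<sigma> \<in> real_embs then 1 else if \<sigma> \<in> cplx_embs then 2 else - 2)"

lemma trace_sign_simps:
  "\<sigma> \<in> real_embs \<Longrightarrow> trace_sign \<sigma> = 1" "\<sigma> \<in> cplx_embs \<Longrightarrow> trace_sign \<sigma> = 2"
  "\<sigma> \<in> cplx_embs \<Longrightarrow> trace_sign (cnj_emb \<sigma>) = - 2"
  by (auto simp: trace_sign_def real_embs_def cplx_embs_def)

lemma field_trace_mult:
  "of_rat (field_trace (x * y)) = (\<Sum>\<sigma>\<in>UNIV. trace_sign \<sigma> * coord \<sigma> x * coord \<sigma> y :: real)"
proof -
  have "of_rat q = Re (of_rat q)" for q by (cases q) (simp add: of_rat_rat)
  then have "of_rat (field_trace (x * y)) = Re (\<Sum>\<sigma>\<in>UNIV. Rep_emb \<sigma> (x * y))"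
    by (metis field_trace_eq_sum_emb)
  also have "\<dots> = (\<Sum>\<sigma>\<in>real_embs. Re (Rep_emb \<sigma> (x * y))) + (\<Sum>\<sigma>\<in>cplx_embs. 2 * Re (Rep_emb \<sigma> (x * y)))"
    unfolding sum_emb_split by simp
  also have "\<dots> = (\<Sum>\<sigma>\<in>real_embs. trace_sign \<sigma> * coord \<sigma> x * coord \<sigma> y) +
      (\<Sum>\<sigma>\<in>cplx_embs. trace_sign \<sigma> * coord \<sigma> x * coord \<sigma> y +
         trace_sign (cnj_emb \<sigma>) * coord (cnj_emb \<sigma>) x * coord (cnj_emb \<sigma>) y)"
    by (rule arg_cong2[where f = "(+)"]; rule sum.cong)
      (simp_all add: trace_sign_simps coord_real coord_cplx coord_cnj_cplx emb.hom_mult Im_real_emb)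
  also have "\<dots> = (\<Sum>\<sigma>\<in>UNIV. trace_sign \<sigma> * coord \<sigma> x * coord \<sigma> y)" by (rule sum_emb_split[symmetric])
  finally show ?thesis .
qed

lemma prod_trace_sign: "\<bar>\<Prod>\<sigma>\<in>UNIV. trace_sign (\<sigma>::'k::number_field emb)\<bar> = 4 ^ card (cplx_embs :: 'k emb set)"
  unfolding prod_emb_split by (simp add: trace_sign_simps abs_mult power_abs)

text \<open>The trace matrix is the congruence transform of the diagonal of signs by
  \<open>coord_matrix\<close>, and the diagonal has determinant \<plusminus> 4^s.\<close>

lemma det_trace_matrix:
  fixes \<beta> :: "'k::number_field emb \<Rightarrow> 'k"
  shows "\<bar>det (\<chi> i j. of_rat (field_trace (\<beta> i * \<beta> j)) :: real^'k emb^'k emb)\<bar>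
     = 4 ^ card (cplx_embs :: 'k emb set) * (det (coord_matrix \<beta>))\<^sup>2"
proof -
  define D :: "real^'k emb^'k emb" where "D = (\<chi> i j. if i = j then trace_sign i else 0)"
  have "(\<chi> i j. of_rat (field_trace (\<beta> i * \<beta> j))) = transpose (coord_matrix \<beta>) ** (D ** coord_matrix \<beta>)"
  proof -
    have "(D ** coord_matrix \<beta>) $ k $ j = trace_sign k * coord k (\<beta> j)" for k j
      by (simp add: matrix_matrix_mult_def D_def coord_matrix_def if_distrib[of "\<lambda>x. x * _"] cong: if_cong)
    then show ?thesis
      unfolding matrix_matrix_mult_def[of "transpose _"]
      by (simp add: vec_eq_iff coord_matrix_def transpose_def field_trace_mult mult_ac)
  qed
  then have "det (\<chi> i j. of_rat (field_trace (\<beta> i * \<beta> j)) :: real^'k emb^'k emb) = det D * (det (coord_matrix \<beta>))\<^sup>2"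
    by (simp add: det_mul power2_eq_square)
  moreover have "det D = (\<Prod>\<sigma>\<in>(UNIV :: 'k emb set). trace_sign \<sigma>)"
    by (subst det_diagonal) (auto simp: D_def)
  ultimately show ?thesis by (simp add: abs_mult prod_trace_sign)
qed

subsection \<open>Integral bases\<close>

lemma ring_of_integers_closed:
  fixes x y :: "'k::number_field"
  shows "(0::'k) \<in> ring_of_integers" "(1::'k) \<in> ring_of_integers" "(of_int k :: 'k) \<in> ring_of_integers"
  "x \<in> ring_of_integers \<Longrightarrow> y \<in> ring_of_integers \<Longrightarrow> x + y \<in> ring_of_integers"
  "x \<in> ring_of_integers \<Longrightarrow> y \<in> ring_of_integers \<Longrightarrow> x - y \<in> ring_of_integers"
  "x \<in> ring_of_integers \<Longrightarrow> y \<in> ring_of_integers \<Longrightarrow> x * y \<in> ring_of_integers"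
  "x \<in> ring_of_integers \<Longrightarrow> - x \<in> ring_of_integers"
  "x \<in> ring_of_integers \<Longrightarrow> x ^ m \<in> ring_of_integers"
proof -
  show mult: "x * y \<in> ring_of_integers" if "x \<in> ring_of_integers" "y \<in> ring_of_integers" for x y :: 'k
    using that by (simp add: ring_of_integers_def algebraic_int_mult)
  show one: "(1::'k) \<in> ring_of_integers" by (simp add: ring_of_integers_def)
  show "x ^ m \<in> ring_of_integers" if "x \<in> ring_of_integers" for x :: 'k
    by (induction m) (use that mult one in auto)
  show "x - y \<in> ring_of_integers" if "x \<in> ring_of_integers" "y \<in> ring_of_integers" for x y :: 'k
    using algebraic_int_add[of x "- y"] that by (simp add: ring_of_integers_def)
qed (auto simp: ring_of_integers_def algebraic_int_add int_imp_algebraic_int)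

lemma ring_of_integers_sum:
  "(\<And>i. i \<in> I \<Longrightarrow> f i \<in> ring_of_integers) \<Longrightarrow> sum f I \<in> ring_of_integers"
  by (induction I rule: infinite_finite_induct) (auto intro: ring_of_integers_closed)

lemma rat_common_denominator:
  assumes "finite A"
  obtains m :: int where "m > 0" "\<And>a. a \<in> A \<Longrightarrow> of_int m * (q a :: rat) \<in> \<int>"
proof -
  have "\<exists>m::int. m > 0 \<and> (\<forall>a\<in>A. of_int m * q a \<in> \<int>)"
    using assms
  proof (induction A)
    case (insert a A)
    then obtain m :: int where m: "m > 0" "\<forall>b\<in>A. of_int m * q b \<in> \<int>" by blast
    obtain u v where uv: "q a = Rat.Fract u v" "v > 0" by (cases "q a")
    have "of_int (m * v) * q a = of_int (m * u)" using uv by (simp add: of_rat_rat Fract_of_int_quotient)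
    moreover have "of_int (m * v) * q b \<in> \<int>" if "b \<in> A" for b
    proof -
      have "of_int (m * v) * q b = of_int v * (of_int m * q b)" by simp
      also have "\<dots> \<in> \<int>" by (rule Ints_mult[OF Ints_of_int m(2)[rule_format, OF that]])
      finally show ?thesis .
    qed
    ultimately have "\<forall>b\<in>insert a A. of_int (m * v) * q b \<in> \<int>" by (metis Ints_of_int insert_iff)
    then show ?case using m(1) uv(2) by (intro exI[of _ "m * v"]) simp
  qed (intro exI[of _ 1], simp)
  then show thesis using that by blast
qed

text \<open>Multiplying the monic rational equation of degree d by m^d gives a monic equation for m
  x with coefficients m^(d-i) c_i. Below the leading term at least one factor m is present, which
  clears the denominator.\<close>

lemma integral_multiple:
  fixes x :: "'k::number_field"
  obtains m :: int where "m > 0" "of_int m * x \<in> ring_of_integers"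
proof -
  obtain p where p: "p \<noteq> 0" "rpoly p x = 0" by (rule algebraic_rat)
  define d where "d = degree p"
  define c where "c = (\<lambda>i. coeff p i / lead_coeff p)"
  obtain m :: int where m: "m > 0" "\<And>i. i \<in> {..d} \<Longrightarrow> of_int m * c i \<in> \<int>"
    using rat_common_denominator[of "{..d}" c] by auto
  have d: "d > 0"
  proof (rule ccontr)
    assume "\<not> d > 0"
    then obtain a where "p = [:a:]" using degree_eq_zeroE[of p] by (auto simp: d_def)
    with p show False by simp
  qed
  have cd: "c d = 1" using p(1) by (simp add: c_def d_def)
  define b where "b = (\<lambda>i. if i = d then 1 else of_int m ^ (d - i) * c i)"
  have bI: "b i \<in> \<int>" if "i \<le> d" for i
  proof (cases "i = d")
    case False
    then obtain k where "d = Suc (i + k)" using less_imp_Suc_add[of i d] \<open>i \<le> d\<close> by auto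
    then have k: "d - i = Suc k" by simp
    have "b i = of_int (m ^ k) * (of_int m * c i)" using False k by (simp add: b_def mult_ac)
    also have "\<dots> \<in> \<int>" by (rule Ints_mult[OF Ints_of_int m(2)]) (use that in auto)
    finally show ?thesis .
  qed (simp add: b_def)
  define g :: "'k poly" where "g = (\<Sum>i\<le>d. monom (of_rat (b i)) i)"
  have cg: "coeff g i = (if i \<le> d then of_rat (b i) else 0)" for i
    by (simp add: g_def coeff_sum coeff_monom if_distrib cong: if_cong)
  have dg: "degree g = d"
    by (rule antisym) (auto intro!: degree_le le_degree simp: cg b_def)
  have "algebraic_int (of_int m * x)"
  proof (rule algebraic_int.intros[of g])
    show "lead_coeff g = 1" by (simp add: dg cg b_def)
    show "\<forall>i. coeff g i \<in> \<int>"
    proof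
      fix i
      show "coeff g i \<in> \<int>"
      proof (cases "i \<le> d")
        case True
        then obtain z where "b i = of_int z" using bI by (auto elim: Ints_cases)
        then show ?thesis using True by (simp add: cg)
      qed (simp add: cg)
    qed
    have "poly g (of_int m * x) = (\<Sum>i\<le>d. of_rat (b i) * (of_int m * x) ^ i)"
      by (simp add: g_def poly_sum poly_monom)
    also have "\<dots> = (\<Sum>i\<le>d. of_int m ^ d * (of_rat (c i) * x ^ i))"
    proof (rule sum.cong[OF refl])
      fix i assume i: "i \<in> {..d}"
      have "b i * of_int m ^ i = of_int m ^ d * c i"
        using i cd by (cases "i = d") (auto simp: b_def power_add[symmetric] mult_ac)
      then have "of_rat (b i * of_int m ^ i) = (of_rat (of_int m ^ d * c i) :: 'k)" by simp
      then have "of_rat (b i) * of_int m ^ i = (of_int m ^ d * of_rat (c i) :: 'k)"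
        by (simp add: of_rat_mult of_rat_power)
      then show "of_rat (b i) * (of_int m * x) ^ i = of_int m ^ d * (of_rat (c i) * x ^ i)"
        by (simp add: power_mult_distrib mult.assoc[symmetric])
    qed
    also have "\<dots> = of_int m ^ d * ((\<Sum>i\<le>d. of_rat (coeff p i) * x ^ i) / of_rat (lead_coeff p))"
      by (simp add: c_def of_rat_divide sum_distrib_left sum_divide_distrib)
    also have "(\<Sum>i\<le>d. of_rat (coeff p i) * x ^ i) = rpoly p x" by (simp add: poly_altdef d_def)
    finally show "poly g (of_int m * x) = 0" using p(2) by simp
  qed
  with m(1) that show thesis by (simp add: ring_of_integers_def)
qed

lemma algebraic_int_field_hom:
  fixes \<sigma> :: "'a::field_char_0 \<Rightarrow> 'b::field_char_0"
  assumes "field_hom \<sigma>" "algebraic_int x" shows "algebraic_int (\<sigma> x)"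
proof -
  interpret field_hom \<sigma> by fact
  obtain p where p: "poly (map_poly of_int p) x = 0" "lead_coeff p = 1"
    using assms(2) unfolding algebraic_int_altdef_ipoly by blast
  have "\<sigma> (poly (map_poly of_int p) x) = poly (map_poly of_int p) (\<sigma> x)" for p
    by (induction p) (simp_all add: hom_distribs map_poly_pCons)
  then show ?thesis unfolding algebraic_int_altdef_ipoly using p by (metis hom_zero)
qed

text \<open>As the sum of the conjugates the trace is an algebraic integer, and it is
  rational.\<close>

lemma field_trace_int: assumes "x \<in> ring_of_integers" shows "field_trace (x :: 'k::number_field) \<in> \<int>"
proof -
  have x: "algebraic_int (Rep_emb \<sigma> x)" for \<sigma>
    by (rule algebraic_int_field_hom[OF field_hom_Rep_emb]) (use assms in \<open>simp add: ring_of_integers_def\<close>)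
  have "algebraic_int (\<Sum>\<sigma>\<in>A. Rep_emb \<sigma> x)" for A :: "'k emb set"
    by (induction A rule: infinite_finite_induct) (simp_all add: algebraic_int_add[OF x])
  then have "algebraic_int (of_rat (field_trace x) :: complex)" by (simp add: field_trace_eq_sum_emb)
  moreover have "of_rat (field_trace x) \<in> (\<rat> :: complex set)" by (simp add: Rats_def)
  ultimately obtain z where z: "(of_rat (field_trace x) :: complex) = of_int z"
    using rational_algebraic_int_is_int by (metis Ints_cases)
  also have "\<dots> = of_rat (of_int z)" by simp
  finally show ?thesis by (simp del: of_rat_of_int_eq)
qed

definition int_basis :: "('k::number_field emb \<Rightarrow> 'k) \<Rightarrow> bool" where
  "int_basis \<beta> \<longleftrightarrow> det (coord_matrix \<beta>) \<noteq> 0 \<and>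
     ring_of_integers = {(\<Sum>j\<in>UNIV. of_int (z j) * \<beta> j) | z. True}"

text \<open>The index of the lattice spanned by \<open>\<beta>\<close> is minimal when the integer \<open>\<bar>det\<bar>\<close> of the trace form is;
  if an integer had a fractional coordinate, Cramer's rule would give a smaller determinant.\<close>

lemma int_basis_exists: obtains \<beta> :: "'k::number_field emb \<Rightarrow> 'k" where "int_basis \<beta>"
proof -
  define P where "P = (\<lambda>\<beta> :: 'k emb \<Rightarrow> 'k. det (coord_matrix \<beta>) \<noteq> 0 \<and> (\<forall>j. \<beta> j \<in> ring_of_integers))"
  define T where "T = (\<lambda>\<beta> :: 'k emb \<Rightarrow> 'k. \<bar>det (\<chi> i j. of_rat (field_trace (\<beta> i * \<beta> j)) :: real^'k emb^'k emb)\<bar>)"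
  have TN: "T \<beta> = of_nat (nat \<lfloor>T \<beta>\<rfloor>)" if "P \<beta>" for \<beta>
  proof -
    have "of_rat (field_trace (\<beta> i * \<beta> j)) \<in> (\<int> :: real set)" for i j
    proof -
      have "field_trace (\<beta> i * \<beta> j) \<in> \<int>"
        using that by (intro field_trace_int ring_of_integers_closed) (auto simp: P_def)
      then show ?thesis by (auto elim!: Ints_cases)
    qed
    then have "det (\<chi> i j. of_rat (field_trace (\<beta> i * \<beta> j)) :: real^'k emb^'k emb) \<in> \<int>"
      unfolding det_def by (intro Ints_sum Ints_mult Ints_prod) auto
    then obtain z where "det (\<chi> i j. of_rat (field_trace (\<beta> i * \<beta> j)) :: real^'k emb^'k emb) = of_int z"
      by (auto elim: Ints_cases)
    then have "T \<beta> = of_int \<bar>z\<bar>" by (simp add: T_def)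
    then show ?thesis by simp
  qed
  obtain \<beta>0 :: "'k emb \<Rightarrow> 'k" where \<beta>0: "rational_basis \<beta>0" by (rule rational_basis_exists)
  have "\<exists>\<beta>. P \<beta>"
  proof -
    have "\<exists>m::int. m > 0 \<and> of_int m * \<beta>0 j \<in> ring_of_integers" for j
      using integral_multiple[of "\<beta>0 j"] by blast
    then obtain m :: "'k emb \<Rightarrow> int" where m: "\<And>j. m j > 0" "\<And>j. of_int (m j) * \<beta>0 j \<in> ring_of_integers" by metis
    have "rational_basis (\<lambda>j. of_int (m j) * \<beta>0 j)"
      unfolding rational_basis_def
    proof
      fix x
      obtain q where "x = (\<Sum>j\<in>UNIV. of_rat (q j) * \<beta>0 j)" using \<beta>0 unfolding rational_basis_def by blast
      also have "\<dots> = (\<Sum>j\<in>UNIV. of_rat (q j / of_int (m j)) * (of_int (m j) * \<beta>0 j))"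
        using m(1) by (intro sum.cong refl) (simp add: of_rat_divide less_imp_neq[symmetric])
      finally show "\<exists>q. x = (\<Sum>j\<in>UNIV. of_rat (q j) * (of_int (m j) * \<beta>0 j))"
        by (rule exI[of _ "\<lambda>j. q j / of_int (m j)"])
    qed
    then show ?thesis using m(2) det_coord_matrix_nonzero unfolding P_def by blast
  qed
  then obtain \<beta> where \<beta>: "P \<beta>" "\<And>\<beta>'. P \<beta>' \<Longrightarrow> nat \<lfloor>T \<beta>\<rfloor> \<le> nat \<lfloor>T \<beta>'\<rfloor>"
    using ex_has_least_nat[of P _ "\<lambda>\<beta>. nat \<lfloor>T \<beta>\<rfloor>"] by blast
  have min: "\<bar>det (coord_matrix \<beta>)\<bar> \<le> \<bar>det (coord_matrix \<beta>')\<bar>" if "P \<beta>'" for \<beta>'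
  proof -
    have "T \<beta> \<le> T \<beta>'" using TN[OF \<beta>(1)] TN[OF that] \<beta>(2)[OF that] by (metis of_nat_le_iff)
    then show ?thesis by (simp add: T_def det_trace_matrix abs_le_square_iff)
  qed
  have nz: "det (coord_matrix \<beta>) \<noteq> 0" and \<beta>O: "\<And>j. \<beta> j \<in> ring_of_integers" using \<beta>(1) by (auto simp: P_def)
  have int: "q k \<in> \<int>" if x: "x \<in> ring_of_integers" "x = (\<Sum>j\<in>UNIV. of_rat (q j) * \<beta> j)" for x q k
  proof (rule ccontr)
    assume k: "q k \<notin> \<int>"
    define q' where "q' = q(k := frac (q k))"
    define y where "y = x - of_int \<lfloor>q k\<rfloor> * \<beta> k"
    have y: "y = (\<Sum>j\<in>UNIV. of_rat (q' j) * \<beta> j)"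
    proof -
      have "(\<Sum>j\<in>UNIV. of_rat (q' j) * \<beta> j) =
          (\<Sum>j\<in>UNIV. of_rat (q j) * \<beta> j - (if j = k then of_int \<lfloor>q k\<rfloor> * \<beta> k else 0))"
        by (intro sum.cong refl) (simp add: q'_def frac_def of_rat_diff algebra_simps)
      then show ?thesis by (simp add: sum_subtractf y_def x(2))
    qed
    have yO: "y \<in> ring_of_integers" unfolding y_def using x(1) \<beta>O by (intro ring_of_integers_closed)
    define \<beta>' where "\<beta>' = \<beta>(k := y)"
    have "coord_matrix \<beta>' = (\<chi> i j. if j = k then (coord_matrix \<beta> *v (\<chi> j. of_rat (q' j)))$i else coord_matrix \<beta>$i$j)"
      by (simp add: vec_eq_iff coord_matrix_mult y[symmetric]) (simp add: coord_matrix_def \<beta>'_def)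
    then have det: "det (coord_matrix \<beta>') = of_rat (frac (q k)) * det (coord_matrix \<beta>)"
      by (simp add: cramer_lemma q'_def)
    have fr: "0 < frac (q k)" "frac (q k) < 1" using k by (auto simp: frac_gt_0_iff frac_lt_1)
    then have fr': "0 < (of_rat (frac (q k)) :: real)" "of_rat (frac (q k)) < (1 :: real)"
      by (simp_all add: zero_less_of_rat_iff of_rat_less_1_iff)
    have "P \<beta>'" using \<beta>O yO det nz fr' by (auto simp: P_def \<beta>'_def)
    then have "\<bar>det (coord_matrix \<beta>)\<bar> \<le> of_rat (frac (q k)) * \<bar>det (coord_matrix \<beta>)\<bar>"
      using min[OF \<open>P \<beta>'\<close>] fr' by (simp add: det abs_mult)
    with fr' nz show False by simp
  qed
  have "int_basis \<beta>"
    unfolding int_basis_def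
  proof (intro conjI nz subset_antisym subsetI)
    fix x :: 'k assume x: "x \<in> ring_of_integers"
    obtain q where q: "x = (\<Sum>j\<in>UNIV. of_rat (q j) * \<beta> j)"
      using rational_basis_if_det(1)[OF nz] unfolding rational_basis_def by blast
    have "\<forall>j. \<exists>z. q j = of_int z" using int[OF x q] by (auto elim: Ints_cases)
    then obtain z where "\<And>j. q j = of_int (z j)" by metis
    with q show "x \<in> {(\<Sum>j\<in>UNIV. of_int (z j) * \<beta> j) | z. True}" by auto
  qed (auto intro!: ring_of_integers_sum ring_of_integers_closed \<beta>O)
  then show thesis by (rule that)
qed

text \<open>Bridges two notions of determinant: the discriminant uses matrices indexed by an initial
  segment of the natural numbers, the geometry uses matrices indexed by the embeddings.\<close>

lemma det_mat_reindex:
  fixes f :: "'i::finite \<Rightarrow> 'i \<Rightarrow> 'a::comm_ring_1"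
  assumes e: "bij_betw e {0..<n} (UNIV :: 'i set)"
  shows "Determinant.det (Matrix.mat n n (\<lambda>(i, j). f (e i) (e j))) = det (\<chi> i j. f i j)"
proof -
  let ?A = "Matrix.mat n n (\<lambda>(i, j). f (e i) (e j))"
  have inj: "inj_on e {0..<n}" and ran: "e ` {0..<n} = UNIV" using e by (auto simp: bij_betw_def)
  let ?m = "map_permutation {0..<n} e"
  have bij: "bij_betw ?m {p. p permutes {0..<n}} {p. p permutes (UNIV :: 'i set)}"
  proof (rule bij_betw_byWitness[where f' = "map_permutation UNIV (inv_into {0..<n} e)"])
    show "\<forall>p\<in>{p. p permutes {0..<n}}. map_permutation UNIV (inv_into {0..<n} e) (?m p) = p"
      using map_permutation_compose_inv[OF e] bij_betw_inv_into_left[OF e] by blast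
    show "\<forall>p\<in>{p. p permutes (UNIV :: 'i set)}. ?m (map_permutation UNIV (inv_into {0..<n} e) p) = p"
      using map_permutation_compose_inv[OF bij_betw_inv_into[OF e]] bij_betw_inv_into_right[OF e] by blast
  qed (use map_permutation_permutes[OF e] map_permutation_permutes[OF bij_betw_inv_into[OF e]] in blast)+
  have "Determinant.det ?A = (\<Sum>p\<in>{p. p permutes {0..<n}}. signof p * (\<Prod>i=0..<n. f (e i) (e (p i))))"
    by (subst det_def'[of _ n]) (auto intro!: sum.cong prod.cong simp: permutes_in_image)
  also have "\<dots> = (\<Sum>p\<in>{p. p permutes {0..<n}}. of_int (sign (?m p)) * (\<Prod>i\<in>UNIV. f i (?m p i)))"
  proof (intro sum.cong refl arg_cong2[where f = "(*)"])
    fix p assume "p \<in> {p. p permutes {0..<n}}"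
    then have p: "p permutes {0..<n}" by simp
    show "signof p = of_int (sign (?m p))"
      using sign_map_permutation[OF inj p] by simp
    have "(\<Prod>i\<in>UNIV. f i (?m p i)) = (\<Prod>i=0..<n. f (e i) (?m p (e i)))"
      by (rule prod.reindex_bij_betw[OF e, symmetric])
    also have "\<dots> = (\<Prod>i=0..<n. f (e i) (e (p i)))"
      using inj by (intro prod.cong refl) (simp add: map_permutation_apply)
    finally show "(\<Prod>i=0..<n. f (e i) (e (p i))) = (\<Prod>i\<in>UNIV. f i (?m p i))" ..
  qed
  also have "\<dots> = (\<Sum>p\<in>{p. p permutes (UNIV :: 'i set)}. of_int (sign p) * (\<Prod>i\<in>UNIV. f i (p i)))"
    by (rule sum.reindex_bij_betw[OF bij])
  finally show ?thesis by (simp add: det_def)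
qed

text \<open>Ensures that the choice made inside \<open>discriminant\<close> picks an actual integral
  basis.\<close>

lemma integral_basis_exists: "\<exists>bs :: 'k::number_field list. integral_basis bs"
proof -
  obtain \<beta> :: "'k emb \<Rightarrow> 'k" where \<beta>: "int_basis \<beta>" by (rule int_basis_exists)
  then have det: "det (coord_matrix \<beta>) \<noteq> 0" and O: "ring_of_integers = {(\<Sum>j\<in>UNIV. of_int (z j) * \<beta> j) | z. True}"
    by (auto simp: int_basis_def)
  have inj: "inj \<beta>" by (rule rational_basis_if_det[OF det])
  obtain bs where bs: "set bs = range \<beta>" "distinct bs" using finite_distinct_list[of "range \<beta>"] by auto
  have "\<not> ZM.dependent (range \<beta>)"
  proof
    assume "ZM.dependent (range \<beta>)"
    then obtain t u where t: "finite t" "t \<subseteq> range \<beta>" "(\<Sum>v\<in>t. of_int (u v) * v) = 0" "\<exists>v\<in>t. u v \<noteq> 0"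
      unfolding ZM.dependent_explicit by blast
    have "(\<Sum>v\<in>t. of_rat (of_int (u v)) * v) = 0" using t(3) by simp
    then have "QV.dependent (range \<beta>)" unfolding QV.dependent_explicit using t
      by (intro exI[of _ t] exI[of _ "\<lambda>v. of_int (u v)"]) auto
    with rational_basis_if_det(3)[OF det] show False by blast
  qed
  moreover have "ZM.span (range \<beta>) = ring_of_integers"
  proof (intro subset_antisym subsetI)
    fix x assume "x \<in> ZM.span (range \<beta>)"
    then obtain u where "x = (\<Sum>v\<in>range \<beta>. of_int (u v) * v)" by (auto simp: ZM.span_finite)
    then show "x \<in> ring_of_integers" unfolding O by (auto simp: sum.reindex[OF inj])
  next
    fix x assume "x \<in> (ring_of_integers :: 'k set)"
    then obtain z where x: "x = (\<Sum>j\<in>UNIV. of_int (z j) * \<beta> j)" unfolding O by blast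
    show "x \<in> ZM.span (range \<beta>)" unfolding x by (intro ZM.span_sum ZM.span_scale ZM.span_base) auto
  qed
  ultimately show ?thesis using bs unfolding integral_basis_def by metis
qed

text \<open>The family \<beta> is a reindexing of the very list chosen inside
  \<open>discriminant\<close>, so the formula speaks about that choice.\<close>

theorem discriminant_int_basis:
  obtains \<beta> :: "'k::number_field emb \<Rightarrow> 'k" where "int_basis \<beta>"
    "\<bar>of_rat (discriminant TYPE('k))\<bar> = 4 ^ card (cplx_embs :: 'k emb set) * (det (coord_matrix \<beta>))\<^sup>2"
proof -
  define bs :: "'k list" where "bs = (SOME bs. integral_basis bs)"
  have "integral_basis bs" unfolding bs_def by (rule someI_ex[OF integral_basis_exists])
  then have bs: "distinct bs" "\<not> ZM.dependent (set bs)" "ZM.span (set bs) = ring_of_integers"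
    by (auto simp: integral_basis_def)
  have ind: "QV.independent (set bs)"
  proof
    assume "QV.dependent (set bs)"
    then obtain u where u: "\<exists>v\<in>set bs. u v \<noteq> 0" "(\<Sum>v\<in>set bs. of_rat (u v) * v) = 0"
      using QV.dependent_finite[of "set bs"] by auto
    obtain m :: int where m: "m > 0" "\<And>v. v \<in> set bs \<Longrightarrow> of_int m * u v \<in> \<int>"
      using rat_common_denominator[of "set bs" u] by auto
    then have "\<forall>v\<in>set bs. \<exists>z. of_int m * u v = of_int z" by (auto elim: Ints_cases)
    from bchoice[OF this] obtain z where z: "\<And>v. v \<in> set bs \<Longrightarrow> of_int m * u v = of_int (z v)" by blast
    have "(\<Sum>v\<in>set bs. of_int (z v) * v) = of_int m * (\<Sum>v\<in>set bs. of_rat (u v) * v)"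
      unfolding sum_distrib_left
    proof (rule sum.cong[OF refl])
      fix v assume "v \<in> set bs"
      then have "of_rat (of_int m * u v) = (of_rat (of_int (z v)) :: 'k)" using z by simp
      then show "of_int (z v) * v = of_int m * (of_rat (u v) * v)" by (simp add: of_rat_mult mult.assoc[symmetric])
    qed
    then have "(\<Sum>v\<in>set bs. of_int (z v) * v) = 0" using u(2) by simp
    moreover obtain v where "v \<in> set bs" "u v \<noteq> 0" using u(1) by blast
    moreover then have "z v \<noteq> 0" using z[of v] m(1) by auto
    ultimately have "ZM.dependent (set bs)" unfolding ZM.dependent_explicit
      by (intro exI[of _ "set bs"] exI[of _ z]) auto
    with bs(2) show False by blast
  qed
  have span: "QV.span (set bs) = UNIV"
  proof (intro subset_antisym subsetI)
    fix x :: 'k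
    obtain m :: int where m: "m > 0" "of_int m * x \<in> ring_of_integers" by (rule integral_multiple)
    then obtain u where u: "of_int m * x = (\<Sum>v\<in>set bs. of_int (u v) * v)"
      using bs(3) ZM.span_finite[of "set bs"] by auto
    then have "x = of_rat (1 / of_int m) * (\<Sum>v\<in>set bs. of_rat (of_int (u v)) * v)"
      using m(1) by (simp add: of_rat_divide field_simps)
    also have "\<dots> \<in> QV.span (set bs)" by (intro QV.span_sum QV.span_scale QV.span_base)
    finally show "x \<in> QV.span (set bs)" .
  qed auto
  define n where "n = length bs"
  have n: "n = CARD('k emb)" using rational_basis_card(2)[OF ind span] bs(1) by (simp add: n_def distinct_card)
  obtain e :: "nat \<Rightarrow> 'k emb" where e: "bij_betw e {0..<n} UNIV"
    by (metis n bij_betw_iff_card card_atLeastLessThan finite finite_atLeastLessThan minus_nat.diff_0)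
  define \<beta> where "\<beta> = (\<lambda>\<sigma>. bs ! inv_into {0..<n} e \<sigma>)"
  have \<beta>e: "\<beta> (e i) = bs ! i" if "i < n" for i using that e by (simp add: \<beta>_def bij_betw_inv_into_left)
  have bij: "bij_betw \<beta> UNIV (set bs)"
    unfolding \<beta>_def using bij_betw_trans[OF bij_betw_inv_into[OF e], of "(!) bs" "set bs"]
      bij_betw_nth[OF bs(1), of "{0..<n}" "set bs"] by (auto simp: comp_def n_def atLeast0LessThan)
  then have inj: "inj \<beta>" and ran: "range \<beta> = set bs" by (auto simp: bij_betw_def)
  have "rational_basis \<beta>" unfolding rational_basis_def
  proof
    fix x
    have "x \<in> QV.span (range \<beta>)" using span ran by simp
    then obtain u where "x = (\<Sum>v\<in>range \<beta>. of_rat (u v) * v)" by (auto simp: QV.span_finite)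
    then show "\<exists>q. x = (\<Sum>j\<in>UNIV. of_rat (q j) * \<beta> j)"
      by (intro exI[of _ "\<lambda>j. u (\<beta> j)"]) (simp add: sum.reindex[OF inj])
  qed
  then have det: "det (coord_matrix \<beta>) \<noteq> 0" by (rule det_coord_matrix_nonzero)
  have "ring_of_integers = {(\<Sum>j\<in>UNIV. of_int (z j) * \<beta> j) | z. True}"
  proof (intro subset_antisym subsetI)
    fix x assume "x \<in> (ring_of_integers :: 'k set)"
    then have "x \<in> ZM.span (range \<beta>)" using bs(3) ran by simp
    then obtain u where "x = (\<Sum>v\<in>range \<beta>. of_int (u v) * v)" by (auto simp: ZM.span_finite)
    then show "x \<in> {(\<Sum>j\<in>UNIV. of_int (z j) * \<beta> j) | z. True}" by (auto simp: sum.reindex[OF inj])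
  next
    fix x assume "x \<in> {(\<Sum>j\<in>UNIV. of_int (z j) * \<beta> j) | z. True}"
    then obtain z where x: "x = (\<Sum>j\<in>UNIV. of_int (z j) * \<beta> j)" by blast
    have "x \<in> ZM.span (range \<beta>)" unfolding x by (intro ZM.span_sum ZM.span_scale ZM.span_base) auto
    then show "x \<in> ring_of_integers" using bs(3) ran by simp
  qed
  with det have "int_basis \<beta>" by (simp add: int_basis_def)
  moreover have "discriminant TYPE('k) = det (\<chi> i j. field_trace (\<beta> i * \<beta> j))"
  proof -
    have "discriminant TYPE('k) = Determinant.det (Matrix.mat n n (\<lambda>(i, j). field_trace (bs ! i * bs ! j)))"
      unfolding discriminant_def Let_def bs_def[symmetric] n_def ..
    also have "Matrix.mat n n (\<lambda>(i, j). field_trace (bs ! i * bs ! j)) =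
        Matrix.mat n n (\<lambda>(i, j). field_trace (\<beta> (e i) * \<beta> (e j)))"
      by (rule cong_mat) (auto simp: \<beta>e)
    also have "Determinant.det \<dots> = det (\<chi> i j. field_trace (\<beta> i * \<beta> j))" by (rule det_mat_reindex[OF e])
    finally show ?thesis .
  qed
  then have "of_rat (discriminant TYPE('k)) = det (\<chi> i j. of_rat (field_trace (\<beta> i * \<beta> j)) :: real^'k emb^'k emb)"
    by (simp add: det_def of_rat_sum of_rat_mult of_rat_prod)
  ultimately show thesis using that det_trace_matrix[of \<beta>] by simp
qed

section \<open>Minkowski's theorem\<close>

text \<open>By Fubini the volume is the product of the volumes of balls, one for each block of
  coordinates. The blocks will be the conjugation orbits of embeddings, giving intervals at real
  places and discs at complex ones.\<close>

lemma emeasure_PiM_blocks: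
  fixes \<rho> :: "'i set \<Rightarrow> real"
  assumes "finite P" "disjoint P" "\<And>b. b \<in> P \<Longrightarrow> finite b" "\<And>b. b \<in> P \<Longrightarrow> \<rho> b > 0"
  shows "emeasure (Pi\<^sub>M (\<Union>P) (\<lambda>_. lborel))
     ({f. \<forall>b\<in>P. sqrt (\<Sum>i\<in>b. (f i)\<^sup>2) \<le> \<rho> b} \<inter> space (Pi\<^sub>M (\<Union>P) (\<lambda>_. lborel)))
     = ennreal (\<Prod>b\<in>P. unit_ball_vol (real (card b)) * \<rho> b ^ card b)"
  using assms
proof (induction P)
  case empty
  then show ?case by (simp add: space_PiM)
next
  case (insert c P)
  let ?M = "\<lambda>I. Pi\<^sub>M I (\<lambda>_::'i. lborel :: real measure)"
  interpret product_sigma_finite "\<lambda>_::'i. lborel :: real measure" by standard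
  define J where "J = \<Union>P"
  have finc: "finite c" and finJ: "finite J" using insert.prems insert.hyps by (auto simp: J_def)
  interpret J: finite_product_sigma_finite "\<lambda>_::'i. lborel :: real measure" J by standard (rule finJ)
  have "c \<inter> b = {}" if "b \<in> P" for b
    using disjointD[OF insert.prems(1), of c b] that insert.hyps(2) by auto
  then have disj: "c \<inter> J = {}" unfolding J_def by auto
  have disjP: "disjoint P" using insert.prems(1) by (meson disjoint_def insertCI)
  define E1 where "E1 = {f. sqrt (\<Sum>i\<in>c. (f i)\<^sup>2) \<le> \<rho> c} \<inter> space (?M c)"
  define E2 where "E2 = {f. \<forall>b\<in>P. sqrt (\<Sum>i\<in>b. (f i)\<^sup>2) \<le> \<rho> b} \<inter> space (?M J)"
  define E where "E = {f. \<forall>b\<in>insert c P. sqrt (\<Sum>i\<in>b. (f i)\<^sup>2) \<le> \<rho> b} \<inter> space (?M (c \<union> J))"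
  have ms: "{f. sqrt (\<Sum>i\<in>b. (f i)\<^sup>2) \<le> \<rho> b} \<inter> space (?M I) \<in> sets (?M I)" if "b \<subseteq> I" for b I
  proof -
    have "(\<lambda>f. sqrt (\<Sum>i\<in>b. (f i)\<^sup>2)) \<in> borel_measurable (?M I)"
    proof (rule measurable_compose[OF _ borel_measurable_sqrt])
      have "(\<lambda>f. f i) \<in> borel_measurable (?M I)" if "i \<in> I" for i
        using measurable_component_singleton[OF that, of "\<lambda>_. lborel"] by simp
      then show "(\<lambda>f. \<Sum>i\<in>b. (f i)\<^sup>2) \<in> borel_measurable (?M I)"
        using \<open>b \<subseteq> I\<close> by (intro borel_measurable_sum borel_measurable_power) auto
    qed
    then have "{f \<in> space (?M I). sqrt (\<Sum>i\<in>b. (f i)\<^sup>2) \<le> \<rho> b} \<in> sets (?M I)"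
      by (intro borel_measurable_le) auto
    then show ?thesis by (simp add: Collect_conj_eq Int_commute)
  qed
  have msP: "{f. \<forall>b\<in>Q. sqrt (\<Sum>i\<in>b. (f i)\<^sup>2) \<le> \<rho> b} \<inter> space (?M I) \<in> sets (?M I)"
    if "finite Q" "\<Union>Q \<subseteq> I" for Q I
    using that
  proof (induction Q)
    case (insert b Q)
    have "{f. \<forall>b\<in>insert b Q. sqrt (\<Sum>i\<in>b. (f i)\<^sup>2) \<le> \<rho> b} \<inter> space (?M I) =
      ({f. sqrt (\<Sum>i\<in>b. (f i)\<^sup>2) \<le> \<rho> b} \<inter> space (?M I)) \<inter>
      ({f. \<forall>b\<in>Q. sqrt (\<Sum>i\<in>b. (f i)\<^sup>2) \<le> \<rho> b} \<inter> space (?M I))" by auto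
    then show ?case using ms[of b I] insert by (simp add: sets.Int)
  qed (simp add: sets.top)
  have E1: "E1 \<in> sets (?M c)" unfolding E1_def by (rule ms) simp
  have E2: "E2 \<in> sets (?M J)" unfolding E2_def by (rule msP) (use insert.hyps in \<open>auto simp: J_def\<close>)
  have E: "E \<in> sets (?M (c \<union> J))" unfolding E_def
    by (rule msP) (use insert.hyps in \<open>auto simp: J_def\<close>)
  have vim: "merge c J -` E \<inter> space (?M c \<Otimes>\<^sub>M ?M J) = E1 \<times> E2"
  proof -
    have s1: "(\<Sum>i\<in>c. (merge c J (f, g) i)\<^sup>2) = (\<Sum>i\<in>c. (f i)\<^sup>2)" for f g :: "'i \<Rightarrow> real"
      by (intro sum.cong) (auto simp: merge_def)
    have s2: "(\<Sum>i\<in>b. (merge c J (f, g) i)\<^sup>2) = (\<Sum>i\<in>b. (g i)\<^sup>2)" if "b \<in> P" for f g :: "'i \<Rightarrow> real" and b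
      using that disj by (intro sum.cong) (auto simp: merge_def J_def)
    have sp: "merge c J (f, g) \<in> space (?M (c \<union> J))" if "f \<in> space (?M c)" "g \<in> space (?M J)" for f g
      using that by (auto simp: space_PiM PiE_def extensional_def merge_def)
    show ?thesis
      by (auto simp: E_def E1_def E2_def space_pair_measure s1 s2 sp)
  qed
  have "emeasure (?M (c \<union> J)) E = emeasure (distr (?M c \<Otimes>\<^sub>M ?M J) (?M (c \<union> J)) (merge c J)) E"
    by (simp add: distr_merge[OF disj finc finJ])
  also have "\<dots> = emeasure (?M c \<Otimes>\<^sub>M ?M J) (E1 \<times> E2)"
    by (subst emeasure_distr[OF measurable_merge E]) (simp add: vim)
  also have "\<dots> = emeasure (?M c) E1 * emeasure (?M J) E2"
    by (rule J.emeasure_pair_measure_Times[OF E1 E2])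
  also have "emeasure (?M c) E1 = ennreal (unit_ball_vol (real (card c)) * \<rho> c ^ card c)"
    unfolding E1_def by (rule emeasure_cball_aux[OF finc]) (use insert.prems in auto)
  also have "emeasure (?M J) E2 = ennreal (\<Prod>b\<in>P. unit_ball_vol (real (card b)) * \<rho> b ^ card b)"
    unfolding E2_def J_def by (rule insert.IH[OF disjP]) (use insert.prems in auto)
  finally show ?case
    using insert.hyps insert.prems
    by (simp add: E_def J_def prod_nonneg less_imp_le flip: ennreal_mult)
qed

section \<open>Products of balls as compact convex symmetric bodies\<close>

definition block_body :: "'n set set \<Rightarrow> ('n set \<Rightarrow> real) \<Rightarrow> (real^'n) set" where
  "block_body P \<rho> = {u. \<forall>b\<in>P. sqrt (\<Sum>i\<in>b. (u $ i)\<^sup>2) \<le> \<rho> b}"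

lemma closed_block_body: "closed (block_body P \<rho> :: (real^'n) set)"
proof -
  have "block_body P \<rho> = (\<Inter>b\<in>P. {u :: real^'n. sqrt (\<Sum>i\<in>b. (u $ i)\<^sup>2) \<le> \<rho> b})" by (auto simp: block_body_def)
  then show ?thesis by (auto intro!: closed_INT closed_Collect_le continuous_intros)
qed

lemma bounded_block_body:
  fixes P :: "'n::finite set set"
  assumes "\<Union>P = UNIV" shows "bounded (block_body P \<rho>)"
proof -
  define m where "m = (\<Sum>b\<in>P. \<bar>\<rho> b\<bar>)"
  have "\<bar>u $ i\<bar> \<le> m" if u: "u \<in> block_body P \<rho>" for u i
  proof -
    have "i \<in> \<Union>P" using assms by simp
    then obtain b where b: "b \<in> P" "i \<in> b" by auto
    have "\<bar>u $ i\<bar> = sqrt ((u $ i)\<^sup>2)" by simp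
    also have "\<dots> \<le> sqrt (\<Sum>i\<in>b. (u $ i)\<^sup>2)"
      by (intro real_sqrt_le_mono member_le_sum) (use b in auto)
    also have "\<dots> \<le> \<rho> b" using u b by (simp add: block_body_def)
    also have "\<dots> \<le> \<bar>\<rho> b\<bar>" by simp
    also have "\<dots> \<le> m" unfolding m_def by (rule member_le_sum) (use b in auto)
    finally show ?thesis .
  qed
  then have "norm u \<le> (\<Sum>i\<in>(UNIV::'n set). m)" if "u \<in> block_body P \<rho>" for u
    using that by (intro order_trans[OF norm_le_l1_cart] sum_mono) auto
  then show ?thesis unfolding bounded_iff by blast
qed

lemma convex_block_body: "convex (block_body P \<rho> :: (real^'n) set)"
proof (rule convexI)
  fix x y :: "real^'n" and u v :: real
  assume x: "x \<in> block_body P \<rho>" and y: "y \<in> block_body P \<rho>" and uv: "0 \<le> u" "0 \<le> v" "u + v = 1"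
  show "u *\<^sub>R x + v *\<^sub>R y \<in> block_body P \<rho>"
    unfolding block_body_def
  proof (intro CollectI ballI)
    fix b assume b: "b \<in> P"
    have "sqrt (\<Sum>i\<in>b. ((u *\<^sub>R x + v *\<^sub>R y) $ i)\<^sup>2) = L2_set (\<lambda>i. u * x $ i + v * y $ i) b"
      by (simp add: L2_set_def)
    also have "\<dots> \<le> L2_set (\<lambda>i. u * x $ i) b + L2_set (\<lambda>i. v * y $ i) b" by (rule L2_set_triangle_ineq)
    also have "\<dots> = u * L2_set (\<lambda>i. x $ i) b + v * L2_set (\<lambda>i. y $ i) b"
      using uv by (simp add: L2_set_right_distrib)
    also have "\<dots> \<le> u * \<rho> b + v * \<rho> b"
      using x y b uv by (intro add_mono mult_left_mono) (auto simp: block_body_def L2_set_def)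
    also have "\<dots> = \<rho> b" using uv by (simp flip: distrib_right)
    finally show "sqrt (\<Sum>i\<in>b. ((u *\<^sub>R x + v *\<^sub>R y) $ i)\<^sup>2) \<le> \<rho> b" .
  qed
qed

lemma symmetric_block_body: "x \<in> block_body P \<rho> \<Longrightarrow> - x \<in> block_body P \<rho>"
  by (simp add: block_body_def)

text \<open>On \<open>real^'n\<close> Lebesgue measure is the image of a product measure indexed by
  the basis vectors, so the blocks are transported to subsets of \<open>Basis\<close> first.\<close>

lemma measure_block_body:
  fixes P :: "'n::finite set set"
  assumes P: "\<Union>P = UNIV" "disjoint P" and \<rho>: "\<And>b. b \<in> P \<Longrightarrow> \<rho> b > 0"
  shows "measure lebesgue (block_body P \<rho>) = (\<Prod>b\<in>P. unit_ball_vol (real (card b)) * \<rho> b ^ card b)"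
proof -
  define ax where "ax = (\<lambda>i::'n. axis i (1::real))"
  have inj: "inj ax" by (auto simp: inj_def ax_def axis_eq_axis)
  have Bas: "(Basis :: (real^'n) set) = range ax" by (auto simp: Basis_vec_def ax_def)
  define P' where "P' = (`) ax ` P"
  have UP': "\<Union>P' = Basis" using P(1) by (auto simp: P'_def Bas)
  have injP: "inj_on ((`) ax) P" using inj by (meson inj_image_eq_iff inj_onI)
  have disj': "disjoint P'"
  proof (rule disjointI)
    fix a b assume "a \<in> P'" "b \<in> P'" "a \<noteq> b"
    then obtain a' b' where "a' \<in> P" "b' \<in> P" "a' \<noteq> b'" "a = ax ` a'" "b = ax ` b'" by (auto simp: P'_def)
    then show "a \<inter> b = {}" using disjointD[OF P(2)] image_Int[OF inj, of a' b'] by simp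
  qed
  define \<rho>' where "\<rho>' = (\<lambda>b. \<rho> (ax -` b))"
  have \<rho>': "\<rho>' (ax ` b) = \<rho> b" for b using inj by (simp add: \<rho>'_def inj_vimage_image_eq)
  have comp: "(\<Sum>b\<in>Basis. f b *\<^sub>R b :: real^'n) $ i = f (ax i)" for f i
  proof -
    have "(\<Sum>b\<in>Basis. f b *\<^sub>R b :: real^'n) $ i = (\<Sum>j\<in>UNIV. f (ax j) * ax j $ i)"
      unfolding Bas by (subst sum.reindex[OF inj]) (simp add: sum_component)
    also have "\<dots> = (\<Sum>j\<in>UNIV. if j = i then f (ax j) else 0)"
      by (intro sum.cong) (auto simp: ax_def axis_def)
    finally show ?thesis by simp
  qed
  have "emeasure lborel (block_body P \<rho>) =
      emeasure (distr (Pi\<^sub>M Basis (\<lambda>_. lborel)) borel (\<lambda>f. \<Sum>b\<in>Basis. f b *\<^sub>R b)) (block_body P \<rho> :: (real^'n) set)"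
    by (subst lborel_eq) simp
  also have "\<dots> = emeasure (Pi\<^sub>M Basis (\<lambda>_. lborel))
      ((\<lambda>f. \<Sum>b\<in>Basis. f b *\<^sub>R b) -` block_body P \<rho> \<inter> space (Pi\<^sub>M (Basis :: (real^'n) set) (\<lambda>_. lborel)))"
    by (rule emeasure_distr) (auto intro: borel_closed closed_block_body)
  also have "(\<lambda>f. \<Sum>b\<in>Basis. f b *\<^sub>R b) -` block_body P \<rho> =
      {f :: real^'n \<Rightarrow> real. \<forall>b\<in>P'. sqrt (\<Sum>i\<in>b. (f i)\<^sup>2) \<le> \<rho>' b}"
  proof -
    have "(\<Sum>i\<in>ax ` b. (f i)\<^sup>2) = (\<Sum>i\<in>b. (f (ax i))\<^sup>2)" for f :: "real^'n \<Rightarrow> real" and b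
      by (subst sum.reindex) (use inj in \<open>auto simp: inj_on_def\<close>)
    then show ?thesis by (auto simp: block_body_def comp[simplified] P'_def \<rho>')
  qed
  also have "emeasure (Pi\<^sub>M Basis (\<lambda>_. lborel)) (\<dots> \<inter> space (Pi\<^sub>M (Basis :: (real^'n) set) (\<lambda>_. lborel))) =
     ennreal (\<Prod>b\<in>P'. unit_ball_vol (real (card b)) * \<rho>' b ^ card b)"
    unfolding UP'[symmetric]
    by (rule emeasure_PiM_blocks) (use disj' \<rho> \<rho>' in \<open>auto simp: P'_def\<close>)
  also have "(\<Prod>b\<in>P'. unit_ball_vol (real (card b)) * \<rho>' b ^ card b) = (\<Prod>b\<in>P. unit_ball_vol (real (card b)) * \<rho> b ^ card b)"
    unfolding P'_def by (subst prod.reindex[OF injP])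
      (auto intro!: prod.cong simp: \<rho>' card_image[OF inj_on_subset[OF inj]])
  finally have "measure lborel (block_body P \<rho>) = (\<Prod>b\<in>P. unit_ball_vol (real (card b)) * \<rho> b ^ card b)"
    using \<rho> by (simp add: measure_def prod_nonneg less_imp_le)
  then show ?thesis by (simp add: borel_closed closed_block_body)
qed

text \<open>Cut \<open>A\<close> along the integer cells and translate the pieces into the unit
  cube. Their total measure exceeds m while the cube has measure 1, so some point q is covered more
  than m times; its translates back into \<open>A\<close> form \<open>P\<close>.\<close>

lemma blichfeldt:
  fixes A :: "(real^'n) set"
  assumes A: "A \<in> sets lebesgue" "bounded A" and m: "measure lebesgue A > real m"
  obtains P where "P \<subseteq> A" "finite P" "card P > m" "\<And>x y i. x \<in> P \<Longrightarrow> y \<in> P \<Longrightarrow> (x - y) $ i \<in> \<int>"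
proof -
  define fl :: "real^'n \<Rightarrow> real^'n" where "fl = (\<lambda>x. \<chi> i. of_int \<lfloor>x $ i\<rfloor>)"
  define Q :: "(real^'n) set" where "Q = cbox 0 (\<chi> i. 1)"
  have mQ: "measure lebesgue Q = 1"
  proof -
    have "(0 :: real^'n) \<in> cbox 0 (\<chi> i. 1)" by (simp add: mem_box_cart)
    then have "content (cbox (0 :: real^'n) (\<chi> i. 1)) = 1" by (subst content_cbox_cart) auto
    then show ?thesis unfolding Q_def by simp
  qed
  have Qm: "Q \<in> lmeasurable" unfolding Q_def by simp
  obtain C where C: "\<And>x. x \<in> A \<Longrightarrow> norm x \<le> C" using A(2) unfolding bounded_iff by blast
  define Z where "Z = fl ` A"
  have finZ: "finite Z"
  proof -
    define K where "K = {-\<lceil>C\<rceil> - 1..\<lceil>C\<rceil> + 1}"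
    have "Z \<subseteq> (\<lambda>k. \<chi> i. of_int (k i)) ` (PiE UNIV (\<lambda>_. K))"
    proof
      fix z assume "z \<in> Z"
      then obtain x where x: "x \<in> A" "z = fl x" by (auto simp: Z_def)
      have "\<lfloor>x $ i\<rfloor> \<in> K" for i
      proof -
        have "\<bar>x $ i\<bar> \<le> C" using C[OF x(1)] component_le_norm_cart[of x i] by linarith
        then show ?thesis unfolding K_def by (simp add: abs_le_iff) linarith
      qed
      then show "z \<in> (\<lambda>k. \<chi> i. of_int (k i)) ` (PiE UNIV (\<lambda>_. K))"
        using x(2) by (intro image_eqI[of _ _ "\<lambda>i. \<lfloor>x $ i\<rfloor>"]) (auto simp: fl_def)
    qed
    moreover have "finite (PiE UNIV (\<lambda>_::'n. K))" by (intro finite_PiE) (auto simp: K_def)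
    ultimately show ?thesis by (meson finite_imageI finite_subset)
  qed
  define A' where "A' = (\<lambda>z. A \<inter> {x. fl x = z})"
  define T where "T = (\<lambda>z. (+) (- z) ` A' z)"
  have fl_meas: "{x. fl x = z} \<in> sets lebesgue" for z
  proof -
    have "{x. fl x = z} = (\<Inter>i. {x. of_int \<lfloor>x $ i\<rfloor> = z $ i})" by (auto simp: fl_def vec_eq_iff)
    moreover have "{x :: real^'n. of_int \<lfloor>x $ i\<rfloor> = z $ i} \<in> sets lebesgue" for i
    proof -
      have "{x :: real^'n. of_int \<lfloor>x $ i\<rfloor> = z $ i} =
         (if z $ i \<in> \<int> then {x. z $ i \<le> x $ i} \<inter> {x. x $ i < z $ i + 1} else {})"
        by (auto elim!: Ints_cases simp: floor_eq_iff) (metis Ints_of_int)+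
      moreover have "{x :: real^'n. z $ i \<le> x $ i} \<in> sets borel" "{x :: real^'n. x $ i < z $ i + 1} \<in> sets borel"
        by (auto intro!: borel_closed borel_open closed_Collect_le open_Collect_less continuous_intros)
      ultimately show ?thesis by (auto intro!: sets.Int lborelD)
    qed
    ultimately show ?thesis by (auto intro!: sets.countable_INT'')
  qed
  have A'm: "A' z \<in> lmeasurable" for z
    by (rule bounded_set_imp_lmeasurable) (use A fl_meas in \<open>auto simp: A'_def intro: bounded_Int\<close>)
  have Tm: "T z \<in> lmeasurable" for z unfolding T_def by (rule measurable_translation[OF A'm])
  have TQ: "T z \<subseteq> Q" for z
  proof
    fix y assume "y \<in> T z"
    then obtain x where x: "fl x = z" "y = - z + x" by (auto simp: T_def A'_def)
    then have "y $ i = x $ i - of_int \<lfloor>x $ i\<rfloor>" for i by (auto simp: fl_def)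
    then have "0 \<le> y $ i \<and> y $ i \<le> 1" for i by (auto intro: less_imp_le simp: floor_le_iff) linarith+
    then show "y \<in> Q" by (simp add: Q_def mem_box_cart)
  qed
  have "measure lebesgue A = measure lebesgue (\<Union>z\<in>Z. A' z)"
    by (rule arg_cong[where f = "measure lebesgue"]) (auto simp: A'_def Z_def)
  also have "\<dots> = (\<Sum>z\<in>Z. measure lebesgue (A' z))"
    by (rule measure_UNION'[OF finZ]) (use A'm in \<open>auto simp: pairwise_def disjnt_def A'_def\<close>)
  also have "\<dots> = (\<Sum>z\<in>Z. measure lebesgue (T z))"
    by (intro sum.cong refl) (simp only: T_def measure_translation)
  finally have sum: "measure lebesgue A = (\<Sum>z\<in>Z. measure lebesgue (T z))" .
  have intT: "integrable lebesgue (indicat_real (T z))" for z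
    using Tm[of z] by (intro integrable_real_indicator) (auto simp: fmeasurable_def infinity_ennreal_def)
  have intQ: "integrable lebesgue (indicat_real Q)"
    using Qm by (intro integrable_real_indicator) (auto simp: fmeasurable_def infinity_ennreal_def)
  have "\<exists>q. card {z \<in> Z. q \<in> T z} > m"
  proof (rule ccontr)
    assume "\<not> ?thesis"
    then have le: "card {z \<in> Z. q \<in> T z} \<le> m" for q by (simp add: not_less)
    have ind: "(\<Sum>z\<in>Z. indicat_real (T z) q) = real (card {z \<in> Z. q \<in> T z})" for q
      using finZ by (simp add: indicator_def sum.If_cases Int_def)
    have "(\<Sum>z\<in>Z. measure lebesgue (T z)) = (\<integral>q. (\<Sum>z\<in>Z. indicat_real (T z) q) \<partial>lebesgue)"
      by (subst Bochner_Integration.integral_sum) (simp_all add: intT)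
    also have "\<dots> \<le> (\<integral>q. real m * indicat_real Q q \<partial>lebesgue)"
    proof (rule integral_mono)
      show "integrable lebesgue (\<lambda>q. \<Sum>z\<in>Z. indicat_real (T z) q)"
        by (intro Bochner_Integration.integrable_sum intT)
      show "integrable lebesgue (\<lambda>q. real m * indicat_real Q q)"
        by (intro integrable_mult_right intQ)
      fix q
      show "(\<Sum>z\<in>Z. indicat_real (T z) q) \<le> real m * indicat_real Q q"
      proof (cases "q \<in> Q")
        case True
        then show ?thesis using le[of q] by (simp add: ind)
      next
        case False
        then have "indicat_real (T z) q = 0" for z using TQ by (auto simp: indicator_def)
        then show ?thesis by simp
      qed
    qed
    also have "\<dots> = real m" using mQ by simp
    finally show False using m sum by simp
  qed
  then obtain q where q: "card {z \<in> Z. q \<in> T z} > m" by blast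
  define P where "P = (\<lambda>z. z + q) ` {z \<in> Z. q \<in> T z}"
  have "card P = card {z \<in> Z. q \<in> T z}" unfolding P_def by (rule card_image) (auto simp: inj_on_def)
  moreover have "P \<subseteq> A" by (auto simp: P_def T_def A'_def)
  moreover have "(x - y) $ i \<in> \<int>" if "x \<in> P" "y \<in> P" for x y i
    using that by (auto simp: P_def Z_def fl_def)
  ultimately show thesis using that[of P] q finZ by (simp add: P_def)
qed

text \<open>Here \<open>f\<close> assigns to a point of \<open>\<int>\<^sup>n\<close> its class modulo a sublattice of index at most \<open>m\<close>.\<close>

lemma minkowski_strict:
  fixes R :: "real^'n::{finite,wellorder}^'n::_" and f :: "('n::{finite,wellorder} \<Rightarrow> int) \<Rightarrow> 'c"
  assumes B: "compact B" "convex B" "\<And>x. x \<in> B \<Longrightarrow> - x \<in> B"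
    and R: "det R \<noteq> 0" and f: "finite (range f)" "card (range f) \<le> m"
    and vol: "measure lebesgue B > 2 ^ CARD('n) * real m * \<bar>det R\<bar>"
  obtains z w where "z \<noteq> w" "f z = f w" "R *v (\<chi> i. of_int (z i - w i)) \<in> B"
proof -
  obtain S where S: "R ** S = mat 1" "S ** R = mat 1" using R by (metis invertible_det_nz invertible_def)
  define g where "g = (\<lambda>x. (1/2) *\<^sub>R (S *v x))"
  have lin: "linear g" unfolding g_def by (intro linear_compose_scale_right matrix_vector_mul_linear)
  have Bm: "B \<in> lmeasurable" by (rule lmeasurable_compact[OF B(1)])
  have detg: "\<bar>det (matrix g)\<bar> * (2 ^ CARD('n) * \<bar>det R\<bar>) = 1"
  proof -
    have "g = (*\<^sub>R) (1/2) \<circ> (*v) S" by (auto simp: g_def)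
    then have "matrix g = matrix ((*\<^sub>R) (1/2) :: real^'n::_ \<Rightarrow> _) ** S"
      using matrix_compose[of "(*v) S" "(*\<^sub>R) (1/2) :: real^'n::_ \<Rightarrow> _"]
      by (simp add: matrix_vector_mul_linear linear_scale_self)
    then have "det (matrix g) = (1/2) ^ CARD('n) * det S"
      by (simp add: det_mul det_matrix_scaleR)
    moreover have "det S * det R = 1" using S(2) by (metis det_I det_mul)
    ultimately have "det (matrix g) * (2 ^ CARD('n) * det R) = 1"
      by (simp add: power_divide field_simps)
    then have "\<bar>det (matrix g) * (2 ^ CARD('n) * det R)\<bar> = 1" by simp
    then show ?thesis by (simp add: abs_mult power_abs)
  qed
  define A where "A = g ` B"
  have Am: "A \<in> lmeasurable" unfolding A_def by (rule measurable_linear_image[OF lin Bm])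
  have "measure lebesgue A = \<bar>det (matrix g)\<bar> * measure lebesgue B"
    unfolding A_def by (rule measure_linear_image[OF lin Bm])
  moreover have "\<bar>det (matrix g)\<bar> > 0" using detg by (metis abs_ge_zero less_eq_real_def mult_zero_left zero_neq_one)
  ultimately have "measure lebesgue A > \<bar>det (matrix g)\<bar> * (2 ^ CARD('n) * real m * \<bar>det R\<bar>)"
    using vol by simp
  also have "\<bar>det (matrix g)\<bar> * (2 ^ CARD('n) * real m * \<bar>det R\<bar>) = real m"
    using detg by (simp add: mult_ac)
  finally have mA: "measure lebesgue A > real m" .
  have bA: "bounded A" unfolding A_def
    using bounded_linear_image[OF compact_imp_bounded[OF B(1)]] lin by (simp add: linear_conv_bounded_linear)
  obtain P where P: "P \<subseteq> A" "finite P" "card P > m" "\<And>x y i. x \<in> P \<Longrightarrow> y \<in> P \<Longrightarrow> (x - y) $ i \<in> \<int>"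
    by (rule blichfeldt[OF _ bA mA]) (use Am in \<open>auto simp: fmeasurableD\<close>)
  have "P \<noteq> {}" using P(3) by auto
  then obtain x0 where x0: "x0 \<in> P" by blast
  define h :: "real^'n::_ \<Rightarrow> 'n \<Rightarrow> int" where "h = (\<lambda>x i. \<lfloor>(x - x0) $ i\<rfloor>)"
  have h: "of_int (h x i) = (x - x0) $ i" if "x \<in> P" for x i
  proof -
    obtain k where "(x - x0) $ i = of_int k" using P(4)[OF \<open>x \<in> P\<close> x0, of i] by (auto elim: Ints_cases)
    then show ?thesis by (simp add: h_def)
  qed
  have "\<not> inj_on (f \<circ> h) P"
  proof
    assume "inj_on (f \<circ> h) P"
    then have "card P = card ((f \<circ> h) ` P)" by (simp only: card_image)
    also have "\<dots> \<le> card (range f)" using f(1) by (intro card_mono) auto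
    finally show False using f(2) P(3) by simp
  qed
  then obtain x y where xy: "x \<in> P" "y \<in> P" "x \<noteq> y" "f (h x) = f (h y)" by (auto simp: inj_on_def)
  have diff: "(\<chi> i. of_int (h x i - h y i)) = x - y" using h[OF xy(1)] h[OF xy(2)] by (simp add: vec_eq_iff)
  have hxy: "h x \<noteq> h y"
  proof
    assume "h x = h y"
    with diff have "x - y = 0" by (simp add: vec_eq_iff)
    with xy(3) show False by simp
  qed
  obtain b c where bc: "b \<in> B" "c \<in> B" "x = g b" "y = g c"
    using subsetD[OF P(1) xy(1)] subsetD[OF P(1) xy(2)] by (auto simp: A_def)
  have "R *v (x - y) = (1/2) *\<^sub>R b + (1/2) *\<^sub>R (- c)"
    using S(1) by (simp add: bc g_def matrix_vector_mult_diff_distrib matrix_vector_mult_scaleR matrix_vector_mul_assoc)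
  also have "\<dots> \<in> B" by (rule convexD[OF B(2)]) (use bc B(3) in auto)
  finally have "R *v (\<chi> i. of_int (h x i - h y i)) \<in> B" by (simp only: diff)
  then show thesis using that hxy xy(4) by blast
qed

text \<open>The case of equality in the volume condition follows from the strict one by
  compactness.\<close>

theorem minkowski:
  fixes R :: "real^'n::{finite,wellorder}^'n::_" and f :: "('n::{finite,wellorder} \<Rightarrow> int) \<Rightarrow> 'c"
  assumes B: "compact B" "convex B" "\<And>x. x \<in> B \<Longrightarrow> - x \<in> B"
    and R: "det R \<noteq> 0" and f: "finite (range f)" "card (range f) \<le> m"
    and vol: "measure lebesgue B \<ge> 2 ^ CARD('n) * real m * \<bar>det R\<bar>"
  obtains z w where "z \<noteq> w" "f z = f w" "R *v (\<chi> i. of_int (z i - w i)) \<in> B"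
proof -
  have m: "m > 0" using f by (metis UNIV_not_empty card_gt_0_iff gr0I image_is_empty le_zero_eq)
  \<comment> \<open>Dividing \<open>R\<close> by t k > 1 lowers its determinant and makes the volume
    inequality strict; t k \<le> 2 keeps the resulting vectors bounded.\<close>
  define t :: "nat \<Rightarrow> real" where "t = (\<lambda>k. 1 + inverse (real (Suc k)))"
  have t: "t k > 1" "t k \<le> 2" for k by (auto simp: t_def inverse_le_1_iff)
  define good where "good = (\<lambda>k (u::'n \<Rightarrow> int). u \<noteq> (\<lambda>_. 0) \<and> (\<exists>z w. f z = f w \<and> u = (\<lambda>i. z i - w i)) \<and>
      (1 / t k) *\<^sub>R (R *v (\<chi> i. of_int (u i))) \<in> B)"
  have "\<exists>u. good k u" for k
  proof -
    define R' where "R' = matrix (\<lambda>x. (1 / t k) *\<^sub>R (R *v x))"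
    have R'v: "R' *v x = (1 / t k) *\<^sub>R (R *v x)" for x
    proof -
      have "linear (\<lambda>x. (1 / t k) *\<^sub>R (R *v x))" by (intro linear_compose_scale_right matrix_vector_mul_linear)
      from matrix_vector_mul(2)[OF this] show ?thesis unfolding R'_def by (rule fun_cong)
    qed
    have "(\<lambda>x. (1 / t k) *\<^sub>R (R *v x)) = (*\<^sub>R) (1 / t k) \<circ> (*v) R" by auto
    then have "R' = matrix ((*\<^sub>R) (1 / t k) :: real^'n::_ \<Rightarrow> _) ** R"
      unfolding R'_def using matrix_compose[of "(*v) R" "(*\<^sub>R) (1 / t k) :: real^'n::_ \<Rightarrow> _"]
      by (simp add: matrix_vector_mul_linear linear_scale_self)
    then have detR': "det R' = (1 / t k) ^ CARD('n) * det R"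
      by (simp add: det_mul det_matrix_scaleR)
    have "t k > 0" using t(1)[of k] by simp
    then have nz: "det R' \<noteq> 0" using R by (simp add: detR')
    have "(1 / t k) ^ CARD('n) < 1" using t(1)[of k] by (intro power_Suc_less_one power_less_one_iff[THEN iffD2]) auto
    then have "\<bar>det R'\<bar> < \<bar>det R\<bar>" using R \<open>t k > 0\<close> by (simp add: detR' abs_mult)
    then have "2 ^ CARD('n) * real m * \<bar>det R'\<bar> < 2 ^ CARD('n) * real m * \<bar>det R\<bar>" using m by simp
    then have "measure lebesgue B > 2 ^ CARD('n) * real m * \<bar>det R'\<bar>" using vol by linarith
    then obtain z w where "z \<noteq> w" "f z = f w" "R' *v (\<chi> i. of_int (z i - w i)) \<in> B"
      using minkowski_strict[OF B nz f] by blast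
    then show ?thesis unfolding good_def R'v by (intro exI[of _ "\<lambda>i. z i - w i"]) (auto simp: fun_eq_iff)
  qed
  then obtain u where "\<And>k. good k (u k)" by metis
  then have u: "\<And>k. u k \<noteq> (\<lambda>_. 0)" "\<And>k. \<exists>z w. f z = f w \<and> u k = (\<lambda>i. z i - w i)"
    "\<And>k. (1 / t k) *\<^sub>R (R *v (\<chi> i. of_int (u k i))) \<in> B" by (auto simp: good_def)
  obtain S where S: "S ** R = mat 1" using R by (metis invertible_det_nz invertible_def)
  obtain C where C: "\<And>x. x \<in> B \<Longrightarrow> norm x \<le> C" using compact_imp_bounded[OF B(1)] unfolding bounded_iff by blast
  obtain D where D: "D > 0" "\<And>x. norm (S *v x) \<le> norm x * D"
    using bounded_linear.pos_bounded[OF matrix_vector_mul_bounded_linear[of S]] by blast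
  define K where "K = {- \<lceil>2 * C * D\<rceil>..\<lceil>2 * C * D\<rceil>}"
  have "range u \<subseteq> PiE UNIV (\<lambda>_. K)"
  proof safe
    fix k i
    define v :: "real^'n::_" where "v = (\<chi> i. of_int (u k i))"
    define w where "w = S *v ((1 / t k) *\<^sub>R (R *v v))"
    have "v = t k *\<^sub>R w"
      using S t(1)[of k] by (simp add: w_def matrix_vector_mult_scaleR matrix_vector_mul_assoc)
    then have "norm v = t k * norm w" using t(1)[of k] by simp
    also have "\<dots> \<le> 2 * (C * D)"
    proof (rule mult_mono)
      have "norm w \<le> norm ((1 / t k) *\<^sub>R (R *v v)) * D" unfolding w_def by (rule D(2))
      also have "\<dots> \<le> C * D" using C[OF u(3)[of k]] D(1) by (intro mult_right_mono) (simp_all add: v_def)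
      finally show "norm w \<le> C * D" .
    qed (use t in auto)
    finally have "\<bar>v $ i\<bar> \<le> 2 * C * D" using component_le_norm_cart[of v i] by simp
    then have "of_int \<bar>u k i\<bar> \<le> 2 * C * D" by (simp add: v_def)
    then have "\<bar>u k i\<bar> \<le> \<lceil>2 * C * D\<rceil>" by linarith
    then show "u k i \<in> K" by (auto simp: K_def)
  qed auto
  moreover have "finite (PiE UNIV (\<lambda>_::'n. K))" by (intro finite_PiE) (auto simp: K_def)
  ultimately have "finite (range u)" by (rule finite_subset)
  \<comment> \<open>Only finitely many integer vectors occur among the \<open>u k\<close>, so one of
    them serves infinitely many k. Letting \<open>t k\<close> tend to 1 along these puts its image
    under \<open>R\<close> into the closed set \<open>B\<close>.\<close>
  then obtain k0 where k0: "infinite {k. u k = u k0}"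
    using pigeonhole_infinite[of UNIV u] by auto
  define v :: "real^'n::_" where "v = R *v (\<chi> i. of_int (u k0 i))"
  define r where "r = enumerate {k. u k = u k0}"
  have r: "strict_mono r" "\<And>j. u (r j) = u k0"
    using strict_mono_enumerate[OF k0] enumerate_in_set[OF k0] by (auto simp: r_def)
  have inB: "(1 / t (r j)) *\<^sub>R v \<in> B" for j using u(3)[of "r j"] r(2)[of j] by (simp add: v_def)
  have "t \<longlonglongrightarrow> 1 + 0" unfolding t_def by (intro tendsto_add tendsto_const LIMSEQ_inverse_real_of_nat)
  then have "(\<lambda>j. t (r j)) \<longlonglongrightarrow> 1" using LIMSEQ_subseq_LIMSEQ[OF _ r(1)] by (auto simp: comp_def)
  then have "(\<lambda>j. (1 / t (r j)) *\<^sub>R v) \<longlonglongrightarrow> (1 / 1) *\<^sub>R v" by (intro tendsto_intros) auto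
  then have "v \<in> B" using closed_sequentially[OF compact_imp_closed[OF B(1)]] inB by fastforce
  moreover obtain z w where zw: "f z = f w" "u k0 = (\<lambda>i. z i - w i)" using u(2) by blast
  moreover have "z \<noteq> w" using u(1)[of k0] zw(2) by auto
  ultimately show thesis using that[of z w] by (simp add: v_def)
qed

section \<open>Prime ideals and their valuations\<close>

abbreviation OK :: "'k::number_field set" where "OK \<equiv> ring_of_integers"

definition oideal :: "'k::number_field set \<Rightarrow> bool" where
  "oideal I \<longleftrightarrow> I \<subseteq> OK \<and> 0 \<in> I \<and> (\<forall>x\<in>I. \<forall>y\<in>I. x + y \<in> I) \<and> (\<forall>a\<in>OK. \<forall>x\<in>I. a * x \<in> I)"

lemma oidealD:
  assumes "oideal I"
  shows "x \<in> I \<Longrightarrow> x \<in> OK" "0 \<in> I" "x \<in> I \<Longrightarrow> y \<in> I \<Longrightarrow> x + y \<in> I" "a \<in> OK \<Longrightarrow> x \<in> I \<Longrightarrow> a * x \<in> I"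
    "a \<in> OK \<Longrightarrow> x \<in> I \<Longrightarrow> x * a \<in> I" "x \<in> I \<Longrightarrow> y \<in> I \<Longrightarrow> x - y \<in> I" "x \<in> I \<Longrightarrow> - x \<in> I"
proof -
  show 1: "x \<in> I \<Longrightarrow> - x \<in> I" for x
    using assms ring_of_integers_closed(7)[OF ring_of_integers_closed(2)] unfolding oideal_def by fastforce
  show "x \<in> I \<Longrightarrow> y \<in> I \<Longrightarrow> x - y \<in> I"
    using assms 1[of y] unfolding oideal_def by (metis add_uminus_conv_diff)
qed (use assms in \<open>auto simp: oideal_def mult.commute\<close>)

text \<open>An ideal containing \<open>a\<close> then contains \<open>m\<close>, so questions about
  ideals reduce to the finitely many residues modulo \<open>m\<close>.\<close>

lemma nonzero_integer_multiple:
  fixes a :: "'k::number_field"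
  assumes "a \<noteq> 0"
  obtains m :: nat and b where "m > 0" "b \<in> OK" "a * b = of_nat m"
proof -
  obtain m :: int where m: "m > 0" "of_int m * inverse a \<in> OK" by (rule integral_multiple)
  show thesis by (rule that[of "nat m" "of_int m * inverse a"]) (use m assms in auto)
qed

text \<open>A system of representatives of the integers modulo m, if \<beta> is an integral
  basis.\<close>

definition box_reps :: "('k::number_field emb \<Rightarrow> 'k) \<Rightarrow> nat \<Rightarrow> 'k set" where
  "box_reps \<beta> m = (\<lambda>z. \<Sum>j\<in>UNIV. of_int (z j) * \<beta> j) ` (PiE UNIV (\<lambda>_. {0..<int m}))"

lemma int_basis_unique:
  assumes "int_basis \<beta>" "(\<Sum>j\<in>UNIV. of_int (z j) * \<beta> j) = (\<Sum>j\<in>UNIV. of_int (w j) * \<beta> j)"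
  shows "z = w"
proof
  fix j
  have "(\<Sum>j\<in>UNIV. of_int (z j - w j) * \<beta> j) = 0"
    using assms(2) by (simp add: left_diff_distrib sum_subtractf)
  then have "(\<Sum>j\<in>UNIV. of_rat (of_int (z j - w j)) * \<beta> j) = 0" by (simp only: of_rat_of_int_eq)
  then have "(of_int (z j - w j) :: rat) = 0"
    using assms(1) rational_basis_unique[of \<beta> "\<lambda>j. of_int (z j - w j)"] by (auto simp: int_basis_def)
  then show "z j = w j" by simp
qed

lemma int_basis_sum_in: "int_basis \<beta> \<Longrightarrow> (\<Sum>j\<in>UNIV. of_int (z j) * \<beta> j) \<in> OK"
  by (auto simp: int_basis_def)

lemma finite_box_reps: "finite (box_reps \<beta> m)"
  unfolding box_reps_def by (intro finite_imageI finite_PiE) auto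

lemma card_box_reps:
  fixes \<beta> :: "'k::number_field emb \<Rightarrow> 'k"
  assumes "int_basis \<beta>" shows "card (box_reps \<beta> m) = m ^ CARD('k emb)"
proof -
  have "card (box_reps \<beta> m) = card (PiE (UNIV :: 'k emb set) (\<lambda>_. {0..<int m}))"
    unfolding box_reps_def by (rule card_image) (use int_basis_unique[OF assms] in \<open>auto intro: inj_onI\<close>)
  then show ?thesis by (simp add: card_PiE)
qed

lemma box_reps_OO: "int_basis \<beta> \<Longrightarrow> box_reps \<beta> m \<subseteq> OK"
  by (auto simp: box_reps_def int_basis_def)

lemma box_reps_rep:
  assumes \<beta>: "int_basis \<beta>" and m: "m > 0" and x: "x \<in> OK"
  obtains d z where "d \<in> box_reps \<beta> m" "x = d + of_nat m * (\<Sum>j\<in>UNIV. of_int (z j) * \<beta> j)"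
proof -
  obtain z where z: "x = (\<Sum>j\<in>UNIV. of_int (z j) * \<beta> j)" using \<beta> x by (auto simp: int_basis_def)
  have "x = (\<Sum>j\<in>UNIV. of_int (z j mod int m) * \<beta> j) + of_nat m * (\<Sum>j\<in>UNIV. of_int (z j div int m) * \<beta> j)"
  proof -
    have "of_int (z j) * \<beta> j = of_int (z j mod int m) * \<beta> j + of_nat m * (of_int (z j div int m) * \<beta> j)" for j
    proof -
      have "z j = z j mod int m + int m * (z j div int m)" by simp
      then have "(of_int (z j) :: 'a) = of_int (z j mod int m) + of_nat m * of_int (z j div int m)"
        by (metis of_int_add of_int_mult of_int_of_nat_eq)
      then show ?thesis by (simp add: distrib_right mult.assoc)
    qed
    then show ?thesis unfolding z by (simp add: sum.distrib sum_distrib_left)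
  qed
  moreover have "(\<Sum>j\<in>UNIV. of_int (z j mod int m) * \<beta> j) \<in> box_reps \<beta> m"
    unfolding box_reps_def using m by (intro imageI) auto
  ultimately show thesis by (rule that[rotated])
qed

lemma box_reps_distinct:
  assumes \<beta>: "int_basis \<beta>" and d: "d \<in> box_reps \<beta> m" "d' \<in> box_reps \<beta> m" and eq: "d - d' = of_nat m * x" "x \<in> OK"
  shows "d = d'"
proof -
  obtain z z' where z: "d = (\<Sum>j\<in>UNIV. of_int (z j) * \<beta> j)" "z \<in> PiE UNIV (\<lambda>_. {0..<int m})"
      and z': "d' = (\<Sum>j\<in>UNIV. of_int (z' j) * \<beta> j)" "z' \<in> PiE UNIV (\<lambda>_. {0..<int m})"
    using d by (auto simp: box_reps_def)
  obtain y where y: "x = (\<Sum>j\<in>UNIV. of_int (y j) * \<beta> j)" using \<beta> eq by (auto simp: int_basis_def)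
  have "d = d' + of_nat m * x" using eq by (simp add: algebra_simps)
  then have "(\<Sum>j\<in>UNIV. of_int (z j) * \<beta> j) = (\<Sum>j\<in>UNIV. of_int (z' j + int m * y j) * \<beta> j)"
    unfolding z(1) z'(1) y by (simp add: distrib_right sum.distrib sum_distrib_left mult.assoc)
  then have e: "z = (\<lambda>j. z' j + int m * y j)" by (rule int_basis_unique[OF \<beta>])
  have "z j = z' j" for j
  proof -
    have "z j mod int m = z' j mod int m" using fun_cong[OF e, of j] by simp
    then show ?thesis using z(2) z'(2) by (simp add: PiE_iff)
  qed
  then show ?thesis by (simp add: z(1) z'(1))
qed

text \<open>An ideal containing \<open>a\<close> contains all multiples of \<open>m\<close>, so it
  is determined by the representatives modulo \<open>m\<close> that lie in it. This finiteness takes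
  the place of the Noetherian property below.\<close>

lemma finite_ideals_above:
  fixes a :: "'k::number_field"
  assumes "a \<noteq> 0"
  shows "finite {I. oideal I \<and> a \<in> I}"
proof -
  obtain \<beta> :: "'k emb \<Rightarrow> 'k" where \<beta>: "int_basis \<beta>" by (rule int_basis_exists)
  obtain m b where m: "m > 0" "b \<in> OK" "a * b = of_nat m" using nonzero_integer_multiple[OF assms] by blast
  let ?D = "box_reps \<beta> m"
  have "inj_on (\<lambda>I. I \<inter> ?D) {I. oideal I \<and> a \<in> I}"
  proof (rule inj_onI)
    have *: "I \<subseteq> J" if IJ: "oideal I" "oideal J" "a \<in> I" "a \<in> J" "I \<inter> ?D = J \<inter> ?D" for I J
    proof
      fix x assume x: "x \<in> I"
      obtain d z where d: "d \<in> ?D" "x = d + of_nat m * (\<Sum>j\<in>UNIV. of_int (z j) * \<beta> j)"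
        using box_reps_rep[OF \<beta> m(1) oidealD(1)[OF IJ(1) x]] by blast
      have "(\<Sum>j\<in>UNIV. of_int (z j) * \<beta> j) \<in> OK" using \<beta> by (auto simp: int_basis_def)
      then have "a * (b * (\<Sum>j\<in>UNIV. of_int (z j) * \<beta> j)) \<in> I \<inter> J"
        using IJ m(2) by (intro IntI oidealD(5) ring_of_integers_closed) auto
      then have y: "of_nat m * (\<Sum>j\<in>UNIV. of_int (z j) * \<beta> j) \<in> I \<inter> J" using m(3) by (metis mult.assoc)
      then have "d \<in> I" using oidealD(6)[OF IJ(1) x] d(2) by (metis IntE add_diff_cancel_right')
      then have "d \<in> J" using IJ(5) d(1) by blast
      then show "x \<in> J" using oidealD(3)[OF IJ(2)] y d(2) by blast
    qed
    fix I J assume "I \<in> {I. oideal I \<and> a \<in> I}" "J \<in> {I. oideal I \<and> a \<in> I}" "I \<inter> ?D = J \<inter> ?D"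
    then show "I = J" using *[of I J] *[of J I] by auto
  qed
  moreover have "finite ((\<lambda>I. I \<inter> ?D) ` {I. oideal I \<and> a \<in> I})"
    by (rule finite_subset[of _ "Pow ?D"]) (auto simp: finite_box_reps)
  ultimately show ?thesis by (rule finite_imageD[rotated])
qed

text \<open>The ideal is generated as a group by its representatives modulo \<open>m\<close>
  together with the m \<beta> j, so \<open>t\<close> stabilizes a finitely generated group.\<close>

lemma integral_if_stable_ideal:
  fixes I :: "'k::number_field set"
  assumes I: "oideal I" "a \<in> I" "a \<noteq> 0" and t: "\<And>x. x \<in> I \<Longrightarrow> t * x \<in> I"
  shows "t \<in> OK"
proof -
  obtain \<beta> :: "'k emb \<Rightarrow> 'k" where \<beta>: "int_basis \<beta>" by (rule int_basis_exists)
  obtain m b where m: "m > 0" "b \<in> OK" "a * b = of_nat m" using nonzero_integer_multiple[OF I(3)] by blast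
  let ?D = "box_reps \<beta> m"
  define W where "W = (?D \<inter> I) \<union> range (\<lambda>j. of_nat m * \<beta> j)"
  have finW: "finite W" by (simp add: W_def finite_box_reps)
  have mI: "of_nat m * x \<in> I" if "x \<in> OK" for x
  proof -
    have "a * (b * x) \<in> I" using that m(2) I by (intro oidealD(5) ring_of_integers_closed) auto
    then show ?thesis using m(3) by (metis mult.assoc)
  qed
  have \<beta>O: "\<beta> j \<in> OK" for j
  proof -
    have "(\<Sum>i\<in>UNIV. of_int (if i = j then 1 else 0) * \<beta> i) = (\<Sum>i\<in>UNIV. if i = j then \<beta> i else 0)"
      by (intro sum.cong) auto
    then have eq: "(\<Sum>i\<in>UNIV. of_int (if i = j then 1 else 0) * \<beta> i) = \<beta> j" by simp
    have "(\<Sum>i\<in>UNIV. of_int (if i = j then 1 else 0) * \<beta> i) \<in> OK" by (rule int_basis_sum_in[OF \<beta>])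
    then show ?thesis unfolding eq .
  qed
  have WI: "W \<subseteq> I" using mI \<beta>O by (auto simp: W_def)
  have span: "x \<in> ZM.span W" if x: "x \<in> I" for x
  proof -
    obtain d z where d: "d \<in> ?D" "x = d + of_nat m * (\<Sum>j\<in>UNIV. of_int (z j) * \<beta> j)"
      using box_reps_rep[OF \<beta> m(1) oidealD(1)[OF I(1) x]] by blast
    have sO: "(\<Sum>j\<in>UNIV. of_int (z j) * \<beta> j) \<in> OK" using \<beta> by (auto simp: int_basis_def)
    have "d \<in> I" using oidealD(6)[OF I(1) x mI[OF sO]] d(2) by simp
    moreover have "x = d + (\<Sum>j\<in>UNIV. of_int (z j) * (of_nat m * \<beta> j))" using d(2) by (simp add: sum_distrib_left mult_ac)
    ultimately show ?thesis using d(1)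
      by (simp only:) (intro ZM.span_add ZM.span_sum ZM.span_scale ZM.span_base; auto simp: W_def)
  qed
  have "\<exists>u. t * w = (\<Sum>v\<in>W. of_int (u v) * v)" if "w \<in> W" for w
  proof -
    have "t * w \<in> ZM.span W" using span t WI that by blast
    then show ?thesis using ZM.span_finite[OF finW] by auto
  qed
  then have "\<forall>w\<in>W. \<exists>u. t * w = (\<Sum>v\<in>W. of_int (u v) * v)" by blast
  from bchoice[OF this] obtain u where "\<forall>w\<in>W. t * w = (\<Sum>v\<in>W. of_int (u w v) * v)" by blast
  then have st: "stable_under W (\<lambda>v. v) t" unfolding stable_under_def by blast
  have "\<exists>w\<in>W. w \<noteq> 0"
  proof (rule ccontr)
    assume "\<not> ?thesis"
    then have "ZM.span W \<subseteq> {0}" using ZM.span_mono[of W "{0}"] ZM.span_minimal[of W "{0}"] by (auto simp: ZM.subspace_def)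
    with span[OF I(2)] I(3) show False by blast
  qed
  then show ?thesis unfolding ring_of_integers_def using algebraic_int_if_stable_under[OF finW _ _ st] by blast
qed

text \<open>These are the nonzero maximal ideals, which in a ring of integers are the nonzero
  primes; invertibility modulo P is the form in which maximality gets used.\<close>

definition primes :: "'k::number_field set set" where
  "primes = {P. oideal P \<and> 1 \<notin> P \<and> P \<noteq> {0} \<and> (\<forall>a\<in>OK - P. \<exists>u\<in>OK. a * u - 1 \<in> P)}"

lemma primesD:
  assumes "P \<in> primes"
  shows "oideal P" "1 \<notin> P" "\<exists>a\<in>P. a \<noteq> 0" "a \<in> OK \<Longrightarrow> a \<notin> P \<Longrightarrow> \<exists>u\<in>OK. a * u - 1 \<in> P"
proof -
  have "0 \<in> P" using assms by (auto simp: primes_def oideal_def)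
  moreover have "P \<noteq> {0}" using assms by (auto simp: primes_def)
  ultimately show "\<exists>a\<in>P. a \<noteq> 0" by blast
qed (use assms in \<open>auto simp: primes_def\<close>)

lemma primes_mult:
  assumes P: "P \<in> primes" and a: "a \<in> OK" "a \<notin> P" and b: "b \<in> OK" "b \<notin> P"
  shows "a * b \<notin> P"
proof
  assume ab: "a * b \<in> P"
  obtain u where u: "u \<in> OK" "a * u - 1 \<in> P" using primesD(4)[OF P a] by blast
  have "b = (a * b) * u - (a * u - 1) * b" by (simp add: algebra_simps)
  moreover note oidealD(6)[OF primesD(1)[OF P] oidealD(5)[OF primesD(1)[OF P] u(1) ab]
      oidealD(5)[OF primesD(1)[OF P] b(1) u(2)]]
  ultimately show False using b by simp
qed

lemma primes_power:
  assumes P: "P \<in> primes" and a: "a \<in> OK" "a \<notin> P" shows "a ^ k \<notin> P"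
  by (induction k) (use primesD(2)[OF P] primes_mult[OF P a] ring_of_integers_closed(8)[OF a(1)] in auto)

text \<open>Only finitely many ideals contain \<open>a\<close>, so there is a maximal proper one
  above \<open>I\<close>. For b outside it, the ideal P + b O is the whole ring, which yields an
  inverse of b modulo P.\<close>

lemma primes_above:
  fixes I :: "'k::number_field set"
  assumes I: "oideal I" "1 \<notin> I" "a \<in> I" "a \<noteq> 0"
  obtains P where "P \<in> primes" "I \<subseteq> P"
proof -
  let ?F = "{J. oideal J \<and> 1 \<notin> J \<and> I \<subseteq> J}"
  have "finite ?F" by (rule finite_subset[OF _ finite_ideals_above[OF I(4)]]) (use I in auto)
  moreover have "I \<in> ?F" using I by simp
  ultimately obtain P where P: "P \<in> ?F" "\<And>J. J \<in> ?F \<Longrightarrow> P \<subseteq> J \<Longrightarrow> P = J"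
    using finite_has_maximal2[of ?F I] by auto
  have oP: "oideal P" using P by simp
  have "\<exists>u\<in>OK. b * u - 1 \<in> P" if b: "b \<in> OK" "b \<notin> P" for b
  proof -
    define J where "J = {p + b * u | p u. p \<in> P \<and> u \<in> OK}"
    have JO: "oideal J"
      unfolding oideal_def
    proof (intro conjI ballI subsetI)
      show "x \<in> OK" if "x \<in> J" for x
        using that b(1) oidealD(1)[OF oP] unfolding J_def by (auto intro!: ring_of_integers_closed)
      show "0 \<in> J" unfolding J_def using oidealD(2)[OF oP] ring_of_integers_closed(1) by force
      show "x + y \<in> J" if xy: "x \<in> J" "y \<in> J" for x y
      proof -
        obtain p u q v where "x = p + b * u" "y = q + b * v" "p \<in> P" "u \<in> OK" "q \<in> P" "v \<in> OK"
          using xy unfolding J_def by blast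
        then have "x + y = (p + q) + b * (u + v)" "p + q \<in> P" "u + v \<in> OK"
          using oidealD(3)[OF oP] by (auto simp: algebra_simps intro: ring_of_integers_closed)
        then show ?thesis unfolding J_def by blast
      qed
      show "c * x \<in> J" if cx: "c \<in> OK" "x \<in> J" for c x
      proof -
        obtain p u where "x = p + b * u" "p \<in> P" "u \<in> OK" using cx(2) unfolding J_def by blast
        then have "c * x = c * p + b * (c * u)" by (simp add: algebra_simps)
        moreover have "c * p \<in> P" "c * u \<in> OK"
          using oidealD(4)[OF oP cx(1)] ring_of_integers_closed(6)[OF cx(1)] \<open>p \<in> P\<close> \<open>u \<in> OK\<close> by blast+
        ultimately show ?thesis unfolding J_def by blast
      qed
    qed
    have PJ: "P \<subseteq> J"
    proof
      fix p assume "p \<in> P"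
      then have "p = p + b * 0" "p \<in> P" "0 \<in> OK" using ring_of_integers_closed(1) by auto
      then show "p \<in> J" unfolding J_def by blast
    qed
    have bJ: "b \<in> J"
    proof -
      have "b = 0 + b * 1" "0 \<in> P" "1 \<in> OK" using ring_of_integers_closed(2) oidealD(2)[OF oP] by auto
      then show ?thesis unfolding J_def by blast
    qed
    have "1 \<in> J"
    proof (rule ccontr)
      assume "1 \<notin> J"
      then have "P = J" using P JO PJ by blast
      with bJ b(2) show False by blast
    qed
    then obtain p u where pu: "1 = p + b * u" "p \<in> P" "u \<in> OK" unfolding J_def by blast
    then have "b * u - 1 = - p" by (simp add: algebra_simps)
    then have "b * u - 1 \<in> P" using oidealD(7)[OF oP pu(2)] by simp
    then show ?thesis using pu(3) by blast
  qed
  then have "P \<in> primes" unfolding primes_def using P I by auto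
  then show thesis using that P by blast
qed

lemma primes_not_subset:
  assumes "P \<in> primes" "Q \<in> primes" "P \<noteq> Q"
  shows "\<not> Q \<subseteq> P"
proof
  assume QP: "Q \<subseteq> P"
  then obtain a where a: "a \<in> P" "a \<notin> Q" using assms(3) by blast
  have "a \<in> OK" using oidealD(1)[OF primesD(1)[OF assms(1)] a(1)] .
  then obtain u where u: "u \<in> OK" "a * u - 1 \<in> Q" using primesD(4)[OF assms(2)] a(2) by blast
  have "1 = a * u - (a * u - 1)" by simp
  also have "\<dots> \<in> P"
    by (rule oidealD(6)[OF primesD(1)[OF assms(1)] oidealD(5)[OF primesD(1)[OF assms(1)] u(1) a(1)]])
      (use u QP in auto)
  finally show False using primesD(2)[OF assms(1)] by blast
qed

text \<open>Among the annihilators \<open>(a : w)\<close> contained in \<open>P\<close>, a maximal one equals \<open>P\<close>, because \<open>\<O>/a\<close> is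
  finite; then \<open>w / a\<close> is the required element.\<close>

lemma prime_inverse_element:
  fixes P :: "'k::number_field set"
  assumes P: "P \<in> primes"
  shows "\<exists>t. t \<notin> OK \<and> (\<forall>z\<in>P. t * z \<in> OK)"
proof -
  obtain a where a: "a \<in> P" "a \<noteq> 0" using primesD(3)[OF P] by blast
  have oP: "oideal P" by (rule primesD(1)[OF P])
  have aO: "a \<in> OK" using oidealD(1)[OF oP a(1)] .
  define ann where "ann = (\<lambda>w. {z \<in> OK. z * w / a \<in> OK})"
  have annI: "oideal (ann w)" "a \<in> ann w" if "w \<in> OK" for w
  proof -
    have add: "(x + y) * w / a = x * w / a + y * w / a" and mult: "c * x * w / a = c * (x * w / a)" for x y c
      by (simp_all add: distrib_right add_divide_distrib mult.assoc)
    show "oideal (ann w)" unfolding oideal_def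
      by (auto simp: ann_def add mult ring_of_integers_closed simp del: times_divide_eq_right)
    show "a \<in> ann w" using that a aO by (simp add: ann_def)
  qed
  define \<W> where "\<W> = {w \<in> OK. w / a \<notin> OK \<and> ann w \<subseteq> P}"
  have "1 / a \<notin> OK"
  proof
    assume "1 / a \<in> OK"
    from oidealD(4)[OF oP this a(1)] a(2) primesD(2)[OF P] show False by simp
  qed
  moreover have "ann 1 \<subseteq> P"
  proof
    fix z assume "z \<in> ann 1"
    then have "z / a \<in> OK" by (simp add: ann_def)
    from oidealD(4)[OF oP this a(1)] a(2) show "z \<in> P" by simp
  qed
  ultimately have one: "1 \<in> \<W>" by (simp add: \<W>_def ring_of_integers_closed)
  have fin: "finite (ann ` \<W>)"
    by (rule finite_subset[OF _ finite_ideals_above[OF a(2)]]) (use annI in \<open>auto simp: \<W>_def\<close>)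
  obtain A where A: "A \<in> ann ` \<W>" "\<And>B. B \<in> ann ` \<W> \<Longrightarrow> A \<subseteq> B \<Longrightarrow> A = B"
    using finite_has_maximal2[OF fin imageI[OF one]] by metis
  then obtain w where w: "w \<in> \<W>" "A = ann w" by blast
  then have wO: "w \<in> OK" "w / a \<notin> OK" "ann w \<subseteq> P" by (auto simp: \<W>_def)
  have "P \<subseteq> ann w"
  proof
    fix x assume x: "x \<in> P"
    have xO: "x \<in> OK" using oidealD(1)[OF oP x] .
    show "x \<in> ann w"
    proof (rule ccontr)
      assume nx: "x \<notin> ann w"
      \<comment> \<open>\<open>Q k\<close> means that x^k w / a becomes integral after
        multiplication by an integer outside P. \<open>Q 0\<close> is impossible, since such a
        factor would lie in \<open>ann w\<close>, which is contained in P.\<close>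
      define Q where "Q = (\<lambda>k. \<exists>s\<in>OK - P. s * x ^ k * w / a \<in> OK)"
      have "\<exists>k. Q k"
      proof -
        have fin: "finite (range (\<lambda>i::nat. ann (x ^ i * w)))"
          by (rule finite_subset[OF _ finite_ideals_above[OF a(2)]])
            (use annI wO(1) xO in \<open>auto intro!: annI ring_of_integers_closed\<close>)
        obtain \<beta> :: "'k emb \<Rightarrow> 'k" where \<beta>: "int_basis \<beta>" by (rule int_basis_exists)
        obtain m b where m: "m > 0" "b \<in> OK" "a * b = of_nat m" using nonzero_integer_multiple[OF a(2)] by blast
        have "\<exists>d\<in>box_reps \<beta> m. \<exists>y\<in>OK. x ^ i * w = d + of_nat m * y" for i
        proof -
          have "x ^ i * w \<in> OK" using wO(1) xO by (intro ring_of_integers_closed)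
          from box_reps_rep[OF \<beta> m(1) this] obtain d z where
            "d \<in> box_reps \<beta> m" "x ^ i * w = d + of_nat m * (\<Sum>j\<in>UNIV. of_int (z j) * \<beta> j)" by blast
          moreover have "(\<Sum>j\<in>UNIV. of_int (z j) * \<beta> j) \<in> OK" using \<beta> by (auto simp: int_basis_def)
          ultimately show ?thesis by blast
        qed
        then obtain d y where dy: "\<And>i. d i \<in> box_reps \<beta> m" "\<And>i. y i \<in> OK" "\<And>i::nat. x ^ i * w = d i + of_nat m * y i" by metis
        have "finite (range d)" using dy(1) finite_box_reps[of \<beta> m] by (meson finite_subset image_subsetI)
        then have "\<not> inj d" using finite_imageD infinite_UNIV_nat by blast
        then obtain i j where ij: "d i = d j" "i < j" unfolding inj_def by (metis nat_neq_iff)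
        \<comment> \<open>Two of the elements x^i w share a residue modulo m, which is a multiple of
          a. So a divides (1 - x^(j-i)) x^i w, and 1 - x^(j-i) avoids P because x lies in P.\<close>
        have "x ^ i * w - x ^ j * w = of_nat m * (y i - y j)" using dy(3) ij(1) by (simp add: algebra_simps)
        also have "of_nat m = a * b" using m(3) by simp
        finally have "(x ^ i * w - x ^ j * w) / a = b * (y i - y j)" using a(2) by (simp add: field_simps)
        moreover have "x ^ j = x ^ i * x ^ (j - i)" using ij(2) by (simp flip: power_add)
        ultimately have "(1 - x ^ (j - i)) * x ^ i * w / a = b * (y i - y j)" by (simp add: algebra_simps)
        then have "(1 - x ^ (j - i)) * x ^ i * w / a \<in> OK" using m(2) dy(2) by (simp add: ring_of_integers_closed)
        moreover have "1 - x ^ (j - i) \<in> OK - P"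
        proof
          show "1 - x ^ (j - i) \<in> OK" using xO by (intro ring_of_integers_closed)
          obtain l where l: "j - i = Suc l" using ij(2) by (metis Suc_diff_Suc)
          have "x ^ (j - i) \<in> P" unfolding l power_Suc using xO x by (intro oidealD(5)[OF oP] ring_of_integers_closed)
          then show "1 - x ^ (j - i) \<notin> P" using oidealD(3)[OF oP, of "1 - x ^ (j - i)" "x ^ (j - i)"] primesD(2)[OF P] by auto
        qed
        ultimately show ?thesis unfolding Q_def by blast
      qed
      define k where "k = (LEAST k. Q k)"
      have Qk: "Q k" unfolding k_def by (rule LeastI_ex) fact
      have min: "\<not> Q l" if "l < k" for l using that not_less_Least unfolding k_def by blast
      obtain s where s: "s \<in> OK" "s \<notin> P" "s * x ^ k * w / a \<in> OK" using Qk by (auto simp: Q_def)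
      have "k \<noteq> 0"
      proof
        assume "k = 0"
        with s have "s \<in> ann w" by (simp add: ann_def)
        with wO(3) s(2) show False by blast
      qed
      then obtain l where l: "k = Suc l" by (cases k) auto
      \<comment> \<open>By minimality of k, \<open>w'\<close> still belongs to \<open>\<W>\<close>,
        while its annihilator contains x in addition to \<open>ann w\<close>; this contradicts
        maximality.\<close>
      define w' where "w' = s * x ^ l * w"
      have w'O: "w' \<in> OK" unfolding w'_def using s(1) xO wO(1) by (intro ring_of_integers_closed)
      have "w' / a \<notin> OK" using min[of l] s l by (auto simp: Q_def w'_def)
      moreover have "ann w' \<subseteq> P"
      proof
        fix z assume z: "z \<in> ann w'"
        show "z \<in> P"
        proof (rule ccontr)
          assume "z \<notin> P"
          then have "z * s \<in> OK - P" using z s primes_mult[OF P] by (auto simp: ann_def ring_of_integers_closed)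
          moreover have "(z * s) * x ^ l * w / a \<in> OK" using z by (simp add: ann_def w'_def mult.assoc)
          ultimately have "Q l" unfolding Q_def by blast
          with min[of l] l show False by simp
        qed
      qed
      ultimately have "w' \<in> \<W>" using w'O by (simp add: \<W>_def)
      moreover have "ann w \<subseteq> ann w'"
      proof
        fix z assume z: "z \<in> ann w"
        have "z * w' / a = (s * x ^ l) * (z * w / a)" by (simp add: w'_def mult_ac)
        also have "\<dots> \<in> OK"
          by (intro ring_of_integers_closed(6)[OF _ CollectD[OF z[unfolded ann_def], THEN conjunct2]]
              ring_of_integers_closed s(1) xO)
        finally show "z \<in> ann w'" using z by (simp add: ann_def)
      qed
      ultimately have "ann w = ann w'" using A(2) w(2) by blast
      moreover have "x \<in> ann w'" using s(3) xO by (simp add: ann_def w'_def l mult_ac)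
      ultimately show False using nx by simp
    qed
  qed
  then have "\<forall>z\<in>P. w / a * z \<in> OK" by (auto simp: ann_def mult.commute)
  then show ?thesis using wO(2) by blast
qed

text \<open>A non-integral element of the inverse ideal of P. It has order -1 at P and serves as the
  inverse of a uniformizer.\<close>

definition prime_inv :: "'k::number_field set \<Rightarrow> 'k" where
  "prime_inv P = (SOME t. t \<notin> OK \<and> (\<forall>z\<in>P. t * z \<in> OK))"

lemma prime_inv:
  assumes "P \<in> primes"
  shows "prime_inv P \<notin> OK" "z \<in> P \<Longrightarrow> prime_inv P * z \<in> OK" "prime_inv P \<noteq> 0"
proof -
  have *: "prime_inv P \<notin> OK \<and> (\<forall>z\<in>P. prime_inv P * z \<in> OK)"
    unfolding prime_inv_def by (rule someI_ex[OF prime_inverse_element[OF assms]])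
  then show "prime_inv P \<notin> OK" "z \<in> P \<Longrightarrow> prime_inv P * z \<in> OK" by auto
  show "prime_inv P \<noteq> 0" using * ring_of_integers_closed(1) by auto
qed

text \<open>If multiplication by \<open>prime_inv P\<close> mapped P into itself, it would be
  integral by \<open>integral_if_stable_ideal\<close>.\<close>

lemma uniformizer:
  assumes P: "P \<in> primes"
  obtains \<pi> c where "\<pi> \<in> P" "c \<in> OK" "c \<notin> P" "prime_inv P * \<pi> = c"
proof -
  obtain a where a: "a \<in> P" "a \<noteq> 0" using primesD(3)[OF P] by blast
  have "\<exists>\<pi>\<in>P. prime_inv P * \<pi> \<notin> P"
    using integral_if_stable_ideal[OF primesD(1)[OF P] a, of "prime_inv P"] prime_inv(1)[OF P] by blast
  then show thesis using that prime_inv(2)[OF P] by blast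
qed

text \<open>The k-th power of the inverse uniformizer turns x into a quotient of two integers
  outside P, that is, into a unit of the localization at P.\<close>

definition has_ord :: "'k::number_field set \<Rightarrow> 'k \<Rightarrow> int \<Rightarrow> bool" where
  "has_ord P x k \<longleftrightarrow> (\<exists>w\<in>OK - P. \<exists>w'\<in>OK - P. w * prime_inv P powi k * x = w')"

text \<open>Comparing the two representations gives c^j u w' = \<pi>^j w u' with j = l - k > 0,
  where the left side lies outside P and the right side inside.\<close>

lemma has_ord_unique_aux:
  assumes P: "P \<in> primes" and k: "has_ord P x k" and l: "has_ord P x l" and lt: "k < l"
  shows False
proof -
  let ?t = "prime_inv P"
  have oP: "oideal P" by (rule primesD(1)[OF P])
  obtain w w' where w: "w \<in> OK" "w \<notin> P" "w' \<in> OK" "w' \<notin> P" "w * ?t powi k * x = w'" using k by (auto simp: has_ord_def)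
  obtain u u' where u: "u \<in> OK" "u \<notin> P" "u' \<in> OK" "u' \<notin> P" "u * ?t powi l * x = u'" using l by (auto simp: has_ord_def)
  obtain \<pi> c where \<pi>: "\<pi> \<in> P" "c \<in> OK" "c \<notin> P" "?t * \<pi> = c" by (rule uniformizer[OF P])
  define j where "j = nat (l - k)"
  have j: "l = k + int j" "j > 0" using lt by (auto simp: j_def)
  have tl: "?t powi l = ?t powi k * ?t ^ j" using prime_inv(3)[OF P] by (simp add: j power_int_add)
  have "c ^ j * (u * w') = \<pi> ^ j * (w * u')"
    unfolding w(5)[symmetric] u(5)[symmetric] \<pi>(4)[symmetric] tl by (simp add: power_mult_distrib mult_ac)
  moreover have "c ^ j * (u * w') \<notin> P"
    by (intro primes_mult[OF P] primes_power[OF P] ring_of_integers_closed w u \<pi>)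
  moreover have "\<pi> ^ j * (w * u') \<in> P"
  proof -
    obtain i where i: "j = Suc i" using j(2) by (cases j) auto
    have "\<pi> \<in> OK" using oidealD(1)[OF oP \<pi>(1)] .
    then have "\<pi> * (\<pi> ^ i * (w * u')) \<in> P"
      by (intro oidealD(5)[OF oP _ \<pi>(1)] ring_of_integers_closed w u)
    then show ?thesis by (simp add: i mult.assoc)
  qed
  ultimately show False by simp
qed

lemma has_ord_unique:
  "P \<in> primes \<Longrightarrow> has_ord P x k \<Longrightarrow> has_ord P x l \<Longrightarrow> k = l"
  by (metis has_ord_unique_aux linorder_neqE)

text \<open>The products t^k a with t = \<open>prime_inv P\<close> cannot all be integral: the
  elements with this property form an ideal stable under t, which would make t integral. The last
  integral one lies outside P, as t maps P into the integers.\<close>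

lemma has_ord_integral:
  assumes P: "P \<in> primes" and a: "a \<in> OK" "a \<noteq> 0"
  obtains k :: nat where "has_ord P a (int k)"
proof -
  let ?t = "prime_inv P"
  have oP: "oideal P" by (rule primesD(1)[OF P])
  have "\<exists>k. ?t ^ k * a \<notin> OK"
  proof (rule ccontr)
    assume "\<not> ?thesis"
    then have all: "?t ^ k * a \<in> OK" for k by blast
    define D where "D = {z \<in> OK. \<forall>k. ?t ^ k * z \<in> OK}"
    have D: "oideal D" unfolding oideal_def D_def
      by (auto simp: distrib_left mult.left_commute[of "?t ^ _"] ring_of_integers_closed)
    have "?t \<in> OK"
    proof (rule integral_if_stable_ideal[OF D])
      show "a \<in> D" using all a by (simp add: D_def)
      show "?t * x \<in> D" if "x \<in> D" for x
      proof -
        have *: "?t ^ k * x \<in> OK" for k using that by (simp add: D_def)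
        have "?t ^ k * (?t * x) \<in> OK" for k using *[of "Suc k"] by (simp add: mult_ac)
        then show ?thesis using *[of 1] by (simp add: D_def)
      qed
    qed fact
    then show False using prime_inv(1)[OF P] by simp
  qed
  define n where "n = (LEAST k. ?t ^ k * a \<notin> OK)"
  have n: "?t ^ n * a \<notin> OK" unfolding n_def by (rule LeastI_ex) fact
  have min: "?t ^ k * a \<in> OK" if "k < n" for k using that not_less_Least unfolding n_def by blast
  have "n \<noteq> 0" using n a by (metis power_0 mult_1)
  then obtain k where k: "n = Suc k" by (cases n) auto
  have kO: "?t ^ k * a \<in> OK" using min k by simp
  moreover have "?t ^ k * a \<notin> P" using prime_inv(2)[OF P, of "?t ^ k * a"] n k by (auto simp: mult_ac)
  ultimately have "has_ord P a (int k)" unfolding has_ord_def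
    by (intro bexI[of _ 1] bexI[of _ "?t ^ k * a"]) (auto simp: ring_of_integers_closed primesD(2)[OF P])
  then show thesis by (rule that)
qed

lemma has_ord_mult:
  assumes P: "P \<in> primes" and "has_ord P x k" "has_ord P y l"
  shows "has_ord P (x * y) (k + l)"
proof -
  obtain w w' where w: "w \<in> OK" "w \<notin> P" "w' \<in> OK" "w' \<notin> P" "w * prime_inv P powi k * x = w'"
    using assms(2) by (auto simp: has_ord_def)
  obtain u u' where u: "u \<in> OK" "u \<notin> P" "u' \<in> OK" "u' \<notin> P" "u * prime_inv P powi l * y = u'"
    using assms(3) by (auto simp: has_ord_def)
  have "(w * u) * prime_inv P powi (k + l) * (x * y) = w' * u'"
    unfolding w(5)[symmetric] u(5)[symmetric] using prime_inv(3)[OF P] by (simp add: power_int_add mult_ac)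
  then show ?thesis unfolding has_ord_def using w u primes_mult[OF P] ring_of_integers_closed(6) by blast
qed

lemma has_ord_inverse:
  assumes P: "P \<in> primes" and "has_ord P x k"
  shows "has_ord P (inverse x) (- k)"
proof -
  obtain w w' where w: "w \<in> OK" "w \<notin> P" "w' \<in> OK" "w' \<notin> P" "w * prime_inv P powi k * x = w'"
    using assms(2) by (auto simp: has_ord_def)
  have "w' \<noteq> 0" "w \<noteq> 0" using w oidealD(2)[OF primesD(1)[OF P]] by auto
  then have "x \<noteq> 0" using w(5) by auto
  have "w' * prime_inv P powi (- k) * inverse x = w"
    unfolding w(5)[symmetric] power_int_minus using \<open>x \<noteq> 0\<close> prime_inv(3)[OF P] by (simp add: field_simps)
  then show ?thesis unfolding has_ord_def using w by blast
qed

lemma has_ord_exists: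
  assumes P: "P \<in> primes" and x: "x \<noteq> 0"
  shows "\<exists>k. has_ord P x k"
proof -
  obtain m :: int where m: "m > 0" "of_int m * x \<in> OK" by (rule integral_multiple)
  obtain k where k: "has_ord P (of_int m * x) (int k)" by (rule has_ord_integral[OF P m(2)]) (use m(1) x in auto)
  obtain l where l: "has_ord P (of_int m) (int l)"
    by (rule has_ord_integral[OF P ring_of_integers_closed(3)]) (use m(1) in auto)
  have "x = (of_int m * x) * inverse (of_int m)" using m(1) by simp
  then show ?thesis using has_ord_mult[OF P k has_ord_inverse[OF P l]] by metis
qed

section \<open>The order at a prime and its inequalities\<close>

definition ord :: "'k::number_field set \<Rightarrow> 'k \<Rightarrow> int" where
  "ord P x = (THE k. has_ord P x k)"

lemma ordI: "P \<in> primes \<Longrightarrow> has_ord P x k \<Longrightarrow> ord P x = k"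
  unfolding ord_def using has_ord_unique by blast

lemma has_ord_ord: "P \<in> primes \<Longrightarrow> x \<noteq> 0 \<Longrightarrow> has_ord P x (ord P x)"
  using has_ord_exists ordI by metis

lemma ord_mult: "P \<in> primes \<Longrightarrow> x \<noteq> 0 \<Longrightarrow> y \<noteq> 0 \<Longrightarrow> ord P (x * y) = ord P x + ord P y"
  by (intro ordI has_ord_mult has_ord_ord)

lemma ord_inverse: "P \<in> primes \<Longrightarrow> x \<noteq> 0 \<Longrightarrow> ord P (inverse x) = - ord P x"
  by (intro ordI has_ord_inverse has_ord_ord)

lemma ord_divide: "P \<in> primes \<Longrightarrow> x \<noteq> 0 \<Longrightarrow> y \<noteq> 0 \<Longrightarrow> ord P (x / y) = ord P x - ord P y"
  by (simp add: divide_inverse ord_mult ord_inverse)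

lemma ord_not_mem: "P \<in> primes \<Longrightarrow> a \<in> OK \<Longrightarrow> a \<notin> P \<Longrightarrow> ord P a = 0"
  by (rule ordI, assumption, unfold has_ord_def, rule bexI[of _ 1], rule bexI[of _ a])
    (auto intro!: ring_of_integers_closed dest: primesD(2))

lemma ord_one: "P \<in> primes \<Longrightarrow> ord P 1 = 0"
  using ord_not_mem[OF _ ring_of_integers_closed(2)] primesD(2) by blast

lemma ord_power: "P \<in> primes \<Longrightarrow> x \<noteq> 0 \<Longrightarrow> ord P (x ^ k) = int k * ord P x"
  by (induction k) (auto simp: ord_one ord_mult algebra_simps)

lemma ord_power_int:
  assumes "P \<in> primes" "x \<noteq> 0" shows "ord P (x powi k) = k * ord P x"
proof (cases "k \<ge> 0")
  case True
  then show ?thesis using assms by (simp add: power_int_def ord_power)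
next
  case False
  then show ?thesis using assms by (simp add: power_int_def ord_power ord_inverse)
qed

lemma ord_prime_inv: "P \<in> primes \<Longrightarrow> ord P (prime_inv P) = - 1"
  by (rule ordI, assumption, unfold has_ord_def, rule bexI[of _ 1], rule bexI[of _ 1])
    (auto intro!: ring_of_integers_closed dest: primesD(2) prime_inv(3))

lemma ord_OK_nonneg: "P \<in> primes \<Longrightarrow> a \<in> OK \<Longrightarrow> a \<noteq> 0 \<Longrightarrow> ord P a \<ge> 0"
  by (rule has_ord_integral[of P a]) (auto simp: ordI)

lemma ord_OK_pos_iff:
  assumes P: "P \<in> primes" and a: "a \<in> OK" "a \<noteq> 0"
  shows "ord P a \<ge> 1 \<longleftrightarrow> a \<in> P"
proof
  assume "a \<in> P"
  have "ord P a \<noteq> 0"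
  proof
    assume "ord P a = 0"
    with has_ord_ord[OF P a(2)] obtain w where "w \<in> OK" "w * a \<notin> P" by (auto simp: has_ord_def)
    with oidealD(4)[OF primesD(1)[OF P]] \<open>a \<in> P\<close> show False by blast
  qed
  with ord_OK_nonneg[OF P a] show "ord P a \<ge> 1" by simp
qed (use ord_not_mem[OF P a(1)] in force)

text \<open>Zero has infinite order, whereas \<open>ord\<close> is integer-valued and carries no
  information at 0; hence the separate case.\<close>

definition ord_ge :: "'k::number_field set \<Rightarrow> int \<Rightarrow> 'k \<Rightarrow> bool" where
  "ord_ge P k x \<longleftrightarrow> x = 0 \<or> k \<le> ord P x"

text \<open>This describes the valuation ring as a localization. Unlike \<open>ord\<close>, a
  denominator outside P is compatible with addition.\<close>

lemma ord_ge_0_iff: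
  assumes P: "P \<in> primes" shows "ord_ge P 0 x \<longleftrightarrow> (\<exists>w\<in>OK - P. w * x \<in> OK)"
proof (cases "x = 0")
  case True
  then show ?thesis using primesD(2)[OF P] ring_of_integers_closed(1,2) by (auto simp: ord_ge_def)
next
  case False
  let ?t = "prime_inv P"
  show ?thesis
  proof
    assume "ord_ge P 0 x"
    then have nn: "0 \<le> ord P x" using False by (simp add: ord_ge_def)
    define k where "k = nat (ord P x)"
    have k: "ord P x = int k" using nn by (simp add: k_def)
    obtain w w' where w: "w \<in> OK" "w \<notin> P" "w' \<in> OK" "w * ?t ^ k * x = w'"
      using has_ord_ord[OF P False] by (auto simp: has_ord_def k)
    obtain \<pi> c where \<pi>: "\<pi> \<in> P" "c \<in> OK" "c \<notin> P" "?t * \<pi> = c" by (rule uniformizer[OF P])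
    have \<pi>O: "\<pi> \<in> OK" using oidealD(1)[OF primesD(1)[OF P] \<pi>(1)] .
    have "w * c ^ k * x = w' * \<pi> ^ k" unfolding w(4)[symmetric] \<pi>(4)[symmetric] by (simp add: power_mult_distrib mult_ac)
    also have "\<dots> \<in> OK" by (intro ring_of_integers_closed w \<pi>O)
    finally have "w * c ^ k * x \<in> OK" .
    moreover have "w * c ^ k \<in> OK - P"
      by (intro DiffI primes_mult[OF P] primes_power[OF P] ring_of_integers_closed w \<pi>)
    ultimately show "\<exists>w\<in>OK - P. w * x \<in> OK" by blast
  next
    assume "\<exists>w\<in>OK - P. w * x \<in> OK"
    then obtain w where w: "w \<in> OK" "w \<notin> P" "w * x \<in> OK" by blast
    have w0: "w \<noteq> 0" using w(2) oidealD(2)[OF primesD(1)[OF P]] by auto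
    have "0 \<le> ord P (w * x)" using ord_OK_nonneg[OF P w(3)] w0 False by simp
    then show "ord_ge P 0 x" using ord_not_mem[OF P w(1,2)] w0 False by (simp add: ord_mult[OF P] ord_ge_def)
  qed
qed

lemma ord_ge_OK: "P \<in> primes \<Longrightarrow> x \<in> OK \<Longrightarrow> ord_ge P 0 x"
  using ord_OK_nonneg unfolding ord_ge_def by blast

lemma ord_ge_1_OK: "P \<in> primes \<Longrightarrow> x \<in> OK \<Longrightarrow> ord_ge P 1 x \<longleftrightarrow> x \<in> P"
  using ord_OK_pos_iff[of P x] oidealD(2)[OF primesD(1)[of P]] by (auto simp: ord_ge_def)

lemma ord_ge_mult: "P \<in> primes \<Longrightarrow> ord_ge P k x \<Longrightarrow> ord_ge P l y \<Longrightarrow> ord_ge P (k + l) (x * y)"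
  by (cases "x = 0 \<or> y = 0") (auto simp: ord_ge_def ord_mult)

lemma ord_ge_mono: "ord_ge P k x \<Longrightarrow> l \<le> k \<Longrightarrow> ord_ge P l x"
  by (auto simp: ord_ge_def)

text \<open>A power of \<open>prime_inv P\<close> shifts the bound to 0, where the two denominators
  can be multiplied.\<close>

lemma ord_ge_add:
  assumes P: "P \<in> primes" and x: "ord_ge P k x" and y: "ord_ge P k y"
  shows "ord_ge P k (x + y)"
proof -
  let ?s = "prime_inv P powi k"
  have s: "?s \<noteq> 0" "ord P ?s = - k" using prime_inv(3)[OF P] by (simp_all add: ord_power_int[OF P] ord_prime_inv[OF P])
  have "ord_ge P 0 (?s * x)" "ord_ge P 0 (?s * y)" using x y s by (auto simp: ord_ge_def ord_mult[OF P])
  then obtain v w where v: "v \<in> OK" "v \<notin> P" "v * (?s * x) \<in> OK" and w: "w \<in> OK" "w \<notin> P" "w * (?s * y) \<in> OK"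
    by (auto simp: ord_ge_0_iff[OF P])
  have "(v * w) * (?s * (x + y)) = w * (v * (?s * x)) + v * (w * (?s * y))" by (simp add: algebra_simps)
  also have "\<dots> \<in> OK"
    by (rule ring_of_integers_closed(4)[OF ring_of_integers_closed(6)[OF w(1) v(3)] ring_of_integers_closed(6)[OF v(1) w(3)]])
  finally have "ord_ge P 0 (?s * (x + y))"
    unfolding ord_ge_0_iff[OF P] using primes_mult[OF P v(1,2) w(1,2)] v(1) w(1) ring_of_integers_closed(6) by blast
  then show ?thesis using s by (cases "x + y = 0") (auto simp: ord_ge_def ord_mult[OF P])
qed

lemma ord_ge_uminus:
  fixes P :: "'k::number_field set"
  assumes P: "P \<in> primes" and x: "ord_ge P k x" shows "ord_ge P k (- x)"
proof -
  have "ord_ge P 0 (- 1)" by (intro ord_ge_OK[OF P] ring_of_integers_closed)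
  from ord_ge_mult[OF P this x] show ?thesis by simp
qed

lemma ord_ge_diff: "P \<in> primes \<Longrightarrow> ord_ge P k x \<Longrightarrow> ord_ge P k y \<Longrightarrow> ord_ge P k (x - y)"
  using ord_ge_add[of P k x "- y"] ord_ge_uminus[of P k y] by simp

text \<open>If x has a denominator outside every P, the ideal of all denominators of x is contained
  in no prime, hence contains 1.\<close>

lemma OK_iff_ord_ge: "x \<in> OK \<longleftrightarrow> (\<forall>P\<in>primes. ord_ge P 0 x)"
proof
  assume all: "\<forall>P\<in>primes. ord_ge P 0 x"
  define D where "D = {z \<in> OK. z * x \<in> OK}"
  have D: "oideal D" unfolding oideal_def D_def by (auto simp: distrib_right mult.assoc intro!: ring_of_integers_closed)
  obtain m :: int where m: "m > 0" "of_int m * x \<in> OK" by (rule integral_multiple)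
  have mD: "of_int m \<in> D" using m(2) by (simp add: D_def ring_of_integers_closed)
  have "1 \<in> D"
  proof (rule ccontr)
    assume "1 \<notin> D"
    then obtain P where P: "P \<in> primes" "D \<subseteq> P" using primes_above[OF D _ mD] m(1) by auto
    then obtain w where "w \<in> OK" "w \<notin> P" "w * x \<in> OK"
      using bspec[OF all P(1)] unfolding ord_ge_0_iff[OF P(1)] by blast
    then show False using P(2) by (auto simp: D_def)
  qed
  then show "x \<in> OK" by (simp add: D_def)
qed (auto intro: ord_ge_OK)

lemma finite_primes_containing: "a \<noteq> 0 \<Longrightarrow> finite {P \<in> primes. a \<in> P}"
  by (rule finite_subset[OF _ finite_ideals_above[of a]]) (auto dest: primesD(1))

lemma finite_ord_nonzero:
  assumes "x \<noteq> 0" shows "finite {P \<in> primes. ord P x \<noteq> 0}"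
proof -
  obtain m :: int where m: "m > 0" "of_int m * x \<in> OK" by (rule integral_multiple)
  have sub: "{P \<in> primes. ord P x \<noteq> 0} \<subseteq> {P \<in> primes. of_int m * x \<in> P} \<union> {P \<in> primes. of_int m \<in> P}"
  proof
    fix P assume "P \<in> {P \<in> primes. ord P x \<noteq> 0}"
    then have P: "P \<in> primes" and nz: "ord P x \<noteq> 0" by auto
    have "ord P (of_int m * x) = ord P (of_int m) + ord P x" using m(1) assms by (simp add: ord_mult[OF P])
    then show "P \<in> {P \<in> primes. of_int m * x \<in> P} \<union> {P \<in> primes. of_int m \<in> P}"
      using nz P ord_not_mem[OF P m(2)] ord_not_mem[OF P ring_of_integers_closed(3)[of m]]
      by (cases "of_int m * x \<in> P"; cases "of_int m \<in> P") simp_all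
  qed
  show ?thesis
    by (rule finite_subset[OF sub], intro finite_UnI finite_primes_containing) (use m(1) assms in auto)
qed

text \<open>A product of high powers of elements of the Q in \<open>\<Q>\<close> chosen outside P;
  they exist because no prime contains another one.\<close>

lemma coprime_element:
  fixes P :: "'k::number_field set"
  assumes P: "P \<in> primes" and Q: "finite \<Q>" "\<Q> \<subseteq> primes - {P}"
  obtains e where "e \<in> OK" "e \<notin> P" "\<And>Q. Q \<in> \<Q> \<Longrightarrow> ord_ge Q (int N) e"
proof -
  have "\<exists>b\<in>Q. b \<notin> P" if "Q \<in> \<Q>" for Q
    using primes_not_subset[OF P, of Q] that Q(2) by blast
  then obtain b where b: "\<And>Q. Q \<in> \<Q> \<Longrightarrow> b Q \<in> Q \<and> b Q \<notin> P" by metis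
  have bO: "b Q \<in> OK" if "Q \<in> \<Q>" for Q
    using oidealD(1)[OF primesD(1)[of Q]] b[OF that] that Q(2) by blast
  have "\<forall>\<R>\<subseteq>\<Q>. (\<Prod>Q\<in>\<R>. b Q ^ N) \<in> OK \<and> (\<Prod>Q\<in>\<R>. b Q ^ N) \<notin> P"
  proof (intro allI impI)
    fix \<R> assume "\<R> \<subseteq> \<Q>"
    then have "finite \<R>" using Q(1) finite_subset by blast
    then show "(\<Prod>Q\<in>\<R>. b Q ^ N) \<in> OK \<and> (\<Prod>Q\<in>\<R>. b Q ^ N) \<notin> P" using \<open>\<R> \<subseteq> \<Q>\<close>
    proof (induction \<R>)
      case empty
      then show ?case using primesD(2)[OF P] ring_of_integers_closed(2) by simp
    next
      case (insert R \<R>)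
      have "b R ^ N \<in> OK" "b R ^ N \<notin> P"
        using insert.prems b bO primes_power[OF P] ring_of_integers_closed(8) by blast+
      moreover have "(\<Prod>Q\<in>\<R>. b Q ^ N) \<in> OK" "(\<Prod>Q\<in>\<R>. b Q ^ N) \<notin> P" using insert by auto
      ultimately show ?case using insert.hyps primes_mult[OF P] ring_of_integers_closed(6)[of "b R ^ N"] by simp
    qed
  qed
  note prods = this
  define e where "e = (\<Prod>Q\<in>\<Q>. b Q ^ N)"
  have "ord_ge Q (int N) e" if Qm: "Q \<in> \<Q>" for Q
  proof -
    have Qp: "Q \<in> primes" using Qm Q(2) by blast
    have "ord_ge Q (int n) (b Q ^ n)" for n
    proof (induction n)
      case 0
      then show ?case using ord_ge_OK[OF Qp ring_of_integers_closed(2)] by simp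
    next
      case (Suc n)
      have "ord_ge Q 1 (b Q)" using ord_ge_1_OK[OF Qp bO[OF Qm]] b[OF Qm] by blast
      from ord_ge_mult[OF Qp this Suc] show ?case by simp
    qed
    moreover have "ord_ge Q 0 (\<Prod>Q\<in>\<Q> - {Q}. b Q ^ N)"
    proof -
      have "(\<Prod>Q\<in>\<Q> - {Q}. b Q ^ N) \<in> OK" using prods by blast
      then show ?thesis by (rule ord_ge_OK[OF Qp])
    qed
    ultimately have "ord_ge Q (int N + 0) (b Q ^ N * (\<Prod>Q\<in>\<Q> - {Q}. b Q ^ N))" by (intro ord_ge_mult[OF Qp])
    then show ?thesis unfolding e_def using Qm Q(1) by (simp add: prod.remove)
  qed
  moreover have "e \<in> OK" "e \<notin> P" using prods unfolding e_def by blast+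
  ultimately show thesis using that by blast
qed

text \<open>For e of finite support this is the fractional ideal with factorization into the P^(e
  P), given by its local conditions.\<close>

definition val_lattice :: "('k::number_field set \<Rightarrow> int) \<Rightarrow> 'k set" where
  "val_lattice e = {x. \<forall>P\<in>primes. ord_ge P (e P) x}"

text \<open>A power of \<open>prime_inv P\<close> has the right order at P. A factor prime to P and
  highly divisible by the finitely many other relevant primes repairs the remaining
  conditions.\<close>

lemma approximation:
  fixes P :: "'k::number_field set"
  assumes P: "P \<in> primes" and fin: "finite {P \<in> primes. e P \<noteq> 0}"
  obtains z where "z \<noteq> 0" "ord P z = e P" "z \<in> val_lattice e"
proof -
  define y where "y = prime_inv P powi (- e P)"
  have y: "y \<noteq> 0" "ord P y = e P"
    using prime_inv(3)[OF P] by (simp_all add: y_def ord_power_int[OF P] ord_prime_inv[OF P])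
  define \<Q> where "\<Q> = ({P \<in> primes. e P \<noteq> 0} \<union> {P \<in> primes. ord P y \<noteq> 0}) - {P}"
  have Q: "finite \<Q>" "\<Q> \<subseteq> primes - {P}" using fin finite_ord_nonzero[OF y(1)] by (auto simp: \<Q>_def)
  \<comment> \<open>Large enough to make up every deficit e Q - ord Q y, since the sum bounds each
    of its terms.\<close>
  define N where "N = nat (\<Sum>Q\<in>\<Q>. \<bar>e Q - ord Q y\<bar>)"
  obtain u where u: "u \<in> OK" "u \<notin> P" "\<And>Q. Q \<in> \<Q> \<Longrightarrow> ord_ge Q (int N) u"
    using coprime_element[OF P Q, of N] by blast
  have u0: "u \<noteq> 0" using u(2) oidealD(2)[OF primesD(1)[OF P]] by auto
  show thesis
  proof (rule that)
    show "y * u \<noteq> 0" using y u0 by simp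
    show Pe: "ord P (y * u) = e P" using y u0 ord_not_mem[OF P u(1,2)] by (simp add: ord_mult[OF P])
    show "y * u \<in> val_lattice e"
      unfolding val_lattice_def
    proof (intro CollectI ballI)
      fix Q :: "'k set" assume Qp: "Q \<in> primes"
      consider "Q = P" | "Q \<in> \<Q>" | "e Q = 0" "ord Q y = 0" using Qp unfolding \<Q>_def by blast
      then show "ord_ge Q (e Q) (y * u)"
      proof cases
        case 1
        then show ?thesis using Pe by (simp add: ord_ge_def)
      next
        case 2
        have "\<bar>e Q - ord Q y\<bar> \<le> (\<Sum>Q\<in>\<Q>. \<bar>e Q - ord Q y\<bar>)" by (rule member_le_sum) (use 2 Q in auto)
        then have "e Q - ord Q y \<le> int N" by (simp add: N_def)
        then have "e Q - ord Q y \<le> ord Q u" using u(3)[OF 2] u0 by (simp add: ord_ge_def)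
        then show ?thesis using y u0 by (simp add: ord_ge_def ord_mult[OF Qp])
      next
        case 3
        then show ?thesis using y u0 ord_OK_nonneg[OF Qp u(1) u0] by (simp add: ord_ge_def ord_mult[OF Qp])
      qed
    qed
  qed
qed

subsection \<open>Indices\<close>

definition add_subgroup :: "'a::ab_group_add set \<Rightarrow> bool" where
  "add_subgroup B \<longleftrightarrow> 0 \<in> B \<and> (\<forall>x\<in>B. \<forall>y\<in>B. x - y \<in> B)"

definition cosets :: "'a::ab_group_add set \<Rightarrow> 'a set \<Rightarrow> 'a set set" where
  "cosets A B = (\<lambda>x. (+) x ` B) ` A"

lemma coset_eq_iff:
  assumes "add_subgroup B" shows "(+) x ` B = (+) y ` B \<longleftrightarrow> x - y \<in> B"
proof
  assume "(+) x ` B = (+) y ` B"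
  moreover have "x \<in> (+) x ` B" using assms by (force simp: add_subgroup_def)
  ultimately obtain b where "x = y + b" "b \<in> B" by blast
  then show "x - y \<in> B" by simp
next
  assume xy: "x - y \<in> B"
  have neg: "- b \<in> B" if "b \<in> B" for b using assms that by (metis add_subgroup_def diff_0)
  have add: "a + b \<in> B" if "a \<in> B" "b \<in> B" for a b
    using assms that neg by (metis add_subgroup_def diff_minus_eq_add)
  have "(+) x ` B \<subseteq> (+) y ` B" if "x - y \<in> B" for x y
  proof
    fix z assume "z \<in> (+) x ` B"
    then obtain b where b: "z = x + b" "b \<in> B" by blast
    then have "z = y + ((x - y) + b)" by simp
    then show "z \<in> (+) y ` B" using add[OF that b(2)] by blast
  qed
  moreover have "y - x \<in> B" using neg[OF xy] by simp
  ultimately show "(+) x ` B = (+) y ` B" using xy by blast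
qed

text \<open>Sums of chosen representatives of \<open>B\<close> in \<open>A\<close> and of
  \<open>C\<close> in \<open>B\<close> represent the cosets of \<open>C\<close> in
  \<open>A\<close>.\<close>

lemma card_cosets_tower:
  assumes B: "add_subgroup B" and C: "add_subgroup C" and A: "add_subgroup A" and sub: "C \<subseteq> B" "B \<subseteq> A"
    and fin: "finite (cosets A B)" "finite (cosets B C)"
  shows "finite (cosets A C)" "card (cosets A C) = card (cosets A B) * card (cosets B C)"
proof -
  have "\<forall>G\<in>cosets A B. \<exists>x. x \<in> A \<and> G = (+) x ` B" by (auto simp: cosets_def)
  from bchoice[OF this] obtain s where s: "\<forall>G\<in>cosets A B. s G \<in> A \<and> G = (+) (s G) ` B" by blast
  have "\<forall>H\<in>cosets B C. \<exists>y. y \<in> B \<and> H = (+) y ` C" by (auto simp: cosets_def)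
  from bchoice[OF this] obtain r where r: "\<forall>H\<in>cosets B C. r H \<in> B \<and> H = (+) (r H) ` C" by blast
  have addB: "a + b \<in> B" if "a \<in> B" "b \<in> B" for a b
    using B that by (metis add_subgroup_def diff_0 diff_minus_eq_add)
  have addA: "a + b \<in> A" if "a \<in> A" "b \<in> A" for a b
    using A that by (metis add_subgroup_def diff_0 diff_minus_eq_add)
  define h where "h = (\<lambda>(G, H). (+) (s G + r H) ` C)"
  have "bij_betw h (cosets A B \<times> cosets B C) (cosets A C)"
  proof (rule bij_betwI')
    fix p q assume p: "p \<in> cosets A B \<times> cosets B C" and q: "q \<in> cosets A B \<times> cosets B C"
    obtain G H G' H' where XY: "p = (G, H)" "q = (G', H')" by (cases p, cases q)
    show "(h p = h q) = (p = q)"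
    proof
      assume "h p = h q"
      then have d: "(s G + r H) - (s G' + r H') \<in> C" by (simp add: h_def XY coset_eq_iff[OF C])
      have rB: "r H' - r H \<in> B" using r p q B by (auto simp: XY add_subgroup_def)
      have "s G - s G' = ((s G + r H) - (s G' + r H')) + (r H' - r H)" by simp
      also have "\<dots> \<in> B" using d sub rB by (intro addB) auto
      finally have "(+) (s G) ` B = (+) (s G') ` B" by (simp add: coset_eq_iff[OF B])
      then have XX: "G = G'" using s p q XY by auto
      then have "r H - r H' \<in> C" using d by simp
      then have "(+) (r H) ` C = (+) (r H') ` C" by (simp add: coset_eq_iff[OF C])
      then have "H = H'" using r p q XY by auto
      with XX XY show "p = q" by simp
    qed simp
  next
    fix p assume "p \<in> cosets A B \<times> cosets B C"
    then show "h p \<in> cosets A C" using s r sub addA by (auto simp: h_def cosets_def)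
  next
    fix Z assume "Z \<in> cosets A C"
    then obtain x where x: "x \<in> A" "Z = (+) x ` C" by (auto simp: cosets_def)
    define G where "G = (+) x ` B"
    have G: "G \<in> cosets A B" using x by (auto simp: G_def cosets_def)
    then have "(+) x ` B = (+) (s G) ` B" using s G_def by auto
    then have b: "x - s G \<in> B" by (simp add: coset_eq_iff[OF B])
    define H where "H = (+) (x - s G) ` C"
    have H: "H \<in> cosets B C" using b by (auto simp: H_def cosets_def)
    then have "(+) (x - s G) ` C = (+) (r H) ` C" using r H_def by auto
    then have "x - s G - r H \<in> C" by (simp add: coset_eq_iff[OF C])
    then have "Z = h (G, H)" by (simp add: h_def x(2) coset_eq_iff[OF C] diff_diff_add)
    then show "\<exists>p\<in>cosets A B \<times> cosets B C. Z = h p" using G H by blast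
  qed
  then show "finite (cosets A C)" "card (cosets A C) = card (cosets A B) * card (cosets B C)"
    using fin by (auto simp: bij_betw_finite[symmetric] bij_betw_same_card[symmetric] card_cartesian_product)
qed

lemma add_subgroup_oideal: "oideal I \<Longrightarrow> add_subgroup I"
  by (auto simp: add_subgroup_def dest: oidealD)

lemma add_subgroup_lattice: "add_subgroup (val_lattice e)"
  by (auto simp: add_subgroup_def val_lattice_def ord_ge_def[of _ _ 0] intro: ord_ge_diff)

lemma lattice_0: "val_lattice (\<lambda>_. 0) = OK"
  by (auto simp: val_lattice_def OK_iff_ord_ge)

definition idnorm :: "'k::number_field set \<Rightarrow> nat" where
  "idnorm P = card (cosets OK P)"

lemma finite_cosets_ideal:
  fixes I :: "'k::number_field set"
  assumes "oideal I" "a \<in> I" "a \<noteq> 0"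
  shows "finite (cosets OK I)"
proof -
  obtain \<beta> :: "'k emb \<Rightarrow> 'k" where \<beta>: "int_basis \<beta>" by (rule int_basis_exists)
  obtain m b where m: "m > 0" "b \<in> OK" "a * b = of_nat m" using nonzero_integer_multiple[OF assms(3)] by blast
  have "cosets OK I \<subseteq> (\<lambda>x. (+) x ` I) ` box_reps \<beta> m"
  proof
    fix G assume "G \<in> cosets OK I"
    then obtain x where x: "x \<in> OK" "G = (+) x ` I" by (auto simp: cosets_def)
    obtain d z where d: "d \<in> box_reps \<beta> m" "x = d + of_nat m * (\<Sum>j\<in>UNIV. of_int (z j) * \<beta> j)"
      using box_reps_rep[OF \<beta> m(1) x(1)] by blast
    have "a * (b * (\<Sum>j\<in>UNIV. of_int (z j) * \<beta> j)) \<in> I"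
      by (intro oidealD(5)[OF assms(1) _ assms(2)] ring_of_integers_closed m(2) int_basis_sum_in[OF \<beta>])
    then have "x - d \<in> I" using d(2) m(3) by (simp flip: mult.assoc)
    then have "G = (+) d ` I" using x(2) coset_eq_iff[OF add_subgroup_oideal[OF assms(1)]] by blast
    then show "G \<in> (\<lambda>x. (+) x ` I) ` box_reps \<beta> m" using d(1) by blast
  qed
  then show ?thesis using finite_box_reps finite_subset finite_imageI by metis
qed

lemma idnorm_gt_1:
  assumes P: "P \<in> primes" shows "idnorm P > 1"
proof -
  obtain a where "a \<in> P" "a \<noteq> 0" using primesD(3)[OF P] by blast
  then have fin: "finite (cosets OK P)" using finite_cosets_ideal[OF primesD(1)[OF P]] by blast
  have "(+) 0 ` P \<noteq> (+) 1 ` P"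
    using primesD(1,2)[OF P] coset_eq_iff[OF add_subgroup_oideal[OF primesD(1)[OF P]], of 0 1] oidealD(7)[OF primesD(1)[OF P], of "-1"]
    by auto
  then have "card {(+) 0 ` P, (+) 1 ` P} = 2" by simp
  moreover have "{(+) 0 ` P, (+) 1 ` P} \<subseteq> cosets OK P"
    using ring_of_integers_closed(1,2) unfolding cosets_def by blast
  then have "card {(+) 0 ` P, (+) 1 ` P} \<le> idnorm P" unfolding idnorm_def by (rule card_mono[OF fin])
  ultimately show ?thesis by linarith
qed

text \<open>Multiplication by an element \<open>z\<close> of the lattice with exact order e P at P
  induces an isomorphism from the integers modulo P onto the quotient of the two lattices.\<close>

lemma lattice_step:
  fixes P :: "'k::number_field set"
  assumes P: "P \<in> primes" and fin: "finite {P \<in> primes. e P \<noteq> 0}"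
  shows "finite (cosets (val_lattice e) (val_lattice (e(P := e P + 1))))"
    "card (cosets (val_lattice e) (val_lattice (e(P := e P + 1)))) = idnorm P"
proof -
  let ?L = "val_lattice e" and ?L' = "val_lattice (e(P := e P + 1))"
  obtain z where z: "z \<noteq> 0" "ord P z = e P" "z \<in> ?L" by (rule approximation[OF P fin])
  have zu: "z * u \<in> ?L" if "u \<in> OK" for u
    using z(3) ord_ge_mult[of _ "e _" z 0 u] ord_ge_OK[OF _ that] by (auto simp: val_lattice_def)
  have L'_iff: "x \<in> ?L' \<longleftrightarrow> x \<in> ?L \<and> ord_ge P (e P + 1) x" for x
    using P ord_ge_mono[of P "e P + 1" x "e P"] by (auto simp: val_lattice_def)
  have ker: "z * u \<in> ?L' \<longleftrightarrow> u \<in> P" if u: "u \<in> OK" for u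
  proof -
    have "z * u \<in> ?L' \<longleftrightarrow> ord_ge P (e P + 1) (z * u)" using L'_iff zu[OF u] by blast
    also have "\<dots> \<longleftrightarrow> ord_ge P 1 u" using z by (cases "u = 0") (auto simp: ord_ge_def ord_mult[OF P])
    also have "\<dots> \<longleftrightarrow> u \<in> P" by (rule ord_ge_1_OK[OF P u])
    finally show ?thesis .
  qed
  have surj: "\<exists>u\<in>OK. x - z * u \<in> ?L'" if x: "x \<in> ?L" for x
  proof -
    define r where "r = x / z"
    have "ord_ge P 0 r" using x z P by (cases "x = 0") (auto simp: r_def val_lattice_def ord_ge_def ord_divide)
    then obtain w where w: "w \<in> OK" "w \<notin> P" "w * r \<in> OK" by (auto simp: ord_ge_0_iff[OF P])
    obtain w1 where w1: "w1 \<in> OK" "w * w1 - 1 \<in> P" using primesD(4)[OF P w(1,2)] by blast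
    \<comment> \<open>\<open>w1\<close> inverts the denominator \<open>w\<close> modulo P, so the
      integer \<open>u\<close> differs from r by r (w w1 - 1), which has order at least 1 at
      P.\<close>
    define u where "u = w1 * (w * r)"
    have uO: "u \<in> OK" unfolding u_def using w1(1) w(3) by (rule ring_of_integers_closed(6))
    have "ord_ge P 1 (w * w1 - 1)" using ord_ge_1_OK[OF P oidealD(1)[OF primesD(1)[OF P] w1(2)]] w1(2) by simp
    then have "ord_ge P (e P + (0 + 1)) (z * (r * (w * w1 - 1)))"
      using \<open>ord_ge P 0 r\<close> z by (intro ord_ge_mult[OF P]) (auto simp: ord_ge_def)
    then have "ord_ge P (e P + 1) (- (z * (r * (w * w1 - 1))))" using ord_ge_uminus[OF P] by simp
    also have "- (z * (r * (w * w1 - 1))) = x - z * u" using z(1) by (simp add: u_def r_def algebra_simps)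
    finally have "ord_ge P (e P + 1) (x - z * u)" .
    moreover have "x - z * u \<in> ?L" using add_subgroup_lattice[of e] x zu[OF uO] by (simp add: add_subgroup_def)
    ultimately show ?thesis using uO L'_iff by blast
  qed
  note iffP = coset_eq_iff[OF add_subgroup_oideal[OF primesD(1)[OF P]]]
  note iffL = coset_eq_iff[OF add_subgroup_lattice]
  have "\<forall>G\<in>cosets OK P. \<exists>u. u \<in> OK \<and> G = (+) u ` P" by (auto simp: cosets_def)
  from bchoice[OF this] obtain s where s: "\<forall>G\<in>cosets OK P. s G \<in> OK \<and> G = (+) (s G) ` P" by blast
  have "bij_betw (\<lambda>G. (+) (z * s G) ` ?L') (cosets OK P) (cosets ?L ?L')"
  proof (rule bij_betwI')
    fix G H assume G: "G \<in> cosets OK P" and H: "H \<in> cosets OK P"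
    have d: "s G - s H \<in> OK" using s G H ring_of_integers_closed(5) by blast
    have "((+) (z * s G) ` ?L' = (+) (z * s H) ` ?L') \<longleftrightarrow> z * (s G - s H) \<in> ?L'" by (simp add: iffL right_diff_distrib)
    also have "\<dots> \<longleftrightarrow> s G - s H \<in> P" by (rule ker[OF d])
    also have "\<dots> \<longleftrightarrow> G = H" using s G H by (auto simp flip: iffP)
    finally show "((+) (z * s G) ` ?L' = (+) (z * s H) ` ?L') = (G = H)" .
  next
    fix G assume "G \<in> cosets OK P"
    then show "(+) (z * s G) ` ?L' \<in> cosets ?L ?L'" using zu s by (auto simp: cosets_def)
  next
    fix Z assume "Z \<in> cosets ?L ?L'"
    then obtain x where x: "x \<in> ?L" "Z = (+) x ` ?L'" by (auto simp: cosets_def)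
    obtain u where u: "u \<in> OK" "x - z * u \<in> ?L'" using surj[OF x(1)] by blast
    define G where "G = (+) u ` P"
    have G: "G \<in> cosets OK P" using u by (auto simp: G_def cosets_def)
    then have "u - s G \<in> P" using s iffP G_def by metis
    then have "z * (u - s G) \<in> ?L'" using ker[OF oidealD(1)[OF primesD(1)[OF P]]] by blast
    then have "(+) (z * u) ` ?L' = (+) (z * s G) ` ?L'" by (simp add: iffL right_diff_distrib)
    moreover have "Z = (+) (z * u) ` ?L'" using u x(2) by (simp add: iffL)
    ultimately show "\<exists>G\<in>cosets OK P. Z = (+) (z * s G) ` ?L'" using G by blast
  qed
  moreover have "finite (cosets OK P)" using primesD(3)[OF P] finite_cosets_ideal[OF primesD(1)[OF P]] by blast
  ultimately show "finite (cosets ?L ?L')" "card (cosets ?L ?L') = idnorm P"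
    by (auto simp: idnorm_def bij_betw_finite bij_betw_same_card)
qed

text \<open>The exponents are built up one unit at a time; each unit at P contributes the index
  \<open>idnorm P\<close>, and indices multiply along the chain.\<close>

theorem index_lattice:
  fixes e :: "'k::number_field set \<Rightarrow> int"
  assumes "finite S" "S \<subseteq> primes" "\<And>P. P \<in> S \<Longrightarrow> e P \<ge> 0" "\<And>P. P \<in> primes - S \<Longrightarrow> e P = 0"
  shows "finite (cosets OK (val_lattice e)) \<and> card (cosets OK (val_lattice e)) = (\<Prod>P\<in>S. idnorm P ^ nat (e P))"
  using assms(3,4)
proof (induction "\<Sum>P\<in>S. nat (e P)" arbitrary: e)
  case 0
  then have e0: "e P = 0" if "P \<in> primes" for P
  proof (cases "P \<in> S")
    case True
    then have "nat (e P) = 0" using 0(1) assms(1) by simp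
    then show ?thesis using 0(2)[OF True] by simp
  qed (use that 0(3) in auto)
  then have "val_lattice e = OK" by (simp add: val_lattice_def OK_iff_ord_ge set_eq_iff)
  moreover have "cosets OK (OK :: 'k set) = {OK}"
  proof -
    have sg: "add_subgroup (OK :: 'k set)" using add_subgroup_lattice[of "\<lambda>_. 0"] by (simp add: lattice_0)
    have "(+) x ` OK = (OK :: 'k set)" if "x \<in> OK" for x using coset_eq_iff[OF sg, of x 0] that by simp
    then show ?thesis using ring_of_integers_closed(1) by (auto simp: cosets_def)
  qed
  ultimately show ?case using e0 assms(2) by (simp add: subset_iff)
next
  case (Suc n)
  have "\<exists>P\<in>S. e P > 0"
  proof (rule ccontr)
    assume "\<not> ?thesis"
    then have "nat (e P) = 0" if "P \<in> S" for P using that by force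
    then show False using Suc.hyps(2) by simp
  qed
  then obtain P where P: "P \<in> S" "e P > 0" by blast
  define e' where "e' = e(P := e P - 1)"
  have e: "e = e'(P := e' P + 1)" by (simp add: e'_def)
  have nn: "nat (e P) = Suc (nat (e' P))" using P by (simp add: e'_def)
  have "(\<Sum>Q\<in>S. nat (e Q)) = Suc (\<Sum>Q\<in>S. nat (e' Q))"
    using P(1) assms(1) nn by (simp add: sum.remove[of S P] e'_def)
  then have n: "n = (\<Sum>Q\<in>S. nat (e' Q))" using Suc.hyps(2) by simp
  have prems: "\<And>Q. Q \<in> S \<Longrightarrow> e' Q \<ge> 0" "\<And>Q. Q \<in> primes - S \<Longrightarrow> e' Q = 0"
    using Suc.prems P by (auto simp: e'_def)
  have IH: "finite (cosets OK (val_lattice e'))" "card (cosets OK (val_lattice e')) = (\<Prod>P\<in>S. idnorm P ^ nat (e' P))"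
    using Suc.hyps(1)[OF n prems] by auto
  have Pp: "P \<in> primes" using P assms(2) by blast
  have fin: "finite {P \<in> primes. e' P \<noteq> 0}"
    by (rule finite_subset[OF _ assms(1)]) (use prems(2) in blast)
  note step = lattice_step[OF Pp fin, folded e]
  have sub: "val_lattice e \<subseteq> val_lattice e'"
    using P by (fastforce simp: val_lattice_def e'_def ord_ge_def)
  have sub2: "val_lattice e' \<subseteq> OK"
  proof
    fix x assume x: "x \<in> val_lattice e'"
    have "ord_ge Q 0 x" if Q: "Q \<in> primes" for Q
    proof -
      have "0 \<le> e' Q" using prems Q by (cases "Q \<in> S") auto
      moreover have "ord_ge Q (e' Q) x" using x Q by (simp add: val_lattice_def)
      ultimately show ?thesis by (rule ord_ge_mono[rotated])
    qed
    then show "x \<in> OK" by (simp add: OK_iff_ord_ge)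
  qed
  have sgO: "add_subgroup (OK :: 'k set)" using add_subgroup_lattice[of "\<lambda>_. 0"] by (simp add: lattice_0)
  note tower = card_cosets_tower[OF add_subgroup_lattice add_subgroup_lattice sgO sub sub2 IH(1) step(1)]
  have "(\<Prod>Q\<in>S. idnorm Q ^ nat (e Q)) = (\<Prod>Q\<in>S. idnorm Q ^ nat (e' Q)) * idnorm P"
    using P(1) assms(1) nn by (simp add: prod.remove[of S P] e'_def mult_ac)
  then show ?case using tower IH(2) step(2) by simp
qed

section \<open>The product formula\<close>

text \<open>The product runs over embeddings, not places, so a complex place counts twice, as its
  normalized absolute value demands.\<close>

definition arch_norm :: "'k::number_field \<Rightarrow> real" where
  "arch_norm x = (\<Prod>\<sigma>\<in>UNIV. cmod (Rep_emb \<sigma> x))"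

text \<open>The norm of the fractional ideal \<open>val_lattice e\<close>. Restricting to the
  support of e makes the product finite whenever it should be.\<close>

definition fin_norm :: "('k::number_field set \<Rightarrow> int) \<Rightarrow> real" where
  "fin_norm e = (\<Prod>P | P \<in> primes \<and> e P \<noteq> 0. real (idnorm P) powi e P)"

lemma arch_norm_mult: "arch_norm (x * y) = arch_norm x * arch_norm y"
  by (simp add: arch_norm_def emb.hom_mult norm_mult prod.distrib)

lemma arch_norm_power: "arch_norm (x ^ k) = arch_norm x ^ k"
  by (simp add: arch_norm_def emb.hom_power norm_power prod_power_distrib)

lemma Rep_emb_eq_0_iff [simp]: "Rep_emb \<sigma> x = 0 \<longleftrightarrow> x = 0"
proof
  assume 0: "Rep_emb \<sigma> x = 0"
  show "x = 0"
  proof (rule ccontr)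
    assume "x \<noteq> 0"
    then have "Rep_emb \<sigma> (x * inverse x) = 1" by simp
    with 0 show False by (simp only: emb.hom_mult) simp
  qed
qed simp

lemma arch_norm_pos: "x \<noteq> 0 \<Longrightarrow> arch_norm x > 0"
  by (simp add: arch_norm_def prod_pos)

lemma idnorm_pos: "P \<in> primes \<Longrightarrow> real (idnorm P) > 0"
  using idnorm_gt_1[of P] by simp

lemma fin_norm_superset:
  assumes "finite S" "S \<subseteq> primes" "\<And>P. P \<in> primes - S \<Longrightarrow> e P = 0"
  shows "fin_norm e = (\<Prod>P\<in>S. real (idnorm P) powi e P)"
  unfolding fin_norm_def
  by (rule prod.mono_neutral_left) (use assms in auto)

lemma fin_norm_pos:
  assumes "finite {P \<in> primes. e P \<noteq> 0}" shows "fin_norm e > 0"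
  unfolding fin_norm_def by (rule prod_pos) (auto intro: zero_less_power_int idnorm_pos)

lemma fin_norm_add:
  assumes "finite {P \<in> primes. e P \<noteq> 0}" "finite {P \<in> primes. f P \<noteq> 0}"
  shows "fin_norm (\<lambda>P. e P + f P) = fin_norm e * fin_norm f"
proof -
  define S where "S = {P \<in> primes. e P \<noteq> 0} \<union> {P \<in> primes. f P \<noteq> 0}"
  have S: "finite S" "S \<subseteq> primes" using assms by (auto simp: S_def)
  have e: "fin_norm e = (\<Prod>P\<in>S. real (idnorm P) powi e P)"
    by (rule fin_norm_superset[OF S]) (auto simp: S_def)
  have f: "fin_norm f = (\<Prod>P\<in>S. real (idnorm P) powi f P)"
    by (rule fin_norm_superset[OF S]) (auto simp: S_def)
  have "fin_norm (\<lambda>P. e P + f P) = (\<Prod>P\<in>S. real (idnorm P) powi (e P + f P))"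
    by (rule fin_norm_superset[OF S]) (auto simp: S_def)
  also have "\<dots> = (\<Prod>P\<in>S. real (idnorm P) powi e P * real (idnorm P) powi f P)"
  proof (rule prod.cong[OF refl])
    fix P assume "P \<in> S"
    then have "real (idnorm P) \<noteq> 0" using S(2) idnorm_pos by fastforce
    then show "real (idnorm P) powi (e P + f P) = real (idnorm P) powi e P * real (idnorm P) powi f P"
      by (simp add: power_int_add)
  qed
  finally show ?thesis by (simp add: e f prod.distrib)
qed

lemma fin_norm_cong: "(\<And>P. P \<in> primes \<Longrightarrow> e P = f P) \<Longrightarrow> fin_norm e = fin_norm f"
  unfolding fin_norm_def by (rule prod.cong) auto

lemma fin_norm_ord_mult:
  assumes "x \<noteq> 0" "y \<noteq> 0"
  shows "fin_norm (\<lambda>P. ord P (x * y)) = fin_norm (\<lambda>P. ord P x) * fin_norm (\<lambda>P. ord P y)"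
  using fin_norm_add[OF finite_ord_nonzero[OF assms(1)] finite_ord_nonzero[OF assms(2)]]
    fin_norm_cong[of "\<lambda>P. ord P (x * y)" "\<lambda>P. ord P x + ord P y"] assms by (simp add: ord_mult)

lemma fin_norm_ord_power:
  assumes "x \<noteq> 0" shows "fin_norm (\<lambda>P. ord P (x ^ k)) = fin_norm (\<lambda>P. ord P x) ^ k"
proof (induction k)
  case 0
  have "fin_norm (\<lambda>P. ord P (1::'a)) = fin_norm (\<lambda>P::'a set. 0)" by (rule fin_norm_cong) (simp add: ord_one)
  then show ?case by (simp add: fin_norm_def)
qed (use assms in \<open>simp add: fin_norm_ord_mult\<close>)

text \<open>For a real embedding the index set collapses to a single element; this lets real and
  complex places be treated alike through the blocks {\<sigma>, \<open>cnj_emb\<close>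
  \<sigma>}.\<close>

lemma coord_norm: "(\<Sum>i\<in>{\<sigma>, cnj_emb \<sigma>}. (coord i x)\<^sup>2) = (cmod (Rep_emb \<sigma> x))\<^sup>2"
proof -
  have cplx: "(\<Sum>i\<in>{\<sigma>, cnj_emb \<sigma>}. (coord i x)\<^sup>2) = (cmod (Rep_emb \<sigma> x))\<^sup>2" if "\<sigma> \<in> cplx_embs" for \<sigma>
    using that coord_cplx[OF that] coord_cnj_cplx[OF that] by (simp add: cplx_embs_def cmod_power2)
  consider "\<sigma> \<in> real_embs" | "\<sigma> \<in> cplx_embs" | \<tau> where "\<tau> \<in> cplx_embs" "\<sigma> = cnj_emb \<tau>"
    using UNIV_emb_split(1) by blast
  then show ?thesis
  proof cases
    case 1
    then show ?thesis using Im_real_emb[OF 1, of x] by (simp add: coord_real real_embs_def cmod_power2)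
  next
    case 3
    then show ?thesis using cplx[OF 3(1)] by (simp add: insert_commute)
  qed (rule cplx)
qed

text \<open>The bound d of the theorem, with the complex places counted by one embedding from each
  conjugate pair.\<close>

definition minkowski_const :: "'k::number_field itself \<Rightarrow> real" where
  "minkowski_const _ = (2 / pi) ^ card (cplx_embs :: 'k emb set) * sqrt \<bar>of_rat (discriminant TYPE('k))\<bar>"

text \<open>The second form is the one produced by volumes: the discriminant equals 4^s times the
  squared determinant up to sign, and the root of 4^s turns (2/pi)^s into (4/pi)^s.\<close>

lemma minkowski_const_pos: "minkowski_const TYPE('k::number_field) > 0"
  and minkowski_const_eq: "\<exists>\<beta> :: 'k emb \<Rightarrow> 'k. int_basis \<beta> \<and>
    minkowski_const TYPE('k) = (4 / pi) ^ card (cplx_embs :: 'k emb set) * \<bar>det (coord_matrix \<beta>)\<bar>"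
proof -
  obtain \<beta> :: "'k emb \<Rightarrow> 'k" where \<beta>: "int_basis \<beta>"
    "\<bar>of_rat (discriminant TYPE('k))\<bar> = 4 ^ card (cplx_embs :: 'k emb set) * (det (coord_matrix \<beta>))\<^sup>2"
    by (rule discriminant_int_basis)
  have "sqrt (4 ^ card (cplx_embs :: 'k emb set)) = 2 ^ card (cplx_embs :: 'k emb set)"
    by (simp add: real_sqrt_power)
  then have eq: "minkowski_const TYPE('k) = (4 / pi) ^ card (cplx_embs :: 'k emb set) * \<bar>det (coord_matrix \<beta>)\<bar>"
    unfolding minkowski_const_def \<beta>(2) by (simp add: real_sqrt_mult power_divide flip: power_mult_distrib)
  then show "\<exists>\<beta> :: 'k emb \<Rightarrow> 'k. int_basis \<beta> \<and>
    minkowski_const TYPE('k) = (4 / pi) ^ card (cplx_embs :: 'k emb set) * \<bar>det (coord_matrix \<beta>)\<bar>"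
    using \<beta>(1) by blast
  show "minkowski_const TYPE('k) > 0" using \<beta>(1) unfolding eq by (simp add: int_basis_def)
qed

text \<open>The lattice enters through the coset map \<open>f\<close> with \<open>fin_norm e\<close>
  classes, while the determinant remains that of the ring of integers. This is why e is nonnegative
  here.\<close>

lemma minkowski_lattice:
  fixes e :: "'k::number_field set \<Rightarrow> int" and \<rho> :: "'k emb \<Rightarrow> real"
  assumes fin: "finite {P \<in> primes. e P \<noteq> 0}" and nn: "\<And>P. P \<in> primes \<Longrightarrow> e P \<ge> 0"
    and \<rho>: "\<And>\<sigma>. \<rho> \<sigma> > 0" "\<And>\<sigma>. \<rho> (cnj_emb \<sigma>) = \<rho> \<sigma>"
    and vol: "(\<Prod>\<sigma>\<in>UNIV. \<rho> \<sigma>) \<ge> minkowski_const TYPE('k) * fin_norm e"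
  shows "\<exists>x\<in>val_lattice e. x \<noteq> 0 \<and> (\<forall>\<sigma>. cmod (Rep_emb \<sigma> x) \<le> \<rho> \<sigma>)"
proof -
  obtain \<beta> :: "'k emb \<Rightarrow> 'k" where \<beta>: "int_basis \<beta>"
    "minkowski_const TYPE('k) = (4 / pi) ^ card (cplx_embs :: 'k emb set) * \<bar>det (coord_matrix \<beta>)\<bar>"
    using minkowski_const_eq by blast
  let ?R = "coord_matrix \<beta>" and ?r = "card (real_embs :: 'k emb set)" and ?s = "card (cplx_embs :: 'k emb set)"
  have det: "det ?R \<noteq> 0" using \<beta>(1) by (simp add: int_basis_def)
  define bl where "bl = (\<lambda>\<sigma> :: 'k emb. {\<sigma>, cnj_emb \<sigma>})"
  \<comment> \<open>\<rho> is constant on each conjugation orbit; \<open>Max\<close> only selects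
    that value as the radius of the block.\<close>
  define \<rho>' where "\<rho>' = (\<lambda>b. Max (\<rho> ` b))"
  have \<rho>': "\<rho>' (bl \<sigma>) = \<rho> \<sigma>" for \<sigma> by (simp add: \<rho>'_def bl_def \<rho>(2))
  define B :: "(real^'k emb) set" where "B = block_body (range bl) \<rho>'"
  have UB: "\<Union>(range bl) = UNIV" by (auto simp: bl_def)
  have disj: "disjoint (range bl)"
  proof (rule disjointI)
    fix a b assume ab: "a \<in> range bl" "b \<in> range bl" "a \<noteq> b"
    then obtain \<sigma> \<tau> where st: "a = bl \<sigma>" "b = bl \<tau>" by blast
    have "bl \<sigma> = bl \<tau>" if "\<upsilon> \<in> bl \<sigma>" "\<upsilon> \<in> bl \<tau>" for \<upsilon>
    proof -
      have "cnj_emb a = cnj_emb b \<longleftrightarrow> a = b" for a b :: "'k emb" by (metis cnj_cnj_emb)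
      then show ?thesis using that by (auto simp: bl_def)
    qed
    then show "a \<inter> b = {}" using ab(3) st by blast
  qed
  have inj: "inj_on bl (real_embs \<union> cplx_embs)"
  proof (rule inj_onI)
    fix \<sigma> \<tau> assume s: "\<sigma> \<in> real_embs \<union> cplx_embs" and t: "\<tau> \<in> real_embs \<union> cplx_embs" and eq: "bl \<sigma> = bl \<tau>"
    then have "\<sigma> = \<tau> \<or> \<sigma> = cnj_emb \<tau>" by (auto simp: bl_def)
    then show "\<sigma> = \<tau>" using s t by (auto simp: real_embs_def cplx_embs_def)
  qed
  have ran: "range bl = bl ` (real_embs \<union> cplx_embs)"
  proof -
    have "bl (cnj_emb \<sigma>) = bl \<sigma>" for \<sigma> by (auto simp: bl_def)
    then have "bl ` (cnj_emb ` cplx_embs) = bl ` cplx_embs" by (simp add: image_image)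
    then show ?thesis unfolding UNIV_emb_split(1) image_Un by blast
  qed
  have cr: "card (bl \<sigma>) = 1" if "\<sigma> \<in> real_embs" for \<sigma> using that by (simp add: bl_def real_embs_def)
  have cc: "card (bl \<sigma>) = 2" if "\<sigma> \<in> cplx_embs" for \<sigma> using that by (simp add: bl_def cplx_embs_def)
  have "measure lebesgue B = (\<Prod>b\<in>range bl. unit_ball_vol (real (card b)) * \<rho>' b ^ card b)"
    unfolding B_def by (rule measure_block_body[OF UB disj]) (auto simp: \<rho>' \<rho>)
  also have "\<dots> = (\<Prod>\<sigma>\<in>real_embs \<union> cplx_embs. unit_ball_vol (real (card (bl \<sigma>))) * \<rho> \<sigma> ^ card (bl \<sigma>))"
    unfolding ran by (subst prod.reindex[OF inj]) (simp add: \<rho>')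
  also have "\<dots> = (\<Prod>\<sigma>\<in>real_embs. unit_ball_vol (real (card (bl \<sigma>))) * \<rho> \<sigma> ^ card (bl \<sigma>)) *
      (\<Prod>\<sigma>\<in>cplx_embs. unit_ball_vol (real (card (bl \<sigma>))) * \<rho> \<sigma> ^ card (bl \<sigma>))"
    by (rule prod.union_disjoint) (use UNIV_emb_split in auto)
  also have "\<dots> = (\<Prod>\<sigma>\<in>real_embs. 2 * \<rho> \<sigma>) * (\<Prod>\<sigma>\<in>cplx_embs. pi * (\<rho> \<sigma>)\<^sup>2)"
    by (intro arg_cong2[where f = "(*)"] prod.cong refl) (simp_all add: cr cc unit_ball_vol_1 unit_ball_vol_2)
  also have "\<dots> = 2 ^ ?r * pi ^ ?s * ((\<Prod>\<sigma>\<in>real_embs. \<rho> \<sigma>) * (\<Prod>\<sigma>\<in>cplx_embs. (\<rho> \<sigma>)\<^sup>2))"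
    by (simp add: prod.distrib mult_ac)
  also have "(\<Prod>\<sigma>\<in>real_embs. \<rho> \<sigma>) * (\<Prod>\<sigma>\<in>cplx_embs. (\<rho> \<sigma>)\<^sup>2) = (\<Prod>\<sigma>\<in>UNIV. \<rho> \<sigma>)"
    by (simp add: prod_emb_split \<rho>(2) power2_eq_square)
  finally have mB: "measure lebesgue B = 2 ^ ?r * pi ^ ?s * (\<Prod>\<sigma>\<in>UNIV. \<rho> \<sigma>)" .
  define S where "S = {P \<in> primes. e P \<noteq> 0}"
  have S: "finite S" "S \<subseteq> primes" using fin by (auto simp: S_def)
  have idx: "finite (cosets OK (val_lattice e)) \<and> card (cosets OK (val_lattice e)) = (\<Prod>P\<in>S. idnorm P ^ nat (e P))"
    by (rule index_lattice[OF S]) (use nn in \<open>auto simp: S_def\<close>)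
  define m where "m = card (cosets OK (val_lattice e))"
  have m: "real m = fin_norm e"
  proof -
    have "real m = (\<Prod>P\<in>S. real (idnorm P) ^ nat (e P))" using idx by (simp add: m_def)
    also have "\<dots> = (\<Prod>P\<in>S. real (idnorm P) powi (e P))"
      using nn by (intro prod.cong refl) (simp add: S_def power_int_def)
    finally show ?thesis by (simp add: fin_norm_def S_def)
  qed
  define x where "x = (\<lambda>z :: 'k emb \<Rightarrow> int. \<Sum>j\<in>UNIV. of_int (z j) * \<beta> j)"
  define f where "f = (\<lambda>z. (+) (x z) ` val_lattice e)"
  have f: "range f = cosets OK (val_lattice e)"
  proof -
    have "OK = range x" using \<beta>(1) by (auto simp: int_basis_def x_def)
    then have "cosets OK (val_lattice e) = (\<lambda>y. (+) y ` val_lattice e) ` range x"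
      unfolding cosets_def by (rule arg_cong)
    also have "\<dots> = range f" unfolding f_def by (rule image_image)
    finally show ?thesis ..
  qed
  have "2 ^ CARD('k emb) * real m * \<bar>det ?R\<bar> = 2 ^ ?r * pi ^ ?s * (minkowski_const TYPE('k) * fin_norm e)"
    unfolding \<beta>(2) m by (simp add: CARD_emb power_add power_mult power_divide)
  also have "\<dots> \<le> measure lebesgue B" unfolding mB using vol by (intro mult_left_mono) auto
  finally have vB: "2 ^ CARD('k emb) * real m * \<bar>det ?R\<bar> \<le> measure lebesgue B" .
  have B: "compact B" "convex B" "\<And>x. x \<in> B \<Longrightarrow> - x \<in> B"
    unfolding B_def using bounded_block_body[OF UB] closed_block_body convex_block_body symmetric_block_body
    by (auto simp: compact_eq_bounded_closed)
  obtain z w where zw: "z \<noteq> w" "f z = f w" "?R *v (\<chi> i. of_int (z i - w i)) \<in> B"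
    by (rule minkowski[OF B det _ _ vB, of f]) (use idx in \<open>auto simp: f m_def\<close>)
  define y where "y = x z - x w"
  have "y \<in> val_lattice e" using zw(2) by (simp add: f_def y_def coset_eq_iff[OF add_subgroup_lattice])
  moreover have "y \<noteq> 0" using zw(1) int_basis_unique[OF \<beta>(1), of z w] by (auto simp: y_def x_def)
  moreover have "cmod (Rep_emb \<sigma> y) \<le> \<rho> \<sigma>" for \<sigma>
  proof -
    have y: "y = (\<Sum>j\<in>UNIV. of_rat (of_int (z j - w j)) * \<beta> j)"
      unfolding of_rat_of_int_eq by (simp add: y_def x_def left_diff_distrib sum_subtractf)
    have "(?R *v (\<chi> i. of_int (z i - w i))) $ \<tau> = coord \<tau> y" for \<tau>
      using coord_matrix_mult[of \<beta> "\<lambda>j. of_int (z j - w j)" \<tau>]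
      unfolding y by (simp only: of_rat_of_int_eq)
    then have "sqrt (\<Sum>i\<in>bl \<sigma>. (coord i y)\<^sup>2) \<le> \<rho>' (bl \<sigma>)" using zw(3) by (simp add: B_def block_body_def)
    then show ?thesis by (simp add: bl_def coord_norm \<rho>'[unfolded bl_def])
  qed
  ultimately show ?thesis by blast
qed

section \<open>Discreteness of the integers and the product formula\<close>

lemma small_integral_aux:
  obtains \<epsilon> where "\<epsilon> > 0" "\<And>x :: 'k::number_field. x \<in> OK \<Longrightarrow> (\<And>\<sigma>. cmod (Rep_emb \<sigma> x) < \<epsilon>) \<Longrightarrow> x = 0"
proof -
  obtain \<beta> :: "'k emb \<Rightarrow> 'k" where \<beta>: "int_basis \<beta>" by (rule int_basis_exists)
  then have det: "det (coord_matrix \<beta>) \<noteq> 0" by (simp add: int_basis_def)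
  obtain S where S: "S ** coord_matrix \<beta> = mat 1" using det by (metis invertible_det_nz invertible_def)
  obtain D where D: "D > 0" "\<And>x. norm (S *v x) \<le> norm x * D"
    using bounded_linear.pos_bounded[OF matrix_vector_mul_bounded_linear[of S]] by blast
  define n where "n = real CARD('k emb)"
  have n: "n > 0" by (simp add: n_def)
  show thesis
  proof (rule that)
    \<comment> \<open>\<open>D\<close> bounds the inverse of the coordinate matrix and
      \<open>n\<close> is lost in passing to the sum of the coordinates; the integer coordinates
      then come out below 1 in absolute value.\<close>
    show "1 / (n * D) > 0" using n D by simp
    fix x :: 'k assume x: "x \<in> OK" and small: "\<And>\<sigma>. cmod (Rep_emb \<sigma> x) < 1 / (n * D)"
    obtain z where z: "x = (\<Sum>j\<in>UNIV. of_int (z j) * \<beta> j)" using \<beta> x by (auto simp: int_basis_def)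
    define v :: "real^'k emb" where "v = (\<chi> i. of_int (z i))"
    have Rv: "(coord_matrix \<beta> *v v) $ \<sigma> = coord \<sigma> x" for \<sigma>
      using coord_matrix_mult[of \<beta> "\<lambda>j. of_int (z j)" \<sigma>] by (simp add: v_def z)
    have "\<bar>coord \<sigma> x\<bar> < 1 / (n * D)" for \<sigma>
    proof -
      have "\<bar>coord \<sigma> x\<bar> \<le> cmod (Rep_emb \<sigma> x)"
        by (simp add: coord_def abs_Re_le_cmod abs_Im_le_cmod)
      then show ?thesis using small[of \<sigma>] by simp
    qed
    then have "(\<Sum>\<sigma>\<in>UNIV. \<bar>(coord_matrix \<beta> *v v) $ \<sigma>\<bar>) < (\<Sum>\<sigma>\<in>(UNIV::'k emb set). 1 / (n * D))"
      unfolding Rv by (intro sum_strict_mono) auto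
    also have "\<dots> = 1 / D" using n by (simp add: n_def)
    finally have "norm (coord_matrix \<beta> *v v) < 1 / D" using norm_le_l1_cart order_le_less_trans by blast
    then have "norm (coord_matrix \<beta> *v v) * D < 1" using D(1) by (simp add: field_simps)
    then have "norm (S *v (coord_matrix \<beta> *v v)) < 1" using D(2)[of "coord_matrix \<beta> *v v"] by linarith
    then have "norm v < 1" using S by (simp add: matrix_vector_mul_assoc)
    have "z i = 0" for i
    proof -
      have "\<bar>v $ i\<bar> < 1" using component_le_norm_cart[of v i] \<open>norm v < 1\<close> by linarith
      then show ?thesis by (simp add: v_def)
    qed
    then show "x = 0" by (simp add: z)
  qed
qed

text \<open>High powers of x fall below the unknown threshold of \<open>small_integral_aux\<close>,
  so 1/2 can replace it.\<close>

lemma small_integral_zero: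
  fixes x :: "'k::number_field"
  assumes x: "x \<in> OK" and small: "\<And>\<sigma>. cmod (Rep_emb \<sigma> x) \<le> 1 / 2"
  shows "x = 0"
proof -
  obtain \<epsilon> where \<epsilon>: "\<epsilon> > 0" "\<And>x :: 'k. x \<in> OK \<Longrightarrow> (\<And>\<sigma>. cmod (Rep_emb \<sigma> x) < \<epsilon>) \<Longrightarrow> x = 0"
    using small_integral_aux by blast
  obtain k where k: "(1 / 2) ^ k < \<epsilon>" using real_arch_pow_inv[OF \<epsilon>(1), of "1/2"] by auto
  have "x ^ k = 0"
  proof (rule \<epsilon>(2))
    show "x ^ k \<in> OK" using x by (rule ring_of_integers_closed)
    fix \<sigma>
    have "cmod (Rep_emb \<sigma> (x ^ k)) \<le> (1 / 2) ^ k"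
      unfolding emb.hom_power norm_power by (rule power_mono[OF small]) simp
    with k show "cmod (Rep_emb \<sigma> (x ^ k)) < \<epsilon>" by simp
  qed
  then show ?thesis by simp
qed

text \<open>Otherwise the discrepancy grows with the powers of a, until Minkowski's theorem finds a
  nonzero multiple of a^k whose conjugates are at most half those of a^k. The quotient would be a
  nonzero integer with all conjugates at most 1/2.\<close>

lemma arch_norm_le_fin_norm:
  fixes a :: "'k::number_field"
  assumes a: "a \<in> OK" "a \<noteq> 0"
  shows "arch_norm a \<le> fin_norm (\<lambda>P. ord P a)"
proof (rule ccontr)
  assume neg: "\<not> ?thesis"
  define M where "M = fin_norm (\<lambda>P. ord P a)"
  define n where "n = CARD('k emb)"
  define d where "d = minkowski_const TYPE('k)"
  have M: "M > 0" unfolding M_def by (rule fin_norm_pos[OF finite_ord_nonzero[OF a(2)]])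
  have gt: "arch_norm a / M > 1" using neg M by (simp add: M_def)
  \<comment> \<open>The exponent absorbs both d and the factor 2^n lost by halving all
    radii.\<close>
  obtain k where k: "d * 2 ^ n < (arch_norm a / M) ^ k" using real_arch_pow[OF gt] by blast
  define \<rho> where "\<rho> = (\<lambda>\<sigma>. cmod (Rep_emb \<sigma> (a ^ k)) / 2)"
  have "\<exists>x\<in>val_lattice (\<lambda>P. ord P (a ^ k)). x \<noteq> 0 \<and> (\<forall>\<sigma>. cmod (Rep_emb \<sigma> x) \<le> \<rho> \<sigma>)"
  proof (rule minkowski_lattice)
    show "finite {P \<in> primes. ord P (a ^ k) \<noteq> 0}" using a by (intro finite_ord_nonzero) simp
    show "0 \<le> ord P (a ^ k)" if "P \<in> primes" for P
      using that a by (intro ord_OK_nonneg ring_of_integers_closed) auto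
    show "\<rho> \<sigma> > 0" "\<rho> (cnj_emb \<sigma>) = \<rho> \<sigma>" for \<sigma> using a(2) by (simp_all add: \<rho>_def)
    have "d * M ^ k \<le> arch_norm a ^ k / 2 ^ n"
      using k M by (simp add: power_divide field_simps)
    also have "\<dots> = (\<Prod>\<sigma>\<in>UNIV. \<rho> \<sigma>)"
      using arch_norm_power[of a k] by (simp add: \<rho>_def prod_dividef arch_norm_def n_def)
    finally show "minkowski_const TYPE('k) * fin_norm (\<lambda>P. ord P (a ^ k)) \<le> (\<Prod>\<sigma>\<in>UNIV. \<rho> \<sigma>)"
      using a(2) by (simp add: d_def M_def fin_norm_ord_power)
  qed
  then obtain x where x: "x \<in> val_lattice (\<lambda>P. ord P (a ^ k))" "x \<noteq> 0" "\<And>\<sigma>. cmod (Rep_emb \<sigma> x) \<le> \<rho> \<sigma>" by blast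
  have ak: "a ^ k \<noteq> 0" using a(2) by simp
  have "x / a ^ k = 0"
  proof (rule small_integral_zero)
    have "ord_ge P 0 (x / a ^ k)" if "P \<in> primes" for P
      using x(1,2) that ak by (auto simp: val_lattice_def ord_ge_def ord_divide)
    then show "x / a ^ k \<in> OK" by (simp add: OK_iff_ord_ge)
    fix \<sigma>
    have "Rep_emb \<sigma> (x / a ^ k) * Rep_emb \<sigma> (a ^ k) = Rep_emb \<sigma> x" using ak by (simp flip: emb.hom_mult)
    then have "cmod (Rep_emb \<sigma> (x / a ^ k)) * cmod (Rep_emb \<sigma> (a ^ k)) = cmod (Rep_emb \<sigma> x)" by (metis norm_mult)
    also have "\<dots> \<le> 1 / 2 * cmod (Rep_emb \<sigma> (a ^ k))" using x(3)[of \<sigma>] by (simp add: \<rho>_def)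
    finally have "cmod (Rep_emb \<sigma> (x / a ^ k)) * cmod (Rep_emb \<sigma> (a ^ k)) \<le> 1 / 2 * cmod (Rep_emb \<sigma> (a ^ k))" .
    moreover have "cmod (Rep_emb \<sigma> (a ^ k)) > 0" using ak by (simp del: emb.hom_power)
    ultimately show "cmod (Rep_emb \<sigma> (x / a ^ k)) \<le> 1 / 2" by (rule mult_right_le_imp_le)
  qed
  then show False using x(2) ak by simp
qed

text \<open>Both sides count residues modulo m: once through an integral basis, which gives m^n, and
  once through the exponents of m at the primes.\<close>

lemma product_formula_nat:
  assumes m: "m > 0"
  shows "arch_norm (of_nat m :: 'k::number_field) = fin_norm (\<lambda>P. ord P (of_nat m :: 'k))"
proof -
  let ?e = "\<lambda>P. ord P (of_nat m :: 'k)"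
  obtain \<beta> :: "'k emb \<Rightarrow> 'k" where \<beta>: "int_basis \<beta>" by (rule int_basis_exists)
  have mO: "(of_nat m :: 'k) \<in> OK" using ring_of_integers_closed(3)[of "int m"] by simp
  have m0: "(of_nat m :: 'k) \<noteq> 0" using m by simp
  have lat: "x \<in> val_lattice ?e \<longleftrightarrow> (\<exists>y\<in>OK. x = of_nat m * y)" for x
  proof
    assume x: "x \<in> val_lattice ?e"
    have "ord_ge P 0 (x / of_nat m)" if "P \<in> primes" for P
      using x that m0 by (cases "x = 0") (auto simp: val_lattice_def ord_ge_def ord_divide)
    then have "x / of_nat m \<in> OK" by (simp add: OK_iff_ord_ge)
    then show "\<exists>y\<in>OK. x = of_nat m * y" using m0 by (intro bexI[of _ "x / of_nat m"]) auto
  next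
    assume "\<exists>y\<in>OK. x = of_nat m * y"
    then obtain y where y: "y \<in> OK" "x = of_nat m * y" by blast
    have "ord_ge P (ord P (of_nat m :: 'k) + 0) (of_nat m * y)" if "P \<in> primes" for P
      by (rule ord_ge_mult[OF that _ ord_ge_OK[OF that y(1)]]) (simp add: ord_ge_def)
    then show "x \<in> val_lattice ?e" by (simp add: val_lattice_def y(2))
  qed
  define S where "S = {P \<in> primes. ?e P \<noteq> 0}"
  have S: "finite S" "S \<subseteq> primes" using finite_ord_nonzero[OF m0] by (auto simp: S_def)
  have nn: "?e P \<ge> 0" if "P \<in> primes" for P using ord_OK_nonneg[OF that mO m0] .
  have "card (cosets OK (val_lattice ?e)) = (\<Prod>P\<in>S. idnorm P ^ nat (?e P))"
    by (rule conjunct2[OF index_lattice[OF S]]) (use S(2) nn in \<open>auto simp: S_def\<close>)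
  moreover have "card (cosets OK (val_lattice ?e)) = card (box_reps \<beta> m)"
  proof -
    have "bij_betw (\<lambda>d. (+) d ` val_lattice ?e) (box_reps \<beta> m) (cosets OK (val_lattice ?e))"
    proof (rule bij_betwI')
      fix d d' assume d: "d \<in> box_reps \<beta> m" "d' \<in> box_reps \<beta> m"
      show "((+) d ` val_lattice ?e = (+) d' ` val_lattice ?e) = (d = d')"
        unfolding coset_eq_iff[OF add_subgroup_lattice] lat
      proof
        assume "\<exists>y\<in>OK. d - d' = of_nat m * y"
        then show "d = d'" using box_reps_distinct[OF \<beta> d] by blast
      next
        assume "d = d'"
        then have "d - d' = of_nat m * 0" by simp
        then show "\<exists>y\<in>OK. d - d' = of_nat m * y" using ring_of_integers_closed(1) by blast
      qed
    next
      fix d assume "d \<in> box_reps \<beta> m"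
      then show "(+) d ` val_lattice ?e \<in> cosets OK (val_lattice ?e)"
        using box_reps_OO[OF \<beta>] by (auto simp: cosets_def)
    next
      fix Z assume "Z \<in> cosets OK (val_lattice ?e)"
      then obtain x where x: "x \<in> OK" "Z = (+) x ` val_lattice ?e" by (auto simp: cosets_def)
      obtain d z where d: "d \<in> box_reps \<beta> m" "x = d + of_nat m * (\<Sum>j\<in>UNIV. of_int (z j) * \<beta> j)"
        using box_reps_rep[OF \<beta> m x(1)] by blast
      have "x - d \<in> val_lattice ?e" unfolding lat using d(2) int_basis_sum_in[OF \<beta>] by auto
      then have "Z = (+) d ` val_lattice ?e" unfolding x(2) coset_eq_iff[OF add_subgroup_lattice] .
      then show "\<exists>d\<in>box_reps \<beta> m. Z = (+) d ` val_lattice ?e" using d(1) by blast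
    qed
    then show ?thesis by (metis bij_betw_same_card)
  qed
  ultimately have "real (m ^ CARD('k emb)) = real (\<Prod>P\<in>S. idnorm P ^ nat (?e P))"
    by (simp only: card_box_reps[OF \<beta>])
  also have "\<dots> = (\<Prod>P\<in>S. real (idnorm P) powi (?e P))"
    unfolding of_nat_prod of_nat_power using nn by (intro prod.cong refl) (simp add: S_def power_int_def)
  finally show ?thesis by (simp add: fin_norm_def S_def arch_norm_def emb.hom_of_nat)
qed

text \<open>For integers with a b = m, the inequalities for a and b multiply to the known equality
  for m, so both are equalities. Quotients extend this to all of K.\<close>

theorem product_formula:
  fixes x :: "'k::number_field"
  assumes "x \<noteq> 0" shows "arch_norm x = fin_norm (\<lambda>P. ord P x)"
proof -
  have OKc: "arch_norm a = fin_norm (\<lambda>P. ord P a)" if a: "a \<in> OK" "a \<noteq> 0" for a :: 'k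
  proof -
    obtain m :: nat and b where m: "m > 0" "b \<in> OK" "a * b = of_nat m" using nonzero_integer_multiple[OF a(2)] by blast
    have b0: "b \<noteq> 0" using m by auto
    define u v where "u = fin_norm (\<lambda>P. ord P a)" and "v = fin_norm (\<lambda>P. ord P b)"
    have pos: "u > 0" "v > 0" unfolding u_def v_def by (rule fin_norm_pos, rule finite_ord_nonzero; fact)+
    have eq: "arch_norm a * arch_norm b = u * v"
      unfolding u_def v_def using product_formula_nat[OF m(1), where 'k = 'k] m(3) a(2) b0
      by (metis arch_norm_mult fin_norm_ord_mult)
    have le: "arch_norm a \<le> u" "arch_norm b \<le> v"
      unfolding u_def v_def using arch_norm_le_fin_norm a m(2) b0 by blast+
    have "arch_norm a = u"
    proof (rule ccontr)
      assume "arch_norm a \<noteq> u"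
      with le have "arch_norm a < u" by simp
      then have "arch_norm a * arch_norm b < u * arch_norm b" using arch_norm_pos[OF b0] by simp
      also have "\<dots> \<le> u * v" using le pos by simp
      finally show False using eq by simp
    qed
    then show ?thesis by (simp add: u_def)
  qed
  obtain m :: int where m: "m > 0" "of_int m * x \<in> OK" by (rule integral_multiple)
  have "arch_norm (of_int m * x) = fin_norm (\<lambda>P. ord P (of_int m * x))" using OKc m assms by simp
  moreover have "arch_norm (of_int m :: 'k) = fin_norm (\<lambda>P. ord P (of_int m :: 'k))"
    using OKc[of "of_int m"] m(1) ring_of_integers_closed(3)[of m] by simp
  moreover have "arch_norm (of_int m :: 'k) > 0" using m(1) by (intro arch_norm_pos) simp
  ultimately show ?thesis using m(1) assms by (simp add: arch_norm_mult fin_norm_ord_mult)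
qed

text \<open>Multiplication by an element \<open>z\<close> with orders at least -e makes the
  exponents nonnegative. By the product formula the product of the radii and the ideal norm grow by
  the same factor.\<close>

theorem minkowski_number_field:
  fixes e :: "'k::number_field set \<Rightarrow> int" and \<rho> :: "'k emb \<Rightarrow> real"
  assumes fin: "finite {P \<in> primes. e P \<noteq> 0}"
    and \<rho>: "\<And>\<sigma>. \<rho> \<sigma> > 0" "\<And>\<sigma>. \<rho> (cnj_emb \<sigma>) = \<rho> \<sigma>"
    and vol: "(\<Prod>\<sigma>\<in>UNIV. \<rho> \<sigma>) \<ge> minkowski_const TYPE('k) * fin_norm e"
  obtains x where "x \<in> val_lattice e" "x \<noteq> 0" "\<And>\<sigma>. cmod (Rep_emb \<sigma> x) \<le> \<rho> \<sigma>"
proof -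
  have "\<exists>z. z \<noteq> 0 \<and> z \<in> val_lattice (\<lambda>P. - e P)"
  proof (cases "primes = ({} :: 'k set set)")
    case True
    then show ?thesis by (intro exI[of _ 1]) (simp add: val_lattice_def)
  next
    case False
    then obtain P :: "'k set" where P: "P \<in> primes" by blast
    show ?thesis by (rule approximation[OF P, of "\<lambda>P. - e P"]) (use fin in auto)
  qed
  then obtain z where z: "z \<noteq> 0" "z \<in> val_lattice (\<lambda>P. - e P)" by blast
  define e' where "e' = (\<lambda>P. e P + ord P z)"
  define \<rho>' where "\<rho>' = (\<lambda>\<sigma>. \<rho> \<sigma> * cmod (Rep_emb \<sigma> z))"
  have fin': "finite {P \<in> primes. e' P \<noteq> 0}"
    by (rule finite_subset[OF _ finite_UnI[OF fin finite_ord_nonzero[OF z(1)]]]) (auto simp: e'_def)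
  have "\<exists>x\<in>val_lattice e'. x \<noteq> 0 \<and> (\<forall>\<sigma>. cmod (Rep_emb \<sigma> x) \<le> \<rho>' \<sigma>)"
  proof (rule minkowski_lattice[OF fin'])
    show "e' P \<ge> 0" if "P \<in> primes" for P using z that by (auto simp: e'_def val_lattice_def ord_ge_def)
    show "\<rho>' \<sigma> > 0" "\<rho>' (cnj_emb \<sigma>) = \<rho>' \<sigma>" for \<sigma> using \<rho> z(1) by (simp_all add: \<rho>'_def)
    have "minkowski_const TYPE('k) * fin_norm e' = minkowski_const TYPE('k) * fin_norm e * arch_norm z"
      using fin_norm_add[OF fin finite_ord_nonzero[OF z(1)]] product_formula[OF z(1)] by (simp add: e'_def)
    also have "\<dots> \<le> (\<Prod>\<sigma>\<in>UNIV. \<rho> \<sigma>) * arch_norm z" using vol arch_norm_pos[OF z(1)] by simp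
    also have "\<dots> = (\<Prod>\<sigma>\<in>UNIV. \<rho>' \<sigma>)" by (simp add: \<rho>'_def prod.distrib arch_norm_def)
    finally show "minkowski_const TYPE('k) * fin_norm e' \<le> (\<Prod>\<sigma>\<in>UNIV. \<rho>' \<sigma>)" .
  qed
  then obtain x where x: "x \<in> val_lattice e'" "x \<noteq> 0" "\<And>\<sigma>. cmod (Rep_emb \<sigma> x) \<le> \<rho>' \<sigma>" by blast
  show thesis
  proof (rule that)
    show "x / z \<noteq> 0" using x z by simp
    show "x / z \<in> val_lattice e" using x(1,2) z(1) by (auto simp: val_lattice_def ord_ge_def ord_divide e'_def)
    fix \<sigma>
    have "Rep_emb \<sigma> (x / z) * Rep_emb \<sigma> z = Rep_emb \<sigma> x" using z(1) by (simp flip: emb.hom_mult)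
    then have "cmod (Rep_emb \<sigma> (x / z)) * cmod (Rep_emb \<sigma> z) = cmod (Rep_emb \<sigma> x)" by (metis norm_mult)
    also have "\<dots> \<le> \<rho> \<sigma> * cmod (Rep_emb \<sigma> z)" using x(3)[of \<sigma>] by (simp add: \<rho>'_def)
    finally show "cmod (Rep_emb \<sigma> (x / z)) \<le> \<rho> \<sigma>" by (rule mult_right_le_imp_le) (use z(1) in simp)
  qed
qed

section \<open>Archimedean absolute values\<close>

text \<open>After extracting roots of order 2^j the factor K c^(j+e) tends to 1. Exponents 2^j are
  used because the weak triangle inequality costs one factor C whenever the number of summands
  doubles.\<close>

lemma root_limit:
  fixes a b c :: real
  assumes a: "a \<ge> 0" and b: "b > 0" and c: "c \<ge> 1" and K: "K > 0"
    and le: "\<And>j. a ^ (2 ^ j) \<le> K * c ^ (j + e) * b ^ (2 ^ j)"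
  shows "a \<le> b"
proof (rule ccontr)
  assume "\<not> a \<le> b"
  then have q: "a / b > 1" using b by simp
  define lq lc lK where "lq = ln (a / b)" and "lc = ln c" and "lK = ln K"
  have lq: "lq > 0" using q by (simp add: lq_def ln_gt_zero)
  have bound: "2 ^ j * lq \<le> lK + (real j + real e) * lc" for j
  proof -
    have "(a / b) ^ (2 ^ j) \<le> K * c ^ (j + e)"
      using le[of j] b by (simp add: power_divide divide_le_eq)
    then have "ln ((a / b) ^ (2 ^ j)) \<le> ln (K * c ^ (j + e))"
      using q c K by (subst ln_le_cancel_iff) (auto intro: mult_pos_pos zero_less_power)
    also have "\<dots> = lK + (real j + real e) * lc"
      using c K by (simp add: ln_mult ln_realpow lc_def lK_def)
    finally show ?thesis using q by (simp add: ln_realpow lq_def)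
  qed
  have "filterlim (\<lambda>j. 2 ^ j * lq - (lK + (real j + real e) * lc)) at_top sequentially"
    using lq by real_asymp
  then have "eventually (\<lambda>j. 0 < 2 ^ j * lq - (lK + (real j + real e) * lc)) sequentially"
    unfolding filterlim_at_top_dense by blast
  then obtain j where "0 < 2 ^ j * lq - (lK + (real j + real e) * lc)"
    unfolding eventually_sequentially by blast
  with bound[of j] show False by simp
qed

lemma base_expansion:
  fixes b x :: nat
  assumes "b > 0" "x < b ^ L"
  shows "\<exists>d. x = (\<Sum>i<L. d i * b ^ i) \<and> (\<forall>i. d i < b)"
  using assms(2)
proof (induction L arbitrary: x)
  case 0
  then show ?case using assms(1) by (intro exI[of _ "\<lambda>_. 0"]) simp
next
  case (Suc L)
  have "x div b < b ^ L" using Suc.prems assms(1) by (simp add: div_less_iff_less_mult mult.commute)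
  then obtain d where d: "x div b = (\<Sum>i<L. d i * b ^ i)" "\<forall>i. d i < b" using Suc.IH by blast
  define d' where "d' = (\<lambda>i. case i of 0 \<Rightarrow> x mod b | Suc k \<Rightarrow> d k)"
  have "(\<Sum>i<Suc L. d' i * b ^ i) = x mod b + (\<Sum>i<L. d i * b ^ i) * b"
    unfolding sum.lessThan_Suc_shift by (simp add: d'_def sum_distrib_left sum_distrib_right mult_ac)
  also have "\<dots> = x" by (simp flip: d(1))
  finally have "x = (\<Sum>i<Suc L. d' i * b ^ i)" ..
  moreover have "\<forall>i. d' i < b" using d(2) assms(1) by (simp add: d'_def split: nat.split)
  ultimately show ?case by blast
qed

section \<open>Absolute values with the weak triangle inequality\<close>

locale weak_abs =
  fixes v :: "'k::number_field \<Rightarrow> real" and C :: real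
  assumes nonneg: "v x \<ge> 0" and eq_0_iff: "v x = 0 \<longleftrightarrow> x = 0" and mult: "v (x * y) = v x * v y"
    and weak_triangle: "v (x + y) \<le> C * max (v x) (v y)"
begin

lemma pos: "x \<noteq> 0 \<Longrightarrow> v x > 0"
  using nonneg[of x] eq_0_iff[of x] by linarith

lemma one: "v 1 = 1"
  using mult[of 1 1] pos[of 1] by simp

lemma uminus_one: "v (- 1) = 1"
proof -
  have "v (- 1) * v (- 1) = 1" using mult[of "-1" "-1"] one by simp
  then have "v (- 1) = 1 \<or> v (- 1) = - 1" by (simp add: square_eq_1_iff)
  then show ?thesis using nonneg[of "-1"] by auto
qed

lemma uminus: "v (- x) = v x"
  using mult[of "-1" x] uminus_one by simp

lemma power: "v (x ^ k) = v x ^ k"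
  by (induction k) (simp_all add: one mult)

lemma inverse: "v (inverse x) = inverse (v x)"
proof (cases "x = 0")
  case False
  then have "v x * v (inverse x) = 1" using mult[of x "inverse x"] one by simp
  then show ?thesis by (simp add: inverse_unique)
next
  case True
  then show ?thesis using eq_0_iff[of 0] by simp
qed

lemma divide: "v (x / y) = v x / v y"
  by (simp add: divide_inverse mult inverse)

lemma C_ge_1: "C \<ge> 1"
  using weak_triangle[of 1 0] one eq_0_iff[of 0] by simp

text \<open>Splitting a sum in halves costs one factor \<open>C\<close> per level, so the loss is
  polynomial in the number of summands and disappears in \<open>root_limit\<close>.\<close>

lemma sum_le:
  assumes "finite I" "card I \<le> 2 ^ k" "\<And>i. i \<in> I \<Longrightarrow> v (f i) \<le> B" "B \<ge> 0"
  shows "v (sum f I) \<le> C ^ k * B"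
  using assms(1-3)
proof (induction k arbitrary: I)
  case 0
  then have "I = {} \<or> (\<exists>i. I = {i})" by (simp add: le_Suc_eq card_1_singleton_iff)
  then show ?case using 0 assms(4) eq_0_iff[of 0] by auto
next
  case (Suc k)
  have ex: "\<exists>J\<subseteq>I. card J = min (card I) (2 ^ k)" by (rule obtain_subset_with_card_n[of "min (card I) (2 ^ k)" I]) auto
  then obtain J where J: "J \<subseteq> I" "card J = min (card I) (2 ^ k)" by blast
  have fin: "finite J" "finite (I - J)" using J Suc.prems finite_subset by auto
  have "card (I - J) \<le> 2 ^ k" using J Suc.prems by (subst card_Diff_subset) (auto simp: fin)
  then have 1: "v (sum f (I - J)) \<le> C ^ k * B" by (intro Suc.IH fin Suc.prems) auto
  have 2: "v (sum f J) \<le> C ^ k * B" using J by (intro Suc.IH fin Suc.prems) auto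
  have "sum f I = sum f J + sum f (I - J)"
    using sum.subset_diff[OF J(1) Suc.prems(1), of f] by (simp add: add.commute)
  then have "v (sum f I) \<le> C * max (v (sum f J)) (v (sum f (I - J)))" using weak_triangle by simp
  also have "\<dots> \<le> C * (C ^ k * B)" using 1 2 C_ge_1 by (intro mult_left_mono) auto
  finally show ?case by simp
qed

text \<open>With N = 2^j, the binomial expansion of (x + y)^N has N + 1 \<le> 2^(j+1) terms, each at
  most M^N since binomial coefficients have value at most 1.\<close>

lemma ultrametric_if_bounded:
  assumes "\<And>n. v (of_nat n) \<le> 1" shows "v (x + y) \<le> max (v x) (v y)"
proof (cases "x = 0 \<and> y = 0")
  case True
  then show ?thesis by simp
next
  case False
  define M where "M = max (v x) (v y)"
  have M: "M > 0" using False pos by (auto simp: M_def less_max_iff_disj)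
  have "v (x + y) \<le> M"
  proof (rule root_limit[OF nonneg M C_ge_1, where K = 1 and e = 1])
    fix j
    let ?N = "(2::nat) ^ j"
    have "v (x + y) ^ ?N = v (\<Sum>i\<le>?N. of_nat (?N choose i) * x ^ i * y ^ (?N - i))"
      by (simp only: power[symmetric] binomial_ring)
    also have "\<dots> \<le> C ^ (j + 1) * M ^ ?N"
    proof (rule sum_le)
      show "card {..?N} \<le> 2 ^ (j + 1)" by simp
      show "v (of_nat (?N choose i) * x ^ i * y ^ (?N - i)) \<le> M ^ ?N" if "i \<in> {..?N}" for i
      proof -
        have "v (of_nat (?N choose i) * x ^ i * y ^ (?N - i)) \<le> 1 * M ^ i * M ^ (?N - i)"
          unfolding mult power using assms nonneg M
          by (intro mult_mono power_mono mult_nonneg_nonneg zero_le_power) (auto simp: M_def)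
        also have "\<dots> = M ^ ?N" using that by (simp flip: power_add)
        finally show ?thesis .
      qed
    qed (use M in auto)
    finally show "v (x + y) ^ ?N \<le> 1 * C ^ (j + 1) * M ^ ?N" by simp
  qed simp
  then show ?thesis by (simp add: M_def)
qed

text \<open>Expand m^N in base b. There are about N log_b m digits, each of value at most
  \<open>D\<close>, and taking N-th roots removes everything but the power of v(b).\<close>

lemma nat_bound:
  fixes m b :: nat
  assumes m: "m \<ge> 2" and b: "b \<ge> 2"
  shows "v (of_nat m) \<le> max 1 (v (of_nat b)) powr log b m"
proof -
  define M where "M = max 1 (v (of_nat b))"
  define \<mu> where "\<mu> = log b m"
  define D where "D = (\<Sum>d<b. v (of_nat d))"
  have M: "M \<ge> 1" by (simp add: M_def)
  have \<mu>: "\<mu> > 0" using m b by (simp add: \<mu>_def)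
  have D: "v (of_nat d) \<le> D" if "d < b" for d
    unfolding D_def by (rule member_le_sum) (use that nonneg in auto)
  have "D \<ge> v 1" using D[of 1] b by simp
  then have D0: "D > 0" using one by simp
  \<comment> \<open>The expansion has at most N \<mu> + 1 \<le> N (\<mu> + 1) digits, hence at most
    2^(j+e) for N = 2^j.\<close>
  obtain e :: nat where e: "\<mu> + 1 \<le> 2 ^ e" using real_arch_pow[of 2 "\<mu> + 1"] by (auto intro: less_imp_le)
  have "v (of_nat m) \<le> M powr \<mu>"
  proof (rule root_limit[OF nonneg _ C_ge_1, where K = "D * M" and e = e])
    show "0 < M powr \<mu>" "0 < D * M" using M D0 by auto
    fix j
    let ?N = "(2::nat) ^ j"
    define L where "L = nat \<lfloor>real ?N * \<mu>\<rfloor> + 1"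
    have L: "real L \<le> real ?N * \<mu> + 1" "real ?N * \<mu> < real L"
      using \<mu> by (auto simp: L_def) linarith+
    have "real (m ^ ?N) = real b powr (real ?N * \<mu>)"
    proof -
      have "real b powr (real ?N * \<mu>) = (real b powr \<mu>) powr real ?N" by (simp add: powr_powr mult.commute)
      also have "real b powr \<mu> = real m" using m b by (simp add: \<mu>_def)
      finally show ?thesis using m powr_realpow[of "real m" ?N] by simp
    qed
    also have "\<dots> < real b powr real L" using L b by (intro powr_less_mono) auto
    also have "\<dots> = real (b ^ L)" using b by (simp add: powr_realpow)
    finally have "m ^ ?N < b ^ L" by (simp only: of_nat_less_iff)
    then obtain d where d: "m ^ ?N = (\<Sum>i<L. d i * b ^ i)" "\<forall>i. d i < b"
      using base_expansion[of b "m ^ ?N" L] b by auto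
    have "v (of_nat m) ^ ?N = v (of_nat (m ^ ?N))" by (simp add: power)
    also have "of_nat (m ^ ?N) = (\<Sum>i<L. of_nat (d i) * of_nat b ^ i :: 'k)" by (simp add: d(1))
    also have "v \<dots> \<le> C ^ (j + e) * (D * M ^ L)"
    proof (rule sum_le)
      have "1 \<le> real ?N" by simp
      then have "real L \<le> real ?N * (\<mu> + 1)" using L(1) unfolding distrib_left by linarith
      also have "\<dots> \<le> real ?N * 2 ^ e" using e by (intro mult_left_mono) auto
      finally have "real L \<le> real (2 ^ (j + e))" by (simp add: power_add)
      then show "card {..<L} \<le> 2 ^ (j + e)" by (simp only: of_nat_le_iff card_lessThan)
      show "v (of_nat (d i) * of_nat b ^ i) \<le> D * M ^ L" if i: "i \<in> {..<L}" for i
      proof -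
        have "v (of_nat b) ^ i \<le> M ^ i" using nonneg by (intro power_mono) (auto simp: M_def)
        also have "\<dots> \<le> M ^ L" using M i by (intro power_increasing) auto
        finally show ?thesis unfolding mult power using D d(2) nonneg D0 by (intro mult_mono) auto
      qed
    qed (use D0 M in auto)
    also have "M ^ L \<le> M * (M powr \<mu>) ^ ?N"
    proof -
      have "M ^ L = M powr real L" using M by (simp add: powr_realpow)
      also have "\<dots> \<le> M powr (real ?N * \<mu> + 1)" using M L by (intro powr_mono) auto
      also have "\<dots> = M * (M powr \<mu>) ^ ?N"
        using M by (simp add: powr_add powr_powr powr_realpow[symmetric] mult.commute del: powr_realpow of_nat_power)
      finally show ?thesis .
    qed
    finally show "v (of_nat m) ^ ?N \<le> D * M * C ^ (j + e) * (M powr \<mu>) ^ ?N"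
      using D0 C_ge_1 by (simp add: mult_ac mult_left_mono)
  qed
  then show ?thesis by (simp add: M_def \<mu>_def)
qed

text \<open>Using \<open>nat_bound\<close> in both directions, ln v(m) / ln m is the same for all m
  \<ge> 2.\<close>

lemma nat_powr:
  assumes n: "v (of_nat n) > 1"
  obtains c where "c > 0" "\<And>m. v (of_nat m) = real m powr c"
proof -
  have n2: "n \<ge> 2"
  proof (rule ccontr)
    assume "\<not> n \<ge> 2"
    then have "n = 0 \<or> n = 1" by auto
    then show False using n one eq_0_iff[of 0] by auto
  qed
  have gt: "v (of_nat b) > 1" if b: "b \<ge> 2" for b :: nat
  proof (rule ccontr)
    assume "\<not> v (of_nat b) > 1"
    then have "max 1 (v (of_nat b)) = 1" by simp
    then show False using nat_bound[OF n2 b] n by simp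
  qed
  define l where "l = (\<lambda>m::nat. ln (v (of_nat m)) / ln m)"
  have le: "l m \<le> l b" if m: "m \<ge> 2" and b: "b \<ge> 2" for m b :: nat
  proof -
    have "v (of_nat m) \<le> v (of_nat b) powr log b m"
      using nat_bound[OF m b] gt[OF b] by simp
    then have "ln (v (of_nat m)) \<le> ln (v (of_nat b) powr log b m)"
      using gt[OF m] gt[OF b] by (subst ln_le_cancel_iff) auto
    also have "\<dots> = ln m / ln b * ln (v (of_nat b))" using gt[OF b] by (simp add: ln_powr log_def)
    finally show ?thesis using m b by (simp add: l_def field_simps)
  qed
  define c where "c = l 2"
  have "c > 0" using gt[of 2] by (simp add: c_def l_def)
  moreover have "v (of_nat m) = real m powr c" for m
  proof -
    consider "m = 0" | "m = 1" | "m \<ge> 2" by fastforce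
    then show ?thesis
    proof cases
      case 3
      then have "l m = c" using le[of m 2] le[of 2 m] by (simp add: c_def)
      then have "ln (v (of_nat m)) = c * ln m" using 3 by (simp add: l_def field_simps)
      then have "exp (ln (v (of_nat m))) = real m powr c" using 3 by (simp add: powr_def)
      then show ?thesis using gt[OF 3] by simp
    qed (use one eq_0_iff[of 0] in auto)
  qed
  ultimately show thesis by (rule that)
qed

lemma rat_powr:
  assumes "\<And>m. v (of_nat m) = real m powr c"
  shows "v (of_rat q) = \<bar>of_rat q\<bar> powr c"
proof -
  obtain a b where q: "q = Rat.Fract a b" "b > 0" by (cases q)
  have int: "v (of_int k) = \<bar>of_int k\<bar> powr c" for k
  proof -
    have "v (of_int k) = v (of_nat (nat \<bar>k\<bar>))" using uminus[of "of_int k"] by (cases "k \<ge> 0") auto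
    also have "\<dots> = real (nat \<bar>k\<bar>) powr c" by (rule assms)
    finally show ?thesis by simp
  qed
  show ?thesis using q by (simp add: of_rat_rat divide int powr_divide)
qed

end

section \<open>Density of K in its real coordinates and the archimedean case of Ostrowski's
  theorem\<close>

definition max_norm :: "'k::number_field \<Rightarrow> real" where
  "max_norm x = Max (range (\<lambda>\<sigma>. cmod (Rep_emb \<sigma> x)))"

lemma max_norm_ge: "cmod (Rep_emb \<sigma> x) \<le> max_norm x"
  unfolding max_norm_def by (rule Max_ge) auto

lemma max_norm_le: "(\<And>\<sigma>. cmod (Rep_emb \<sigma> x) \<le> B) \<Longrightarrow> max_norm x \<le> B"
  unfolding max_norm_def by (subst Max_le_iff) auto

lemma max_norm_pos: "x \<noteq> 0 \<Longrightarrow> max_norm x > 0"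
  using max_norm_ge[of undefined x] by (rule less_le_trans[rotated]) simp

lemma coord_le_max_norm: "\<bar>coord \<sigma> x\<bar> \<le> max_norm x"
proof -
  have "\<bar>coord \<sigma> x\<bar> \<le> cmod (Rep_emb \<sigma> x)" by (simp add: coord_def abs_Re_le_cmod abs_Im_le_cmod)
  then show ?thesis using max_norm_ge[of \<sigma> x] by simp
qed

lemma cmod_le_coords:
  assumes "\<bar>coord \<sigma> x\<bar> \<le> B" "\<bar>coord (cnj_emb \<sigma>) x\<bar> \<le> B"
  shows "cmod (Rep_emb \<sigma> x) \<le> 2 * B"
proof -
  have B: "B \<ge> 0" using assms(1) by linarith
  have "(cmod (Rep_emb \<sigma> x))\<^sup>2 = (\<Sum>i\<in>{\<sigma>, cnj_emb \<sigma>}. (coord i x)\<^sup>2)" by (rule coord_norm[symmetric])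
  also have "\<dots> \<le> (\<Sum>i\<in>{\<sigma>, cnj_emb \<sigma>}. B\<^sup>2)"
    by (rule sum_mono) (use assms in \<open>auto simp: abs_le_square_iff[symmetric] B\<close>)
  also have "\<dots> = real (card {\<sigma>, cnj_emb \<sigma>}) * B\<^sup>2" by simp
  also have "\<dots> \<le> 2 * B\<^sup>2" by (intro mult_right_mono) (auto simp: card_insert_if)
  also have "\<dots> \<le> (2 * B)\<^sup>2" by (simp add: power2_eq_square B)
  finally show ?thesis by (rule power2_le_imp_le) (use B in simp)
qed

text \<open>The real coordinates with respect to an integral basis are approximated by rationals;
  \<open>A\<close> bounds how much the coordinate matrix magnifies the error.\<close>

lemma coord_dense:
  fixes w :: "'k::number_field emb \<Rightarrow> real"
  assumes "\<epsilon> > 0"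
  obtains x where "\<And>\<sigma>. \<bar>coord \<sigma> x - w \<sigma>\<bar> < \<epsilon>"
proof -
  obtain \<beta> :: "'k emb \<Rightarrow> 'k" where \<beta>: "int_basis \<beta>" by (rule int_basis_exists)
  then have det: "det (coord_matrix \<beta>) \<noteq> 0" by (simp add: int_basis_def)
  obtain S where S: "coord_matrix \<beta> ** S = mat 1" using det by (metis invertible_det_nz invertible_def)
  define z where "z = S *v (\<chi> i. w i)"
  have Rz: "coord_matrix \<beta> *v z = (\<chi> i. w i)" using S by (simp add: z_def matrix_vector_mul_assoc)
  define A where "A = (\<Sum>\<sigma>\<in>UNIV. \<Sum>j\<in>UNIV. \<bar>coord \<sigma> (\<beta> j)\<bar>) + 1"
  have A: "A > 0" unfolding A_def by (intro add_nonneg_pos sum_nonneg) auto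
  have "\<exists>q. \<bar>of_rat q - z $ j\<bar> < \<epsilon> / A" for j
  proof -
    have "z $ j < z $ j + \<epsilon> / A" using assms A by simp
    then obtain q where "z $ j < of_rat q" "of_rat q < z $ j + \<epsilon> / A" using of_rat_dense by blast
    then show ?thesis by (intro exI[of _ q]) auto
  qed
  then obtain q where q: "\<And>j. \<bar>of_rat (q j) - z $ j\<bar> < \<epsilon> / A" by metis
  define x where "x = (\<Sum>j\<in>UNIV. of_rat (q j) * \<beta> j)"
  have "\<bar>coord \<sigma> x - w \<sigma>\<bar> < \<epsilon>" for \<sigma>
  proof -
    have "coord \<sigma> x - w \<sigma> = (coord_matrix \<beta> *v (\<chi> j. of_rat (q j))) $ \<sigma> - (coord_matrix \<beta> *v z) $ \<sigma>"
      by (simp add: Rz coord_matrix_mult x_def)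
    also have "\<dots> = (\<Sum>j\<in>UNIV. coord \<sigma> (\<beta> j) * (of_rat (q j) - z $ j))"
      by (simp add: matrix_vector_mult_def coord_matrix_def right_diff_distrib sum_subtractf)
    finally have "\<bar>coord \<sigma> x - w \<sigma>\<bar> \<le> (\<Sum>j\<in>UNIV. \<bar>coord \<sigma> (\<beta> j)\<bar> * \<bar>of_rat (q j) - z $ j\<bar>)"
      by (metis (mono_tags, lifting) abs_mult sum_abs sum.cong)
    also have "\<dots> \<le> (\<Sum>j\<in>UNIV. \<bar>coord \<sigma> (\<beta> j)\<bar> * (\<epsilon> / A))"
      using q by (intro sum_mono mult_left_mono) (auto intro: less_imp_le)
    also have "\<dots> = (\<Sum>j\<in>UNIV. \<bar>coord \<sigma> (\<beta> j)\<bar>) * (\<epsilon> / A)" by (simp add: sum_distrib_right sum_divide_distrib)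
    also have "\<dots> < A * (\<epsilon> / A)"
    proof (rule mult_strict_right_mono)
      have "(\<Sum>j\<in>UNIV. \<bar>coord \<sigma> (\<beta> j)\<bar>) \<le> (\<Sum>\<sigma>\<in>UNIV. \<Sum>j\<in>UNIV. \<bar>coord \<sigma> (\<beta> j)\<bar>)"
        by (rule member_le_sum[of \<sigma> UNIV "\<lambda>\<sigma>. \<Sum>j\<in>UNIV. \<bar>coord \<sigma> (\<beta> j)\<bar>"]) (auto intro: sum_nonneg)
      then show "(\<Sum>j\<in>UNIV. \<bar>coord \<sigma> (\<beta> j)\<bar>) < A" by (simp add: A_def)
    qed (use assms A in simp)
    finally show ?thesis using A by simp
  qed
  then show thesis by (rule that)
qed

context weak_abs
begin

text \<open>Rational coordinates are bounded linearly by \<open>max_norm\<close>, which gives the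
  estimate up to a constant \<open>K\<close>. Applying it to powers of x and taking roots removes
  \<open>K\<close>.\<close>

lemma bounded_by_max_norm:
  assumes c: "c > 0" "\<And>m. v (of_nat m) = real m powr c"
  shows "v x \<le> max_norm x powr c"
proof (cases "x = 0")
  case True
  then show ?thesis using eq_0_iff[of 0] by simp
next
  case False
  obtain \<beta> :: "'k emb \<Rightarrow> 'k" where \<beta>: "int_basis \<beta>" by (rule int_basis_exists)
  then have det: "det (coord_matrix \<beta>) \<noteq> 0" by (simp add: int_basis_def)
  obtain S where S: "S ** coord_matrix \<beta> = mat 1" using det by (metis invertible_det_nz invertible_def)
  obtain D where D: "D > 0" "\<And>x. norm (S *v x) \<le> norm x * D"
    using bounded_linear.pos_bounded[OF matrix_vector_mul_bounded_linear[of S]] by blast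
  define n where "n = real CARD('k emb)"
  have n: "n > 0" by (simp add: n_def)
  obtain k where k: "CARD('k emb) \<le> 2 ^ k" using less_exp less_imp_le by blast
  define V where "V = (\<Sum>j\<in>UNIV. v (\<beta> j))"
  have V: "v (\<beta> j) \<le> V" for j unfolding V_def by (rule member_le_sum) (auto simp: nonneg)
  have V0: "V \<ge> 0" unfolding V_def by (intro sum_nonneg nonneg)
  define K where "K = C ^ k * ((n * D) powr c * V) + 1"
  have K: "K > 0" unfolding K_def using C_ge_1 V0 by (intro add_nonneg_pos mult_nonneg_nonneg) auto
  have bound: "v y \<le> K * max_norm y powr c" for y
  proof -
    obtain q where q: "y = (\<Sum>j\<in>UNIV. of_rat (q j) * \<beta> j)"
      using rational_basis_if_det(1)[OF det] unfolding rational_basis_def by blast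
    have M0: "max_norm y \<ge> 0" using max_norm_ge[of undefined y] norm_ge_zero order_trans by blast
    have qj: "\<bar>of_rat (q j)\<bar> \<le> n * D * max_norm y" for j
    proof -
      define w :: "real^'k emb" where "w = (\<chi> j. of_rat (q j))"
      have "norm (coord_matrix \<beta> *v w) \<le> (\<Sum>i\<in>UNIV. \<bar>(coord_matrix \<beta> *v w) $ i\<bar>)" by (rule norm_le_l1_cart)
      also have "\<dots> \<le> (\<Sum>i\<in>(UNIV::'k emb set). max_norm y)"
        unfolding w_def coord_matrix_mult q[symmetric] by (intro sum_mono coord_le_max_norm)
      finally have le: "norm (coord_matrix \<beta> *v w) \<le> n * max_norm y" by (simp add: n_def)
      have "\<bar>w $ j\<bar> \<le> norm w" by (rule component_le_norm_cart)
      also have "norm w \<le> norm (coord_matrix \<beta> *v w) * D"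
        using D(2)[of "coord_matrix \<beta> *v w"] S by (simp add: matrix_vector_mul_assoc)
      also have "\<dots> \<le> n * max_norm y * D" using le D(1) by (intro mult_right_mono) auto
      finally show ?thesis by (simp add: w_def mult_ac)
    qed
    have "v y \<le> C ^ k * (((n * D) powr c * V) * max_norm y powr c)"
      unfolding q
    proof (rule sum_le)
      show "v (of_rat (q j) * \<beta> j) \<le> ((n * D) powr c * V) * max_norm (\<Sum>j\<in>UNIV. of_rat (q j) * \<beta> j) powr c" for j
      proof -
        have "v (of_rat (q j) * \<beta> j) = \<bar>of_rat (q j)\<bar> powr c * v (\<beta> j)"
          by (simp add: mult rat_powr[OF c(2)])
        also have "\<dots> \<le> (n * D * max_norm y) powr c * V"
          using qj[of j] V[of j] c(1) nonneg by (intro mult_mono powr_mono2) auto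
        also have "\<dots> = ((n * D) powr c * V) * max_norm y powr c"
          using n D(1) M0 by (simp add: powr_mult mult_ac)
        finally show ?thesis unfolding q .
      qed
    qed (use k V0 in auto)
    also have "\<dots> \<le> K * max_norm y powr c"
      using powr_ge_zero[of "max_norm y" c] by (simp add: K_def algebra_simps)
    finally show ?thesis .
  qed
  have Mx: "max_norm x > 0" by (rule max_norm_pos[OF False])
  show ?thesis
  proof (rule root_limit[OF nonneg _ order_refl K])
    show "0 < max_norm x powr c" using Mx by simp
    fix j
    let ?N = "(2::nat) ^ j"
    have "max_norm (x ^ ?N) \<le> max_norm x ^ ?N"
      by (rule max_norm_le) (simp add: emb.hom_power norm_power power_mono max_norm_ge)
    then have "max_norm (x ^ ?N) powr c \<le> (max_norm x ^ ?N) powr c"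
      using c(1) max_norm_pos[of "x ^ ?N"] False by (intro powr_mono2) auto
    also have "\<dots> = (max_norm x powr c) ^ ?N"
      using Mx by (simp add: powr_power powr_powr flip: powr_realpow) (simp add: mult.commute)
    finally have "K * max_norm (x ^ ?N) powr c \<le> K * (max_norm x powr c) ^ ?N" using K by simp
    then show "v x ^ ?N \<le> K * 1 ^ (j + 0) * (max_norm x powr c) ^ ?N"
      using bound[of "x ^ ?N"] by (simp add: power)
  qed
qed

text \<open>If every \<open>\<sigma>\<close> failed, then elements close to the idempotents of \<open>K \<otimes> \<real>\<close> would all have small
  absolute value, although they sum to almost \<open>1\<close>.\<close>

lemma archimedean_embedding:
  assumes c: "c > 0" "\<And>m. v (of_nat m) = real m powr c"
  shows "\<exists>\<sigma>. \<forall>x. v x = cmod (Rep_emb \<sigma> x) powr c"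
proof -
  have "\<exists>\<sigma>. \<forall>x. v x \<le> cmod (Rep_emb \<sigma> x) powr c"
  proof (rule ccontr)
    assume "\<not> ?thesis"
    then have ex: "\<exists>x. v x > cmod (Rep_emb \<sigma> x) powr c" for \<sigma> by (meson not_le)
    \<comment> \<open>Division by a rational between |\<sigma> x| and v(x)^(1/c) turns a
      counterexample into an element small at \<sigma> and large under v.\<close>
    have u_ex: "\<exists>u. cmod (Rep_emb \<sigma> u) < 1 \<and> v u > 1" for \<sigma>
    proof -
      obtain x where x: "v x > cmod (Rep_emb \<sigma> x) powr c" using ex by blast
      have vx: "v x > 0" using x by (rule le_less_trans[rotated]) simp
      have "cmod (Rep_emb \<sigma> x) = (cmod (Rep_emb \<sigma> x) powr c) powr (1 / c)" using c(1) by (simp add: powr_powr)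
      also have "\<dots> < v x powr (1 / c)" using x c(1) by (intro powr_less_mono2) auto
      finally obtain q where q: "cmod (Rep_emb \<sigma> x) < of_rat q" "of_rat q < v x powr (1 / c)"
        using of_rat_dense by blast
      have q0: "of_rat q > (0::real)" using q(1) norm_ge_zero le_less_trans by blast
      have "cmod (Rep_emb \<sigma> (x / of_rat q)) * of_rat q = cmod (Rep_emb \<sigma> x)"
      proof -
        have "q \<noteq> 0" using q0 by auto
        then have "x / of_rat q * of_rat q = x" by simp
        then have "Rep_emb \<sigma> (x / of_rat q) * of_rat q = Rep_emb \<sigma> x" by (metis Rep_emb_of_rat emb.hom_mult)
        then have "cmod (Rep_emb \<sigma> (x / of_rat q)) * cmod (of_rat q) = cmod (Rep_emb \<sigma> x)" by (metis norm_mult)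
        moreover have "cmod (of_rat q) = of_rat q"
        proof -
          have "(of_rat q :: complex) = complex_of_real (of_rat q)" by (cases q) (simp add: of_rat_rat)
          then show ?thesis using q0 by simp
        qed
        ultimately show ?thesis by simp
      qed
      then have "cmod (Rep_emb \<sigma> (x / of_rat q)) * of_rat q < 1 * of_rat q" using q(1) by simp
      then have "cmod (Rep_emb \<sigma> (x / of_rat q)) < 1" by (rule mult_right_less_imp_less) (use q0 in simp)
      moreover have "v (x / of_rat q) > 1"
      proof -
        have "of_rat q powr c < (v x powr (1 / c)) powr c" using q q0 c(1) by (intro powr_less_mono2) auto
        also have "\<dots> = v x" using c(1) vx by (simp add: powr_powr)
        finally show ?thesis using q0 by (simp add: divide rat_powr[OF c(2)])
      qed
      ultimately show ?thesis by blast
    qed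
    \<comment> \<open>One embedding from each conjugation orbit: exactly at these indices 1 has
      coordinate 1, and its other coordinates vanish.\<close>
    define E :: "'k emb set" where "E = real_embs \<union> cplx_embs"
    have e_ex: "\<exists>e. v e \<le> \<delta> powr c \<and> (\<forall>\<tau>. \<bar>coord \<tau> e - (if \<tau> = \<sigma> then 1 else 0)\<bar> \<le> \<delta>)"
      if \<delta>: "\<delta> > 0" and \<sigma>: "\<sigma> \<in> E" for \<delta> \<sigma>
    proof -
      obtain u where u: "cmod (Rep_emb \<sigma> u) < 1" "v u > 1" using u_ex by blast
      have u0: "u \<noteq> 0" using u(2) eq_0_iff[of 0] by auto
      obtain N where N: "cmod (Rep_emb \<sigma> u) ^ N < \<delta> / 4" using real_arch_pow_inv[OF _ u(1), of "\<delta> / 4"] \<delta> by auto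
      define M where "M = max_norm (u ^ N)"
      have M: "M > 0" unfolding M_def by (rule max_norm_pos) (use u0 in simp)
      \<comment> \<open>At \<sigma> the power u^N is small, so there a bound on \<open>e\<close>
        suffices, which the entry 1 provides. Elsewhere u^N may be as large as \<open>M\<close>, and
        the last entry absorbs that.\<close>
      define \<epsilon> where "\<epsilon> = min 1 (min \<delta> (\<delta> / (2 * M)))"
      have \<epsilon>: "\<epsilon> > 0" "\<epsilon> \<le> 1" "\<epsilon> \<le> \<delta>" "2 * \<epsilon> * M \<le> \<delta>"
      proof -
        have "\<epsilon> \<le> \<delta> / (2 * M)" by (simp add: \<epsilon>_def)
        then show "2 * \<epsilon> * M \<le> \<delta>" using M by (simp add: field_simps)
      qed (use \<delta> M in \<open>auto simp: \<epsilon>_def\<close>)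
      obtain e where e: "\<And>\<tau>. \<bar>coord \<tau> e - (if \<tau> = \<sigma> then 1 else 0)\<bar> < \<epsilon>"
        using coord_dense[OF \<epsilon>(1), of "\<lambda>\<tau>. if \<tau> = \<sigma> then 1 else 0"] by blast
      have "max_norm (u ^ N * e) \<le> \<delta>"
      proof (rule max_norm_le)
        fix \<tau>
        show "cmod (Rep_emb \<tau> (u ^ N * e)) \<le> \<delta>"
        proof (cases "\<tau> \<in> {\<sigma>, cnj_emb \<sigma>}")
          case True
          have "\<bar>coord \<upsilon> e\<bar> \<le> 2" for \<upsilon> using e[of \<upsilon>] \<epsilon>(2) by (auto split: if_splits)
          then have "cmod (Rep_emb \<tau> e) \<le> 2 * 2" by (intro cmod_le_coords)
          moreover have "cmod (Rep_emb \<tau> (u ^ N)) = cmod (Rep_emb \<sigma> u) ^ N"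
            using True by (auto simp: emb.hom_power norm_power)
          ultimately have "cmod (Rep_emb \<tau> (u ^ N * e)) \<le> \<delta> / 4 * 4"
            unfolding emb.hom_mult norm_mult using N \<delta> by (intro mult_mono) auto
          then show ?thesis by simp
        next
          case False
          then have "\<tau> \<noteq> \<sigma>" "cnj_emb \<tau> \<noteq> \<sigma>" by auto
          then have "\<bar>coord \<tau> e\<bar> \<le> \<epsilon>" "\<bar>coord (cnj_emb \<tau>) e\<bar> \<le> \<epsilon>"
            using e[of \<tau>] e[of "cnj_emb \<tau>"] by auto
          then have "cmod (Rep_emb \<tau> e) \<le> 2 * \<epsilon>" by (rule cmod_le_coords)
          then have "cmod (Rep_emb \<tau> (u ^ N * e)) \<le> M * (2 * \<epsilon>)"
            unfolding emb.hom_mult norm_mult using max_norm_ge[of \<tau> "u ^ N"] M by (intro mult_mono) (auto simp: M_def)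
          then show ?thesis using \<epsilon>(4) by (simp add: mult_ac)
        qed
      qed
      then have "v (u ^ N * e) \<le> \<delta> powr c"
        using bounded_by_max_norm[OF c, of "u ^ N * e"] c(1) max_norm_ge[of \<sigma> "u ^ N * e"]
        by (meson less_imp_le norm_ge_zero order_trans powr_mono2)
      \<comment> \<open>Since v u > 1, the bound for u^N e passes to \<open>e\<close>
        itself.\<close>
      moreover have "1 * v e \<le> v u ^ N * v e" using u(2) nonneg[of e] by (intro mult_right_mono) auto
      ultimately have "v e \<le> \<delta> powr c" by (simp add: mult power)
      moreover have "\<bar>coord \<tau> e - (if \<tau> = \<sigma> then 1 else 0)\<bar> \<le> \<delta>" for \<tau> using e[of \<tau>] \<epsilon>(3) by simp
      ultimately show ?thesis by blast
    qed
    define n where "n = CARD('k emb)"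
    obtain k where k: "n \<le> 2 ^ k" using less_exp less_imp_le by blast
    \<comment> \<open>Chosen so that ((2n + 1) \<delta>)^c = 1 / (2 C^(k+1)): the k levels of
      \<open>sum_le\<close> and one further weak triangle inequality then yield v 1 \<le>
      1/2.\<close>
    define \<delta> where "\<delta> = (1 / (2 * C ^ Suc k)) powr (1 / c) / (2 * real n + 1)"
    have \<delta>: "\<delta> > 0" using C_ge_1 by (simp add: \<delta>_def)
    obtain e where e: "\<And>\<sigma>. \<sigma> \<in> E \<Longrightarrow> v (e \<sigma>) \<le> \<delta> powr c"
      "\<And>\<sigma> \<tau>. \<sigma> \<in> E \<Longrightarrow> \<bar>coord \<tau> (e \<sigma>) - (if \<tau> = \<sigma> then 1 else 0)\<bar> \<le> \<delta>"
      using e_ex[OF \<delta>] by metis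
    define s where "s = (\<Sum>\<sigma>\<in>E. e \<sigma>)"
    have cardE: "card E \<le> n" unfolding n_def by (intro card_mono) auto
    have c1: "coord \<tau> (1::'k) = (\<Sum>\<sigma>\<in>E. if \<tau> = \<sigma> then 1 else 0)" for \<tau>
    proof -
      have "(\<Sum>\<sigma>\<in>E. if \<tau> = \<sigma> then 1 else 0) = (if \<tau> \<in> E then 1 else 0 :: real)" by simp
      moreover have "\<tau> \<in> E \<longleftrightarrow> \<tau> \<le> cnj_emb \<tau>" by (auto simp: E_def real_embs_def cplx_embs_def)
      ultimately show ?thesis by (simp add: coord_def)
    qed
    have "\<bar>coord \<tau> (1 - s)\<bar> \<le> real n * \<delta>" for \<tau>
    proof -
      have "coord \<tau> (1 - s) = (\<Sum>\<sigma>\<in>E. (if \<tau> = \<sigma> then 1 else 0) - coord \<tau> (e \<sigma>))"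
        by (simp add: coord_diff c1 s_def coord_sum sum_subtractf)
      also have "\<bar>\<dots>\<bar> \<le> (\<Sum>\<sigma>\<in>E. \<delta>)"
        using e(2) by (intro order_trans[OF sum_abs] sum_mono) (auto simp: abs_minus_commute)
      also have "\<dots> \<le> real n * \<delta>" using cardE \<delta> by simp
      finally show ?thesis .
    qed
    then have "max_norm (1 - s) \<le> 2 * (real n * \<delta>)" by (intro max_norm_le cmod_le_coords)
    also have "\<dots> \<le> (2 * real n + 1) * \<delta>" using \<delta> by (simp add: distrib_right)
    finally have Mr: "max_norm (1 - s) \<le> (2 * real n + 1) * \<delta>" .
    define B where "B = ((2 * real n + 1) * \<delta>) powr c"
    have B: "B = 1 / (2 * C ^ Suc k)" using C_ge_1 c(1) by (simp add: B_def \<delta>_def powr_powr)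
    have B0: "B > 0" using B C_ge_1 by simp
    have "v (1 - s) \<le> B"
      using bounded_by_max_norm[OF c, of "1 - s"] Mr c(1) max_norm_ge[of undefined "1 - s"] unfolding B_def
      by (meson less_imp_le norm_ge_zero order_trans powr_mono2)
    moreover have "v s \<le> C ^ k * B"
      unfolding s_def
    proof (rule sum_le)
      show "v (e \<sigma>) \<le> B" if "\<sigma> \<in> E" for \<sigma>
      proof -
        have "\<delta> \<le> (2 * real n + 1) * \<delta>" using \<delta> by simp
        then have "\<delta> powr c \<le> B" unfolding B_def using \<delta> c(1) by (intro powr_mono2) auto
        then show ?thesis using e(1)[OF that] by simp
      qed
    qed (use cardE k B0 in auto)
    moreover have "B \<le> C ^ k * B" using C_ge_1 B0 by simp
    ultimately have "max (v s) (v (1 - s)) \<le> C ^ k * B" by simp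
    then have "v (s + (1 - s)) \<le> C * (C ^ k * B)"
      using weak_triangle[of s "1 - s"] C_ge_1 by (meson mult_left_mono order_trans zero_le_one)
    also have "\<dots> = 1 / 2" using C_ge_1 by (simp add: B)
    finally show False by (simp add: one)
  qed
  then obtain \<sigma> where \<sigma>: "\<And>x. v x \<le> cmod (Rep_emb \<sigma> x) powr c" by blast
  \<comment> \<open>The upper bound applied to \<open>inverse x\<close> is the lower bound for
    x.\<close>
  have "v x = cmod (Rep_emb \<sigma> x) powr c" for x
  proof (cases "x = 0")
    case False
    have "inverse a powr c = inverse (a powr c)" if "a \<ge> 0" for a :: real
      using that by (simp add: inverse_eq_divide powr_divide)
    then have "cmod (Rep_emb \<sigma> (inverse x)) powr c = inverse (cmod (Rep_emb \<sigma> x) powr c)"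
      unfolding emb.hom_inverse norm_inverse by simp
    then have "inverse (v x) \<le> inverse (cmod (Rep_emb \<sigma> x) powr c)"
      using \<sigma>[of "inverse x"] inverse[of x] by simp
    then have "cmod (Rep_emb \<sigma> x) powr c \<le> v x" using pos[OF False] False by (simp add: inverse_le_iff)
    with \<sigma>[of x] show ?thesis by simp
  qed (use eq_0_iff[of 0] in simp)
  then show ?thesis by blast
qed

theorem ostrowski:
  assumes "\<not> (\<forall>x y. v (x + y) \<le> max (v x) (v y))"
  obtains \<sigma> c where "c > 0" "\<And>x. v x = cmod (Rep_emb \<sigma> x) powr c"
proof -
  obtain n where "v (of_nat n) > 1" using assms ultrametric_if_bounded not_le by blast
  then show thesis using nat_powr archimedean_embedding that by metis
qed

end

section \<open>Places\<close>

lemma weak_absI: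
  assumes "absolute_value v" obtains C where "weak_abs v C"
  using assms unfolding absolute_value_def weak_abs_def by blast

abbreviation ultrametric :: "('k::field \<Rightarrow> real) \<Rightarrow> bool" where
  "ultrametric v \<equiv> \<forall>x y. v (x + y) \<le> max (v x) (v y)"

lemma max_powr: "c > 0 \<Longrightarrow> a \<ge> 0 \<Longrightarrow> b \<ge> 0 \<Longrightarrow> max a b powr c = max (a powr c) (b powr (c::real))"
  using powr_mono2[of c a b] powr_mono2[of c b a] by (cases "a \<le> b") (auto simp: max_def intro: order_antisym)

lemma NAV_nonneg: "v \<in> nontrivial_absolute_values \<Longrightarrow> v x \<ge> 0"
  by (auto simp: nontrivial_absolute_values_def absolute_value_def)

lemma NAV_powr:
  assumes v: "v \<in> nontrivial_absolute_values" and c: "c > 0"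
  shows "(\<lambda>x. v x powr c) \<in> nontrivial_absolute_values"
proof -
  have nn: "v x \<ge> 0" for x using v by (rule NAV_nonneg)
  have a: "v x = 0 \<longleftrightarrow> x = 0" "v (x * y) = v x * v y" for x y
    using v by (auto simp: nontrivial_absolute_values_def absolute_value_def)
  obtain C where C: "v (x + y) \<le> C * max (v x) (v y)" for x y
    using v by (auto simp: nontrivial_absolute_values_def absolute_value_def)
  obtain x where x: "x \<noteq> 0" "v x \<noteq> 1" using v by (auto simp: nontrivial_absolute_values_def)
  have "v (x + y) powr c \<le> \<bar>C\<bar> powr c * max (v x powr c) (v y powr c)" for x y
  proof -
    \<comment> \<open>The absolute value of \<open>C\<close> is taken because \<open>powr\<close>
      respects products of nonnegative reals.\<close>
    have "v (x + y) \<le> \<bar>C\<bar> * max (v x) (v y)"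
      by (rule order_trans[OF C]) (intro mult_right_mono, auto simp: nn le_max_iff_disj)
    then have "v (x + y) powr c \<le> (\<bar>C\<bar> * max (v x) (v y)) powr c"
      using c nn by (intro powr_mono2) auto
    also have "\<dots> = \<bar>C\<bar> powr c * max (v x powr c) (v y powr c)"
      using c nn by (simp add: powr_mult max_powr le_max_iff_disj)
    finally show ?thesis .
  qed
  then have "absolute_value (\<lambda>x. v x powr c)"
    unfolding absolute_value_def using a nn by (auto simp: powr_mult)
  moreover have "v x powr c \<noteq> 1"
  proof
    assume "v x powr c = 1"
    then have "v x = 1" using c nn[of x] a(1)[of x] x(1) by (metis powr_eq_one_iff_gen less_eq_real_def less_irrefl)
    with x(2) show False by simp
  qed
  ultimately show ?thesis using x(1) by (auto simp: nontrivial_absolute_values_def)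
qed

definition place_of :: "('k::field \<Rightarrow> real) \<Rightarrow> 'k place" where
  "place_of v = equivalent_absolute_values `` {v}"

lemma mem_place_of:
  assumes v: "v \<in> nontrivial_absolute_values"
  shows "w \<in> place_of v \<longleftrightarrow> (\<exists>c>0. w = (\<lambda>x. v x powr c))"
proof
  assume "w \<in> place_of v"
  then show "\<exists>c>0. w = (\<lambda>x. v x powr c)"
    by (auto simp: place_of_def equivalent_absolute_values_def fun_eq_iff)
next
  assume "\<exists>c>0. w = (\<lambda>x. v x powr c)"
  then obtain c where "c > 0" "w = (\<lambda>x. v x powr c)" by blast
  then show "w \<in> place_of v"
    using NAV_powr[OF v, of c] v by (auto simp: place_of_def equivalent_absolute_values_def)
qed

lemma mem_place_ofE:
  assumes "w \<in> place_of v" "v \<in> nontrivial_absolute_values"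
  obtains c where "c > 0" "w = (\<lambda>x. v x powr c)"
  using assms mem_place_of by blast

lemma equiv_EAV: "equiv nontrivial_absolute_values (equivalent_absolute_values :: (('k::field \<Rightarrow> real) \<times> _) set)"
  (is "equiv ?A ?r")
proof (rule equivI)
  show "?r \<subseteq> ?A \<times> ?A"
    by (auto simp: equivalent_absolute_values_def)
  show "refl_on ?A ?r"
    by (auto simp: refl_on_def equivalent_absolute_values_def NAV_nonneg intro!: exI[of _ 1])
  show "sym ?r"
  proof (rule symI)
    fix v w :: "'k \<Rightarrow> real" assume "(v, w) \<in> equivalent_absolute_values"
    then obtain c where c: "v \<in> nontrivial_absolute_values" "w \<in> nontrivial_absolute_values" "c > 0" "\<forall>x. w x = v x powr c"
      by (auto simp: equivalent_absolute_values_def)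
    then have "\<forall>x. v x = w x powr (1 / c)" by (simp add: powr_powr NAV_nonneg)
    then show "(w, v) \<in> equivalent_absolute_values"
      using c unfolding equivalent_absolute_values_def by (auto intro!: exI[of _ "1 / c"])
  qed
  show "trans ?r"
  proof (rule transI)
    fix u v w :: "'k \<Rightarrow> real" assume "(u, v) \<in> equivalent_absolute_values" "(v, w) \<in> equivalent_absolute_values"
    then obtain c d where c: "u \<in> nontrivial_absolute_values" "w \<in> nontrivial_absolute_values" "c > 0" "d > 0"
      "\<forall>x. v x = u x powr c" "\<forall>x. w x = v x powr d"
      by (auto simp: equivalent_absolute_values_def)
    then have "\<forall>x. w x = u x powr (c * d)" by (simp add: powr_powr)
    then show "(u, w) \<in> equivalent_absolute_values"
      using c unfolding equivalent_absolute_values_def by (auto intro!: exI[of _ "c * d"])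
  qed
qed

lemma places_eq: "places = place_of ` nontrivial_absolute_values"
  by (auto simp: places_def quotient_def place_of_def)

lemma place_of_self: "v \<in> nontrivial_absolute_values \<Longrightarrow> v \<in> place_of v"
  unfolding place_of_def by (rule equiv_class_self[OF equiv_EAV])

lemma place_of_eqI:
  assumes "v \<in> nontrivial_absolute_values" "w \<in> place_of v"
  shows "place_of w = place_of v" "w \<in> nontrivial_absolute_values"
proof -
  have "(v, w) \<in> equivalent_absolute_values" using assms(2) by (simp add: place_of_def)
  then show "place_of w = place_of v" "w \<in> nontrivial_absolute_values"
    unfolding place_of_def using equiv_class_eq[OF equiv_EAV, of v w] by (auto simp: equivalent_absolute_values_def)
qed

lemma ultrametric_powr:
  assumes "v \<in> nontrivial_absolute_values" "ultrametric v" "c > 0"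
  shows "ultrametric (\<lambda>x. v x powr c)"
proof (intro allI)
  fix x y
  have "v (x + y) powr c \<le> max (v x) (v y) powr c"
    using assms NAV_nonneg[OF assms(1)] by (intro powr_mono2) auto
  then show "v (x + y) powr c \<le> max (v x powr c) (v y powr c)"
    using assms(3) NAV_nonneg[OF assms(1)] by (simp add: max_powr)
qed

lemma finite_places_eq: "finite_places = place_of ` {v \<in> nontrivial_absolute_values. ultrametric v}"
proof (intro subset_antisym subsetI)
  fix p :: "'a place" assume "p \<in> finite_places"
  then obtain v where v: "v \<in> nontrivial_absolute_values" "p = place_of v" "\<forall>w\<in>p. ultrametric w"
    by (auto simp: finite_places_def places_eq)
  then have "ultrametric v" using place_of_self[OF v(1)] by blast
  with v show "p \<in> place_of ` {v \<in> nontrivial_absolute_values. ultrametric v}" by blast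
next
  fix p :: "'a place" assume "p \<in> place_of ` {v \<in> nontrivial_absolute_values. ultrametric v}"
  then obtain v where v: "v \<in> nontrivial_absolute_values" "ultrametric v" "p = place_of v" by blast
  have "ultrametric w" if "w \<in> p" for w
    using that ultrametric_powr[OF v(1,2)] unfolding v(3) mem_place_of[OF v(1)] by auto
  then show "p \<in> finite_places" using v by (auto simp: finite_places_def places_eq)
qed

lemma archimedean_places_eq: "archimedean_places = place_of ` {v \<in> nontrivial_absolute_values. \<not> ultrametric v}"
proof (intro subset_antisym subsetI)
  fix p :: "'a place" assume p: "p \<in> archimedean_places"
  then obtain w where w: "p \<in> places" "w \<in> p" "\<not> ultrametric w" by (auto simp: archimedean_places_def finite_places_def)
  then obtain v where "v \<in> nontrivial_absolute_values" "p = place_of v" by (auto simp: places_eq)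
  then show "p \<in> place_of ` {v \<in> nontrivial_absolute_values. \<not> ultrametric v}"
    using w place_of_eqI[of v w] by blast
next
  fix p :: "'a place" assume "p \<in> place_of ` {v \<in> nontrivial_absolute_values. \<not> ultrametric v}"
  then obtain v where "v \<in> nontrivial_absolute_values" "\<not> ultrametric v" "p = place_of v" by blast
  then show "p \<in> archimedean_places"
    using place_of_self[of v] by (auto simp: archimedean_places_def finite_places_def places_eq)
qed

subsection \<open>Archimedean places\<close>

definition emb_abs :: "'k::number_field emb \<Rightarrow> 'k \<Rightarrow> real" where
  "emb_abs \<sigma> x = cmod (Rep_emb \<sigma> x)"

definition arch_place :: "'k::number_field emb \<Rightarrow> 'k place" where
  "arch_place \<sigma> = place_of (emb_abs \<sigma>)"

lemma emb_abs_2: "emb_abs \<sigma> 2 = 2"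
proof -
  have "Rep_emb \<sigma> (of_int 2) = of_int 2" by (rule Rep_emb_of_int)
  then show ?thesis by (simp add: emb_abs_def)
qed

lemma emb_abs_NAV: "emb_abs \<sigma> \<in> nontrivial_absolute_values"
proof -
  have "emb_abs \<sigma> (x + y) \<le> 2 * max (emb_abs \<sigma> x) (emb_abs \<sigma> y)" for x y
  proof -
    have "emb_abs \<sigma> (x + y) \<le> emb_abs \<sigma> x + emb_abs \<sigma> y" by (simp add: emb_abs_def emb.hom_add norm_triangle_ineq)
    then show ?thesis by linarith
  qed
  then have "absolute_value (emb_abs \<sigma>)"
    unfolding absolute_value_def by (auto simp: emb_abs_def emb.hom_mult norm_mult)
  then show ?thesis using emb_abs_2[of \<sigma>] by (auto simp: nontrivial_absolute_values_def intro!: exI[of _ 2])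
qed

lemma emb_abs_not_ultrametric: "\<not> ultrametric (emb_abs \<sigma>)"
proof
  assume "ultrametric (emb_abs \<sigma>)"
  then have "emb_abs \<sigma> (1 + 1) \<le> max (emb_abs \<sigma> 1) (emb_abs \<sigma> 1)" by blast
  then show False using emb_abs_2[of \<sigma>] by (simp add: emb_abs_def)
qed

lemma emb_abs_cnj: "emb_abs (cnj_emb \<sigma>) = emb_abs \<sigma>"
  by (simp add: emb_abs_def fun_eq_iff)

lemma arch_place_cnj: "arch_place (cnj_emb \<sigma>) = arch_place \<sigma>"
  by (simp add: arch_place_def emb_abs_cnj)

lemma range_arch_place: "range arch_place = (archimedean_places :: 'k::number_field place set)"
proof (intro subset_antisym subsetI)
  fix p :: "'k place" assume "p \<in> archimedean_places"
  then obtain v where v: "v \<in> nontrivial_absolute_values" "\<not> ultrametric v" "p = place_of v"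
    by (auto simp: archimedean_places_eq)
  then obtain C where "weak_abs v C" using weak_absI by (auto simp: nontrivial_absolute_values_def)
  then interpret weak_abs v C .
  obtain \<sigma> c where "c > 0" "\<And>x. v x = cmod (Rep_emb \<sigma> x) powr c" using ostrowski v(2) by blast
  then have "v \<in> place_of (emb_abs \<sigma>)" unfolding mem_place_of[OF emb_abs_NAV] emb_abs_def by blast
  then have "p = arch_place \<sigma>" using place_of_eqI(1)[OF emb_abs_NAV] v(3) by (simp add: arch_place_def)
  then show "p \<in> range arch_place" by blast
next
  fix p :: "'k place" assume "p \<in> range arch_place"
  then obtain \<sigma> where p: "p = place_of (emb_abs \<sigma>)" by (auto simp: arch_place_def)
  show "p \<in> archimedean_places" unfolding archimedean_places_eq p
    using emb_abs_NAV[of \<sigma>] emb_abs_not_ultrametric[of \<sigma>] by (intro imageI) blast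
qed

lemma two_powr_eq_iff: "2 powr c = (2::real) powr d \<longleftrightarrow> c = d"
  by (auto simp: powr_inj)

text \<open>The absolute values of x and x + 1 determine the real part, so imaginary parts agree up
  to sign. The sign cannot vary with x, as K would be the union of two proper additive
  subgroups.\<close>

lemma emb_eq_or_cnj:
  assumes eq: "\<And>x. cmod (Rep_emb \<tau> x) = cmod (Rep_emb \<sigma> x)"
  shows "\<tau> = \<sigma> \<or> \<tau> = cnj_emb \<sigma>"
proof -
  have Re: "Re (Rep_emb \<tau> x) = Re (Rep_emb \<sigma> x)" for x
  proof -
    have sq: "(cmod (Rep_emb \<tau> y))\<^sup>2 = (cmod (Rep_emb \<sigma> y))\<^sup>2" for y by (simp add: eq)
    have "(Re (Rep_emb \<tau> x) + 1)\<^sup>2 - (Re (Rep_emb \<sigma> x) + 1)\<^sup>2 = (Re (Rep_emb \<tau> x))\<^sup>2 - (Re (Rep_emb \<sigma> x))\<^sup>2"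
      using sq[of x] sq[of "x + 1"] unfolding cmod_power2 by (simp add: emb.hom_add)
    then show ?thesis by (simp add: power2_sum)
  qed
  have Im: "Im (Rep_emb \<tau> x) = Im (Rep_emb \<sigma> x) \<or> Im (Rep_emb \<tau> x) = - Im (Rep_emb \<sigma> x)" for x
  proof -
    have "(Im (Rep_emb \<tau> x))\<^sup>2 = (Im (Rep_emb \<sigma> x))\<^sup>2"
      using arg_cong[OF eq[of x], of power2] Re[of x] by (simp add: cmod_power2)
    then show ?thesis by (simp add: power2_eq_iff)
  qed
  show ?thesis
  proof (rule ccontr)
    assume "\<not> ?thesis"
    then obtain a b where a: "Rep_emb \<tau> a \<noteq> Rep_emb \<sigma> a" and b: "Rep_emb \<tau> b \<noteq> Rep_emb (cnj_emb \<sigma>) b"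
      using emb_eqI[of \<tau> \<sigma>] emb_eqI[of \<tau> "cnj_emb \<sigma>"] by blast
    have "Im (Rep_emb \<tau> a) \<noteq> Im (Rep_emb \<sigma> a)" "Im (Rep_emb \<tau> b) \<noteq> - Im (Rep_emb \<sigma> b)"
      using a b Re by (auto simp: complex_eq_iff)
    then show False using Im[of a] Im[of b] Im[of "a + b"] by (auto simp: emb.hom_add)
  qed
qed

lemma arch_place_eq_iff: "arch_place \<tau> = arch_place \<sigma> \<longleftrightarrow> \<tau> = \<sigma> \<or> \<tau> = cnj_emb \<sigma>"
proof
  assume "arch_place \<tau> = arch_place \<sigma>"
  then have "emb_abs \<tau> \<in> place_of (emb_abs \<sigma>)" using place_of_self[OF emb_abs_NAV] by (auto simp: arch_place_def)
  then obtain c where c: "c > 0" "emb_abs \<tau> = (\<lambda>x. emb_abs \<sigma> x powr c)" unfolding mem_place_of[OF emb_abs_NAV] by blast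
  have "(2::real) powr c = 2 powr 1" using fun_cong[OF c(2), of 2] by (simp add: emb_abs_2)
  then have "c = 1" unfolding two_powr_eq_iff .
  then have "emb_abs \<tau> x = emb_abs \<sigma> x" for x using fun_cong[OF c(2), of x] by (simp add: emb_abs_def)
  then show "\<tau> = \<sigma> \<or> \<tau> = cnj_emb \<sigma>" by (intro emb_eq_or_cnj) (simp add: emb_abs_def)
qed (auto simp: arch_place_cnj)

lemma real_emb_iff: "\<sigma> \<in> real_embs \<longleftrightarrow> range (Rep_emb \<sigma>) \<subseteq> \<real>"
proof
  assume "range (Rep_emb \<sigma>) \<subseteq> \<real>"
  then have "Rep_emb \<sigma> x \<in> \<real>" for x by blast
  then have "Rep_emb (cnj_emb \<sigma>) x = Rep_emb \<sigma> x" for x unfolding Rep_cnj_emb by (simp only: Reals_cnj_iff)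
  then show "\<sigma> \<in> real_embs" unfolding real_embs_def by (auto intro: emb_eqI)
qed (auto simp: complex_is_Real_iff Im_real_emb)

lemma real_places_eq: "real_places = arch_place ` (real_embs :: 'k::number_field emb set)"
proof (intro subset_antisym subsetI)
  fix p :: "'k place" assume "p \<in> real_places"
  then obtain s :: "'k \<Rightarrow> real" where s: "p \<in> archimedean_places" "field_hom s" "(\<lambda>x. \<bar>s x\<bar>) \<in> p"
    by (auto simp: real_places_def)
  interpret s: field_hom s by fact
  have "field_hom (\<lambda>x. complex_of_real (s x))" by unfold_locales (simp_all add: s.hom_add s.hom_mult)
  then have rep: "Rep_emb (Abs_emb (\<lambda>x. complex_of_real (s x))) = (\<lambda>x. complex_of_real (s x))"
    by (intro Abs_emb_inverse) (simp add: embeddings_def)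
  define \<sigma> where "\<sigma> = Abs_emb (\<lambda>x. complex_of_real (s x))"
  have "\<sigma> \<in> real_embs" unfolding real_emb_iff \<sigma>_def rep by auto
  moreover have "(\<lambda>x. \<bar>s x\<bar>) = emb_abs \<sigma>" by (simp add: fun_eq_iff emb_abs_def \<sigma>_def rep)
  moreover obtain v where "v \<in> nontrivial_absolute_values" "p = place_of v" using s(1) by (auto simp: archimedean_places_eq)
  ultimately show "p \<in> arch_place ` real_embs" using s(3) place_of_eqI(1)[of v "emb_abs \<sigma>"] by (auto simp: arch_place_def)
next
  fix p :: "'k place" assume "p \<in> arch_place ` real_embs"
  then obtain \<sigma> where \<sigma>: "\<sigma> \<in> real_embs" "p = arch_place \<sigma>" by blast
  have h: "field_hom (\<lambda>x. Re (Rep_emb \<sigma> x))"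
    by unfold_locales (simp_all add: emb.hom_add emb.hom_mult Im_real_emb[OF \<sigma>(1)])
  have "(\<lambda>x. \<bar>Re (Rep_emb \<sigma> x)\<bar>) = emb_abs \<sigma>"
    by (simp add: fun_eq_iff emb_abs_def cmod_def Im_real_emb[OF \<sigma>(1)])
  then have "(\<lambda>x. \<bar>Re (Rep_emb \<sigma> x)\<bar>) \<in> p" using place_of_self[OF emb_abs_NAV] \<sigma>(2) by (simp add: arch_place_def)
  moreover have "p \<in> archimedean_places" using \<sigma>(2) range_arch_place by blast
  ultimately show "p \<in> real_places" using h by (auto simp: real_places_def)
qed

lemma complex_places_eq: "complex_places = arch_place ` (cplx_embs :: 'k::number_field emb set)"
proof (intro subset_antisym subsetI)
  fix p :: "'k place" assume "p \<in> complex_places"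
  then obtain s :: "'k \<Rightarrow> complex" where s: "p \<in> archimedean_places" "field_hom s" "\<not> range s \<subseteq> \<real>" "(\<lambda>x. cmod (s x)) \<in> p"
    by (auto simp: complex_places_def)
  have rep: "Rep_emb (Abs_emb s) = s" using s(2) by (intro Abs_emb_inverse) (simp add: embeddings_def)
  define \<sigma> where "\<sigma> = Abs_emb s"
  have "\<sigma> \<notin> real_embs" unfolding real_emb_iff \<sigma>_def rep by (rule s(3))
  then consider "\<sigma> \<in> cplx_embs" | \<tau> where "\<tau> \<in> cplx_embs" "\<sigma> = cnj_emb \<tau>" using UNIV_emb_split(1) by blast
  then have "arch_place \<sigma> \<in> arch_place ` cplx_embs" by cases (auto simp: arch_place_cnj)
  moreover have "(\<lambda>x. cmod (s x)) = emb_abs \<sigma>" by (simp add: fun_eq_iff emb_abs_def \<sigma>_def rep)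
  moreover obtain v where "v \<in> nontrivial_absolute_values" "p = place_of v" using s(1) by (auto simp: archimedean_places_eq)
  ultimately show "p \<in> arch_place ` cplx_embs" using s(4) place_of_eqI(1)[of v "emb_abs \<sigma>"] by (auto simp: arch_place_def)
next
  fix p :: "'k place" assume "p \<in> arch_place ` cplx_embs"
  then obtain \<sigma> where \<sigma>: "\<sigma> \<in> cplx_embs" "p = arch_place \<sigma>" by blast
  have "\<not> range (Rep_emb \<sigma>) \<subseteq> \<real>" using \<sigma>(1) UNIV_emb_split(2) unfolding real_emb_iff[symmetric] by blast
  moreover have "(\<lambda>x. cmod (Rep_emb \<sigma> x)) \<in> p"
    using place_of_self[OF emb_abs_NAV, of \<sigma>] \<sigma>(2) by (simp add: arch_place_def emb_abs_def[abs_def])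
  moreover have "p \<in> archimedean_places" using \<sigma>(2) range_arch_place by blast
  ultimately show "p \<in> complex_places" using field_hom_Rep_emb[of \<sigma>] unfolding complex_places_def by blast
qed

lemma inj_arch_place: "inj_on arch_place (real_embs \<union> cplx_embs)"
proof (rule inj_onI)
  fix \<sigma> \<tau> :: "'a emb"
  assume "\<sigma> \<in> real_embs \<union> cplx_embs" "\<tau> \<in> real_embs \<union> cplx_embs" "arch_place \<sigma> = arch_place \<tau>"
  then show "\<sigma> = \<tau>" unfolding arch_place_eq_iff by (auto simp: real_embs_def cplx_embs_def)
qed

lemma archimedean_places_reps: "archimedean_places = arch_place ` (real_embs \<union> cplx_embs :: 'k::number_field emb set)"
proof -
  have "arch_place ` cnj_emb ` (cplx_embs :: 'k emb set) = arch_place ` cplx_embs"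
    by (simp add: image_image arch_place_cnj)
  then show ?thesis unfolding range_arch_place[symmetric] UNIV_emb_split(1) image_Un by blast
qed

lemma card_complex_places: "card (complex_places :: 'k::number_field place set) = card (cplx_embs :: 'k emb set)"
  unfolding complex_places_eq by (rule card_image) (rule inj_on_subset[OF inj_arch_place], blast)

text \<open>The members of a place are powers of one absolute value, and the value at 2 fixes the
  exponent; so the description in \<open>normalized_abs\<close> is unique.\<close>

lemma normalized_abs_arch:
  fixes p :: "'k::number_field place"
  assumes "p \<in> archimedean_places" "w \<in> p" "(p \<in> real_places \<longrightarrow> w 2 = 2) \<and> (p \<in> complex_places \<longrightarrow> w 2 = 4)"
  shows "normalized_abs p = w"
  unfolding normalized_abs_def
proof (rule the_equality)
  have nf: "p \<notin> finite_places" using assms(1) by (simp add: archimedean_places_def)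
  show "w \<in> p \<and> (p \<in> real_places \<longrightarrow> w 2 = 2) \<and> (p \<in> complex_places \<longrightarrow> w 2 = 4) \<and>
    (p \<in> finite_places \<longrightarrow> w ` (- {0}) = range (\<lambda>k. real (place_norm p) powi k))"
    using assms nf by blast
  fix u assume u: "u \<in> p \<and> (p \<in> real_places \<longrightarrow> u 2 = 2) \<and> (p \<in> complex_places \<longrightarrow> u 2 = 4) \<and>
    (p \<in> finite_places \<longrightarrow> u ` (- {0}) = range (\<lambda>k. real (place_norm p) powi k))"
  obtain \<sigma> where \<sigma>: "p = arch_place \<sigma>" using assms(1) range_arch_place by blast
  obtain c where c: "u = (\<lambda>x. emb_abs \<sigma> x powr c)"
    by (rule mem_place_ofE[OF u[THEN conjunct1, unfolded \<sigma> arch_place_def] emb_abs_NAV])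
  obtain d where d: "w = (\<lambda>x. emb_abs \<sigma> x powr d)"
    by (rule mem_place_ofE[OF assms(2)[unfolded \<sigma> arch_place_def] emb_abs_NAV])
  have "p \<in> real_places \<or> p \<in> complex_places"
    using assms(1) unfolding archimedean_places_reps real_places_eq complex_places_eq by blast
  then have "u 2 = w 2" using u assms(3) by auto
  then have "c = d" unfolding c d emb_abs_2 two_powr_eq_iff .
  then show "u = w" by (simp add: c d)
qed

lemma normalized_abs_real: "\<sigma> \<in> real_embs \<Longrightarrow> normalized_abs (arch_place \<sigma>) x = cmod (Rep_emb \<sigma> x)"
proof -
  assume \<sigma>: "\<sigma> \<in> real_embs"
  have "arch_place \<sigma> \<notin> complex_places"
  proof
    assume "arch_place \<sigma> \<in> complex_places"
    then obtain \<tau> where "\<tau> \<in> cplx_embs" "arch_place \<sigma> = arch_place \<tau>" by (auto simp: complex_places_eq)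
    then show False using \<sigma> unfolding arch_place_eq_iff by (auto simp: real_embs_def cplx_embs_def)
  qed
  then have "normalized_abs (arch_place \<sigma>) = emb_abs \<sigma>"
    using range_arch_place place_of_self[OF emb_abs_NAV] emb_abs_2
    by (intro normalized_abs_arch) (auto simp: arch_place_def)
  then show ?thesis by (simp add: emb_abs_def)
qed

lemma normalized_abs_cplx: "\<sigma> \<in> cplx_embs \<Longrightarrow> normalized_abs (arch_place \<sigma>) x = (cmod (Rep_emb \<sigma> x))\<^sup>2"
proof -
  assume \<sigma>: "\<sigma> \<in> cplx_embs"
  have nr: "arch_place \<sigma> \<notin> real_places"
  proof
    assume "arch_place \<sigma> \<in> real_places"
    then obtain \<tau> where "\<tau> \<in> real_embs" "arch_place \<sigma> = arch_place \<tau>" by (auto simp: real_places_eq)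
    then show False using \<sigma> unfolding arch_place_eq_iff by (auto simp: real_embs_def cplx_embs_def)
  qed
  have sq: "(\<lambda>x. (emb_abs \<sigma> x)\<^sup>2) = (\<lambda>x. emb_abs \<sigma> x powr 2)"
    by (simp add: emb_abs_def fun_eq_iff)
  have "normalized_abs (arch_place \<sigma>) = (\<lambda>x. (emb_abs \<sigma> x)\<^sup>2)"
  proof (rule normalized_abs_arch)
    show "arch_place \<sigma> \<in> archimedean_places" using range_arch_place by blast
    show "(\<lambda>x. (emb_abs \<sigma> x)\<^sup>2) \<in> arch_place \<sigma>" unfolding arch_place_def mem_place_of[OF emb_abs_NAV] sq
      by (intro exI[of _ 2]) simp
  qed (use nr emb_abs_2[of \<sigma>] in simp)
  then show ?thesis by (simp add: emb_abs_def)
qed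

subsection \<open>Finite places\<close>

definition prime_abs :: "'k::number_field set \<Rightarrow> 'k \<Rightarrow> real" where
  "prime_abs P x = (if x = 0 then 0 else real (idnorm P) powi (- ord P x))"

definition prime_place :: "'k::number_field set \<Rightarrow> 'k place" where
  "prime_place P = place_of (prime_abs P)"

lemma prime_abs_nonneg: "prime_abs P x \<ge> 0"
  by (simp add: prime_abs_def)

lemma powi_mono: "(a::real) > 1 \<Longrightarrow> a powi i \<le> a powi j \<longleftrightarrow> i \<le> j"
  by (meson linorder_not_le power_int_increasing power_int_strict_increasing order.strict_implies_order less_imp_le)

lemma prime_abs_le_iff:
  assumes P: "P \<in> primes" shows "prime_abs P x \<le> real (idnorm P) powi (- k) \<longleftrightarrow> ord_ge P k x"
  using powi_mono[of "real (idnorm P)" "- ord P x" "- k"] idnorm_gt_1[OF P]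
  by (auto simp: prime_abs_def ord_ge_def)

lemma prime_abs_mult: "P \<in> primes \<Longrightarrow> prime_abs P (x * y) = prime_abs P x * prime_abs P y"
  using idnorm_gt_1[of P] by (simp add: prime_abs_def ord_mult power_int_add power_int_diff power_int_minus field_simps)

lemma prime_abs_eq_0: "P \<in> primes \<Longrightarrow> prime_abs P x = 0 \<longleftrightarrow> x = 0"
  using idnorm_gt_1[of P] by (simp add: prime_abs_def)

lemma prime_abs_ultrametric: assumes P: "P \<in> primes" shows "ultrametric (prime_abs P)"
proof (intro allI)
  have *: "prime_abs P (x + y) \<le> prime_abs P y" if le: "prime_abs P x \<le> prime_abs P y" for x y
  proof (cases "y = 0")
    case True
    then have "x = 0" using le prime_abs_nonneg[of P x] prime_abs_eq_0[OF P] by (metis order_antisym)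
    with True show ?thesis by simp
  next
    case False
    then have y: "prime_abs P y = real (idnorm P) powi (- ord P y)" by (simp add: prime_abs_def)
    have "ord_ge P (ord P y) x" using le unfolding y prime_abs_le_iff[OF P] .
    moreover have "ord_ge P (ord P y) y" by (simp add: ord_ge_def)
    ultimately show ?thesis unfolding y prime_abs_le_iff[OF P] by (rule ord_ge_add[OF P])
  qed
  fix x y
  show "prime_abs P (x + y) \<le> max (prime_abs P x) (prime_abs P y)"
    using *[of x y] *[of y x] by (cases "prime_abs P x \<le> prime_abs P y") (auto simp: add.commute max_def)
qed

lemma prime_abs_prime_inv: "P \<in> primes \<Longrightarrow> prime_abs P (prime_inv P) = real (idnorm P)"
  using prime_inv(3)[of P] by (simp add: prime_abs_def ord_prime_inv)

lemma prime_abs_NAV: assumes P: "P \<in> primes" shows "prime_abs P \<in> nontrivial_absolute_values"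
proof -
  have "\<exists>C. \<forall>x y. prime_abs P (x + y) \<le> C * max (prime_abs P x) (prime_abs P y)"
    using prime_abs_ultrametric[OF P] by (intro exI[of _ 1]) simp
  then have "absolute_value (prime_abs P)"
    unfolding absolute_value_def using prime_abs_nonneg prime_abs_eq_0[OF P] prime_abs_mult[OF P] by blast
  moreover have "prime_abs P (prime_inv P) \<noteq> 1" using prime_abs_prime_inv[OF P] idnorm_gt_1[OF P] by simp
  ultimately show ?thesis using prime_inv(3)[OF P] by (auto simp: nontrivial_absolute_values_def)
qed

text \<open>Integers have v \<le> 1 by their monic equations, and those with v < 1 form a prime P.
  Up to factors with v = 1, every x \<noteq> 0 is a power of \<open>prime_inv P\<close>, so v is
  determined by one value.\<close>

lemma ultrametric_prime:
  fixes v :: "'k::number_field \<Rightarrow> real"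
  assumes v: "v \<in> nontrivial_absolute_values" and ultra: "ultrametric v"
  obtains P c where "P \<in> primes" "c > 0" "v = (\<lambda>x. prime_abs P x powr c)"
proof -
  obtain C where "weak_abs v C" using weak_absI v by (auto simp: nontrivial_absolute_values_def)
  then interpret v: weak_abs v C .
  have sum: "v (\<Sum>i\<in>I. f i) \<le> B" if "\<And>i. i \<in> I \<Longrightarrow> v (f i) \<le> B" "B \<ge> 0" "finite I" for I :: "nat set" and f B
    using that(3,1)
  proof (induction I)
    case empty
    then show ?case using that(2) v.eq_0_iff[of 0] by simp
  next
    case (insert i I)
    then have "v (f i + sum f I) \<le> max (v (f i)) (v (sum f I))" using ultra by blast
    also have "\<dots> \<le> B" using insert by auto
    finally show ?case using insert.hyps by simp
  qed
  have int: "v (of_int k) \<le> 1" for k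
  proof -
    have nat: "v (of_nat n) \<le> 1" for n
    proof (induction n)
      case (Suc n)
      have "v (1 + of_nat n) \<le> max (v 1) (v (of_nat n))" using ultra by blast
      with Suc show ?case by (simp add: v.one)
    qed (use v.eq_0_iff[of 0] in simp)
    show ?thesis using nat[of "nat \<bar>k\<bar>"] v.uminus[of "of_int k"] by (cases "k \<ge> 0") auto
  qed
  have le1: "v x \<le> 1" if x: "x \<in> OK" for x
  proof (rule ccontr)
    assume "\<not> v x \<le> 1"
    then have gt: "v x > 1" by simp
    obtain m :: nat and a where m: "m > 0" "\<And>i. i < m \<Longrightarrow> x * x ^ i = (\<Sum>j<m. of_int (a i j) * x ^ j)"
      using power_reduction x unfolding ring_of_integers_def by blast
    then obtain l where l: "m = Suc l" by (cases m) auto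
    have "v x * v x ^ l = v (\<Sum>j<m. of_int (a l j) * x ^ j)" using m(2)[of l] l by (simp flip: v.power v.mult)
    also have "\<dots> \<le> v x ^ l"
    proof (rule sum)
      fix j assume "j \<in> {..<m}"
      then have "v x ^ j \<le> v x ^ l" using gt l by (intro power_increasing) auto
      then show "v (of_int (a l j) * x ^ j) \<le> v x ^ l"
        using mult_mono[OF int[of "a l j"], of "v x ^ j" "v x ^ l"] v.nonneg by (simp add: v.mult v.power)
    qed (use gt in auto)
    finally show False using gt by simp
  qed
  define P where "P = {x \<in> OK. v x < 1}"
  have oP: "oideal P"
    unfolding oideal_def P_def
  proof (intro conjI ballI subsetI)
    fix x y :: 'k assume xy: "x \<in> {x \<in> OK. v x < 1}" "y \<in> {x \<in> OK. v x < 1}"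
    have "v (x + y) \<le> max (v x) (v y)" using ultra by blast
    with xy show "x + y \<in> {x \<in> OK. v x < 1}" by (auto intro: ring_of_integers_closed)
  next
    fix a x :: 'k assume "a \<in> OK" "x \<in> {x \<in> OK. v x < 1}"
    then show "a * x \<in> {x \<in> OK. v x < 1}"
      using le1[of a] mult_left_mono[of "v a" 1 "v x"] v.nonneg[of x]
      by (auto simp: v.mult mult.commute intro: ring_of_integers_closed)
  qed (use ring_of_integers_closed(1) v.eq_0_iff[of 0] in auto)
  have eq1: "v x = 1" if "x \<in> OK" "x \<notin> P" for x using le1[OF that(1)] that by (auto simp: P_def)
  have "\<exists>a\<in>P. a \<noteq> 0"
  proof (rule ccontr)
    assume no: "\<not> ?thesis"
    have "v x = 1" if "x \<noteq> 0" for x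
    proof -
      obtain m :: int where m: "m > 0" "of_int m * x \<in> OK" by (rule integral_multiple)
      have "v (of_int m * x) = 1" using no m that by (intro eq1) auto
      moreover have "v (of_int m) = 1" using no m(1) ring_of_integers_closed(3) by (intro eq1) auto
      ultimately show ?thesis by (simp add: v.mult)
    qed
    then show False using v by (auto simp: nontrivial_absolute_values_def)
  qed
  then obtain a where a: "a \<in> P" "a \<noteq> 0" by blast
  \<comment> \<open>The integers modulo P are finite, so two powers x^i and x^j agree modulo P.
    Cancelling x^i, which has value 1, leaves x^(j-i) congruent to 1.\<close>
  have "\<exists>u\<in>OK. x * u - 1 \<in> P" if x: "x \<in> OK - P" for x
  proof -
    have xO: "x \<in> OK" using x by simp
    have fin: "finite (range (\<lambda>i::nat. (+) (x ^ i) ` P))"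
      by (rule finite_subset[OF _ finite_cosets_ideal[OF oP a]])
        (use xO in \<open>auto simp: cosets_def intro!: imageI ring_of_integers_closed\<close>)
    then have "\<not> inj (\<lambda>i::nat. (+) (x ^ i) ` P)" using finite_imageD infinite_UNIV_nat by blast
    then obtain i j where ij: "i < j" "(+) (x ^ i) ` P = (+) (x ^ j) ` P" unfolding inj_def by (metis nat_neq_iff)
    have "x ^ j - x ^ i \<in> P" using ij(2) coset_eq_iff[OF add_subgroup_oideal[OF oP], of "x ^ j" "x ^ i"] by simp
    moreover obtain l where l: "j = Suc (i + l)" using less_imp_Suc_add[OF ij(1)] by blast
    have "x ^ j - x ^ i = x ^ i * (x * x ^ l - 1)" by (simp add: l power_add algebra_simps)
    ultimately have "v (x ^ i * (x * x ^ l - 1)) < 1" by (simp add: P_def)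
    then have "v (x * x ^ l - 1) < 1" using eq1[of x] x by (simp add: v.mult v.power)
    moreover have "x ^ l \<in> OK" "x * x ^ l - 1 \<in> OK" using xO by (auto intro!: ring_of_integers_closed)
    ultimately show ?thesis unfolding P_def by blast
  qed
  moreover have "1 \<notin> P" by (simp add: P_def v.one)
  ultimately have P: "P \<in> primes" unfolding primes_def using oP a by blast
  define T where "T = v (prime_inv P)"
  have T1: "T > 1"
  proof -
    obtain \<pi> c where \<pi>: "\<pi> \<in> P" "c \<in> OK" "c \<notin> P" "prime_inv P * \<pi> = c" by (rule uniformizer[OF P])
    have "T * v \<pi> = 1" using eq1[OF \<pi>(2,3)] by (simp add: T_def flip: \<pi>(4) v.mult)
    moreover have "v \<pi> < 1" using \<pi>(1) by (simp add: P_def)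
    moreover have "T > 0" unfolding T_def using prime_inv(3)[OF P] by (rule v.pos)
    ultimately show ?thesis by (metis less_eq_real_def linorder_not_less mult.commute mult_le_cancel_left1 mult_left_le not_less_iff_gr_or_eq)
  qed
  have vT: "v x = T powi (- ord P x)" if x0: "x \<noteq> 0" for x
  proof -
    obtain w w' where w: "w \<in> OK" "w \<notin> P" "w' \<in> OK" "w' \<notin> P" "w * prime_inv P powi ord P x * x = w'"
      using has_ord_ord[OF P x0] unfolding has_ord_def by blast
    have vp: "v (prime_inv P powi k) = T powi k" for k
      by (simp add: power_int_def T_def v.power v.inverse)
    have "T powi ord P x * v x = 1" using eq1[OF w(3,4)] eq1[OF w(1,2)] by (simp add: v.mult vp flip: w(5))
    then show ?thesis using T1 by (simp add: power_int_minus inverse_unique inverse_eq_iff_eq)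
  qed
  define N where "N = real (idnorm P)"
  have N1: "N > 1" using idnorm_gt_1[OF P] by (simp add: N_def)
  define c where "c = ln T / ln N"
  have c: "c > 0" using T1 N1 by (simp add: c_def)
  have NT: "N powr c = T" using T1 N1 by (simp add: c_def powr_def)
  have "v x = prime_abs P x powr c" for x
  proof (cases "x = 0")
    case True
    then show ?thesis using v.eq_0_iff[of 0] by (simp add: prime_abs_def)
  next
    case False
    have "prime_abs P x powr c = (N powr real_of_int (- ord P x)) powr c"
      using False N1 by (simp add: prime_abs_def N_def powr_real_of_int' power_int_minus powr_minus)
    also have "\<dots> = (N powr c) powr real_of_int (- ord P x)" by (simp add: powr_powr mult.commute)
    also have "\<dots> = T powi (- ord P x)" unfolding NT using T1 by (subst powr_real_of_int') auto
    finally show ?thesis using vT[OF False] by simp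
  qed
  then show thesis using that[OF P c] by blast
qed

lemma finite_places_primes: "finite_places = prime_place ` primes"
proof (intro subset_antisym subsetI)
  fix p :: "'a place" assume "p \<in> finite_places"
  then obtain v where v: "v \<in> nontrivial_absolute_values" "ultrametric v" "p = place_of v" by (auto simp: finite_places_eq)
  obtain P c where P: "P \<in> primes" "c > 0" "v = (\<lambda>x. prime_abs P x powr c)" by (rule ultrametric_prime[OF v(1,2)])
  then have "v \<in> place_of (prime_abs P)" unfolding mem_place_of[OF prime_abs_NAV[OF P(1)]] by blast
  then have "p = prime_place P" using place_of_eqI(1)[OF prime_abs_NAV[OF P(1)]] v(3) by (simp add: prime_place_def)
  then show "p \<in> prime_place ` primes" using P(1) by blast
qed (auto simp: finite_places_eq prime_place_def intro!: imageI prime_abs_NAV prime_abs_ultrametric[rule_format])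

lemma powr_lt_1_iff: assumes "c > 0" "a \<ge> 0" shows "a powr c < 1 \<longleftrightarrow> a < (1::real)"
proof (cases "a < 1")
  case True
  then show ?thesis using powr_less_mono2[of c a 1] assms by simp
next
  case False
  then show ?thesis using powr_mono2[of c 1 a] assms by simp
qed

lemma powr_le_1_iff: assumes "c > 0" "a \<ge> 0" shows "a powr c \<le> 1 \<longleftrightarrow> a \<le> (1::real)"
proof (cases "a \<le> 1")
  case True
  then show ?thesis using powr_mono2[of c a 1] assms by simp
next
  case False
  then show ?thesis using powr_less_mono2[of c 1 a] assms by (simp add: not_le)
qed

lemma valuation_ring_prime:
  assumes P: "P \<in> primes" shows "valuation_ring (prime_place P) = {x. ord_ge P 0 x}"
proof -
  have "(\<forall>v\<in>prime_place P. v x \<le> 1) \<longleftrightarrow> prime_abs P x \<le> 1" for x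
  proof
    assume "prime_abs P x \<le> 1"
    then show "\<forall>v\<in>prime_place P. v x \<le> 1"
      unfolding prime_place_def Ball_def mem_place_of[OF prime_abs_NAV[OF P]]
      using powr_le_1_iff[OF _ prime_abs_nonneg, of _ P x] by auto
  qed (use place_of_self[OF prime_abs_NAV[OF P]] in \<open>auto simp: prime_place_def\<close>)
  then show ?thesis using prime_abs_le_iff[OF P, of _ 0] by (simp add: valuation_ring_def)
qed

lemma prime_abs_lt_1_iff: "P \<in> primes \<Longrightarrow> prime_abs P x < 1 \<longleftrightarrow> ord_ge P 1 x"
proof -
  assume P: "P \<in> primes"
  have N: "real (idnorm P) > 1" using idnorm_gt_1[OF P] by simp
  have "real (idnorm P) powi (- ord P x) < real (idnorm P) powi 0 \<longleftrightarrow> - ord P x < 0"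
    using powi_mono[OF N, of 0 "- ord P x"] by linarith
  then show ?thesis by (auto simp: prime_abs_def ord_ge_def)
qed

lemma valuation_ideal_prime:
  assumes P: "P \<in> primes" shows "valuation_ideal (prime_place P) = {x. ord_ge P 1 x}"
proof -
  have "(\<forall>v\<in>prime_place P. v x < 1) \<longleftrightarrow> prime_abs P x < 1" for x
  proof
    assume "prime_abs P x < 1"
    then show "\<forall>v\<in>prime_place P. v x < 1"
      unfolding prime_place_def Ball_def mem_place_of[OF prime_abs_NAV[OF P]]
      using powr_lt_1_iff[OF _ prime_abs_nonneg, of _ P x] by auto
  qed (use place_of_self[OF prime_abs_NAV[OF P]] in \<open>auto simp: prime_place_def\<close>)
  then show ?thesis using prime_abs_lt_1_iff[OF P] by (simp add: valuation_ideal_def)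
qed

lemma prime_of_place_prime: "P \<in> primes \<Longrightarrow> prime_of_place (prime_place P) = P"
  using ord_ge_1_OK[of P] oidealD(1)[OF primesD(1)[of P]]
  by (auto simp: prime_of_place_def valuation_ideal_prime)

lemma inj_prime_place: "inj_on prime_place primes"
  by (rule inj_on_inverseI[of _ prime_of_place]) (rule prime_of_place_prime)

text \<open>A denominator outside P can be inverted modulo P, so integers represent every residue
  class of the valuation ring.\<close>

lemma residue_representative:
  assumes P: "P \<in> primes" and r: "ord_ge P 0 r"
  obtains u where "u \<in> OK" "ord_ge P 1 (r - u)"
proof -
  obtain w where w: "w \<in> OK" "w \<notin> P" "w * r \<in> OK" using r by (auto simp: ord_ge_0_iff[OF P])
  obtain w1 where w1: "w1 \<in> OK" "w * w1 - 1 \<in> P" using primesD(4)[OF P w(1,2)] by blast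
  have "ord_ge P 1 (w * w1 - 1)" using ord_ge_1_OK[OF P oidealD(1)[OF primesD(1)[OF P] w1(2)]] w1(2) by simp
  then have "ord_ge P (0 + 1) (r * (w * w1 - 1))" by (rule ord_ge_mult[OF P r])
  then have "ord_ge P 1 (- (r * (w * w1 - 1)))" using ord_ge_uminus[OF P] by simp
  also have "- (r * (w * w1 - 1)) = r - w1 * (w * r)" by (simp add: algebra_simps)
  finally show thesis by (rule that[OF ring_of_integers_closed(6)[OF w1(1) w(3)]])
qed

text \<open>The integers already exhaust the residue field, and two of them are identified exactly
  when they agree modulo P.\<close>

lemma place_norm_prime:
  assumes P: "P \<in> primes" shows "place_norm (prime_place P) = idnorm P"
proof -
  define V M where "V = {x. ord_ge P 0 x}" and "M = {x. ord_ge P 1 x}"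
  define r where "r = {(x, y). x \<in> V \<and> y \<in> V \<and> x - y \<in> M}"
  have rc: "residue_classes (prime_place P) = V // r"
    by (simp add: residue_classes_def valuation_ring_prime[OF P] valuation_ideal_prime[OF P] V_def M_def r_def)
  have eq: "equiv V r"
  proof (rule equivI)
    show "r \<subseteq> V \<times> V" by (auto simp: r_def)
    show "refl_on V r" by (auto simp: refl_on_def r_def M_def ord_ge_def)
    show "sym r" unfolding r_def M_def sym_def using ord_ge_uminus[OF P, of 1] by force
    show "trans r"
    proof (rule transI)
      fix x y z assume "(x, y) \<in> r" "(y, z) \<in> r"
      then show "(x, z) \<in> r" using ord_ge_add[OF P, of 1 "x - y" "y - z"] by (auto simp: r_def M_def)
    qed
  qed
  have OV: "u \<in> V" if "u \<in> OK" for u using ord_ge_OK[OF P that] by (simp add: V_def)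
  have OM: "u \<in> M \<longleftrightarrow> u \<in> P" if "u \<in> OK" for u using ord_ge_1_OK[OF P that] by (simp add: M_def)
  note iffP = coset_eq_iff[OF add_subgroup_oideal[OF primesD(1)[OF P]]]
  have "\<forall>G\<in>cosets OK P. \<exists>u. u \<in> OK \<and> G = (+) u ` P" by (auto simp: cosets_def)
  from bchoice[OF this] obtain s where s: "\<forall>G\<in>cosets OK P. s G \<in> OK \<and> G = (+) (s G) ` P" by blast
  have "bij_betw (\<lambda>G. r `` {s G}) (cosets OK P) (V // r)"
  proof (rule bij_betwI')
    fix G H assume GH: "G \<in> cosets OK P" "H \<in> cosets OK P"
    then have sO: "s G \<in> OK" "s H \<in> OK" using s by auto
    have "(r `` {s G} = r `` {s H}) \<longleftrightarrow> (s G, s H) \<in> r"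
      by (rule eq_equiv_class_iff[OF eq]) (use sO OV in auto)
    also have "\<dots> \<longleftrightarrow> s G - s H \<in> P"
      using OM[OF ring_of_integers_closed(5)[OF sO]] OV sO by (auto simp: r_def)
    also have "\<dots> \<longleftrightarrow> G = H" using s GH by (auto simp flip: iffP)
    finally show "(r `` {s G} = r `` {s H}) = (G = H)" .
  next
    fix G assume "G \<in> cosets OK P"
    then show "r `` {s G} \<in> V // r" using s OV by (auto intro: quotientI)
  next
    fix Z assume "Z \<in> V // r"
    then obtain x where x: "x \<in> V" "Z = r `` {x}" by (auto elim: quotientE)
    obtain u where u: "u \<in> OK" "ord_ge P 1 (x - u)" using residue_representative[OF P] x(1) by (auto simp: V_def)
    define G where "G = (+) u ` P"
    have G: "G \<in> cosets OK P" using u by (auto simp: G_def cosets_def)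
    have "(+) u ` P = (+) (s G) ` P" using s G G_def by auto
    then have "u - s G \<in> P" by (simp only: iffP)
    then have "u - s G \<in> M" using OM[OF oidealD(1)[OF primesD(1)[OF P]]] by blast
    then have "x - s G \<in> M" using ord_ge_add[OF P u(2), of "u - s G"] by (simp add: M_def)
    then have "(x, s G) \<in> r" using x(1) s G OV by (auto simp: r_def)
    then have "Z = r `` {s G}" unfolding x(2) by (rule equiv_class_eq[OF eq])
    then show "\<exists>G\<in>cosets OK P. Z = r `` {s G}" using G by (rule bexI)
  qed
  then show ?thesis unfolding place_norm_def rc idnorm_def by (metis bij_betw_same_card)
qed

lemma prime_abs_image:
  assumes P: "P \<in> primes" shows "prime_abs P ` (- {0}) = range (\<lambda>k::int. real (idnorm P) powi k)"
proof (intro subset_antisym subsetI)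
  fix y assume "y \<in> range (\<lambda>k::int. real (idnorm P) powi k)"
  then obtain k where k: "y = real (idnorm P) powi k" by blast
  have "prime_inv P powi k \<noteq> 0" using prime_inv(3)[OF P] by simp
  moreover have "prime_abs P (prime_inv P powi k) = y"
    using prime_inv(3)[OF P] by (simp add: k prime_abs_def ord_power_int[OF P] ord_prime_inv[OF P])
  ultimately show "y \<in> prime_abs P ` (- {0})" by blast
qed (auto simp: prime_abs_def)

text \<open>Another member of the place has the value group N^(c \<int>). Equality with N^\<int>
  makes both c and 1/c integers, so the positive number c is 1.\<close>

lemma normalized_abs_prime:
  assumes P: "P \<in> primes" shows "normalized_abs (prime_place P) = prime_abs P"
  unfolding normalized_abs_def
proof (rule the_equality)
  have fin: "prime_place P \<in> finite_places" using P by (simp add: finite_places_primes)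
  then have na: "prime_place P \<notin> real_places" "prime_place P \<notin> complex_places"
    by (auto simp: real_places_def complex_places_def archimedean_places_def)
  show "prime_abs P \<in> prime_place P \<and> (prime_place P \<in> real_places \<longrightarrow> prime_abs P 2 = 2) \<and>
    (prime_place P \<in> complex_places \<longrightarrow> prime_abs P 2 = 4) \<and>
    (prime_place P \<in> finite_places \<longrightarrow> prime_abs P ` (- {0}) = range (\<lambda>k. real (place_norm (prime_place P)) powi k))"
    using na place_of_self[OF prime_abs_NAV[OF P]] prime_abs_image[OF P] by (simp add: prime_place_def[of P, symmetric] place_norm_prime[OF P])
  fix u assume u: "u \<in> prime_place P \<and> (prime_place P \<in> real_places \<longrightarrow> u 2 = 2) \<and>
    (prime_place P \<in> complex_places \<longrightarrow> u 2 = 4) \<and>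
    (prime_place P \<in> finite_places \<longrightarrow> u ` (- {0}) = range (\<lambda>k. real (place_norm (prime_place P)) powi k))"
  define N where "N = real (idnorm P)"
  have N: "N > 1" using idnorm_gt_1[OF P] by (simp add: N_def)
  obtain c where c: "c > 0" "u = (\<lambda>x. prime_abs P x powr c)"
    by (rule mem_place_ofE[OF u[THEN conjunct1, unfolded prime_place_def] prime_abs_NAV[OF P]])
  have img: "u ` (- {0}) = range (\<lambda>k::int. N powi k)" using u fin by (simp add: place_norm_prime[OF P] N_def)
  have pw: "N powi k = N powr of_int k" for k using N by (subst powr_real_of_int') auto
  have u_img: "u ` (- {0}) = range (\<lambda>k::int. N powr (c * of_int k))"
  proof -
    have "u ` (- {0}) = (\<lambda>y. y powr c) ` (prime_abs P ` (- {0}))" by (simp add: c(2) image_image)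
    then show ?thesis unfolding prime_abs_image[OF P] N_def[symmetric] by (simp add: image_image pw powr_powr mult.commute)
  qed
  have "N powr (c * of_int 1) \<in> range (\<lambda>k::int. N powi k)" unfolding img[symmetric] u_img by (rule rangeI)
  then obtain k :: int where "N powr c = N powr of_int k" by (auto simp: pw)
  then have ck: "c = of_int k" using N by (simp add: powr_inj)
  have "N powi 1 \<in> range (\<lambda>k::int. N powr (c * of_int k))" unfolding u_img[symmetric] img by (rule rangeI)
  then obtain l :: int where "N powr 1 = N powr (c * of_int l)" using N by auto
  then have "1 = c * of_int l" using N by (simp only: powr_inj)
  then have "of_int 1 = (of_int (k * l) :: real)" by (simp add: ck)
  then have "1 = k * l" by (simp only: of_int_eq_iff)
  moreover have "k > 0" using c(1) ck by simp
  ultimately have "k = 1" using pos_zmult_eq_1_iff by auto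
  then show "u = prime_abs P" using ck c(2) prime_abs_nonneg[of P] by (simp add: fun_eq_iff)
qed

section \<open>Heights and S-units\<close>

lemma places_split: "places = archimedean_places \<union> (finite_places :: 'k::field place set)"
  "archimedean_places \<inter> (finite_places :: 'k place set) = {}"
  by (auto simp: archimedean_places_def finite_places_def)

lemma max_1_square: "a \<ge> 0 \<Longrightarrow> max 1 (a\<^sup>2) = max 1 a * max 1 (a :: real)"
  using mult_mono[of a 1 a 1] mult_mono[of 1 a 1 a] by (cases "a \<le> 1") (auto simp: max_def power2_eq_square)

text \<open>The normalized absolute value at a complex place is a square and splits into one factor
  for each of the two conjugate embeddings.\<close>

lemma height_eq:
  fixes x :: "'k::number_field"
  assumes x: "x \<noteq> 0"
  shows "height x = (\<Prod>\<sigma>\<in>UNIV. max 1 (cmod (Rep_emb \<sigma> x))) * fin_norm (\<lambda>P. max 0 (- ord P x))"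
proof -
  define h where "h p = max 1 (normalized_abs p x)" for p
  define A :: "'k emb set" where "A = real_embs \<union> cplx_embs"
  define B :: "'k set set" where "B = {P \<in> primes. max 0 (- ord P x) \<noteq> 0}"
  have B: "B \<subseteq> primes" "finite B"
    unfolding B_def by (auto intro: finite_subset[OF _ finite_ord_nonzero[OF x]])
  have hB: "h (prime_place P) = real (idnorm P) powi max 0 (- ord P x)" if "P \<in> primes" for P
    using powi_mono[of "real (idnorm P)" 0 "- ord P x"] idnorm_gt_1[OF that] x
    by (auto simp: h_def normalized_abs_prime[OF that] prime_abs_def max_def)
  have hB1: "h (prime_place P) = 1" if "P \<in> primes" "P \<notin> B" for P
    using that by (simp add: hB B_def)
  have fp: "prime_place P \<in> finite_places" if "P \<in> primes" for P using that by (simp add: finite_places_primes)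
  have "height x = prod h {p \<in> places. h p \<noteq> 1}" by (simp add: height_def h_def)
  also have "\<dots> = prod h (arch_place ` A \<union> prime_place ` B)"
  proof (rule prod.mono_neutral_left)
    show "{p \<in> places. h p \<noteq> 1} \<subseteq> arch_place ` A \<union> prime_place ` B"
    proof
      fix p assume "p \<in> {p \<in> places. h p \<noteq> 1}"
      then have p: "p \<in> places" "h p \<noteq> 1" by auto
      show "p \<in> arch_place ` A \<union> prime_place ` B"
      proof (cases "p \<in> archimedean_places")
        case True
        then show ?thesis by (simp add: archimedean_places_reps A_def)
      next
        case False
        then obtain P where "P \<in> primes" "p = prime_place P"
          using p(1) unfolding places_split finite_places_primes by blast
        then show ?thesis using p(2) hB1[of P] by blast
      qed
    qed
    have "arch_place ` A \<subseteq> places" unfolding A_def archimedean_places_reps[symmetric] places_split by blast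
    moreover have "prime_place ` B \<subseteq> places" using B(1) fp unfolding places_split by blast
    ultimately show "\<forall>p\<in>arch_place ` A \<union> prime_place ` B - {p \<in> places. h p \<noteq> 1}. h p = 1" by blast
  qed (use B in simp)
  also have "\<dots> = prod h (arch_place ` A) * prod h (prime_place ` B)"
  proof (rule prod.union_disjoint)
    show "arch_place ` A \<inter> prime_place ` B = {}"
      unfolding A_def archimedean_places_reps[symmetric] using B(1) fp places_split(2) by blast
  qed (use B in simp_all)
  also have "prod h (arch_place ` A) = (\<Prod>\<sigma>\<in>A. h (arch_place \<sigma>))"
    unfolding A_def by (simp add: prod.reindex[OF inj_arch_place])
  also have "\<dots> = (\<Prod>\<sigma>\<in>real_embs. h (arch_place \<sigma>)) * (\<Prod>\<sigma>\<in>cplx_embs. h (arch_place \<sigma>))"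
    unfolding A_def by (rule prod.union_disjoint) (simp_all add: UNIV_emb_split)
  also have "\<dots> = (\<Prod>\<sigma>\<in>UNIV. max 1 (cmod (Rep_emb \<sigma> x)))"
    unfolding prod_emb_split
  proof (intro arg_cong2[where f = times] prod.cong refl)
    fix \<sigma> :: "'k emb" assume "\<sigma> \<in> real_embs"
    then show "h (arch_place \<sigma>) = max 1 (cmod (Rep_emb \<sigma> x))" by (simp add: h_def normalized_abs_real)
  next
    fix \<sigma> :: "'k emb" assume "\<sigma> \<in> cplx_embs"
    then show "h (arch_place \<sigma>) = max 1 (cmod (Rep_emb \<sigma> x)) * max 1 (cmod (Rep_emb (cnj_emb \<sigma>) x))"
      by (simp add: h_def normalized_abs_cplx max_1_square)
  qed
  also have "prod h (prime_place ` B) = (\<Prod>P\<in>B. real (idnorm P) powi max 0 (- ord P x))"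
    using B(1) by (simp add: prod.reindex[OF inj_on_subset[OF inj_prime_place B(1)]] hB subset_iff)
  also have "\<dots> = fin_norm (\<lambda>P. max 0 (- ord P x))" by (simp add: fin_norm_def B_def)
  finally show ?thesis .
qed

section \<open>Size of ideal norms\<close>

lemma fin_norm_ge_1:
  assumes "\<And>P. P \<in> primes \<Longrightarrow> e P \<ge> 0" shows "fin_norm e \<ge> 1"
  unfolding fin_norm_def
proof (rule prod_ge_1)
  fix P assume "P \<in> {P \<in> primes. e P \<noteq> 0}"
  then show "1 \<le> real (idnorm P) powi e P"
    using powi_mono[of "real (idnorm P)" 0 "e P"] idnorm_gt_1[of P] assms[of P] by simp
qed

text \<open>Split off one unit of the exponent at P; what remains is nonnegative and has norm at
  least 1.\<close>

lemma fin_norm_ge_idnorm: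
  assumes fin: "finite {P \<in> primes. e P \<noteq> 0}" and e: "\<And>P. P \<in> primes \<Longrightarrow> e P \<ge> 0"
    and P: "P \<in> primes" "e P \<noteq> 0"
  shows "fin_norm e \<ge> idnorm P"
proof -
  define f where "f = (\<lambda>Q. if Q = P then 1 else 0 :: int)"
  have "{P \<in> primes. f P \<noteq> 0} \<subseteq> {P}" by (auto simp: f_def)
  then have ff: "finite {P \<in> primes. f P \<noteq> 0}" by (rule finite_subset) simp
  have fe: "finite {P \<in> primes. e P - f P \<noteq> 0}"
    by (rule finite_subset[OF _ finite_UnI[OF fin ff]]) auto
  have "fin_norm e = fin_norm (\<lambda>P. (e P - f P) + f P)" by simp
  also have "\<dots> = fin_norm (\<lambda>P. e P - f P) * fin_norm f" by (rule fin_norm_add[OF fe ff])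
  also have "fin_norm f = idnorm P"
    using fin_norm_superset[of "{P}" f] P(1) by (simp add: f_def)
  also have "fin_norm (\<lambda>P. e P - f P) \<ge> 1"
    using e[OF P(1)] P(2) by (intro fin_norm_ge_1) (auto simp: f_def e)
  ultimately show ?thesis using mult_right_mono[of 1 "fin_norm (\<lambda>P. e P - f P)" "real (idnorm P)"] by simp
qed

lemma finite_support_combine:
  fixes e f :: "'k::number_field set \<Rightarrow> int"
  assumes "finite {P \<in> primes. e P \<noteq> 0}" "finite {P \<in> primes. f P \<noteq> 0}"
    and "\<And>P. P \<in> primes \<Longrightarrow> e P = 0 \<Longrightarrow> f P = 0 \<Longrightarrow> g P = (0::int)"
  shows "finite {P \<in> primes. g P \<noteq> 0}"
  by (rule finite_subset[OF _ finite_UnI[OF assms(1,2)]]) (use assms(3) in auto)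

lemma fin_norm_mono:
  assumes "finite {P \<in> primes. e P \<noteq> 0}" "finite {P \<in> primes. f P \<noteq> 0}" "\<And>P. P \<in> primes \<Longrightarrow> e P \<le> f P"
  shows "fin_norm e \<le> fin_norm f"
proof -
  have "finite {P \<in> primes. f P - e P \<noteq> 0}" by (rule finite_support_combine[OF assms(1,2)]) simp
  from fin_norm_add[OF this assms(1)] have "fin_norm f = fin_norm (\<lambda>P. f P - e P) * fin_norm e" by simp
  moreover have "fin_norm (\<lambda>P. f P - e P) \<ge> 1" using assms(3) by (intro fin_norm_ge_1) simp
  ultimately show ?thesis
    using mult_right_mono[of 1 "fin_norm (\<lambda>P. f P - e P)" "fin_norm e"] fin_norm_pos[OF assms(1)] by simp
qed

lemma fin_norm_uminus:
  assumes "finite {P \<in> primes. e P \<noteq> 0}" shows "fin_norm (\<lambda>P. - e P) = inverse (fin_norm e)"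
proof -
  have "fin_norm (\<lambda>P. - e P + e P) = fin_norm (\<lambda>P. - e P) * fin_norm e"
    using assms by (intro fin_norm_add) simp_all
  then have "fin_norm (\<lambda>P. - e P) * fin_norm e = 1" by (simp add: fin_norm_def)
  then show ?thesis using fin_norm_pos[OF assms] by (simp add: field_simps)
qed

text \<open>In the paper's notation the radius at a finite place
  \<open>P\<close> is \<open>idnorm P powi (- e P)\<close>; in \<open>balanced\<close> the product of all radii is \<open>d\<close>, and only the
  primes of \<open>S\<close> have a radius different from \<open>1\<close>.\<close>

definition bounded_by :: "('k::number_field emb \<Rightarrow> real) \<Rightarrow> ('k set \<Rightarrow> int) \<Rightarrow> 'k set" where
  "bounded_by \<rho> e = {x \<in> val_lattice e. \<forall>\<sigma>. cmod (Rep_emb \<sigma> x) \<le> \<rho> \<sigma>}"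

definition balanced :: "('k::number_field emb \<Rightarrow> real) \<Rightarrow> ('k set \<Rightarrow> int) \<Rightarrow> bool" where
  "balanced \<rho> e \<longleftrightarrow> finite {P \<in> primes. e P \<noteq> 0} \<and>
     (\<forall>P\<in>primes. e P \<noteq> 0 \<longrightarrow> idnorm P \<le> minkowski_const TYPE('k)) \<and>
     (\<forall>\<sigma>. \<rho> \<sigma> > 0 \<and> \<rho> (cnj_emb \<sigma>) = \<rho> \<sigma>) \<and>
     (\<Prod>\<sigma>\<in>UNIV. \<rho> \<sigma>) = minkowski_const TYPE('k) * fin_norm e"

text \<open>The group K_S in terms of orders: a prime may occur exactly if its norm is at most d.
  \<open>S_units_eq\<close> makes the link to places.\<close>

definition minkowski_units :: "'k::number_field set" where
  "minkowski_units = {x. x \<noteq> 0 \<and> (\<forall>P\<in>primes. ord P x \<noteq> 0 \<longrightarrow> idnorm P \<le> minkowski_const TYPE('k))}"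

text \<open>By the product formula the ideal with the excess exponents ord x - e has norm at most d.
  As these exponents are nonnegative, every prime with positive excess has norm at most d.\<close>

lemma lattice_element_small:
  fixes e :: "'k::number_field set \<Rightarrow> int"
  assumes fin: "finite {P \<in> primes. e P \<noteq> 0}" and x: "x \<in> val_lattice e" "x \<noteq> 0"
    and le: "arch_norm x \<le> minkowski_const TYPE('k) * fin_norm e"
  shows "fin_norm (\<lambda>P. ord P x - e P) \<le> minkowski_const TYPE('k)"
    "\<And>P. P \<in> primes \<Longrightarrow> ord P x \<noteq> e P \<Longrightarrow> idnorm P \<le> minkowski_const TYPE('k)"
    "\<And>P. P \<in> primes \<Longrightarrow> e P \<le> ord P x"
proof -
  note fx = finite_ord_nonzero[OF x(2)]
  show ge: "e P \<le> ord P x" if "P \<in> primes" for P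
    using x that by (auto simp: val_lattice_def ord_ge_def)
  have f: "finite {P \<in> primes. ord P x - e P \<noteq> 0}" by (rule finite_support_combine[OF fx fin]) simp
  have "fin_norm (\<lambda>P. ord P x) = fin_norm (\<lambda>P. ord P x - e P) * fin_norm e"
    using fin_norm_add[OF f fin] by simp
  then show *: "fin_norm (\<lambda>P. ord P x - e P) \<le> minkowski_const TYPE('k)"
    using le fin_norm_pos[OF fin] by (simp add: product_formula[OF x(2)])
  show "idnorm P \<le> minkowski_const TYPE('k)" if "P \<in> primes" "ord P x \<noteq> e P" for P
  proof -
    have "real (idnorm P) \<le> fin_norm (\<lambda>P. ord P x - e P)"
      using that ge by (intro fin_norm_ge_idnorm[OF f]) simp_all
    with * show ?thesis by simp
  qed
qed

lemma arch_norm_le_bounded: "x \<in> bounded_by \<rho> e \<Longrightarrow> arch_norm x \<le> (\<Prod>\<sigma>\<in>UNIV. \<rho> \<sigma>)"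
  unfolding arch_norm_def bounded_by_def by (intro prod_mono) auto

lemma bounded_by_balanced:
  fixes e :: "'k::number_field set \<Rightarrow> int"
  assumes "balanced \<rho> e" "x \<in> bounded_by \<rho> e" "x \<noteq> 0"
  shows "x \<in> minkowski_units"
proof -
  have "idnorm P \<le> minkowski_const TYPE('k)" if P: "P \<in> primes" "ord P x \<noteq> 0" for P
  proof (cases "e P = 0")
    case True
    show ?thesis
      by (rule lattice_element_small(2)[of e x])
        (use assms P True arch_norm_le_bounded[OF assms(2)] in \<open>auto simp: balanced_def bounded_by_def\<close>)
  qed (use assms(1) P in \<open>simp add: balanced_def\<close>)
  then show ?thesis using assms(3) by (simp add: minkowski_units_def)
qed

lemma balanced_covers:
  fixes e :: "'k::number_field set \<Rightarrow> int"
  assumes "balanced \<rho> e" obtains x where "x \<in> bounded_by \<rho> e" "x \<in> minkowski_units"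
proof -
  obtain x where "x \<in> val_lattice e" "x \<noteq> 0" "\<And>\<sigma>. cmod (Rep_emb \<sigma> x) \<le> \<rho> \<sigma>"
    by (rule minkowski_number_field[of e \<rho>]) (use assms in \<open>auto simp: balanced_def\<close>)
  then have "x \<in> bounded_by \<rho> e" "x \<noteq> 0" by (auto simp: bounded_by_def)
  with bounded_by_balanced[OF assms] show thesis using that by blast
qed

lemma minkowski_units_divide:
  assumes "x \<in> minkowski_units" "y \<in> minkowski_units" shows "x / y \<in> minkowski_units"
  using assms by (fastforce simp: minkowski_units_def ord_divide)

lemma height_divide_le:
  fixes x y :: "'k::number_field"
  assumes b: "balanced \<rho> e" "balanced \<rho>' e'" and x: "x \<in> bounded_by \<rho> e" "x \<noteq> 0"
    and y: "y \<in> bounded_by \<rho>' e'" "y \<noteq> 0"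
  shows "height (y / x) \<le> (\<Prod>\<sigma>\<in>UNIV. max (\<rho> \<sigma>) (\<rho>' \<sigma>)) * fin_norm (\<lambda>P. - min (e P) (e' P))"
proof -
  note fx = finite_ord_nonzero[OF x(2)] and fy = finite_ord_nonzero[OF y(2)]
  have fe: "finite {P \<in> primes. e P \<noteq> 0}" "finite {P \<in> primes. e' P \<noteq> 0}" using b by (auto simp: balanced_def)
  let ?m = "\<lambda>P. - min (ord P x) (ord P y)"
  have fm: "finite {P \<in> primes. ?m P \<noteq> 0}" by (rule finite_support_combine[OF fx fy]) simp
  have "max 1 (cmod (Rep_emb \<sigma> (y / x))) * cmod (Rep_emb \<sigma> x) = max (cmod (Rep_emb \<sigma> x)) (cmod (Rep_emb \<sigma> y))" for \<sigma>
  proof -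
    have *: "cmod (Rep_emb \<sigma> (y / x)) * cmod (Rep_emb \<sigma> x) = cmod (Rep_emb \<sigma> y)"
      using x(2) by (simp flip: norm_mult emb.hom_mult)
    have "max 1 (cmod (Rep_emb \<sigma> (y / x))) * cmod (Rep_emb \<sigma> x) =
        max (1 * cmod (Rep_emb \<sigma> x)) (cmod (Rep_emb \<sigma> (y / x)) * cmod (Rep_emb \<sigma> x))"
      by (rule max_mult_distrib_right[THEN trans]) simp
    then show ?thesis unfolding * by simp
  qed
  then have A: "(\<Prod>\<sigma>\<in>UNIV. max 1 (cmod (Rep_emb \<sigma> (y / x)))) * arch_norm x =
      (\<Prod>\<sigma>\<in>UNIV. max (cmod (Rep_emb \<sigma> x)) (cmod (Rep_emb \<sigma> y)))"
    unfolding arch_norm_def by (simp flip: prod.distrib)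
  \<comment> \<open>\<open>?m P\<close> is the exponent belonging to the larger of |x| and |y| at P.
    Splitting off \<open>ord P x\<close> trades it for \<open>arch_norm x\<close>, which clears the
    denominator x at the archimedean places.\<close>
  have "fin_norm (\<lambda>P. max 0 (- ord P (y / x))) = fin_norm (\<lambda>P. ord P x + ?m P)"
    using x(2) y(2) by (intro fin_norm_cong) (auto simp: ord_divide)
  also have "\<dots> = arch_norm x * fin_norm ?m" unfolding fin_norm_add[OF fx fm] product_formula[OF x(2)] ..
  finally have "height (y / x) = (\<Prod>\<sigma>\<in>UNIV. max (cmod (Rep_emb \<sigma> x)) (cmod (Rep_emb \<sigma> y))) * fin_norm ?m"
    using x(2) y(2) A by (simp add: height_eq)
  also have "\<dots> \<le> (\<Prod>\<sigma>\<in>UNIV. max (\<rho> \<sigma>) (\<rho>' \<sigma>)) * fin_norm (\<lambda>P. - min (e P) (e' P))"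
  proof (rule mult_mono)
    show "(\<Prod>\<sigma>\<in>UNIV. max (cmod (Rep_emb \<sigma> x)) (cmod (Rep_emb \<sigma> y))) \<le> (\<Prod>\<sigma>\<in>UNIV. max (\<rho> \<sigma>) (\<rho>' \<sigma>))"
      using x(1) y(1) by (intro prod_mono conjI max.mono) (auto simp: bounded_by_def le_max_iff_disj)
    have me: "finite {P \<in> primes. - min (e P) (e' P) \<noteq> 0}" by (rule finite_support_combine[OF fe]) simp
    have "e P \<le> ord P x" "e' P \<le> ord P y" if "P \<in> primes" for P
      using x y that by (auto simp: bounded_by_def val_lattice_def ord_ge_def)
    then show "fin_norm ?m \<le> fin_norm (\<lambda>P. - min (e P) (e' P))"
      by (intro fin_norm_mono[OF fm me]) (simp add: min.coboundedI1 min.coboundedI2)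
    show "0 \<le> fin_norm ?m" using fin_norm_pos[OF fm] by simp
    show "0 \<le> (\<Prod>\<sigma>\<in>UNIV. max (\<rho> \<sigma>) (\<rho>' \<sigma>))"
      using b(1) by (intro prod_nonneg) (auto simp: balanced_def le_max_iff_disj less_imp_le)
  qed
  finally show ?thesis .
qed

lemma fin_norm_0: "(\<And>P. P \<in> primes \<Longrightarrow> e P = 0) \<Longrightarrow> fin_norm e = 1"
  by (simp add: fin_norm_def)

lemma val_lattice_cong: "(\<And>P. P \<in> primes \<Longrightarrow> e P = f P) \<Longrightarrow> val_lattice e = val_lattice f"
  by (simp add: val_lattice_def)

abbreviation unit_radius :: "'k::number_field itself \<Rightarrow> real" where
  "unit_radius _ \<equiv> root CARD('k emb) (minkowski_const TYPE('k))"

lemma balanced_const: "balanced (\<lambda>_ :: 'k::number_field emb. unit_radius TYPE('k)) (\<lambda>_. 0)"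
  using minkowski_const_pos[where 'k = 'k] by (simp add: balanced_def fin_norm_0)

text \<open>For e = 0 and equal radii, Minkowski's theorem produces an integer whose ideal norm lies
  between 1 and d.\<close>

lemma minkowski_const_ge_1: "minkowski_const TYPE('k::number_field) \<ge> 1"
proof -
  let ?e = "\<lambda>_ :: 'k set. 0 :: int"
  obtain x :: 'k where x: "x \<in> bounded_by (\<lambda>_. unit_radius TYPE('k)) ?e" "x \<in> minkowski_units"
    by (rule balanced_covers[OF balanced_const])
  have fin: "finite {P \<in> primes. ?e P \<noteq> 0}" and xl: "x \<in> val_lattice ?e" and x0: "x \<noteq> 0"
    using x by (auto simp: bounded_by_def minkowski_units_def)
  have le: "arch_norm x \<le> minkowski_const TYPE('k) * fin_norm ?e"
    using arch_norm_le_bounded[OF x(1)] balanced_const[where 'k = 'k] by (simp add: balanced_def)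
  have "fin_norm (\<lambda>P. ord P x - ?e P) \<ge> 1"
    using lattice_element_small(3)[OF fin xl x0 le] by (intro fin_norm_ge_1) simp
  then show ?thesis using lattice_element_small(1)[OF fin xl x0 le] by linarith
qed

lemma countable_number_field: "countable (UNIV :: 'k::number_field set)"
proof -
  obtain B :: "'k set" where B: "finite B" "\<forall>x. \<exists>c. x = (\<Sum>b\<in>B. of_rat (c b) * b)"
    using finite_degree by blast
  have "UNIV \<subseteq> (\<lambda>c. \<Sum>b\<in>B. of_rat (c b) * b) ` (PiE B (\<lambda>_. UNIV))"
  proof
    fix x :: 'k
    obtain c where c: "x = (\<Sum>b\<in>B. of_rat (c b) * b)" using B(2) by blast
    show "x \<in> (\<lambda>c. \<Sum>b\<in>B. of_rat (c b) * b) ` (PiE B (\<lambda>_. UNIV))"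
      by (rule image_eqI[of _ _ "restrict c B"]) (simp_all add: c)
  qed
  moreover have "countable (PiE B (\<lambda>_. UNIV :: rat set))" using B(1) by (intro countable_PiE) simp_all
  ultimately show ?thesis by (meson countable_image countable_subset)
qed

lemma fin_norm_upd:
  assumes P: "P \<in> primes" and fin: "finite {P \<in> primes. e P \<noteq> 0}"
  shows "finite {Q \<in> primes. (e(P := e P + s)) Q \<noteq> 0}"
    "fin_norm (e(P := e P + s)) = real (idnorm P) powi s * fin_norm e"
proof -
  define f where "f = (\<lambda>Q. if Q = P then s else 0)"
  have "{P \<in> primes. f P \<noteq> 0} \<subseteq> {P}" by (auto simp: f_def)
  then have ff: "finite {P \<in> primes. f P \<noteq> 0}" by (rule finite_subset) simp
  have *: "e(P := e P + s) = (\<lambda>Q. f Q + e Q)" by (auto simp: f_def)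
  show "finite {Q \<in> primes. (e(P := e P + s)) Q \<noteq> 0}"
    unfolding * by (rule finite_support_combine[OF ff fin]) simp
  have "fin_norm f = real (idnorm P) powi s"
    using fin_norm_superset[of "{P}" f] P by (simp add: f_def)
  then show "fin_norm (e(P := e P + s)) = real (idnorm P) powi s * fin_norm e"
    unfolding * fin_norm_add[OF ff fin] by simp
qed

text \<open>\<open>G\<close> stands for the subgroup generated by the S-units of small height.
  Closure under products is enough, since each step writes an element as (y / x) x with both factors
  known to be in \<open>G\<close>.\<close>

locale height_generated =
  fixes G :: "'k::number_field set"
  assumes mult_closed: "x \<in> G \<Longrightarrow> y \<in> G \<Longrightarrow> x * y \<in> G"
    and small: "x \<in> minkowski_units \<Longrightarrow> height x \<le> (minkowski_const TYPE('k))\<^sup>2 \<Longrightarrow> x \<in> G"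
begin

definition covered :: "('k emb \<Rightarrow> real) \<Rightarrow> ('k set \<Rightarrow> int) \<Rightarrow> bool" where
  "covered \<rho> e \<longleftrightarrow> bounded_by \<rho> e - {0} \<subseteq> G"

text \<open>For balanced systems, \<open>height_divide_le\<close> shows that the left-hand side
  bounds the height of any quotient y / x of nonzero elements under these radii. Nearness thus makes
  such quotients generators.\<close>

definition near :: "('k emb \<Rightarrow> real) \<Rightarrow> ('k set \<Rightarrow> int) \<Rightarrow> ('k emb \<Rightarrow> real) \<Rightarrow> ('k set \<Rightarrow> int) \<Rightarrow> bool" where
  "near \<rho> e \<rho>' e' \<longleftrightarrow> (\<Prod>\<sigma>\<in>UNIV. max (\<rho> \<sigma>) (\<rho>' \<sigma>)) * fin_norm (\<lambda>P. - min (e P) (e' P)) \<le> (minkowski_const TYPE('k))\<^sup>2"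

lemma near_sym: "near \<rho> e \<rho>' e' \<longleftrightarrow> near \<rho>' e' \<rho> e"
  by (simp add: near_def max.commute min.commute)

text \<open>Minkowski's theorem supplies one x under the first system, and every y under the second
  one is (y / x) x.\<close>

lemma covered_near:
  assumes b: "balanced \<rho> e" "balanced \<rho>' e'" and n: "near \<rho> e \<rho>' e'" and c: "covered \<rho> e"
  shows "covered \<rho>' e'"
  unfolding covered_def
proof
  fix y assume "y \<in> bounded_by \<rho>' e' - {0}"
  then have y: "y \<in> bounded_by \<rho>' e'" "y \<noteq> 0" by auto
  obtain x where x: "x \<in> bounded_by \<rho> e" "x \<in> minkowski_units" by (rule balanced_covers[OF b(1)])
  then have x0: "x \<noteq> 0" by (simp add: minkowski_units_def)
  have "height (y / x) \<le> (minkowski_const TYPE('k))\<^sup>2" using height_divide_le[OF b x(1) x0 y] n by (simp add: near_def)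
  then have "y / x \<in> G"
    using minkowski_units_divide[OF bounded_by_balanced[OF b(2) y] x(2)] by (intro small)
  moreover have "x \<in> G" using c x(1) x0 by (auto simp: covered_def)
  ultimately have "y / x * x \<in> G" by (rule mult_closed)
  then show "y \<in> G" using x0 by simp
qed

text \<open>The starting point: the radii d^(1/n) \<ge> 1 bound the element 1, and comparison with 1
  gives height at most d, which is at most d^2.\<close>

lemma covered_const: "covered (\<lambda>_. unit_radius TYPE('k)) (\<lambda>_. 0)"
  unfolding covered_def
proof
  let ?\<rho> = "\<lambda>_ :: 'k emb. unit_radius TYPE('k)" and ?e = "\<lambda>_ :: 'k set. 0 :: int"
  fix x assume "x \<in> bounded_by ?\<rho> ?e - {0}"
  then have x: "x \<in> bounded_by ?\<rho> ?e" "x \<noteq> 0" by auto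
  have "(1::'k) \<in> OK" by (rule ring_of_integers_closed)
  then have 1: "(1::'k) \<in> bounded_by ?\<rho> ?e"
    using minkowski_const_ge_1[where 'k = 'k] lattice_0[where 'a = 'k] by (simp add: bounded_by_def)
  have "height (x / 1) \<le> (\<Prod>\<sigma>\<in>(UNIV :: 'k emb set). max (?\<rho> \<sigma>) (?\<rho> \<sigma>)) * fin_norm (\<lambda>P::'k set. - min (?e P) (?e P))"
    by (rule height_divide_le[OF balanced_const balanced_const 1 _ x]) simp
  also have "\<dots> = minkowski_const TYPE('k)" using minkowski_const_pos[where 'k = 'k] by (simp add: fin_norm_0)
  also have "\<dots> \<le> (minkowski_const TYPE('k))\<^sup>2" using minkowski_const_ge_1[where 'k = 'k] by (simp add: self_le_power)
  finally show "x \<in> G" using bounded_by_balanced[OF balanced_const x] by (intro small) simp_all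
qed

lemma covered_interpolate:
  assumes d: "minkowski_const TYPE('k) > 1" and b: "balanced \<rho> e" "balanced \<rho>' e" and c: "covered \<rho> e"
  shows "covered \<rho>' e"
proof -
  have pos: "\<rho> \<sigma> > 0" "\<rho>' \<sigma> > 0" for \<sigma> using b by (auto simp: balanced_def)
  define q where "q \<sigma> = \<rho>' \<sigma> / \<rho> \<sigma>" for \<sigma>
  have q: "q \<sigma> > 0" for \<sigma> using pos by (simp add: q_def)
  have fe: "finite {P \<in> primes. e P \<noteq> 0}" using b(1) by (simp add: balanced_def)
  have prodq: "(\<Prod>\<sigma>\<in>UNIV. q \<sigma>) = 1"
    using b minkowski_const_pos[where 'k = 'k] fin_norm_pos[OF fe] by (simp add: q_def prod_dividef balanced_def)
  \<comment> \<open>The factor by which the product of maxima grows on going from \<rho> to \<rho>'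
    at once. One of m equal steps costs only its m-th root, which falls below d for large m because
    d > 1.\<close>
  define A where "A = (\<Prod>\<sigma>\<in>UNIV. max 1 (q \<sigma>))"
  have A: "A > 0" unfolding A_def by (intro prod_pos) (simp add: less_max_iff_disj)
  have "(\<lambda>m. root m A) \<longlonglongrightarrow> 1" using A by (rule LIMSEQ_root_const)
  then have "eventually (\<lambda>m. root m A < minkowski_const TYPE('k)) sequentially" using d by (rule order_tendstoD)
  then obtain m where m: "root m A < minkowski_const TYPE('k)" "m > 0"
    using eventually_happens'[OF sequentially_bot eventually_conj[OF _ eventually_gt_at_top[of 0]]] by blast
  have Am: "A powr (1 / m) < minkowski_const TYPE('k)" using m A by (simp add: root_powr_inverse inverse_eq_divide)
  define r where "r t \<sigma> = \<rho> \<sigma> * q \<sigma> powr (real t / m)" for t :: nat and \<sigma>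
  have prodr: "(\<Prod>\<sigma>\<in>UNIV. r t \<sigma>) = minkowski_const TYPE('k) * fin_norm e" for t
  proof -
    have "(\<Prod>\<sigma>\<in>UNIV. r t \<sigma>) = (\<Prod>\<sigma>\<in>UNIV. \<rho> \<sigma>) * (\<Prod>\<sigma>\<in>UNIV. q \<sigma>) powr (real t / m)"
      unfolding r_def prod.distrib using q by (subst prod_powr_distrib) (auto simp: less_imp_le)
    then show ?thesis using b(1) by (simp add: prodq balanced_def)
  qed
  have rpos: "r t \<sigma> > 0" for t \<sigma>
  proof -
    have "q \<sigma> powr (real t / m) > 0" using less_imp_neq[OF q[of \<sigma>]] by simp
    then show ?thesis unfolding r_def using pos(1) by simp
  qed
  have "r t (cnj_emb \<sigma>) = r t \<sigma>" for t \<sigma>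
    using b by (simp add: balanced_def r_def q_def)
  then have br: "balanced (r t) e" for t
    using b(1) prodr[of t] rpos by (simp add: balanced_def)
  have "near (r t) e (r (Suc t)) e" for t
  proof -
    have "max (r t \<sigma>) (r (Suc t) \<sigma>) = r t \<sigma> * max 1 (q \<sigma>) powr (1 / m)" for \<sigma>
    proof -
      have *: "r (Suc t) \<sigma> = r t \<sigma> * q \<sigma> powr (1 / m)"
        by (simp add: r_def add_divide_distrib powr_add mult_ac)
      have "r t \<sigma> \<ge> 0" using rpos[of t \<sigma>] by simp
      then have "max (r t \<sigma> * 1) (r t \<sigma> * q \<sigma> powr (1 / m)) = r t \<sigma> * max 1 (q \<sigma> powr (1 / m))"
        by (simp add: max_mult_distrib_left)
      also have "max 1 (q \<sigma> powr (1 / m)) = max 1 (q \<sigma>) powr (1 / m)"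
        using m(2) q[of \<sigma>] by (subst max_powr) auto
      finally show ?thesis by (simp add: *)
    qed
    then have "(\<Prod>\<sigma>\<in>UNIV. max (r t \<sigma>) (r (Suc t) \<sigma>)) = (\<Prod>\<sigma>\<in>UNIV. r t \<sigma>) * A powr (1 / m)"
      unfolding A_def by (subst prod_powr_distrib) (auto simp: prod.distrib le_max_iff_disj)
    then have "(\<Prod>\<sigma>\<in>UNIV. max (r t \<sigma>) (r (Suc t) \<sigma>)) * fin_norm (\<lambda>P. - min (e P) (e P)) = minkowski_const TYPE('k) * A powr (1 / m)"
      using fin_norm_pos[OF fe] by (simp add: prodr fin_norm_uminus[OF fe] field_simps)
    also have "\<dots> \<le> (minkowski_const TYPE('k))\<^sup>2" unfolding power2_eq_square using Am d by (intro mult_left_mono) auto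
    finally show ?thesis unfolding near_def .
  qed
  then have "covered (r t) e" for t
  proof (induction t)
    case 0
    have "r 0 = \<rho>" using q by (auto simp: r_def fun_eq_iff less_imp_neq[OF q, symmetric])
    then show ?case using c by simp
  next
    case (Suc t)
    then show ?case using covered_near[OF br br] by blast
  qed
  moreover have "r m \<sigma> = \<rho>' \<sigma>" for \<sigma>
  proof -
    have "q \<sigma> powr (real m / m) = q \<sigma>" using m(2) q[of \<sigma>] by simp
    then show ?thesis using pos(1)[of \<sigma>] by (simp add: r_def q_def)
  qed
  then have "r m = \<rho>'" by (rule ext)
  ultimately show ?thesis by metis
qed

text \<open>The n-th root distributes the factor N(P)^s evenly over the embeddings, so that the
  product of the radii follows \<open>fin_norm\<close>.\<close>

lemma balanced_upd:
  fixes e :: "'k set \<Rightarrow> int"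
  assumes b: "balanced \<rho> e" and P: "P \<in> primes" "idnorm P \<le> minkowski_const TYPE('k)"
  shows "balanced (\<lambda>\<sigma>. root CARD('k emb) (real (idnorm P) powi s) * \<rho> \<sigma>) (e(P := e P + s))"
proof -
  have fin: "finite {P \<in> primes. e P \<noteq> 0}" using b by (simp add: balanced_def)
  have "real (idnorm P) powi s > 0" using idnorm_pos[OF P(1)] by simp
  then show ?thesis
    using b P fin_norm_upd[OF P(1) fin, of s] by (auto simp: balanced_def prod.distrib)
qed

text \<open>Raising one exponent leaves the minimum of the exponents at e, while every archimedean
  radius grows; the product of the maxima is N(P) d.\<close>

lemma near_upd:
  fixes e :: "'k set \<Rightarrow> int"
  assumes b: "balanced \<rho> e" and P: "P \<in> primes" "idnorm P \<le> minkowski_const TYPE('k)"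
  shows "near \<rho> e (\<lambda>\<sigma>. root CARD('k emb) (real (idnorm P)) * \<rho> \<sigma>) (e(P := e P + 1))"
proof -
  have fin: "finite {P \<in> primes. e P \<noteq> 0}" using b by (simp add: balanced_def)
  have N: "real (idnorm P) > 1" using idnorm_gt_1[OF P(1)] by simp
  let ?c = "root CARD('k emb) (real (idnorm P))"
  have c: "?c > 1" using N by simp
  have "max (\<rho> \<sigma>) (?c * \<rho> \<sigma>) = ?c * \<rho> \<sigma>" for \<sigma>
    using b mult_right_mono[of 1 ?c "\<rho> \<sigma>"] c by (intro max_absorb2) (auto simp: balanced_def less_imp_le)
  then have "(\<Prod>\<sigma>\<in>UNIV. max (\<rho> \<sigma>) (?c * \<rho> \<sigma>)) = real (idnorm P) * (minkowski_const TYPE('k) * fin_norm e)"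
    using b N by (simp add: prod.distrib balanced_def)
  moreover have "fin_norm (\<lambda>Q. - min (e Q) ((e(P := e P + 1)) Q)) = inverse (fin_norm e)"
    unfolding fin_norm_uminus[OF fin, symmetric] by (rule fin_norm_cong) auto
  ultimately have "(\<Prod>\<sigma>\<in>UNIV. max (\<rho> \<sigma>) (?c * \<rho> \<sigma>)) * fin_norm (\<lambda>Q. - min (e Q) ((e(P := e P + 1)) Q)) = idnorm P * minkowski_const TYPE('k)"
    using fin_norm_pos[OF fin] by simp
  also have "\<dots> \<le> (minkowski_const TYPE('k))\<^sup>2" unfolding power2_eq_square using P(2) minkowski_const_pos[where 'k = 'k] by (intro mult_right_mono) auto
  finally show ?thesis unfolding near_def .
qed

text \<open>Induction on the total size of the exponents: one of them moves by 1 towards 0, with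
  compensation at the archimedean places. At e = 0 the interpolation reaches \<rho> from the
  constant radii.\<close>

lemma covered_if_gt_1:
  assumes d: "minkowski_const TYPE('k) > 1"
  shows "balanced \<rho> e \<Longrightarrow> covered \<rho> e"
proof (induction "\<Sum>P\<in>{P \<in> primes. e P \<noteq> 0}. nat \<bar>e P\<bar>" arbitrary: \<rho> e rule: less_induct)
  case less
  let ?T = "{P \<in> primes. e P \<noteq> 0}"
  have fin: "finite ?T" using less.prems by (simp add: balanced_def)
  show ?case
  proof (cases "?T = {}")
    case True
    then have e0: "\<And>P. P \<in> primes \<Longrightarrow> e P = 0" by blast
    have "balanced \<rho> (\<lambda>_. 0)" using less.prems fin_norm_0[of e] e0 by (simp add: balanced_def fin_norm_0)
    from covered_interpolate[OF d balanced_const this covered_const] have "covered \<rho> (\<lambda>_. 0)" .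
    moreover have "bounded_by \<rho> e = bounded_by \<rho> (\<lambda>_. 0)"
      using val_lattice_cong[of e "\<lambda>_. 0"] e0 by (simp add: bounded_by_def)
    ultimately show ?thesis by (simp add: covered_def)
  next
    case False
    then obtain P where P: "P \<in> primes" "e P \<noteq> 0" by blast
    then have Pd: "idnorm P \<le> minkowski_const TYPE('k)" using less.prems by (simp add: balanced_def)
    define s where "s = - sgn (e P)"
    define e' where "e' = e(P := e P + s)"
    define \<rho>' where "\<rho>' = (\<lambda>\<sigma>. root CARD('k emb) (real (idnorm P) powi s) * \<rho> \<sigma>)"
    have b': "balanced \<rho>' e'" unfolding \<rho>'_def e'_def by (rule balanced_upd[OF less.prems P(1) Pd])
    have "(\<Sum>P\<in>{P \<in> primes. e' P \<noteq> 0}. nat \<bar>e' P\<bar>) = (\<Sum>P\<in>?T. nat \<bar>e' P\<bar>)"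
      by (rule sum.mono_neutral_left) (use fin P in \<open>auto simp: e'_def\<close>)
    also have "\<dots> < (\<Sum>P\<in>?T. nat \<bar>e P\<bar>)"
    proof (rule sum_strict_mono_ex1[OF fin])
      show "\<forall>Q\<in>?T. nat \<bar>e' Q\<bar> \<le> nat \<bar>e Q\<bar>" by (auto simp: e'_def s_def sgn_if)
      show "\<exists>Q\<in>?T. nat \<bar>e' Q\<bar> < nat \<bar>e Q\<bar>" using P by (intro bexI[of _ P]) (auto simp: e'_def s_def sgn_if)
    qed
    finally have c': "covered \<rho>' e'" using less.hyps b' by blast
    \<comment> \<open>\<open>near_upd\<close> describes steps that raise an exponent; a lowering
      step is such a step read backwards.\<close>
    have "near \<rho> e \<rho>' e'"
    proof (cases "e P > 0")
      case True
      then have s: "s = - 1" by (simp add: s_def)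
      have "near \<rho>' e' (\<lambda>\<sigma>. root CARD('k emb) (real (idnorm P)) * \<rho>' \<sigma>) (e'(P := e' P + 1))"
        by (rule near_upd[OF b' P(1) Pd])
      moreover have "(\<lambda>\<sigma>. root CARD('k emb) (real (idnorm P)) * \<rho>' \<sigma>) = \<rho>"
        using idnorm_pos[OF P(1)] by (simp add: \<rho>'_def s power_int_minus real_root_inverse fun_eq_iff)
      moreover have "e'(P := e' P + 1) = e" by (simp add: e'_def s)
      ultimately show ?thesis using near_sym by simp
    next
      case False
      then have s: "s = 1" using P(2) by (simp add: s_def sgn_if)
      show ?thesis using near_upd[OF less.prems P(1) Pd] by (simp add: \<rho>'_def e'_def s)
    qed
    then show ?thesis using covered_near[OF b' less.prems _ c'] near_sym by blast
  qed
qed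

lemma height_le_1_if_eq_1:
  fixes x :: 'k
  assumes d: "minkowski_const TYPE('k) = 1" and x: "x \<in> minkowski_units"
  shows "height x \<le> 1"
proof -
  have ord0: "ord P y = 0" if "y \<in> minkowski_units" "P \<in> primes" for P and y :: 'k
    using that idnorm_gt_1[OF that(2)] d by (fastforce simp: minkowski_units_def)
  have an: "arch_norm y = 1" if "y \<in> minkowski_units" for y :: 'k
  proof -
    have "y \<noteq> 0" using that by (simp add: minkowski_units_def)
    then show ?thesis using ord0[OF that] by (simp add: product_formula fin_norm_0)
  qed
  have x0: "x \<noteq> 0" using x by (simp add: minkowski_units_def)
  have one: "cmod (Rep_emb \<tau> x) = 1" for \<tau>
  proof (rule ccontr)
    assume ne: "cmod (Rep_emb \<tau> x) \<noteq> 1"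
    have "\<exists>y. cmod (Rep_emb \<tau> y) = cmod (Rep_emb \<tau> x) powr t" for t
    proof -
      let ?\<rho> = "\<lambda>\<sigma>. cmod (Rep_emb \<sigma> x) powr t"
      have pr: "(\<Prod>\<sigma>\<in>UNIV. ?\<rho> \<sigma>) = 1"
        using an[OF x] unfolding arch_norm_def by (subst prod_powr_distrib[symmetric]) auto
      have "balanced ?\<rho> (\<lambda>_. 0)" using x0 pr by (simp add: balanced_def d fin_norm_0)
      then obtain y where y: "y \<in> bounded_by ?\<rho> (\<lambda>_. 0)" "y \<in> minkowski_units" by (rule balanced_covers)
      \<comment> \<open>The full products of the |\<sigma> y| and of the radii are both 1, and no
        factor exceeds its radius; so equality holds at \<tau>.\<close>
      have "(\<Prod>\<sigma>\<in>UNIV - {\<tau>}. cmod (Rep_emb \<sigma> y)) \<le> (\<Prod>\<sigma>\<in>UNIV - {\<tau>}. ?\<rho> \<sigma>)"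
        using y(1) by (intro prod_mono) (auto simp: bounded_by_def)
      moreover have "cmod (Rep_emb \<tau> y) * (\<Prod>\<sigma>\<in>UNIV - {\<tau>}. cmod (Rep_emb \<sigma> y)) = 1"
        using an[OF y(2)] unfolding arch_norm_def by (subst (asm) prod.remove[of _ \<tau>]) auto
      moreover have "?\<rho> \<tau> * (\<Prod>\<sigma>\<in>UNIV - {\<tau>}. ?\<rho> \<sigma>) = 1"
        using pr by (subst (asm) prod.remove[of _ \<tau>]) auto
      moreover have "cmod (Rep_emb \<tau> y) \<le> ?\<rho> \<tau>" using y(1) by (simp add: bounded_by_def)
      moreover have "(\<Prod>\<sigma>\<in>UNIV - {\<tau>}. ?\<rho> \<sigma>) > 0" using x0 by (intro prod_pos) simp
      ultimately have "cmod (Rep_emb \<tau> y) * (\<Prod>\<sigma>\<in>UNIV - {\<tau>}. ?\<rho> \<sigma>) \<ge> ?\<rho> \<tau> * (\<Prod>\<sigma>\<in>UNIV - {\<tau>}. ?\<rho> \<sigma>)"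
        using mult_left_mono[of "\<Prod>\<sigma>\<in>UNIV - {\<tau>}. cmod (Rep_emb \<sigma> y)" _ "cmod (Rep_emb \<tau> y)"] by simp
      then have "cmod (Rep_emb \<tau> y) \<ge> ?\<rho> \<tau>"
        using \<open>(\<Prod>\<sigma>\<in>UNIV - {\<tau>}. ?\<rho> \<sigma>) > 0\<close> by (simp only: mult_le_cancel_right_pos)
      with \<open>cmod (Rep_emb \<tau> y) \<le> ?\<rho> \<tau>\<close> show ?thesis by (intro exI[of _ y]) simp
    qed
    then obtain f where f: "\<And>t. cmod (Rep_emb \<tau> (f t)) = cmod (Rep_emb \<tau> x) powr t" by metis
    have "inj f"
    proof (rule injI)
      fix t u assume "f t = f u"
      then have "cmod (Rep_emb \<tau> x) powr t = cmod (Rep_emb \<tau> x) powr u" by (metis f)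
      then show "t = u" using ne x0 by (subst (asm) powr_inj) auto
    qed
    then have "countable (UNIV :: real set)"
      using countable_subset[OF subset_UNIV countable_number_field] countable_image_inj_on[of f UNIV] by blast
    then show False using uncountable_UNIV_real by blast
  qed
  have "height x = fin_norm (\<lambda>P. max 0 (- ord P x))" by (simp add: height_eq[OF x0] one)
  also have "\<dots> = 1" using ord0[OF x] by (intro fin_norm_0) simp
  finally show ?thesis by simp
qed

theorem minkowski_units_subset: "minkowski_units \<subseteq> G"
proof
  fix x :: 'k assume x: "x \<in> minkowski_units"
  then have x0: "x \<noteq> 0" by (simp add: minkowski_units_def)
  show "x \<in> G"
  proof (cases "minkowski_const TYPE('k) = 1")
    case True
    show ?thesis using height_le_1_if_eq_1[OF True x] True by (intro small[OF x]) simp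
  next
    case False
    then have d: "minkowski_const TYPE('k) > 1" using minkowski_const_ge_1[where 'k = 'k] by simp
    \<comment> \<open>The exponents ord x require radii with product d times the norm of x. A factor
      d^(1/n) \<ge> 1 at every embedding achieves this and keeps x itself under the radii.\<close>
    define \<rho> where "\<rho> \<sigma> = unit_radius TYPE('k) * cmod (Rep_emb \<sigma> x)" for \<sigma>
    have "(\<Prod>\<sigma>\<in>UNIV. \<rho> \<sigma>) = minkowski_const TYPE('k) * arch_norm x"
      using d by (simp add: \<rho>_def prod.distrib arch_norm_def)
    then have "balanced \<rho> (\<lambda>P. ord P x)"
      using x x0 d finite_ord_nonzero[OF x0] by (simp add: balanced_def \<rho>_def minkowski_units_def product_formula)
    then have "covered \<rho> (\<lambda>P. ord P x)" by (rule covered_if_gt_1[OF d])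
    moreover have "cmod (Rep_emb \<sigma> x) \<le> \<rho> \<sigma>" for \<sigma>
      using d mult_right_mono[of 1 "unit_radius TYPE('k)" "cmod (Rep_emb \<sigma> x)"] by (simp add: \<rho>_def)
    then have "x \<in> bounded_by \<rho> (\<lambda>P. ord P x)" by (simp add: bounded_by_def val_lattice_def ord_ge_def)
    ultimately show ?thesis using x0 by (auto simp: covered_def)
  qed
qed

end

section \<open>The ideal class group\<close>

abbreviation finite_support :: "('k::number_field set \<Rightarrow> int) \<Rightarrow> bool" where
  "finite_support e \<equiv> finite {P \<in> primes. e P \<noteq> 0}"

lemma val_latticeD:
  assumes "P \<in> primes" "x \<in> val_lattice e" "x \<noteq> 0" shows "e P \<le> ord P x"
  using assms by (auto simp: val_lattice_def ord_ge_def)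

lemma val_lattice_zero: "0 \<in> val_lattice e"
  by (simp add: val_lattice_def ord_ge_def)

lemma val_lattice_add: "x \<in> val_lattice e \<Longrightarrow> y \<in> val_lattice e \<Longrightarrow> x + y \<in> val_lattice e"
  by (auto simp: val_lattice_def intro: ord_ge_add)

lemma val_lattice_mult: "x \<in> val_lattice e \<Longrightarrow> y \<in> val_lattice f \<Longrightarrow> x * y \<in> val_lattice (\<lambda>P. e P + f P)"
  by (auto simp: val_lattice_def intro: ord_ge_mult)

lemma val_lattice_scale: "a \<in> OK \<Longrightarrow> x \<in> val_lattice e \<Longrightarrow> a * x \<in> val_lattice e"
  using val_lattice_mult[of a "\<lambda>_. 0" x e] by (simp add: lattice_0)

text \<open>Every element of \<open>val_lattice e\<close> lies in \<open>I\<close> because its denominator ideal \<open>{a. a * y \<in> I}\<close> is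
  contained in no prime.\<close>

lemma val_lattice_eqI:
  fixes I :: "'k::number_field set"
  assumes zero: "0 \<in> I" and add: "\<And>x y. x \<in> I \<Longrightarrow> y \<in> I \<Longrightarrow> x + y \<in> I"
    and scale: "\<And>a x. a \<in> OK \<Longrightarrow> x \<in> I \<Longrightarrow> a * x \<in> I"
    and ne: "x0 \<in> I" "x0 \<noteq> 0" and sub: "I \<subseteq> val_lattice e"
    and attained: "\<And>P. P \<in> primes \<Longrightarrow> \<exists>x\<in>I. x \<noteq> 0 \<and> ord P x = e P"
  shows "I = val_lattice e"
proof (rule subset_antisym[OF sub], rule subsetI)
  fix y assume y: "y \<in> val_lattice e"
  define D where "D = {a \<in> OK. a * y \<in> I}"
  have D: "oideal D"
    unfolding oideal_def D_def
    using zero add scale by (auto simp: distrib_right mult.assoc intro!: ring_of_integers_closed)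
  obtain m :: int where m: "m > 0" "of_int m * (y / x0) \<in> OK" by (rule integral_multiple)
  have "of_int m * (y / x0) * x0 \<in> I" by (rule scale[OF m(2) ne(1)])
  then have mD: "of_int m \<in> D" using ne(2) by (simp add: D_def ring_of_integers_closed(3))
  have m0: "(of_int m :: 'k) \<noteq> 0" using m(1) by simp
  have "1 \<in> D"
  proof (rule ccontr)
    assume "1 \<notin> D"
    then obtain P where P: "P \<in> primes" "D \<subseteq> P" by (rule primes_above[OF D _ mD m0])
    obtain x where x: "x \<in> I" "x \<noteq> 0" "ord P x = e P" using attained[OF P(1)] by blast
    have "ord_ge P 0 (y / x)"
      using val_latticeD[OF P(1) y] P(1) x by (cases "y = 0") (auto simp: ord_ge_def ord_divide)
    then obtain w where w: "w \<in> OK" "w \<notin> P" "w * (y / x) \<in> OK" by (auto simp: ord_ge_0_iff[OF P(1)])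
    have "w * (y / x) * x \<in> I" by (rule scale[OF w(3) x(1)])
    then have "w \<in> D" using w(1) x(2) by (simp add: D_def)
    then show False using w(2) P(2) by blast
  qed
  then show "y \<in> I" by (simp add: D_def)
qed

text \<open>Equal radii with product d times the ideal norm; besides the bound this supplies nonzero
  elements of the lattice.\<close>

lemma val_lattice_small:
  fixes e :: "'k::number_field set \<Rightarrow> int"
  assumes "finite_support e"
  obtains x where "x \<in> val_lattice e" "x \<noteq> 0" "arch_norm x \<le> minkowski_const TYPE('k) * fin_norm e"
proof -
  let ?c = "minkowski_const TYPE('k) * fin_norm e"
  have c: "?c > 0" using minkowski_const_pos[where 'k = 'k] fin_norm_pos[OF assms] by simp
  obtain x where x: "x \<in> val_lattice e" "x \<noteq> 0" "\<And>\<sigma>. cmod (Rep_emb \<sigma> x) \<le> root CARD('k emb) ?c"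
    by (rule minkowski_number_field[OF assms, of "\<lambda>_. root CARD('k emb) ?c"]) (use c in simp_all)
  have "arch_norm x \<le> (\<Prod>\<sigma>\<in>(UNIV :: 'k emb set). root CARD('k emb) ?c)"
    unfolding arch_norm_def using x(3) by (intro prod_mono) simp
  then show thesis using that x c by simp
qed

lemma finite_support_uminus: "finite_support e \<Longrightarrow> finite_support (\<lambda>P. - e P)"
  by simp

lemma finite_support_add: "finite_support e \<Longrightarrow> finite_support f \<Longrightarrow> finite_support (\<lambda>P. e P + f P)"
  by (rule finite_support_combine[of e f]) simp_all

lemma fractional_ideal_val_lattice:
  fixes e :: "'k::number_field set \<Rightarrow> int"
  assumes e: "finite_support e"
  shows "fractional_ideal (val_lattice e)"
proof -
  obtain x where x: "x \<in> val_lattice e" "x \<noteq> 0" by (rule val_lattice_small[OF e])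
  obtain b where b: "b \<in> val_lattice (\<lambda>P. - e P)" "b \<noteq> 0"
    by (rule val_lattice_small[OF finite_support_uminus[OF e]])
  obtain m :: int where m: "m > 0" "of_int m * b \<in> OK" by (rule integral_multiple)
  have "of_int m * b * y \<in> OK" if "y \<in> val_lattice e" for y
    using val_lattice_mult[OF val_lattice_scale[OF ring_of_integers_closed(3) b(1)] that, of m] by (simp add: lattice_0)
  then have "\<exists>a\<in>OK. a \<noteq> 0 \<and> (\<forall>y\<in>val_lattice e. a * y \<in> OK)"
    using m b(2) by (intro bexI[OF _ m(2)]) simp
  then show ?thesis
    unfolding fractional_ideal_def using x val_lattice_zero val_lattice_add val_lattice_scale by blast
qed

text \<open>This amounts to the factorization of fractional ideals. The exponent at P is the least
  order attained on \<open>I\<close>; a common denominator bounds it below and one nonzero element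
  bounds it above, so almost all exponents vanish.\<close>

lemma fractional_ideal_eq_val_lattice:
  fixes I :: "'k::number_field set"
  assumes I: "fractional_ideal I"
  obtains e where "finite_support e" "I = val_lattice e"
proof -
  obtain x0 where x0: "x0 \<in> I" "x0 \<noteq> 0" using I unfolding fractional_ideal_def by blast
  obtain a where a: "a \<in> OK" "a \<noteq> 0" "\<And>x. x \<in> I \<Longrightarrow> a * x \<in> OK" using I unfolding fractional_ideal_def by blast
  have lb: "- ord P a \<le> ord P x" if "P \<in> primes" "x \<in> I" "x \<noteq> 0" for P x
    using ord_ge_OK[OF that(1) a(3)[OF that(2)]] that a(2) by (simp add: ord_ge_def ord_mult)
  have "\<exists>x\<in>I. x \<noteq> 0 \<and> (\<forall>y\<in>I. y \<noteq> 0 \<longrightarrow> ord P x \<le> ord P y)" if P: "P \<in> primes" for P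
  proof -
    \<comment> \<open>The shift by \<open>ord P a\<close> makes all orders on \<open>I\<close>
      nonnegative, so \<open>nat\<close> loses nothing and a least value exists.\<close>
    obtain x where x: "x \<in> I \<and> x \<noteq> 0" "\<And>y. y \<in> I \<and> y \<noteq> 0 \<Longrightarrow> nat (ord P x + ord P a) \<le> nat (ord P y + ord P a)"
      using ex_has_least_nat[of "\<lambda>x. x \<in> I \<and> x \<noteq> 0" x0 "\<lambda>x. nat (ord P x + ord P a)"] x0 by blast
    have "ord P x \<le> ord P y" if "y \<in> I" "y \<noteq> 0" for y
      using x(2)[of y] lb[OF P] that x(1) by fastforce
    with x(1) show ?thesis by blast
  qed
  then obtain s where s: "\<And>P. P \<in> primes \<Longrightarrow> s P \<in> I \<and> s P \<noteq> 0 \<and> (\<forall>y\<in>I. y \<noteq> 0 \<longrightarrow> ord P (s P) \<le> ord P y)" by metis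
  define e where "e P = ord P (s P)" for P
  have "- ord P a \<le> e P \<and> e P \<le> ord P x0" if "P \<in> primes" for P
    using s[OF that] lb[OF that] x0 by (auto simp: e_def)
  then have fin: "finite_support e"
    by (intro finite_support_combine[OF finite_ord_nonzero[OF a(2)] finite_ord_nonzero[OF x0(2)]]) fastforce
  have "I = val_lattice e"
  proof (rule val_lattice_eqI[OF _ _ _ x0])
    show "I \<subseteq> val_lattice e" using s by (auto simp: val_lattice_def ord_ge_def e_def)
    show "\<exists>x\<in>I. x \<noteq> 0 \<and> ord P x = e P" if "P \<in> primes" for P using s[OF that] by (auto simp: e_def)
  qed (use I in \<open>auto simp: fractional_ideal_def\<close>)
  with fin show thesis by (rule that)
qed

lemma Zspan_scale:
  fixes A :: "'k::number_field set"
  assumes "\<And>x. x \<in> A \<Longrightarrow> a * x \<in> A" and z: "z \<in> Zspan A" shows "a * z \<in> Zspan A"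
  using z
proof (rule ZM.span_induct)
  show "ZM.subspace {z. a * z \<in> Zspan A}"
    unfolding ZM.subspace_def
    using ZM.span_zero[of A] ZM.span_add[of _ A] ZM.span_scale[of _ A] by (auto simp: distrib_left mult.left_commute[of a])
  fix x assume "x \<in> A"
  then show "a * x \<in> Zspan A" using ZM.span_base[OF assms(1)] by blast
qed

text \<open>Products of elements with exact orders e P and f P attain the order e P + f P, which is
  what \<open>val_lattice_eqI\<close> asks for.\<close>

lemma val_lattice_product:
  fixes e f :: "'k::number_field set \<Rightarrow> int"
  assumes e: "finite_support e" and f: "finite_support f"
  shows "Zspan {x * y | x y. x \<in> val_lattice e \<and> y \<in> val_lattice f} = val_lattice (\<lambda>P. e P + f P)"
proof -
  let ?X = "{x * y | x y. x \<in> val_lattice e \<and> y \<in> val_lattice f}"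
  obtain x where x: "x \<in> val_lattice e" "x \<noteq> 0" by (rule val_lattice_small[OF e])
  obtain y where y: "y \<in> val_lattice f" "y \<noteq> 0" by (rule val_lattice_small[OF f])
  have X: "x * y \<in> Zspan ?X" if "x \<in> val_lattice e" "y \<in> val_lattice f" for x y
    using that by (intro ZM.span_base) blast
  show ?thesis
  proof (rule val_lattice_eqI)
    show "0 \<in> Zspan ?X" by (rule ZM.span_zero)
    show "u + v \<in> Zspan ?X" if "u \<in> Zspan ?X" "v \<in> Zspan ?X" for u v using that by (rule ZM.span_add)
    show "a * z \<in> Zspan ?X" if a: "a \<in> OK" and "z \<in> Zspan ?X" for a z
    proof (rule Zspan_scale[OF _ that(2)])
      fix w assume "w \<in> ?X"
      then obtain u v where uv: "w = u * v" "u \<in> val_lattice e" "v \<in> val_lattice f" by blast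
      have "a * w = (a * u) * v" by (simp add: uv)
      then show "a * w \<in> ?X" using val_lattice_scale[OF a uv(2)] uv(3) by blast
    qed
    show "x * y \<in> Zspan ?X" "x * y \<noteq> 0" using X x y by auto
    show "Zspan ?X \<subseteq> val_lattice (\<lambda>P. e P + f P)"
    proof (rule ZM.span_minimal)
      show "ZM.subspace (val_lattice (\<lambda>P. e P + f P))"
        unfolding ZM.subspace_def
        using val_lattice_zero val_lattice_add val_lattice_scale[OF ring_of_integers_closed(3)] by blast
    qed (auto intro: val_lattice_mult)
    show "\<exists>z\<in>Zspan ?X. z \<noteq> 0 \<and> ord P z = e P + f P" if P: "P \<in> primes" for P
    proof -
      obtain u where u: "u \<noteq> 0" "ord P u = e P" "u \<in> val_lattice e" by (rule approximation[OF P e])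
      obtain v where v: "v \<noteq> 0" "ord P v = f P" "v \<in> val_lattice f" by (rule approximation[OF P f])
      show ?thesis using X[OF u(3) v(3)] u v P by (intro bexI[of _ "u * v"]) (auto simp: ord_mult)
    qed
  qed
qed

section \<open>The group of fractional ideals and its quotient by the principal ones\<close>

lemma fractional_ideal_group_carrier:
  "carrier fractional_ideal_group = {val_lattice e | e :: 'k::number_field set \<Rightarrow> int. finite_support e}"
proof -
  have "fractional_ideal I \<longleftrightarrow> (\<exists>e. finite_support e \<and> I = val_lattice e)" for I :: "'k set"
    using fractional_ideal_val_lattice fractional_ideal_eq_val_lattice[of I] by blast
  then show ?thesis by (auto simp: fractional_ideal_group_def)
qed

lemma fractional_ideal_group_mult:
  assumes "finite_support e" "finite_support f"
  shows "val_lattice e \<otimes>\<^bsub>fractional_ideal_group\<^esub> val_lattice f = val_lattice (\<lambda>P. e P + f P)"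
  using val_lattice_product[OF assms] by (simp add: fractional_ideal_group_def)

lemma fractional_ideal_group_one: "\<one>\<^bsub>fractional_ideal_group\<^esub> = val_lattice (\<lambda>_. 0)"
  by (simp add: fractional_ideal_group_def lattice_0)

lemma val_lattice_in_carrier: "finite_support e \<Longrightarrow> val_lattice e \<in> carrier fractional_ideal_group"
  unfolding fractional_ideal_group_carrier by blast

lemma comm_group_fractional_ideals: "comm_group (fractional_ideal_group :: 'k::number_field set monoid)"
  (is "comm_group ?F")
proof (rule comm_groupI)
  have rep: "\<exists>e. finite_support e \<and> I = val_lattice e" if "I \<in> carrier ?F" for I
    using that unfolding fractional_ideal_group_carrier by blast
  show "\<one>\<^bsub>?F\<^esub> \<in> carrier ?F"
    unfolding fractional_ideal_group_one by (rule val_lattice_in_carrier) simp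
  fix I assume "I \<in> carrier ?F"
  then obtain e where e: "finite_support e" "I = val_lattice e" using rep by blast
  show "\<one>\<^bsub>?F\<^esub> \<otimes>\<^bsub>?F\<^esub> I = I"
    unfolding e(2) fractional_ideal_group_one using fractional_ideal_group_mult[OF _ e(1), of "\<lambda>_. 0"] by simp
  have "val_lattice (\<lambda>P. - e P) \<otimes>\<^bsub>?F\<^esub> I = \<one>\<^bsub>?F\<^esub>"
    unfolding e(2) fractional_ideal_group_mult[OF finite_support_uminus[OF e(1)] e(1)] fractional_ideal_group_one by simp
  then show "\<exists>J\<in>carrier ?F. J \<otimes>\<^bsub>?F\<^esub> I = \<one>\<^bsub>?F\<^esub>"
    using val_lattice_in_carrier[OF finite_support_uminus[OF e(1)]] by blast
  fix J assume "J \<in> carrier ?F"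
  then obtain f where f: "finite_support f" "J = val_lattice f" using rep by blast
  show "I \<otimes>\<^bsub>?F\<^esub> J \<in> carrier ?F"
    unfolding e(2) f(2) fractional_ideal_group_mult[OF e(1) f(1)]
    by (rule val_lattice_in_carrier[OF finite_support_add[OF e(1) f(1)]])
  show "I \<otimes>\<^bsub>?F\<^esub> J = J \<otimes>\<^bsub>?F\<^esub> I"
    unfolding e(2) f(2) fractional_ideal_group_mult[OF e(1) f(1)] fractional_ideal_group_mult[OF f(1) e(1)]
    by (simp add: add.commute)
  fix K assume "K \<in> carrier ?F"
  then obtain g where g: "finite_support g" "K = val_lattice g" using rep by blast
  show "I \<otimes>\<^bsub>?F\<^esub> J \<otimes>\<^bsub>?F\<^esub> K = I \<otimes>\<^bsub>?F\<^esub> (J \<otimes>\<^bsub>?F\<^esub> K)"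
    unfolding e(2) f(2) g(2) fractional_ideal_group_mult[OF e(1) f(1)] fractional_ideal_group_mult[OF f(1) g(1)]
      fractional_ideal_group_mult[OF finite_support_add[OF e(1) f(1)] g(1)]
      fractional_ideal_group_mult[OF e(1) finite_support_add[OF f(1) g(1)]]
    by (simp add: add.assoc)
qed

interpretation frac: comm_group fractional_ideal_group
  by (rule comm_group_fractional_ideals)

lemma principal_eq_val_lattice:
  assumes x: "x \<noteq> 0" shows "(*) x ` OK = val_lattice (\<lambda>P. ord P x)"
proof (intro subset_antisym subsetI)
  fix y assume "y \<in> val_lattice (\<lambda>P. ord P x)"
  then have "y / x \<in> OK"
    unfolding OK_iff_ord_ge using x by (auto simp: val_lattice_def ord_ge_def ord_divide)
  then show "y \<in> (*) x ` OK" using x by (intro image_eqI[of _ _ "y / x"]) auto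
next
  fix y assume "y \<in> (*) x ` OK"
  then obtain a where "a \<in> OK" "y = a * x" by (auto simp: mult.commute)
  moreover have "x \<in> val_lattice (\<lambda>P. ord P x)" by (simp add: val_lattice_def ord_ge_def)
  ultimately show "y \<in> val_lattice (\<lambda>P. ord P x)" using val_lattice_scale by blast
qed

lemma principal_fractional_ideals_eq:
  "principal_fractional_ideals = {val_lattice (\<lambda>P. ord P x) | x :: 'k::number_field. x \<noteq> 0}"
  unfolding principal_fractional_ideals_def using principal_eq_val_lattice by blast

lemma subgroup_principal: "subgroup principal_fractional_ideals (fractional_ideal_group :: 'k::number_field set monoid)"
  (is "subgroup ?H ?F")
proof (rule frac.subgroupI)
  have mem: "val_lattice (\<lambda>P. ord P x) \<in> ?H" if "x \<noteq> 0" for x :: 'k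
    using that unfolding principal_fractional_ideals_eq by blast
  note fin = finite_ord_nonzero
  show "?H \<subseteq> carrier ?F"
    unfolding principal_fractional_ideals_eq using fin by (auto intro: val_lattice_in_carrier)
  show "?H \<noteq> {}" using mem[of 1] by auto
  fix I assume "I \<in> ?H"
  then obtain x where x: "x \<noteq> 0" "I = val_lattice (\<lambda>P. ord P x)" unfolding principal_fractional_ideals_eq by blast
  have x': "inverse x \<noteq> 0" using x(1) by simp
  have "inv\<^bsub>?F\<^esub> I = val_lattice (\<lambda>P. ord P (inverse x))"
  proof (rule frac.inv_equality)
    show "val_lattice (\<lambda>P. ord P (inverse x)) \<otimes>\<^bsub>?F\<^esub> I = \<one>\<^bsub>?F\<^esub>"
      unfolding x(2) fractional_ideal_group_mult[OF fin[OF x'] fin[OF x(1)]] fractional_ideal_group_one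
      using x(1) by (intro val_lattice_cong) (simp add: ord_inverse)
    show "I \<in> carrier ?F" unfolding x(2) by (rule val_lattice_in_carrier[OF fin[OF x(1)]])
    show "val_lattice (\<lambda>P. ord P (inverse x)) \<in> carrier ?F" by (rule val_lattice_in_carrier[OF fin[OF x']])
  qed
  then show "inv\<^bsub>?F\<^esub> I \<in> ?H" using mem[OF x'] by simp
  fix J assume "J \<in> ?H"
  then obtain y where y: "y \<noteq> 0" "J = val_lattice (\<lambda>P. ord P y)" unfolding principal_fractional_ideals_eq by blast
  have "I \<otimes>\<^bsub>?F\<^esub> J = val_lattice (\<lambda>P. ord P (x * y))"
    unfolding x(2) y(2) fractional_ideal_group_mult[OF fin[OF x(1)] fin[OF y(1)]]
    using x(1) y(1) by (intro val_lattice_cong) (simp add: ord_mult)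
  then show "I \<otimes>\<^bsub>?F\<^esub> J \<in> ?H" using mem[of "x * y"] x(1) y(1) by simp
qed

interpretation principal: normal principal_fractional_ideals fractional_ideal_group
  by (rule frac.subgroup_imp_normal[OF subgroup_principal])

interpretation ideal_class_group: group ideal_class_group
  unfolding ideal_class_group_def by (rule principal.factorgroup_is_group)

lemma ideal_class_group_carrier: "carrier ideal_class_group = ideal_class ` carrier fractional_ideal_group"
  by (auto simp: ideal_class_group_def FactGroup_def RCOSETS_def ideal_class_def)

lemma ideal_class_mult:
  assumes "I \<in> carrier fractional_ideal_group" "J \<in> carrier fractional_ideal_group"
  shows "ideal_class (I \<otimes>\<^bsub>fractional_ideal_group\<^esub> J) = ideal_class I \<otimes>\<^bsub>ideal_class_group\<^esub> ideal_class J"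
  using principal.rcos_sum[OF assms] by (simp add: ideal_class_group_def FactGroup_def ideal_class_def)

lemma ideal_class_one: "ideal_class \<one>\<^bsub>fractional_ideal_group\<^esub> = \<one>\<^bsub>ideal_class_group\<^esub>"
  using frac.coset_mult_one[OF principal.subset] by (simp add: ideal_class_group_def FactGroup_def ideal_class_def)

lemma ideal_class_principal:
  assumes "x \<noteq> 0" shows "ideal_class (val_lattice (\<lambda>P. ord P x)) = \<one>\<^bsub>ideal_class_group\<^esub>"
proof -
  have "val_lattice (\<lambda>P. ord P x) \<in> principal_fractional_ideals"
    using assms unfolding principal_fractional_ideals_eq by blast
  then show ?thesis
    by (simp add: ideal_class_group_def FactGroup_def ideal_class_def principal.rcos_const)
qed

lemma prime_eq_val_lattice:
  assumes P: "P \<in> primes" shows "P = val_lattice (\<lambda>Q. if Q = P then 1 else 0)"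
proof (intro subset_antisym subsetI)
  fix x assume x: "x \<in> P"
  then have xO: "x \<in> OK" by (rule oidealD(1)[OF primesD(1)[OF P]])
  then show "x \<in> val_lattice (\<lambda>Q. if Q = P then 1 else 0)"
    using x ord_ge_1_OK[OF P xO] ord_ge_OK[OF _ xO] by (simp add: val_lattice_def)
next
  fix x assume "x \<in> val_lattice (\<lambda>Q. if Q = P then 1 else 0)"
  then have x: "ord_ge Q (if Q = P then 1 else 0) x" if "Q \<in> primes" for Q using that by (simp add: val_lattice_def)
  have "ord_ge Q 0 x" if "Q \<in> primes" for Q by (rule ord_ge_mono[OF x[OF that]]) simp
  then have "x \<in> OK" unfolding OK_iff_ord_ge by blast
  then show "x \<in> P" using ord_ge_1_OK[OF P] x[OF P] by simp
qed

text \<open>One prime factor is removed at a time; nonnegative exponents make the total exponent a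
  measure for the induction.\<close>

lemma ideal_class_generated:
  fixes f :: "'k::number_field set \<Rightarrow> int"
  assumes "finite_support f" "\<And>P. P \<in> primes \<Longrightarrow> f P \<ge> 0" "\<And>P. P \<in> primes \<Longrightarrow> f P \<noteq> 0 \<Longrightarrow> ideal_class P \<in> A"
  shows "ideal_class (val_lattice f) \<in> generate ideal_class_group A"
  using assms
proof (induction "\<Sum>P\<in>{P \<in> primes. f P \<noteq> 0}. nat (f P)" arbitrary: f rule: less_induct)
  case less
  let ?T = "{P \<in> primes. f P \<noteq> 0}"
  show ?case
  proof (cases "?T = {}")
    case True
    then have "val_lattice f = val_lattice (\<lambda>_. 0)" by (intro val_lattice_cong) blast
    then have "ideal_class (val_lattice f) = \<one>\<^bsub>ideal_class_group\<^esub>"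
      using ideal_class_one by (simp add: fractional_ideal_group_one)
    then show ?thesis by (simp add: generate.one)
  next
    case False
    then obtain P where P: "P \<in> primes" "f P \<noteq> 0" by blast
    then have fP: "f P \<ge> 1" using less.prems(2)[OF P(1)] by simp
    define i where "i Q = (if Q = P then 1 else 0 :: int)" for Q
    define g where "g Q = f Q - i Q" for Q
    have "{Q \<in> primes. i Q \<noteq> 0} \<subseteq> {P}" by (auto simp: i_def)
    then have fi: "finite_support i" by (rule finite_subset) simp
    have fg: "finite_support g" by (rule finite_support_combine[OF less.prems(1) fi]) (simp add: g_def)
    have gf: "g Q \<noteq> 0 \<Longrightarrow> f Q \<noteq> 0" for Q using fP by (cases "Q = P") (auto simp: g_def i_def)
    have "(\<Sum>Q\<in>{Q \<in> primes. g Q \<noteq> 0}. nat (g Q)) = (\<Sum>Q\<in>?T. nat (g Q))"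
      by (rule sum.mono_neutral_left) (use less.prems(1) gf in auto)
    also have "\<dots> < (\<Sum>Q\<in>?T. nat (f Q))"
    proof (rule sum_strict_mono_ex1[OF less.prems(1)])
      show "\<forall>Q\<in>?T. nat (g Q) \<le> nat (f Q)" by (auto simp: g_def i_def)
      show "\<exists>Q\<in>?T. nat (g Q) < nat (f Q)" using P fP by (intro bexI[of _ P]) (auto simp: g_def i_def)
    qed
    finally have "ideal_class (val_lattice g) \<in> generate ideal_class_group A"
    proof (rule less.hyps[OF _ fg])
      show "0 \<le> g Q" if "Q \<in> primes" for Q using less.prems(2)[OF that] fP by (auto simp: g_def i_def)
      show "ideal_class Q \<in> A" if "Q \<in> primes" "g Q \<noteq> 0" for Q using less.prems(3) that gf by blast
    qed
    moreover have "ideal_class (val_lattice i) \<in> generate ideal_class_group A"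
      using less.prems(3)[OF P] prime_eq_val_lattice[OF P(1)] by (intro generate.incl) (simp add: i_def[abs_def])
    moreover have "val_lattice g \<otimes>\<^bsub>fractional_ideal_group\<^esub> val_lattice i = val_lattice f"
      unfolding fractional_ideal_group_mult[OF fg fi] by (simp add: g_def)
    then have "ideal_class (val_lattice f) = ideal_class (val_lattice g) \<otimes>\<^bsub>ideal_class_group\<^esub> ideal_class (val_lattice i)"
      using ideal_class_mult[OF val_lattice_in_carrier[OF fg] val_lattice_in_carrier[OF fi]] by simp
    ultimately show ?thesis by (simp add: generate.eng)
  qed
qed

theorem ideal_class_group_generated:
  "generate (ideal_class_group :: 'k::number_field set set monoid)
     {ideal_class P | P. P \<in> primes \<and> idnorm P \<le> minkowski_const TYPE('k)} = carrier ideal_class_group"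
  (is "generate ?C ?X = _")
proof (rule subset_antisym)
  have "?X \<subseteq> carrier ?C"
  proof
    fix c assume "c \<in> ?X"
    then obtain P where P: "P \<in> primes" "c = ideal_class P" by blast
    have "{Q \<in> primes. (if Q = P then 1 else 0 :: int) \<noteq> 0} \<subseteq> {P}" by auto
    then have "finite_support (\<lambda>Q. if Q = P then 1 else 0)" by (rule finite_subset) simp
    then have "P \<in> carrier fractional_ideal_group" by (subst prime_eq_val_lattice[OF P(1)]) (rule val_lattice_in_carrier)
    then show "c \<in> carrier ?C" using P(2) ideal_class_group_carrier by blast
  qed
  then show "generate ?C ?X \<subseteq> carrier ?C" by (rule ideal_class_group.generate_incl)
  show "carrier ?C \<subseteq> generate ?C ?X"
  proof
    fix c assume "c \<in> carrier ?C"
    then obtain e where e: "finite_support e" "c = ideal_class (val_lattice e)"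
      unfolding ideal_class_group_carrier fractional_ideal_group_carrier by blast
    note me = finite_support_uminus[OF e(1)]
    \<comment> \<open>For x in the inverse of the ideal I, the ideal x I is integral and in the
      class of I; its exponents ord x + e are supported on primes of norm at most d.\<close>
    obtain x where x: "x \<in> val_lattice (\<lambda>P. - e P)" "x \<noteq> 0"
      "arch_norm x \<le> minkowski_const TYPE('k) * fin_norm (\<lambda>P. - e P)"
      by (rule val_lattice_small[OF me])
    note small = lattice_element_small[OF me x]
    note fx = finite_ord_nonzero[OF x(2)]
    have "ideal_class (val_lattice (\<lambda>P. ord P x + e P)) \<in> generate ?C ?X"
    proof (rule ideal_class_generated[OF finite_support_add[OF fx e(1)]])
      show "0 \<le> ord P x + e P" if "P \<in> primes" for P using small(3)[OF that] by simp
      show "ideal_class P \<in> ?X" if "P \<in> primes" "ord P x + e P \<noteq> 0" for P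
        using small(2)[OF that(1)] that by auto
    qed
    also have "val_lattice (\<lambda>P. ord P x + e P) = val_lattice (\<lambda>P. ord P x) \<otimes>\<^bsub>fractional_ideal_group\<^esub> val_lattice e"
      by (simp add: fractional_ideal_group_mult[OF fx e(1)])
    also have "ideal_class \<dots> = c"
      using ideal_class_mult[OF val_lattice_in_carrier[OF fx] val_lattice_in_carrier[OF e(1)]]
        ideal_class_principal[OF x(2)] \<open>c \<in> carrier ?C\<close> by (simp add: e(2))
    finally show "c \<in> generate ?C ?X" .
  qed
qed

section \<open>Return from primes to places and proof of the theorem\<close>

lemma S_units_eq:
  fixes S :: "'k::number_field place set"
  assumes S: "S = archimedean_places \<union> {p \<in> finite_places. real (place_norm p) \<le> minkowski_const TYPE('k)}"
  shows "S_units S = minkowski_units"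
proof -
  have out: "places - S = prime_place ` {P \<in> primes. \<not> idnorm P \<le> minkowski_const TYPE('k)}"
    unfolding S places_split finite_places_primes
    using places_split(2)[where 'k = 'k] by (auto simp: place_norm_prime finite_places_primes)
  have "normalized_abs (prime_place P) x = 1 \<longleftrightarrow> ord P x = 0" if P: "P \<in> primes" and x: "x \<noteq> 0" for P and x :: 'k
    using powi_mono[of "real (idnorm P)" "- ord P x" 0] powi_mono[of "real (idnorm P)" 0 "- ord P x"] idnorm_gt_1[OF P] x
    by (auto simp: normalized_abs_prime[OF P] prime_abs_def)
  then show ?thesis unfolding S_units_def out minkowski_units_def by auto
qed

lemma group_S_units:
  fixes S :: "'k::number_field place set"
  assumes S: "S_units S = minkowski_units"
  shows "group (S_unit_group S)"
proof (rule groupI)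
  have div: "x / y \<in> minkowski_units" if "x \<in> minkowski_units" "y \<in> minkowski_units" for x y :: 'k
    using that by (rule minkowski_units_divide)
  have one: "(1::'k) \<in> minkowski_units" by (simp add: minkowski_units_def ord_one)
  have inv: "inverse x \<in> minkowski_units" if "x \<in> minkowski_units" for x :: 'k
    using div[OF one that] by (simp add: divide_inverse)
  show "x \<otimes>\<^bsub>S_unit_group S\<^esub> y \<in> carrier (S_unit_group S)"
    if "x \<in> carrier (S_unit_group S)" "y \<in> carrier (S_unit_group S)" for x y
    using div[OF _ inv, of x y] that by (simp add: S_unit_group_def S divide_inverse)
  show "\<exists>y\<in>carrier (S_unit_group S). y \<otimes>\<^bsub>S_unit_group S\<^esub> x = \<one>\<^bsub>S_unit_group S\<^esub>"
    if "x \<in> carrier (S_unit_group S)" for x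
    using inv[of x] that by (intro bexI[of _ "inverse x"]) (auto simp: S_unit_group_def S minkowski_units_def)
qed (use S in \<open>auto simp: S_unit_group_def minkowski_units_def ord_one mult.assoc\<close>)

theorem theorem5p4:
  fixes \<Delta> :: rat and s :: nat and d :: real and S :: "'k::number_field place set"
  assumes "\<Delta> = discriminant TYPE('k)"
    and "s = card (complex_places :: 'k place set)"
    and "d = (2 / pi) ^ s * sqrt \<bar>of_rat \<Delta>\<bar>"
    and "S = archimedean_places \<union> {p \<in> finite_places. real (place_norm p) \<le> d}"
  shows "generate (S_unit_group S) {x \<in> S_units S. height x \<le> d ^ 2} = carrier (S_unit_group S)
       \<and> generate (ideal_class_group :: 'k set set monoid)
           {ideal_class (prime_of_place p) | p. p \<in> S \<inter> finite_places}
         = carrier ideal_class_group"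
proof
  have d: "d = minkowski_const TYPE('k)"
    using assms(1-3) by (simp add: minkowski_const_def card_complex_places)
  note S = assms(4)[unfolded d]
  note units = S_units_eq[OF S]
  interpret G: group "S_unit_group S" by (rule group_S_units[OF units])
  let ?H = "{x \<in> S_units S. height x \<le> d\<^sup>2}"
  interpret height_generated "generate (S_unit_group S) ?H"
  proof
    show "x * y \<in> generate (S_unit_group S) ?H"
      if "x \<in> generate (S_unit_group S) ?H" "y \<in> generate (S_unit_group S) ?H" for x y
      using generate.eng[OF that] by (simp add: S_unit_group_def)
    show "x \<in> generate (S_unit_group S) ?H"
      if "x \<in> minkowski_units" "height x \<le> (minkowski_const TYPE('k))\<^sup>2" for x
      using that by (intro generate.incl) (simp add: units d)
  qed
  have car: "carrier (S_unit_group S) = S_units S" by (simp add: S_unit_group_def)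
  show "generate (S_unit_group S) ?H = carrier (S_unit_group S)"
  proof (rule subset_antisym)
    show "generate (S_unit_group S) ?H \<subseteq> carrier (S_unit_group S)"
      by (rule G.generate_incl) (auto simp: car)
    show "carrier (S_unit_group S) \<subseteq> generate (S_unit_group S) ?H"
      using minkowski_units_subset by (simp add: car units)
  qed
  have "S \<inter> finite_places = prime_place ` {P \<in> primes. idnorm P \<le> minkowski_const TYPE('k)}"
    unfolding S using places_split(2)[where 'k = 'k] by (auto simp: finite_places_primes place_norm_prime)
  then have "{ideal_class (prime_of_place p) | p. p \<in> S \<inter> finite_places} =
      (\<lambda>P. ideal_class (prime_of_place (prime_place P))) ` {P \<in> primes. idnorm P \<le> minkowski_const TYPE('k)}"
    by (auto simp: image_iff)
  also have "\<dots> = {ideal_class P | P. P \<in> primes \<and> idnorm P \<le> minkowski_const TYPE('k)}"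
    by (auto simp: prime_of_place_prime)
  finally show "generate (ideal_class_group :: 'k set set monoid)
      {ideal_class (prime_of_place p) | p. p \<in> S \<inter> finite_places} = carrier ideal_class_group"
    using ideal_class_group_generated by simp
qed

end
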